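(* Let $F$ be a field. If $A$ and $A'$ are semiassociative $F$-algebras, then $A\otimes_F A'$ is a semiassociative $F$-algebra.
   Context: Algebras are unital and not necessarily associative. The associator is $(x,y,z)=(xy)z-x(yz)$; the nucleus $\mathfrak{N}(A)$ is the set of $x\in A$ with $(x,A,A)=(A,x,A)=(A,A,x)=0$, an associative subalgebra; the center is $Z(A)=\{x\in\mathfrak{N}(A):xa=ax\text{ for all }a\in A\}$; $A$ is $F$-central if $Z(A)=F$. An étale $F$-algebra is a finite direct product of finite separable field extensions of $F$. A module over an associative ring is minimally faithful if it is faithful and has no faithful proper section (quotient of submodules). A finite dimensional $F$-central algebra $A$ is semiassociative if there is an étale $F$-subalgebra $K\subseteq\mathfrak{N}(A)$ (containing $1_A$) such that $A$ is minimally faithful (equivalently, faithful and cyclic) as a $K\otimes_F K$-module via $(k\otimes k')a=kak'$. *)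

theory Defs
  imports "HOL-Algebra.Algebra" "Jordan_Normal_Form.Missing_VectorSpace"
begin

section \<open>Nonassociative algebras\<close>

text \<open>
  An algebra is a record of type \<open>('f, 'a) module\<close>, whose fields \<open>mult\<close> and \<open>one\<close> carry the
  product and the unit. Neither associativity nor commutativity of the product is required, so
  the locales \<open>ring\<close> and \<open>algebra\<close> of HOL-Algebra do not apply in general.
\<close>

locale nonassoc_algebra = vectorspace F A
  for F :: "('f, 'm) ring_scheme" and A :: "('f, 'a) module" +
  assumes prod_closed: "\<lbrakk>x \<in> carrier A; y \<in> carrier A\<rbrakk> \<Longrightarrow> x \<otimes>\<^bsub>A\<^esub> y \<in> carrier A"
    and unit_closed: "\<one>\<^bsub>A\<^esub> \<in> carrier A"
    and unit_left: "x \<in> carrier A \<Longrightarrow> \<one>\<^bsub>A\<^esub> \<otimes>\<^bsub>A\<^esub> x = x"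
    and unit_right: "x \<in> carrier A \<Longrightarrow> x \<otimes>\<^bsub>A\<^esub> \<one>\<^bsub>A\<^esub> = x"
    and prod_add_left: "\<lbrakk>x \<in> carrier A; y \<in> carrier A; z \<in> carrier A\<rbrakk>
      \<Longrightarrow> (x \<oplus>\<^bsub>A\<^esub> y) \<otimes>\<^bsub>A\<^esub> z = (x \<otimes>\<^bsub>A\<^esub> z) \<oplus>\<^bsub>A\<^esub> (y \<otimes>\<^bsub>A\<^esub> z)"
    and prod_add_right: "\<lbrakk>x \<in> carrier A; y \<in> carrier A; z \<in> carrier A\<rbrakk>
      \<Longrightarrow> z \<otimes>\<^bsub>A\<^esub> (x \<oplus>\<^bsub>A\<^esub> y) = (z \<otimes>\<^bsub>A\<^esub> x) \<oplus>\<^bsub>A\<^esub> (z \<otimes>\<^bsub>A\<^esub> y)"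
    and prod_smult_left: "\<lbrakk>c \<in> carrier F; x \<in> carrier A; y \<in> carrier A\<rbrakk>
      \<Longrightarrow> (c \<odot>\<^bsub>A\<^esub> x) \<otimes>\<^bsub>A\<^esub> y = c \<odot>\<^bsub>A\<^esub> (x \<otimes>\<^bsub>A\<^esub> y)"
    and prod_smult_right: "\<lbrakk>c \<in> carrier F; x \<in> carrier A; y \<in> carrier A\<rbrakk>
      \<Longrightarrow> x \<otimes>\<^bsub>A\<^esub> (c \<odot>\<^bsub>A\<^esub> y) = c \<odot>\<^bsub>A\<^esub> (x \<otimes>\<^bsub>A\<^esub> y)"

definition associator :: "('f, 'a) module \<Rightarrow> 'a \<Rightarrow> 'a \<Rightarrow> 'a \<Rightarrow> 'a" where
  "associator A x y z = ((x \<otimes>\<^bsub>A\<^esub> y) \<otimes>\<^bsub>A\<^esub> z) \<ominus>\<^bsub>A\<^esub> (x \<otimes>\<^bsub>A\<^esub> (y \<otimes>\<^bsub>A\<^esub> z))"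

definition nucleus :: "('f, 'a) module \<Rightarrow> 'a set" where
  "nucleus A = {x \<in> carrier A. \<forall>a\<in>carrier A. \<forall>b\<in>carrier A.
     associator A x a b = \<zero>\<^bsub>A\<^esub> \<and> associator A a x b = \<zero>\<^bsub>A\<^esub> \<and> associator A a b x = \<zero>\<^bsub>A\<^esub>}"

definition alg_center :: "('f, 'a) module \<Rightarrow> 'a set" where
  "alg_center A = {x \<in> nucleus A. \<forall>a\<in>carrier A. x \<otimes>\<^bsub>A\<^esub> a = a \<otimes>\<^bsub>A\<^esub> x}"

text \<open>
  \<open>Z(A) = F\<close> is read through the structure map \<open>c \<mapsto> c \<sqdot> 1\<close>. Asking for a bijection, not just
  for \<open>Z(A) = F \<sqdot> 1\<close>, excludes the zero algebra.
\<close>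

definition central :: "('f, 'm) ring_scheme \<Rightarrow> ('f, 'a) module \<Rightarrow> bool" where
  "central F A \<longleftrightarrow> bij_betw (\<lambda>c. c \<odot>\<^bsub>A\<^esub> \<one>\<^bsub>A\<^esub>) (carrier F) (alg_center A)"

definition unital_subalgebra :: "('f, 'm) ring_scheme \<Rightarrow> 'a set \<Rightarrow> ('f, 'a) module \<Rightarrow> bool" where
  "unital_subalgebra F K A \<longleftrightarrow>
     subspace F K A \<and> \<one>\<^bsub>A\<^esub> \<in> K \<and> (\<forall>x\<in>K. \<forall>y\<in>K. x \<otimes>\<^bsub>A\<^esub> y \<in> K)"


section \<open>Etale algebras\<close>

text \<open>
  HOL-Algebra represents polynomials as coefficient lists, leading coefficient first: the entry
  at position \<open>i\<close> of \<open>p\<close> is the coefficient of \<open>X\<close> to the power \<open>length p - Suc i\<close>.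
\<close>

definition formal_deriv :: "('a, 'm) ring_scheme \<Rightarrow> 'a list \<Rightarrow> 'a list" where
  "formal_deriv R p = ring.normalize R
     (map (\<lambda>i. add_pow R (length p - Suc i) (p ! i)) [0..<length p - 1])"

text \<open>A polynomial over \<open>K\<close> is separable if it is coprime in \<open>K[X]\<close> to its derivative.\<close>

definition separable_poly :: "('a, 'm) ring_scheme \<Rightarrow> 'a set \<Rightarrow> 'a list \<Rightarrow> bool" where
  "separable_poly R K p \<longleftrightarrow>
     (\<forall>d \<in> carrier (K[X]\<^bsub>R\<^esub>).
        d divides\<^bsub>K[X]\<^bsub>R\<^esub>\<^esub> p \<and> d divides\<^bsub>K[X]\<^bsub>R\<^esub>\<^esub> formal_deriv R p \<longrightarrow> d \<in> Units (K[X]\<^bsub>R\<^esub>))"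

text \<open>
  An extension \<open>L\<close> of \<open>F\<close> is given by its structure as an \<open>F\<close>-algebra. The library's minimal
  polynomial \<open>Irr\<close> refers to a subfield of \<open>L\<close>, here the image \<open>F \<sqdot> 1\<close> of \<open>F\<close> in \<open>L\<close>.
\<close>

definition finite_separable_extension ::
    "('f, 'm) ring_scheme \<Rightarrow> ('f, 'a) module \<Rightarrow> bool" where
  "finite_separable_extension F L \<longleftrightarrow>
     field F \<and> field L \<and> algebra F L \<and> vectorspace.fin_dim F L \<and>
     (let K = (\<lambda>c. c \<odot>\<^bsub>L\<^esub> \<one>\<^bsub>L\<^esub>) ` carrier F
      in \<forall>x\<in>carrier L. separable_poly L K (ring.Irr L K x))"

definition prod_algebra :: "'i set \<Rightarrow> ('i \<Rightarrow> ('f, 'a) module) \<Rightarrow> ('f, 'i \<Rightarrow> 'a) module" where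
  "prod_algebra I L =
     \<lparr>carrier = (\<Pi>\<^sub>E i\<in>I. carrier (L i)),
      monoid.mult = (\<lambda>x y. \<lambda>i\<in>I. x i \<otimes>\<^bsub>L i\<^esub> y i),
      one = (\<lambda>i\<in>I. \<one>\<^bsub>L i\<^esub>),
      ring.zero = (\<lambda>i\<in>I. \<zero>\<^bsub>L i\<^esub>),
      add = (\<lambda>x y. \<lambda>i\<in>I. x i \<oplus>\<^bsub>L i\<^esub> y i),
      smult = (\<lambda>c x. \<lambda>i\<in>I. c \<odot>\<^bsub>L i\<^esub> x i)\<rparr>"

definition alg_iso ::
    "('f, 'm) ring_scheme \<Rightarrow> ('f, 'a) module \<Rightarrow> ('f, 'b) module \<Rightarrow> ('a \<Rightarrow> 'b) set" where
  "alg_iso F A B = ring_iso A B \<inter> module_hom F A B"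

text \<open>
  The factors \<open>L i\<close> may be taken on the element type of \<open>K\<close> without loss of generality: in a
  decomposition of \<open>K\<close> as a product, each factor is isomorphic to an ideal of \<open>K\<close>.
\<close>

definition etale_algebra :: "('f, 'm) ring_scheme \<Rightarrow> ('f, 'a) module \<Rightarrow> bool" where
  "etale_algebra F K \<longleftrightarrow>
     (\<exists>(n::nat) (L :: nat \<Rightarrow> ('f, 'a) module).
        (\<forall>i<n. finite_separable_extension F (L i)) \<and> alg_iso F K (prod_algebra {..<n} L) \<noteq> {})"


section \<open>Quotients and minimally faithful modules\<close>

text \<open>
  The module version of \<open>Quot\<close>; if \<open>M\<close> is an algebra and \<open>N\<close> an ideal, this is the quotient algebra.
\<close>

definition quot_module :: "('r, 'a) module \<Rightarrow> 'a set \<Rightarrow> ('r, 'a set) module" where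
  "quot_module M N =
     \<lparr>carrier = a_rcosets\<^bsub>M\<^esub> N,
      monoid.mult = rcoset_mult M N,
      one = N +>\<^bsub>M\<^esub> \<one>\<^bsub>M\<^esub>,
      ring.zero = N,
      add = set_add M,
      smult = (\<lambda>c U. \<Union>x\<in>U. N +>\<^bsub>M\<^esub> (c \<odot>\<^bsub>M\<^esub> x))\<rparr>"

definition faithful :: "('r, 'm) ring_scheme \<Rightarrow> ('r, 'a) module \<Rightarrow> bool" where
  "faithful R M \<longleftrightarrow>
     (\<forall>r\<in>carrier R. (\<forall>x\<in>carrier M. r \<odot>\<^bsub>M\<^esub> x = \<zero>\<^bsub>M\<^esub>) \<longrightarrow> r = \<zero>\<^bsub>R\<^esub>)"

text \<open>
  The sections of \<open>M\<close> are the quotients \<open>P / N\<close> of submodules \<open>N \<subseteq> P\<close> of \<open>M\<close>; a section is proper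
  unless \<open>P = M\<close> and \<open>N = 0\<close>. The locale \<open>module\<close> is for commutative rings, which covers
  the rings \<open>K \<otimes> K\<close> needed below.
\<close>

definition minimally_faithful :: "('r, 'm) ring_scheme \<Rightarrow> ('r, 'a) module \<Rightarrow> bool" where
  "minimally_faithful R M \<longleftrightarrow> module R M \<and> faithful R M \<and>
     (\<forall>P N. LinearCombinations.submodule R P M \<and> LinearCombinations.submodule R N M \<and> N \<subseteq> P \<and>
        faithful R (quot_module (M\<lparr>carrier := P\<rparr>) N) \<longrightarrow> P = carrier M \<and> N = {\<zero>\<^bsub>M\<^esub>})"


section \<open>Tensor products\<close>

definition basis_elem :: "('f, 'm) ring_scheme \<Rightarrow> 's \<Rightarrow> 's \<Rightarrow> 'f" where
  "basis_elem F s = (\<lambda>t. if t = s then \<one>\<^bsub>F\<^esub> else \<zero>\<^bsub>F\<^esub>)"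

text \<open>
  The free \<open>F\<close>-module on the carrier of a unital magma \<open>G\<close>, made of the finitely supported functions,
  with the bilinear product that extends the one of \<open>G\<close> on the basis.
\<close>

definition magma_algebra ::
    "('f, 'm) ring_scheme \<Rightarrow> ('s, 'n) monoid_scheme \<Rightarrow> ('f, 's \<Rightarrow> 'f) module" where
  "magma_algebra F G =
     \<lparr>carrier = {f. f \<in> carrier G \<rightarrow> carrier F \<and> (\<forall>s. s \<notin> carrier G \<longrightarrow> f s = \<zero>\<^bsub>F\<^esub>) \<and>
                    finite {s. f s \<noteq> \<zero>\<^bsub>F\<^esub>}},
      monoid.mult = (\<lambda>f g u.
        \<Oplus>\<^bsub>F\<^esub>p \<in> {(s, t). f s \<noteq> \<zero>\<^bsub>F\<^esub> \<and> g t \<noteq> \<zero>\<^bsub>F\<^esub> \<and> s \<otimes>\<^bsub>G\<^esub> t = u}. f (fst p) \<otimes>\<^bsub>F\<^esub> g (snd p)),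
      one = basis_elem F \<one>\<^bsub>G\<^esub>,
      ring.zero = (\<lambda>_. \<zero>\<^bsub>F\<^esub>),
      add = (\<lambda>f g s. f s \<oplus>\<^bsub>F\<^esub> g s),
      smult = (\<lambda>c f s. c \<otimes>\<^bsub>F\<^esub> f s)\<rparr>"

text \<open>
  \<open>A \<otimes> B\<close> is the free module on \<open>A \<times> B\<close> modulo the relations of bilinearity; the class of the basis
  element \<open>(a, b)\<close> is \<open>a \<otimes> b\<close>. The product of the magma algebra of \<open>A \<times> B\<close> induces
  \<open>(a \<otimes> b) (a' \<otimes> b') = a a' \<otimes> b b'\<close>.
\<close>

definition tensor_relators ::
    "('f, 'm) ring_scheme \<Rightarrow> ('f, 'a) module \<Rightarrow> ('f, 'b) module \<Rightarrow> ('a \<times> 'b \<Rightarrow> 'f) set" where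
  "tensor_relators F A B =
     (let M = magma_algebra F (A \<times>\<times> B); e = (\<lambda>a b. basis_elem F (a, b)) in
        {e (a \<oplus>\<^bsub>A\<^esub> a') b \<ominus>\<^bsub>M\<^esub> (e a b \<oplus>\<^bsub>M\<^esub> e a' b) | a a' b.
            a \<in> carrier A \<and> a' \<in> carrier A \<and> b \<in> carrier B} \<union>
        {e a (b \<oplus>\<^bsub>B\<^esub> b') \<ominus>\<^bsub>M\<^esub> (e a b \<oplus>\<^bsub>M\<^esub> e a b') | a b b'.
            a \<in> carrier A \<and> b \<in> carrier B \<and> b' \<in> carrier B} \<union>
        {e (c \<odot>\<^bsub>A\<^esub> a) b \<ominus>\<^bsub>M\<^esub> c \<odot>\<^bsub>M\<^esub> e a b | c a b.
            c \<in> carrier F \<and> a \<in> carrier A \<and> b \<in> carrier B} \<union>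
        {e a (c \<odot>\<^bsub>B\<^esub> b) \<ominus>\<^bsub>M\<^esub> c \<odot>\<^bsub>M\<^esub> e a b | c a b.
            c \<in> carrier F \<and> a \<in> carrier A \<and> b \<in> carrier B})"

definition tensor_algebra ::
    "('f, 'm) ring_scheme \<Rightarrow> ('f, 'a) module \<Rightarrow> ('f, 'b) module \<Rightarrow>
     ('f, ('a \<times> 'b \<Rightarrow> 'f) set) module" where
  "tensor_algebra F A B =
     (let M = magma_algebra F (A \<times>\<times> B) in
        quot_module M (module.span F M (tensor_relators F A B)))"


section \<open>Semiassociative algebras\<close>

text \<open>
  The action of \<open>K \<otimes> K\<close> on \<open>A\<close> that extends \<open>(k \<otimes> k') a = (k a) k'\<close>. An element \<open>U\<close> of \<open>K \<otimes> K\<close> is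
  a coset of formal sums of pairs \<open>(k, k')\<close>; the value does not depend on the representative, so
  \<open>the_elem\<close> extracts it from a singleton.
\<close>

definition bimodule_action :: "('f, 'm) ring_scheme \<Rightarrow> ('f, 'a) module \<Rightarrow>
    ('a \<times> 'a \<Rightarrow> 'f) set \<Rightarrow> 'a \<Rightarrow> 'a" where
  "bimodule_action F A U a = the_elem
     ((\<lambda>f. \<Oplus>\<^bsub>A\<^esub>p \<in> {p. f p \<noteq> \<zero>\<^bsub>F\<^esub>}. f p \<odot>\<^bsub>A\<^esub> ((fst p \<otimes>\<^bsub>A\<^esub> a) \<otimes>\<^bsub>A\<^esub> snd p)) ` U)"

definition bimodule :: "('f, 'm) ring_scheme \<Rightarrow> ('f, 'a) module \<Rightarrow>
    (('a \<times> 'a \<Rightarrow> 'f) set, 'a) module" where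
  "bimodule F A =
     \<lparr>carrier = carrier A, monoid.mult = monoid.mult A, one = one A,
      ring.zero = ring.zero A, add = add A, smult = bimodule_action F A\<rparr>"

definition semiassociative :: "('f, 'm) ring_scheme \<Rightarrow> ('f, 'a) module \<Rightarrow> bool" where
  "semiassociative F A \<longleftrightarrow>
     nonassoc_algebra F A \<and> vectorspace.fin_dim F A \<and> central F A \<and>
     (\<exists>K. unital_subalgebra F K A \<and> K \<subseteq> nucleus A \<and>
        (let E = A\<lparr>carrier := K\<rparr> in
           etale_algebra F E \<and> minimally_faithful (tensor_algebra F E E) (bimodule F A)))"

end

theory Submission
  imports Defs
begin

text \<open>
  A finite-dimensional commutative algebra is etale iff it is von Neumann regular and, in
  characteristic \<open>p > 0\<close>, spanned by its \<open>p\<close>-th powers. This description passes to tensor products: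
  spanning by \<open>p\<close>-th powers is inherited, and it implies that the algebra is reduced; in
  characteristic 0, a tensor product is reduced because the trace forms of the factors are
  nondegenerate.

  Let \<open>A\<close> be minimally faithful over \<open>S = K \<otimes> K\<close>. Choose \<open>e a\<^sub>e \<noteq> 0\<close> for every primitive idempotent \<open>e\<close>
  of \<open>S\<close>, and let \<open>a\<close> be the sum of these elements. Then \<open>a\<close> has annihilator 0 in \<open>S\<close>, so \<open>S a\<close> is
  faithful and \<open>A = S a\<close> is free of rank 1; in particular \<open>dim A = (dim K)\<^sup>2\<close>. If \<open>a'\<close> generates \<open>A'\<close> in the
  same way, then \<open>a \<otimes> a'\<close> generates \<open>A \<otimes> A'\<close> as a module over \<open>S'' = (K \<otimes> K') \<otimes> (K \<otimes> K')\<close>. The dimensions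
  of \<open>S''\<close> and \<open>A \<otimes> A'\<close> agree, so this module is free of rank 1, and a free module of rank 1 over a
  finite product of fields is minimally faithful.
\<close>


section \<open>Finite-dimensional vector spaces and dual bases\<close>

text \<open>The description of an etale algebra by a list of fields is not visibly stable under
  tensor products: the tensor product of two field extensions may split into many fields, with no
  formula for the factors. Hence both conditions of the intrinsic description are stated in linear
  algebra over the ground field, and the fields are recovered only afterwards, as the corners
  \<open>e A\<close> at primitive idempotents \<open>e\<close>. The characteristic matters because
  the trace argument rests on the trace of an idempotent being its rank, an integer that may vanish
  in characteristic \<open>p\<close>; there the independence of the \<open>p\<close>-th powers of a
  basis takes its place.

  A second obstacle is that the etale subalgebra of \<open>A \<otimes> A'\<close> has to be a subset
  of it, so the image of \<open>K \<otimes> K'\<close> is used. Functionals on \<open>K\<close> and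
  \<open>K'\<close> extend to \<open>A\<close> and \<open>A'\<close>, which makes products of
  functionals available on this image and determines its dimension.\<close>

definition self_module :: "('f, 'm) ring_scheme \<Rightarrow> ('f, 'f) module" where
  "self_module F = \<lparr>carrier = carrier F, monoid.mult = monoid.mult F, one = one F,
     ring.zero = ring.zero F, add = add F, smult = monoid.mult F\<rparr>"

lemma self_module_simps [simp]:
  "carrier (self_module F) = carrier F" "\<zero>\<^bsub>self_module F\<^esub> = \<zero>\<^bsub>F\<^esub>"
  "x \<oplus>\<^bsub>self_module F\<^esub> y = x \<oplus>\<^bsub>F\<^esub> y" "c \<odot>\<^bsub>self_module F\<^esub> y = c \<otimes>\<^bsub>F\<^esub> y"
  by (auto simp: self_module_def)

lemma finsum_self_module [simp]: "finsum (self_module F) g I = finsum F g I"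
  by (simp add: finsum_def finprod_def self_module_def)

text \<open>With \<open>F\<close> as a module over itself, linear functionals are ordinary elements
  of \<open>module_hom F V (self_module F)\<close>, and the lemmas on homs cover them.\<close>

lemma module_self_module: "cring F \<Longrightarrow> module F (self_module F)"
proof -
  assume "cring F"
  then interpret cring F .
  show ?thesis
    by (rule module_criteria)
      (auto simp: a_ac m_assoc l_distr r_distr cring_axioms intro: bexI[of _ "\<ominus>\<^bsub>F\<^esub> x" for x] r_neg)
qed

section \<open>Linear maps as functions on carriers\<close>

lemma module_homI:
  assumes "\<And>x. x \<in> carrier M \<Longrightarrow> h x \<in> carrier N"
    and "\<And>x y. x \<in> carrier M \<Longrightarrow> y \<in> carrier M \<Longrightarrow> h (x \<oplus>\<^bsub>M\<^esub> y) = h x \<oplus>\<^bsub>N\<^esub> h y"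
    and "\<And>c x. c \<in> carrier R \<Longrightarrow> x \<in> carrier M \<Longrightarrow> h (c \<odot>\<^bsub>M\<^esub> x) = c \<odot>\<^bsub>N\<^esub> h x"
  shows "h \<in> module_hom R M N"
  using assms by (auto simp: module_hom_def)

lemma module_hom_in: "h \<in> module_hom R M N \<Longrightarrow> x \<in> carrier M \<Longrightarrow> h x \<in> carrier N"
  unfolding module_hom_def by blast

lemma module_hom_restrict:
  "h \<in> module_hom R M N \<Longrightarrow> W \<subseteq> carrier M \<Longrightarrow> h \<in> module_hom R (M\<lparr>carrier := W\<rparr>) N"
  by (simp add: module_hom_def Pi_iff subset_iff)

text \<open>Homs are total HOL functions constrained only on the carrier. This allows a map to be
  replaced by another expression that agrees with it there.\<close>

lemma module_hom_cong:
  assumes "module R M" "h \<in> module_hom R M N" "\<And>x. x \<in> carrier M \<Longrightarrow> g x = h x"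
  shows "g \<in> module_hom R M N"
proof -
  interpret M: module R M by fact
  show ?thesis using assms(2,3) by (simp add: module_hom_def Pi_iff)
qed

lemma module_hom_comp:
  "g \<in> module_hom R M N \<Longrightarrow> h \<in> module_hom R N P \<Longrightarrow> (\<lambda>x. h (g x)) \<in> module_hom R M P"
  by (auto simp: module_hom_def Pi_iff)

lemma module_hom_zero:
  assumes "module R M" "module R N" "h \<in> module_hom R M N"
  shows "h \<zero>\<^bsub>M\<^esub> = \<zero>\<^bsub>N\<^esub>"
proof -
  interpret mod_hom R M N h using assms by (simp add: mod_hom_def mod_hom_axioms_def)
  show ?thesis by simp
qed

lemma module_hom_finsum:
  assumes "module R M" "module R N" "h \<in> module_hom R M N" "g \<in> I \<rightarrow> carrier M"
  shows "h (finsum M g I) = finsum N (\<lambda>i. h (g i)) I"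
proof -
  interpret M: module R M by fact
  interpret N: module R N by fact
  show ?thesis using assms(4)
  proof (induct I rule: infinite_finite_induct)
    case (insert i I)
    then have "finsum N (\<lambda>i. h (g i)) (insert i I) = h (g i) \<oplus>\<^bsub>N\<^esub> finsum N (\<lambda>i. h (g i)) I"
      by (intro N.finsum_insert) (simp_all add: Pi_iff module_hom_in[OF assms(3)])
    moreover have "finsum M g (insert i I) = g i \<oplus>\<^bsub>M\<^esub> finsum M g I"
      using insert by (intro M.finsum_insert) auto
    ultimately show ?case using insert module_hom_add[OF assms(3)] by (simp add: Pi_iff)
  qed (simp_all add: module_hom_zero[OF assms(1-3)])
qed

lemma module_hom_add_fun:
  assumes "module R N" "g \<in> module_hom R M N" "h \<in> module_hom R M N"
  shows "(\<lambda>x. g x \<oplus>\<^bsub>N\<^esub> h x) \<in> module_hom R M N"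
proof -
  interpret N: module R N by fact
  note i = module_hom_in[OF assms(2)] module_hom_in[OF assms(3)]
  show ?thesis using i
    by (intro module_homI) (auto simp: module_hom_add[OF assms(2)] module_hom_add[OF assms(3)]
        module_hom_smult[OF assms(2)] module_hom_smult[OF assms(3)] N.a_ac N.smult_r_distr)
qed

lemma module_hom_smult_fun:
  assumes "module R N" "h \<in> module_hom R M N" "c \<in> carrier R"
  shows "(\<lambda>x. c \<odot>\<^bsub>N\<^esub> h x) \<in> module_hom R M N"
proof -
  interpret N: module R N by fact
  note i = module_hom_in[OF assms(2)]
  show ?thesis using i assms(3)
    by (intro module_homI) (auto simp: module_hom_add[OF assms(2)]
        module_hom_smult[OF assms(2)] N.smult_r_distr N.smult_assoc_simp N.R.m_comm)
qed

lemma module_hom_smult_vec: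
  assumes "module R N" "f \<in> module_hom R M (self_module R)" "v \<in> carrier N"
  shows "(\<lambda>x. f x \<odot>\<^bsub>N\<^esub> v) \<in> module_hom R M N"
proof -
  interpret N: module R N by fact
  have "\<And>x. x \<in> carrier M \<Longrightarrow> f x \<in> carrier R" using module_hom_in[OF assms(2)] by simp
  then show ?thesis using assms(3)
    by (intro module_homI) (auto simp: module_hom_add[OF assms(2)]
        module_hom_smult[OF assms(2)] N.smult_l_distr N.smult_assoc1)
qed

text \<open>For infinite \<open>I\<close> the sum is zero, which is again a linear map, so the
  induction covers every index set.\<close>

lemma module_hom_sum_fun:
  assumes "module R M" "module R N" "\<And>i. i \<in> I \<Longrightarrow> g i \<in> module_hom R M N"
  shows "(\<lambda>x. finsum N (\<lambda>i. g i x) I) \<in> module_hom R M N"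
  using assms(3)
proof (induct I rule: infinite_finite_induct)
  case (insert i I)
  interpret M: module R M by fact
  interpret N: module R N by fact
  have "(\<lambda>x. g i x \<oplus>\<^bsub>N\<^esub> finsum N (\<lambda>i. g i x) I) \<in> module_hom R M N"
    using insert assms by (intro module_hom_add_fun) auto
  moreover have "finsum N (\<lambda>i. g i x) (insert i I) = g i x \<oplus>\<^bsub>N\<^esub> finsum N (\<lambda>i. g i x) I"
    if x: "x \<in> carrier M" for x
  proof -
    have "g j x \<in> carrier N" if "j \<in> insert i I" for j
      using module_hom_in[OF insert.prems[OF that] x] .
    then show ?thesis using insert(1,2) by (intro N.finsum_insert) simp_all
  qed
  ultimately show ?case by (rule module_hom_cong[OF assms(1)])
next
  case (infinite A)
  interpret M: module R M by fact
  interpret N: module R N by fact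
  show ?case using infinite by (intro module_homI) auto
next
  case empty
  interpret M: module R M by fact
  interpret N: module R N by fact
  show ?case by (intro module_homI) auto
qed

text \<open>The inclusion of a submodule is a hom and hence commutes with sums. The two sides are
  different terms because \<open>finsum\<close> depends on the carrier of its structure.\<close>

lemma (in module) finsum_carrier_update:
  assumes "LinearCombinations.submodule R N M" "g \<in> I \<rightarrow> N"
  shows "finsum (M\<lparr>carrier := N\<rparr>) g I = finsum M g I"
proof -
  have "module R (M\<lparr>carrier := N\<rparr>)" using assms(1) by (rule submodule_is_module)
  moreover have "N \<subseteq> carrier M" using assms(1) by (simp add: LinearCombinations.submodule_def)
  ultimately have "(\<lambda>x. x) (finsum (M\<lparr>carrier := N\<rparr>) g I) = finsum M (\<lambda>i. g i) I"
    using assms(2) module_axioms by (intro module_hom_finsum[of R]) (auto simp: module_hom_def)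
  then show ?thesis by simp
qed

text \<open>A finite basis together with its coordinate functionals. The duality relations give
  independence, the expansion gives spanning. The index set is kept apart from the vectors so that a
  basis of a tensor product can be indexed by pairs, and the coordinates are linear maps instead of
  coefficients chosen vector by vector.\<close>

definition dual_basis :: "('f, 'm) ring_scheme \<Rightarrow> ('f, 'a, 'n) module_scheme \<Rightarrow> 'i set \<Rightarrow> ('i \<Rightarrow> 'a)
    \<Rightarrow> ('i \<Rightarrow> 'a \<Rightarrow> 'f) \<Rightarrow> bool" where
  "dual_basis F V I b f \<longleftrightarrow> finite I \<and> b \<in> I \<rightarrow> carrier V \<and>
     (\<forall>i\<in>I. f i \<in> module_hom F V (self_module F)) \<and>
     (\<forall>i\<in>I. \<forall>j\<in>I. f i (b j) = (if i = j then \<one>\<^bsub>F\<^esub> else \<zero>\<^bsub>F\<^esub>)) \<and>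
     (\<forall>v\<in>carrier V. (\<Oplus>\<^bsub>V\<^esub>i\<in>I. f i v \<odot>\<^bsub>V\<^esub> b i) = v)"

lemma dual_basisD:
  assumes "dual_basis F V I b f"
  shows "finite I" "i \<in> I \<Longrightarrow> b i \<in> carrier V" "i \<in> I \<Longrightarrow> f i \<in> module_hom F V (self_module F)"
    "i \<in> I \<Longrightarrow> j \<in> I \<Longrightarrow> f i (b j) = (if i = j then \<one>\<^bsub>F\<^esub> else \<zero>\<^bsub>F\<^esub>)"
    "v \<in> carrier V \<Longrightarrow> (\<Oplus>\<^bsub>V\<^esub>i\<in>I. f i v \<odot>\<^bsub>V\<^esub> b i) = v"
    "i \<in> I \<Longrightarrow> v \<in> carrier V \<Longrightarrow> f i v \<in> carrier F"
proof -
  show "i \<in> I \<Longrightarrow> f i \<in> module_hom F V (self_module F)"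
    using assms by (auto simp: dual_basis_def)
  then show "i \<in> I \<Longrightarrow> v \<in> carrier V \<Longrightarrow> f i v \<in> carrier F"
    using module_hom_in[of "f i" F V "self_module F"] by auto
qed (use assms in \<open>auto simp: dual_basis_def\<close>)

lemma dual_basis_finsum:
  assumes "module F V" "dual_basis F V I b f" "c \<in> I \<rightarrow> carrier F" "j \<in> I"
  shows "f j (\<Oplus>\<^bsub>V\<^esub>i\<in>I. c i \<odot>\<^bsub>V\<^esub> b i) = c j"
proof -
  interpret V: module F V by fact
  note d = dual_basisD[OF assms(2)]
  have "f j (\<Oplus>\<^bsub>V\<^esub>i\<in>I. c i \<odot>\<^bsub>V\<^esub> b i) = (\<Oplus>\<^bsub>F\<^esub>i\<in>I. f j (c i \<odot>\<^bsub>V\<^esub> b i))"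
    using module_hom_finsum[OF assms(1) module_self_module[OF V.R.is_cring] d(3)[OF assms(4)],
        of "\<lambda>i. c i \<odot>\<^bsub>V\<^esub> b i" I] d(2) assms(3)
    by (simp add: Pi_iff)
  also have "\<dots> = (\<Oplus>\<^bsub>F\<^esub>i\<in>I. if j = i then c i else \<zero>\<^bsub>F\<^esub>)"
    using d assms by (intro V.R.finsum_cong') (auto simp: module_hom_smult[OF d(3)] Pi_iff)
  also have "\<dots> = c j" using assms d(1) by (intro V.R.finsum_singleton) auto
  finally show ?thesis .
qed

section \<open>Dual bases of spaces and subspaces, extension of functionals\<close>

context vectorspace begin

text \<open>Link to bases as sets: applying \<open>f j\<close> to a relation isolates its
  \<open>j\<close>-th coefficient, and two indices with the same vector would give
  \<open>1 = 0\<close>.\<close>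

lemma dual_basis_image:
  assumes "dual_basis K V I b f"
  shows "inj_on b I" "finite (b ` I)" "basis (b ` I)"
proof -
  note d = dual_basisD[OF assms]
  show inj: "inj_on b I"
    by (rule inj_onI) (metis d(4) zero_not_one)
  show fin: "finite (b ` I)" using d(1) by simp
  have bi: "b ` I \<subseteq> carrier V" using d(2) by auto
  have lc: "lincomb a (b ` I) = (\<Oplus>\<^bsub>V\<^esub>i\<in>I. a (b i) \<odot>\<^bsub>V\<^esub> b i)" if "a \<in> b ` I \<rightarrow> carrier K" for a
    unfolding lincomb_def using inj that d(2)
    by (subst M.finsum_reindex) (auto intro!: smult_closed)
  have li: "lin_indpt (b ` I)"
  proof (rule finite_lin_indpt2[OF fin bi])
    fix a assume a: "a \<in> b ` I \<rightarrow> carrier K" "lincomb a (b ` I) = \<zero>\<^bsub>V\<^esub>"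
    show "\<forall>v\<in>b ` I. a v = \<zero>\<^bsub>K\<^esub>"
    proof
      fix v assume "v \<in> b ` I"
      then obtain j where j: "j \<in> I" "v = b j" by auto
      have "f j (\<Oplus>\<^bsub>V\<^esub>i\<in>I. a (b i) \<odot>\<^bsub>V\<^esub> b i) = a (b j)"
        using dual_basis_finsum[OF module_axioms assms, of "\<lambda>i. a (b i)" j] j a by auto
      then show "a v = \<zero>\<^bsub>K\<^esub>"
        using lc[OF a(1)] a(2) j module_hom_zero[OF module_axioms module_self_module[OF R.is_cring] d(3)[OF j(1)]]
        by simp
    qed
  qed
  have "v \<in> span (b ` I)" if v: "v \<in> carrier V" for v
  proof -
    \<comment> \<open>Coefficients of a linear combination are a function of the vector, so the
      index is recovered by inverting \<open>b\<close>.\<close>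
    define a where "a = (\<lambda>w. f (inv_into I b w) v)"
    have a: "a (b i) = f i v" if "i \<in> I" for i using that inj by (simp add: a_def)
    then have ac: "a \<in> b ` I \<rightarrow> carrier K" using d(6)[OF _ v] by auto
    have "lincomb a (b ` I) = (\<Oplus>\<^bsub>V\<^esub>i\<in>I. f i v \<odot>\<^bsub>V\<^esub> b i)"
      unfolding lc[OF ac] using a d(2) d(6)[OF _ v] by (intro M.finsum_cong') auto
    then have "lincomb a (b ` I) = v" using d(5) v by simp
    then show ?thesis unfolding span_def using fin ac by blast
  qed
  then have "gen_set (b ` I)" using span_is_subset2[OF bi] by auto
  then show "basis (b ` I)" using li bi by (simp add: basis_def)
qed

lemma dual_basis_dim:
  assumes "dual_basis K V I b f"
  shows "fin_dim" "dim = card I"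
  using dual_basis_image[OF assms] dim_basis[of "b ` I"]
  by (auto simp: fin_dim_def basis_def card_image)

text \<open>Coordinates with respect to a basis are unique, and uniqueness makes them linear: the
  sum of two coordinate vectors represents the sum of the vectors.\<close>

lemma basis_dual_basis:
  assumes "finite B" "basis B"
  shows "\<exists>f. dual_basis K V B (\<lambda>x. x) f"
proof -
  have B: "B \<subseteq> carrier V" using assms by (simp add: basis_def)
  have ex: "\<exists>!a. a \<in> B \<rightarrow>\<^sub>E carrier K \<and> lincomb a B = v" if "v \<in> carrier V" for v
    using basis_criterion[OF assms(1) B] assms(2) that by blast
  define c where "c = (\<lambda>v. THE a. a \<in> B \<rightarrow>\<^sub>E carrier K \<and> lincomb a B = v)"
  have c: "c v \<in> B \<rightarrow>\<^sub>E carrier K" "lincomb (c v) B = v" if "v \<in> carrier V" for v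
    using theI'[OF ex[OF that]] unfolding c_def by auto
  have cI: "c v w = a w" if "w \<in> B" "a \<in> B \<rightarrow> carrier K" "lincomb a B = v" for v a w
  proof -
    have v: "v \<in> carrier V" using that B by auto
    \<comment> \<open>Uniqueness is available for extensional coefficient functions, hence the
      passage to \<open>restrict a B\<close>.\<close>
    have "lincomb (restrict a B) B = v"
      using that B by (subst lincomb_cong[OF refl B, of _ a]) auto
    then have "c v = restrict a B" using ex[OF v] c[OF v] that by (metis restrict_PiE)
    then show ?thesis using that by simp
  qed
  have cc: "c v w \<in> carrier K" if "v \<in> carrier V" "w \<in> B" for v w using c(1)[OF that(1)] that by auto
  have "(\<lambda>v. c v w) \<in> module_hom K V (self_module K)" if w: "w \<in> B" for w
  proof (rule module_homI)
    fix x y assume "x \<in> carrier V" "y \<in> carrier V"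
    then show "c (x \<oplus>\<^bsub>V\<^esub> y) w = c x w \<oplus>\<^bsub>self_module K\<^esub> c y w"
      using c[of x] c[of y] lincomb_sum[OF assms(1) B, of "c x" "c y"]
      by (subst cI[OF w, of "\<lambda>w. c x w \<oplus>\<^bsub>K\<^esub> c y w"]) (auto intro!: cc)
  next
    fix r x assume "r \<in> carrier K" "x \<in> carrier V"
    then show "c (r \<odot>\<^bsub>V\<^esub> x) w = r \<odot>\<^bsub>self_module K\<^esub> c x w"
      using c[of x] lincomb_smult[OF B, of "c x" r]
      by (subst cI[OF w, of "\<lambda>w. r \<otimes>\<^bsub>K\<^esub> c x w"]) (auto intro!: cc)
  qed (use cc w in auto)
  moreover have "c w v = (if v = w then \<one>\<^bsub>K\<^esub> else \<zero>\<^bsub>K\<^esub>)" if "v \<in> B" "w \<in> B" for v w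
  proof (rule cI[OF that(1)])
    have "lincomb (\<lambda>v. if v = w then \<one>\<^bsub>K\<^esub> else \<zero>\<^bsub>K\<^esub>) B = (\<Oplus>\<^bsub>V\<^esub>v\<in>B. if w = v then v else \<zero>\<^bsub>V\<^esub>)"
      unfolding lincomb_def using B by (intro M.finsum_cong') auto
    also have "\<dots> = w" using that B assms(1) by (intro M.finsum_singleton) auto
    finally show "lincomb (\<lambda>v. if v = w then \<one>\<^bsub>K\<^esub> else \<zero>\<^bsub>K\<^esub>) B = w" .
  qed auto
  moreover have "(\<Oplus>\<^bsub>V\<^esub>i\<in>B. c v i \<odot>\<^bsub>V\<^esub> i) = v" if "v \<in> carrier V" for v
    using c[OF that] by (simp add: lincomb_def)
  ultimately have "dual_basis K V B (\<lambda>x. x) (\<lambda>w v. c v w)"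
    using assms(1) B by (auto simp: dual_basis_def)
  then show ?thesis by blast
qed

lemma dual_basis_exists:
  assumes fin_dim
  shows "\<exists>B f. dual_basis K V B (\<lambda>x. x) f"
  using finite_basis_exists[OF assms] basis_dual_basis by blast

text \<open>A set that is maximal among the independent sets containing \<open>C\<close> is maximal
  among all independent sets, because every superset of it still contains \<open>C\<close>. The
  bound by \<open>dim\<close> makes a maximal one exist.\<close>

lemma extend_to_basis:
  assumes fin_dim "C \<subseteq> carrier V" "lin_indpt C"
  shows "\<exists>B. finite B \<and> C \<subseteq> B \<and> basis B"
proof -
  have "\<exists>B. finite B \<and> maximal B (\<lambda>S. S \<subseteq> carrier V \<and> lin_indpt S \<and> C \<subseteq> S)"
  proof (rule maximal_exists[of _ dim C])
    show "finite S \<and> card S \<le> dim" if "S \<subseteq> carrier V \<and> lin_indpt S \<and> C \<subseteq> S" for S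
      using li_le_dim[OF assms(1), of S] that by blast
  qed (use assms in blast)
  then obtain B where B: "finite B" "maximal B (\<lambda>S. S \<subseteq> carrier V \<and> lin_indpt S \<and> C \<subseteq> S)" by blast
  then have BB: "B \<subseteq> carrier V" "lin_indpt B" "C \<subseteq> B"
    and m: "\<And>S. S \<supseteq> B \<Longrightarrow> S \<subseteq> carrier V \<Longrightarrow> lin_indpt S \<Longrightarrow> C \<subseteq> S \<Longrightarrow> S = B"
    unfolding maximal_def by blast+
  have "maximal B (\<lambda>S. S \<subseteq> carrier V \<and> lin_indpt S)"
    unfolding maximal_def using BB m order_trans[OF BB(3)] by blast
  then have "basis B" by (rule max_li_is_basis)
  then show ?thesis using B(1) BB(3) by blast
qed

text \<open>\<open>C\<close> is a maximal independent subset of \<open>W\<close>, so it spans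
  \<open>W\<close>. After extension to a basis \<open>B\<close> of the whole space, vectors of
  \<open>W\<close> have no coordinates outside \<open>C\<close>. The same functionals thus serve
  \<open>V\<close> and \<open>W\<close>.\<close>

lemma adapted_dual_basis:
  assumes fd: fin_dim and W: "subspace K W V"
  shows "\<exists>B C f. dual_basis K V B (\<lambda>x. x) f \<and> C \<subseteq> B \<and> C \<subseteq> W \<and> (\<forall>w\<in>W. \<forall>x\<in>B - C. f x w = \<zero>\<^bsub>K\<^esub>)"
proof -
  have sub: "LinearCombinations.submodule K W V" using W by simp
  have Wc: "W \<subseteq> carrier V" using sub by (simp add: LinearCombinations.submodule_def)
  have "\<exists>C. finite C \<and> maximal C (\<lambda>S. S \<subseteq> W \<and> lin_indpt S)"
  proof (rule maximal_exists[of _ dim "{}"])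
    show "finite S \<and> card S \<le> dim" if "S \<subseteq> W \<and> lin_indpt S" for S
      using li_le_dim[OF fd, of S] that Wc by blast
  qed (simp add: lin_dep_def)
  then obtain C where C0: "finite C" "maximal C (\<lambda>S. S \<subseteq> W \<and> lin_indpt S)" by blast
  then have C: "finite C" "C \<subseteq> W" "lin_indpt C" "maximal C (\<lambda>S. S \<subseteq> W \<and> lin_indpt S)"
    unfolding maximal_def by blast+
  have spC: "w \<in> span C" if "w \<in> W" for w
  proof (cases "w \<in> C")
    case True then show ?thesis using in_own_span[of C] C Wc by auto
  next
    case False
    then have "lin_dep (C \<union> {w})" using C(2,4) that unfolding maximal_def by blast
    then show ?thesis using lin_dep_iff_in_span[of C w] C Wc that False by auto
  qed
  obtain B where B: "finite B" "C \<subseteq> B" "basis B" using extend_to_basis[OF fd _ C(3)] C Wc by auto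
  obtain f where f: "dual_basis K V B (\<lambda>x. x) f" using basis_dual_basis[OF B(1,3)] by blast
  note d = dual_basisD[OF f]
  have "f x w = \<zero>\<^bsub>K\<^esub>" if w: "w \<in> W" and x: "x \<in> B - C" for x w
  proof -
    obtain a where a: "a \<in> C \<rightarrow> carrier K" "lincomb a C = w"
      using finite_in_span[OF C(1) _ spC[OF w]] C Wc by auto
    \<comment> \<open>Extended by zero, the expansion of \<open>w\<close> over \<open>C\<close>
      becomes one over \<open>B\<close>, from which \<open>f x\<close> reads off the coefficient
      zero.\<close>
    define a' where "a' = (\<lambda>v. if v \<in> C then a v else \<zero>\<^bsub>K\<^esub>)"
    have "(\<Oplus>\<^bsub>V\<^esub>i\<in>B. a' i \<odot>\<^bsub>V\<^esub> i) = (\<Oplus>\<^bsub>V\<^esub>i\<in>C. a i \<odot>\<^bsub>V\<^esub> i)"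
      using a(1) B d(2) C unfolding a'_def
      by (intro M.add.finprod_mono_neutral_cong_right) (auto intro!: smult_closed)
    then have "w = (\<Oplus>\<^bsub>V\<^esub>i\<in>B. a' i \<odot>\<^bsub>V\<^esub> i)" using a(2) by (simp add: lincomb_def)
    moreover have "a' \<in> B \<rightarrow> carrier K" using a(1) by (auto simp: a'_def)
    then have "f x (\<Oplus>\<^bsub>V\<^esub>i\<in>B. a' i \<odot>\<^bsub>V\<^esub> i) = a' x"
      using dual_basis_finsum[OF module_axioms f, of a' x] x by blast
    ultimately show ?thesis using x by (simp add: a'_def)
  qed
  then show ?thesis using f B C by blast
qed

lemma subspace_dual_basis:
  assumes W: "subspace K W V" and d: "dual_basis K V B b f" and C: "C \<subseteq> B" "b ` C \<subseteq> W"
    and z: "\<forall>w\<in>W. \<forall>x\<in>B - C. f x w = \<zero>\<^bsub>K\<^esub>"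
  shows "dual_basis K (V\<lparr>carrier := W\<rparr>) C b f"
proof -
  have sub: "LinearCombinations.submodule K W V" using W by simp
  have Wc: "W \<subseteq> carrier V" using sub by (simp add: LinearCombinations.submodule_def)
  have sm: "r \<in> carrier K \<Longrightarrow> w \<in> W \<Longrightarrow> r \<odot>\<^bsub>V\<^esub> w \<in> W" for r w
    using sub by (simp add: LinearCombinations.submodule_def)
  note D = dual_basisD[OF d]
  have "(\<Oplus>\<^bsub>V\<lparr>carrier := W\<rparr>\<^esub>i\<in>C. f i v \<odot>\<^bsub>V\<^esub> b i) = v" if v: "v \<in> W" for v
  proof -
    have "(\<Oplus>\<^bsub>V\<lparr>carrier := W\<rparr>\<^esub>i\<in>C. f i v \<odot>\<^bsub>V\<^esub> b i) = (\<Oplus>\<^bsub>V\<^esub>i\<in>C. f i v \<odot>\<^bsub>V\<^esub> b i)"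
      using C v Wc by (intro finsum_carrier_update[OF sub]) (auto intro!: sm D(6))
    also have "\<dots> = (\<Oplus>\<^bsub>V\<^esub>i\<in>B. f i v \<odot>\<^bsub>V\<^esub> b i)"
      using C v Wc D z by (intro M.add.finprod_mono_neutral_cong_left) auto
    finally show ?thesis using D(5) v Wc by auto
  qed
  moreover have "f i \<in> module_hom K (V\<lparr>carrier := W\<rparr>) (self_module K)" if "i \<in> C" for i
  proof -
    have "f i \<in> module_hom K V (self_module K)" using D(3) C that by auto
    then show ?thesis using Wc by (rule module_hom_restrict)
  qed
  moreover have "finite C" using D(1) C(1) finite_subset by blast
  moreover have "f i (b j) = (if i = j then \<one>\<^bsub>K\<^esub> else \<zero>\<^bsub>K\<^esub>)" if "i \<in> C" "j \<in> C" for i j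
    using D(4) C(1) that by blast
  ultimately show ?thesis using C(2) by (simp add: dual_basis_def image_subset_iff)
qed

text \<open>All three facts are read off an adapted dual basis, where \<open>card C\<close> is the
  dimension of \<open>W\<close>: \<open>C\<close> exhausts \<open>B\<close> when \<open>W\<close> is
  large enough, and \<open>C\<close> is empty when the dimension is zero.\<close>

lemma subspace_dim:
  assumes fd: fin_dim and W: "subspace K W V"
  shows "vectorspace.fin_dim K (V\<lparr>carrier := W\<rparr>)"
    "vectorspace.dim K (V\<lparr>carrier := W\<rparr>) \<ge> dim \<Longrightarrow> W = carrier V"
    "vectorspace.dim K (V\<lparr>carrier := W\<rparr>) = 0 \<Longrightarrow> W = {\<zero>\<^bsub>V\<^esub>}"
proof -
  interpret W: vectorspace K "V\<lparr>carrier := W\<rparr>" using W by (rule subspace_is_vs)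
  have sub: "LinearCombinations.submodule K W V" using W by simp
  have Wc: "W \<subseteq> carrier V" using sub by (simp add: LinearCombinations.submodule_def)
  obtain B C f where f: "dual_basis K V B (\<lambda>x. x) f" "C \<subseteq> B" "C \<subseteq> W" "\<forall>w\<in>W. \<forall>x\<in>B - C. f x w = \<zero>\<^bsub>K\<^esub>"
    using adapted_dual_basis[OF assms] by blast
  have w: "dual_basis K (V\<lparr>carrier := W\<rparr>) C (\<lambda>x. x) f" using subspace_dual_basis[OF W f(1,2)] f by auto
  show "W.fin_dim" by (rule W.dual_basis_dim(1)[OF w])
  show "W = {\<zero>\<^bsub>V\<^esub>}" if "W.dim = 0"
  proof -
    have "C = {}" using that W.dual_basis_dim(2)[OF w] dual_basisD(1)[OF w] by simp
    then have "v = \<zero>\<^bsub>V\<^esub>" if "v \<in> W" for v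
      using dual_basisD(5)[OF w, of v] that W.M.finsum_empty by simp
    moreover have "\<zero>\<^bsub>V\<^esub> \<in> W" using W.M.zero_closed by simp
    ultimately show ?thesis by blast
  qed
  show "W = carrier V" if "W.dim \<ge> dim"
  proof -
    have "card C \<ge> card B" using that W.dual_basis_dim(2)[OF w] dual_basis_dim(2)[OF f(1)] by simp
    then have CB: "C = B" using f(2) dual_basisD(1)[OF f(1)] card_seteq by blast
    have "v \<in> W" if v: "v \<in> carrier V" for v
    proof -
      have g: "(\<lambda>i. f i v \<odot>\<^bsub>V\<^esub> i) \<in> B \<rightarrow> W" using CB f(3) dual_basisD(6)[OF f(1)] v W.smult_closed by auto
      have "finsum (V\<lparr>carrier := W\<rparr>) (\<lambda>i. f i v \<odot>\<^bsub>V\<^esub> i) B \<in> carrier (V\<lparr>carrier := W\<rparr>)"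
        using g by (intro W.M.finsum_closed) simp
      then have "(\<Oplus>\<^bsub>V\<^esub>i\<in>B. f i v \<odot>\<^bsub>V\<^esub> i) \<in> W"
        unfolding finsum_carrier_update[OF sub g] by simp
      then show ?thesis using dual_basisD(5)[OF f(1) v] by simp
    qed
    then show ?thesis using Wc by auto
  qed
qed

text \<open>The extension is \<open>\<Sum> f c \<cdot> h c\<close> over an adapted basis. It is
  defined on all of \<open>V\<close> because the coordinate functionals of \<open>W\<close> are
  restrictions of functionals on \<open>V\<close>. Its purpose is the control of
  \<open>K \<otimes> L\<close> inside \<open>A \<otimes> B\<close>.\<close>

lemma extend_functional:
  assumes fd: fin_dim and W: "subspace K W V"
    and h: "h \<in> module_hom K (V\<lparr>carrier := W\<rparr>) (self_module K)"
  shows "\<exists>g\<in>module_hom K V (self_module K). \<forall>w\<in>W. g w = h w"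
proof -
  interpret W: vectorspace K "V\<lparr>carrier := W\<rparr>" using W by (rule subspace_is_vs)
  have sub: "LinearCombinations.submodule K W V" using W by simp
  have Wc: "W \<subseteq> carrier V" using sub by (simp add: LinearCombinations.submodule_def)
  have ms: "module K (self_module K)" by (rule module_self_module[OF R.is_cring])
  obtain B C f where f: "dual_basis K V B (\<lambda>x. x) f" "C \<subseteq> B" "C \<subseteq> W" "\<forall>w\<in>W. \<forall>x\<in>B - C. f x w = \<zero>\<^bsub>K\<^esub>"
    using adapted_dual_basis[OF assms(1,2)] by blast
  have w: "dual_basis K (V\<lparr>carrier := W\<rparr>) C (\<lambda>x. x) f" using subspace_dual_basis[OF W f(1,2)] f by auto
  note dw = dual_basisD[OF w]
  have hC: "h c \<in> carrier K" if "c \<in> C" for c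
    using module_hom_in[OF h, of c] that f(3) by auto
  define g where "g = (\<lambda>v. \<Oplus>\<^bsub>self_module K\<^esub>c\<in>C. f c v \<odot>\<^bsub>self_module K\<^esub> h c)"
  have "(\<lambda>v. \<Oplus>\<^bsub>self_module K\<^esub>c\<in>C. f c v \<odot>\<^bsub>self_module K\<^esub> h c) \<in> module_hom K V (self_module K)"
    using dual_basisD(3)[OF f(1)] f(2) hC
    by (intro module_hom_sum_fun[OF module_axioms ms] module_hom_smult_vec ms) auto
  then have "g \<in> module_hom K V (self_module K)" unfolding g_def .
  moreover have "g w = h w" if "w \<in> W" for w
  proof -
    have fw: "f c w \<in> carrier K" if "c \<in> C" for c using dw(6)[OF that] \<open>w \<in> W\<close> by simp
    have "h w = h (\<Oplus>\<^bsub>V\<lparr>carrier := W\<rparr>\<^esub>c\<in>C. f c w \<odot>\<^bsub>V\<^esub> c)" using dw(5)[of w] that by simp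
    also have "\<dots> = (\<Oplus>\<^bsub>self_module K\<^esub>c\<in>C. h (f c w \<odot>\<^bsub>V\<^esub> c))"
      using fw f(3) W.smult_closed
      by (intro module_hom_finsum[OF W.module_axioms ms h]) (simp add: subset_iff)
    also have "\<dots> = (\<Oplus>\<^bsub>self_module K\<^esub>c\<in>C. f c w \<odot>\<^bsub>self_module K\<^esub> h c)"
      unfolding finsum_self_module
    proof (rule R.finsum_cong'[OF refl])
      show "(\<lambda>c. f c w \<odot>\<^bsub>self_module K\<^esub> h c) \<in> C \<rightarrow> carrier K"
        unfolding self_module_simps using R.m_closed[OF fw hC] by blast
      show "h (f c w \<odot>\<^bsub>V\<^esub> c) = f c w \<odot>\<^bsub>self_module K\<^esub> h c" if "c \<in> C" for c
        using module_hom_smult[OF h fw[OF that], of c] that f(3) by (simp add: subset_iff)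
    qed
    finally show ?thesis unfolding g_def by (rule sym)
  qed
  ultimately show ?thesis by blast
qed

end

section \<open>Rank and nullity as a criterion for bijectivity\<close>

context linear_map begin

lemma surj_imp_inj:
  assumes "V.fin_dim" "W.dim = V.dim" "T ` carrier V = carrier W"
  shows "inj_on T (carrier V)"
proof -
  have "imT = carrier W" by (rule surj_imp_imT_carrier[OF assms(3)])
  then have e: "W.vs imT = W" by simp
  have "W.dim + vectorspace.dim K (V.vs kerT) = V.dim"
    using rank_nullity[OF assms(1)] unfolding e .
  then have "vectorspace.dim K (V.vs kerT) = 0" using assms(2) by linarith
  then have "kerT = {\<zero>\<^bsub>V\<^esub>}" by (rule V.subspace_dim(3)[OF assms(1) kerT_is_subspace])
  then have "carrier (V.vs kerT) = {\<zero>\<^bsub>V\<^esub>}" by simp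
  then show ?thesis by (rule Ke0_imp_inj)
qed

lemma inj_imp_surj:
  assumes "V.fin_dim" "W.fin_dim" "W.dim = V.dim" "inj_on T (carrier V)"
  shows "T ` carrier V = carrier W"
proof -
  have "vectorspace.dim K (W.vs imT) = V.dim"
    using rank_nullity[OF assms(1)] inj_imp_dim_ker0[OF assms(4)] by linarith
  then have "vectorspace.dim K (W.vs imT) \<ge> W.dim" using assms(3) by linarith
  then have "imT = carrier W" by (rule W.subspace_dim(2)[OF assms(2) imT_is_subspace])
  then show ?thesis unfolding im_def .
qed

end


lemma linear_mapI:
  assumes "vectorspace F V" "vectorspace F W" "h \<in> module_hom F V W"
  shows "linear_map F V W h"
  using assms by (simp add: linear_map_def mod_hom_def mod_hom_axioms_def vectorspace_def)

text \<open>Used with minimality of a span: to show that \<open>h\<close> maps the span of a set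
  into \<open>S\<close>, it suffices to check the generators.\<close>

lemma submodule_vimage:
  assumes "module F M" "module F N" "h \<in> module_hom F M N" "LinearCombinations.submodule F S N"
  shows "LinearCombinations.submodule F {x \<in> carrier M. h x \<in> S} M"
proof -
  interpret M: module F M by fact
  show ?thesis
    using assms(4) M.module_axioms unfolding LinearCombinations.submodule_def
    by (simp add: module_hom_zero[OF assms(1-3)] module_hom_add[OF assms(3)] module_hom_smult[OF assms(3)] subset_iff)
qed

text \<open>Rank-nullity with trivial kernel and full image. It turns freeness of rank one into an
  equality of dimensions.\<close>

lemma (in linear_map) dim_eq_of_bij:
  assumes fd: "V.fin_dim" and surj: "T ` carrier V = carrier W"
    and ker: "\<And>v. v \<in> carrier V \<Longrightarrow> T v = \<zero>\<^bsub>W\<^esub> \<Longrightarrow> v = \<zero>\<^bsub>V\<^esub>"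
  shows "W.dim = V.dim"
proof -
  have "kerT = {\<zero>\<^bsub>V\<^esub>}"
  proof (intro equalityI subsetI)
    fix v assume "v \<in> kerT"
    then show "v \<in> {\<zero>\<^bsub>V\<^esub>}" using ker unfolding ker_def by simp
  next
    fix v assume "v \<in> {\<zero>\<^bsub>V\<^esub>}"
    then show "v \<in> kerT" unfolding ker_def using f0_is_0 by simp
  qed
  then have "carrier (V.vs kerT) = {\<zero>\<^bsub>V\<^esub>}" by simp
  then have k: "vectorspace.dim K (V.vs kerT) = 0" by (intro inj_imp_dim_ker0 Ke0_imp_inj)
  have "imT = carrier W" by (rule surj_imp_imT_carrier[OF surj])
  then have e: "W.vs imT = W" by simp
  show ?thesis using rank_nullity[OF fd] unfolding e k by simp
qed

section \<open>Linear extension to magma algebras\<close>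

context abelian_monoid begin

lemma finsum_cartesian:
  assumes "finite A" "finite B" "\<And>a b. a \<in> A \<Longrightarrow> b \<in> B \<Longrightarrow> g a b \<in> carrier G"
  shows "finsum G (\<lambda>p. g (fst p) (snd p)) (A \<times> B) = finsum G (\<lambda>a. finsum G (g a) B) A"
  using assms(1,3)
proof (induct A rule: finite_induct)
  case (insert a A)
  have "insert a A \<times> B = Pair a ` B \<union> A \<times> B" by auto
  moreover have "finsum G (\<lambda>p. g (fst p) (snd p)) (Pair a ` B \<union> A \<times> B)
      = finsum G (\<lambda>p. g (fst p) (snd p)) (Pair a ` B) \<oplus> finsum G (\<lambda>p. g (fst p) (snd p)) (A \<times> B)"
    using insert assms(2) by (intro finsum_Un_disjoint) auto
  moreover have "finsum G (\<lambda>p. g (fst p) (snd p)) (Pair a ` B) = finsum G (g a) B"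
    using insert by (subst finsum_reindex) (auto simp: inj_on_def)
  moreover have "finsum G (\<lambda>a. finsum G (g a) B) (insert a A)
      = finsum G (g a) B \<oplus> finsum G (\<lambda>a. finsum G (g a) B) A"
    using insert by (intro finsum_insert) (auto intro!: finsum_closed)
  ultimately show ?case using insert by simp
qed simp

lemma finsum_interchange:
  assumes "finite A" "finite B" "\<And>a b. a \<in> A \<Longrightarrow> b \<in> B \<Longrightarrow> g a b \<in> carrier G"
  shows "finsum G (\<lambda>a. finsum G (g a) B) A = finsum G (\<lambda>b. finsum G (\<lambda>a. g a b) A) B"
  using assms(1,3)
proof (induct A rule: finite_induct)
  case (insert a A)
  have "finsum G (\<lambda>a. finsum G (g a) B) (insert a A)
      = finsum G (g a) B \<oplus> finsum G (\<lambda>a. finsum G (g a) B) A"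
    using insert by (intro finsum_insert) (auto intro!: finsum_closed)
  also have "\<dots> = finsum G (g a) B \<oplus> finsum G (\<lambda>b. finsum G (\<lambda>a. g a b) A) B"
    using insert by simp
  also have "\<dots> = finsum G (\<lambda>b. g a b \<oplus> finsum G (\<lambda>a. g a b) A) B"
    using insert by (intro finsum_addf[symmetric]) (auto intro!: finsum_closed)
  also have "\<dots> = finsum G (\<lambda>b. finsum G (\<lambda>a. g a b) (insert a A)) B"
    using insert by (intro finsum_cong') (auto intro!: finsum_closed)
  finally show ?case .
qed simp

text \<open>Infinite \<open>I\<close> is covered by the base case, since the sum is then
  zero.\<close>

lemma finsum_induct:
  assumes "P \<zero>" "\<And>x y. x \<in> carrier G \<Longrightarrow> y \<in> carrier G \<Longrightarrow> P x \<Longrightarrow> P y \<Longrightarrow> P (x \<oplus> y)"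
    and "\<And>i. i \<in> I \<Longrightarrow> g i \<in> carrier G" "\<And>i. i \<in> I \<Longrightarrow> P (g i)"
  shows "P (finsum G g I)"
  using assms(3,4)
proof (induct I rule: infinite_finite_induct)
  case (insert i I)
  have "finsum G g (insert i I) = g i \<oplus> finsum G g I"
    using insert by (intro finsum_insert) auto
  moreover have "finsum G g I \<in> carrier G" using insert by (intro finsum_closed) auto
  ultimately show ?case using insert assms(2) by simp
qed (simp_all add: assms(1))

end

lemma magma_algebra_simps [simp]:
  "(f \<oplus>\<^bsub>magma_algebra F G\<^esub> g) = (\<lambda>s. f s \<oplus>\<^bsub>F\<^esub> g s)"
  "(c \<odot>\<^bsub>magma_algebra F G\<^esub> g) = (\<lambda>s. c \<otimes>\<^bsub>F\<^esub> g s)"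
  "\<zero>\<^bsub>magma_algebra F G\<^esub> = (\<lambda>_. \<zero>\<^bsub>F\<^esub>)"
  "\<one>\<^bsub>magma_algebra F G\<^esub> = basis_elem F \<one>\<^bsub>G\<^esub>"
  by (simp_all add: magma_algebra_def)

text \<open>The linear extension of \<open>\<beta>\<close> from basis elements to formal sums. The
  sum is written exactly as in \<open>bimodule_action\<close>, so that the action of
  \<open>K \<otimes> K\<close> is an instance of \<open>tens_lift\<close> by reflexivity.\<close>

definition lin_ext :: "('f, 'm) ring_scheme \<Rightarrow> ('f, 'a, 'n) module_scheme \<Rightarrow> ('s \<Rightarrow> 'a) \<Rightarrow> ('s \<Rightarrow> 'f) \<Rightarrow> 'a" where
  "lin_ext F V \<beta> f = (\<Oplus>\<^bsub>V\<^esub>p \<in> {p. f p \<noteq> \<zero>\<^bsub>F\<^esub>}. f p \<odot>\<^bsub>V\<^esub> \<beta> p)"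

section \<open>The free module on a magma\<close>

locale magma_alg = F: cring F for F :: "('f, 'm) ring_scheme" +
  fixes G :: "('s, 'n) monoid_scheme"
begin

abbreviation "M \<equiv> magma_algebra F G"

lemma magma_carrier:
  "f \<in> carrier M \<longleftrightarrow> (\<forall>s. f s \<in> carrier F) \<and> {s. f s \<noteq> \<zero>\<^bsub>F\<^esub>} \<subseteq> carrier G \<and> finite {s. f s \<noteq> \<zero>\<^bsub>F\<^esub>}"
  unfolding magma_algebra_def by (auto simp: Pi_iff)

lemma magma_module: "module F M"
proof (rule module_criteria)
  show "\<forall>v w. v \<in> carrier M \<and> w \<in> carrier M \<longrightarrow> v \<oplus>\<^bsub>M\<^esub> w \<in> carrier M"
  proof (intro allI impI)
    fix v w assume a: "v \<in> carrier M \<and> w \<in> carrier M"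
    have "{s. v s \<oplus>\<^bsub>F\<^esub> w s \<noteq> \<zero>\<^bsub>F\<^esub>} \<subseteq> {s. v s \<noteq> \<zero>\<^bsub>F\<^esub>} \<union> {s. w s \<noteq> \<zero>\<^bsub>F\<^esub>}" by auto
    then have "finite {s. v s \<oplus>\<^bsub>F\<^esub> w s \<noteq> \<zero>\<^bsub>F\<^esub>}" "{s. v s \<oplus>\<^bsub>F\<^esub> w s \<noteq> \<zero>\<^bsub>F\<^esub>} \<subseteq> carrier G"
      using a by (auto simp: magma_carrier intro: finite_subset)
    then show "v \<oplus>\<^bsub>M\<^esub> w \<in> carrier M" using a by (simp add: magma_carrier)
  qed
  show sm: "\<forall>c v. c \<in> carrier F \<and> v \<in> carrier M \<longrightarrow> c \<odot>\<^bsub>M\<^esub> v \<in> carrier M"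
  proof (intro allI impI)
    fix c v assume a: "c \<in> carrier F \<and> v \<in> carrier M"
    have "{s. c \<otimes>\<^bsub>F\<^esub> v s \<noteq> \<zero>\<^bsub>F\<^esub>} \<subseteq> {s. v s \<noteq> \<zero>\<^bsub>F\<^esub>}" using a by auto
    then have "finite {s. c \<otimes>\<^bsub>F\<^esub> v s \<noteq> \<zero>\<^bsub>F\<^esub>}" "{s. c \<otimes>\<^bsub>F\<^esub> v s \<noteq> \<zero>\<^bsub>F\<^esub>} \<subseteq> carrier G"
      using a by (auto simp: magma_carrier intro: finite_subset)
    then show "c \<odot>\<^bsub>M\<^esub> v \<in> carrier M" using a by (simp add: magma_carrier)
  qed
  show "\<forall>v\<in>carrier M. \<exists>neg_v\<in>carrier M. v \<oplus>\<^bsub>M\<^esub> neg_v = \<zero>\<^bsub>M\<^esub>"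
  proof
    fix v assume v: "v \<in> carrier M"
    then have c: "v s \<in> carrier F" for s by (simp add: magma_carrier)
    have "(\<ominus>\<^bsub>F\<^esub> \<one>\<^bsub>F\<^esub>) \<odot>\<^bsub>M\<^esub> v \<in> carrier M" using sm v by blast
    moreover have "v \<oplus>\<^bsub>M\<^esub> ((\<ominus>\<^bsub>F\<^esub> \<one>\<^bsub>F\<^esub>) \<odot>\<^bsub>M\<^esub> v) = \<zero>\<^bsub>M\<^esub>"
      using c by (simp add: F.l_minus F.r_neg)
    ultimately show "\<exists>neg_v\<in>carrier M. v \<oplus>\<^bsub>M\<^esub> neg_v = \<zero>\<^bsub>M\<^esub>" by blast
  qed
qed (auto simp: magma_carrier F.is_cring F.a_ac F.m_assoc F.l_distr F.r_distr)

sublocale module F M by (rule magma_module)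

lemma basis_elem_closed: "s \<in> carrier G \<Longrightarrow> basis_elem F s \<in> carrier M"
  unfolding magma_carrier by (auto simp: basis_elem_def intro: finite_subset[of _ "{s}"])

lemma eval_hom: "(\<lambda>f. f u) \<in> module_hom F M (self_module F)"
  by (intro module_homI) (auto simp: magma_carrier)

lemma supp_finite: "f \<in> carrier M \<Longrightarrow> finite {s. f s \<noteq> \<zero>\<^bsub>F\<^esub>}"
  and supp_subset: "f \<in> carrier M \<Longrightarrow> {s. f s \<noteq> \<zero>\<^bsub>F\<^esub>} \<subseteq> carrier G"
  and val_closed: "f \<in> carrier M \<Longrightarrow> f s \<in> carrier F"
  by (simp_all add: magma_carrier)

text \<open>Supports shrink under cancellation, so additivity cannot be shown on the defining index
  sets. Any finite set of basis indices that contains the support may be used instead.\<close>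

lemma lin_ext_eq:
  assumes "module F V" "f \<in> carrier M" "\<beta> \<in> carrier G \<rightarrow> carrier V"
    and "finite B" "{s. f s \<noteq> \<zero>\<^bsub>F\<^esub>} \<subseteq> B" "B \<subseteq> carrier G"
  shows "lin_ext F V \<beta> f = (\<Oplus>\<^bsub>V\<^esub>s\<in>B. f s \<odot>\<^bsub>V\<^esub> \<beta> s)"
proof -
  interpret V: module F V by fact
  have c: "f s \<odot>\<^bsub>V\<^esub> \<beta> s \<in> carrier V" if "s \<in> B" for s
    using that assms val_closed[OF assms(2)] by (intro V.smult_closed) auto
  show ?thesis unfolding lin_ext_def
  proof (rule V.M.add.finprod_mono_neutral_cong_left[OF assms(4,5)])
    fix s assume s: "s \<in> B - {s. f s \<noteq> \<zero>\<^bsub>F\<^esub>}"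
    then have "f s = \<zero>\<^bsub>F\<^esub>" "\<beta> s \<in> carrier V" using assms(3,6) by auto
    then show "f s \<odot>\<^bsub>V\<^esub> \<beta> s = \<zero>\<^bsub>V\<^esub>" by simp
  qed (use c in auto)
qed

lemma lin_ext_hom:
  assumes "module F V" "\<beta> \<in> carrier G \<rightarrow> carrier V"
  shows "lin_ext F V \<beta> \<in> module_hom F M V"
proof -
  interpret V: module F V by fact
  have \<beta>: "\<beta> s \<in> carrier V" if "s \<in> carrier G" for s using assms(2) that by auto
  show ?thesis
  proof (rule module_homI)
    fix f assume f: "f \<in> carrier M"
    have "f s \<odot>\<^bsub>V\<^esub> \<beta> s \<in> carrier V" if "f s \<noteq> \<zero>\<^bsub>F\<^esub>" for s
      using that \<beta> val_closed[OF f] supp_subset[OF f] by auto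
    then show "lin_ext F V \<beta> f \<in> carrier V" unfolding lin_ext_def by (intro V.finsum_closed) auto
  next
    fix f g assume f: "f \<in> carrier M" and g: "g \<in> carrier M"
    define B where "B = {s. f s \<noteq> \<zero>\<^bsub>F\<^esub>} \<union> {s. g s \<noteq> \<zero>\<^bsub>F\<^esub>}"
    have B: "finite B" "B \<subseteq> carrier G" using f g by (auto simp: B_def magma_carrier)
    have fg: "f \<oplus>\<^bsub>M\<^esub> g \<in> carrier M" using f g by (rule M.a_closed)
    have "lin_ext F V \<beta> (f \<oplus>\<^bsub>M\<^esub> g) = (\<Oplus>\<^bsub>V\<^esub>s\<in>B. (f \<oplus>\<^bsub>M\<^esub> g) s \<odot>\<^bsub>V\<^esub> \<beta> s)"
      by (rule lin_ext_eq[OF assms(1) fg assms(2) B(1) _ B(2)]) (auto simp: B_def)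
    also have "\<dots> = (\<Oplus>\<^bsub>V\<^esub>s\<in>B. f s \<odot>\<^bsub>V\<^esub> \<beta> s \<oplus>\<^bsub>V\<^esub> g s \<odot>\<^bsub>V\<^esub> \<beta> s)"
      using \<beta> B val_closed[OF f] val_closed[OF g] by (intro V.finsum_cong') (auto simp: V.smult_l_distr subset_iff)
    also have "\<dots> = (\<Oplus>\<^bsub>V\<^esub>s\<in>B. f s \<odot>\<^bsub>V\<^esub> \<beta> s) \<oplus>\<^bsub>V\<^esub> (\<Oplus>\<^bsub>V\<^esub>s\<in>B. g s \<odot>\<^bsub>V\<^esub> \<beta> s)"
      using \<beta> B val_closed[OF f] val_closed[OF g] by (intro V.finsum_addf) (auto simp: subset_iff)
    also have "(\<Oplus>\<^bsub>V\<^esub>s\<in>B. f s \<odot>\<^bsub>V\<^esub> \<beta> s) = lin_ext F V \<beta> f"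
      by (rule lin_ext_eq[OF assms(1) f assms(2) B(1) _ B(2), symmetric]) (auto simp: B_def)
    also have "(\<Oplus>\<^bsub>V\<^esub>s\<in>B. g s \<odot>\<^bsub>V\<^esub> \<beta> s) = lin_ext F V \<beta> g"
      by (rule lin_ext_eq[OF assms(1) g assms(2) B(1) _ B(2), symmetric]) (auto simp: B_def)
    finally show "lin_ext F V \<beta> (f \<oplus>\<^bsub>M\<^esub> g) = lin_ext F V \<beta> f \<oplus>\<^bsub>V\<^esub> lin_ext F V \<beta> g" .
  next
    fix c f assume c: "c \<in> carrier F" and f: "f \<in> carrier M"
    define B where "B = {s. f s \<noteq> \<zero>\<^bsub>F\<^esub>}"
    have B: "finite B" "B \<subseteq> carrier G" using f by (auto simp: B_def magma_carrier)
    have fg: "c \<odot>\<^bsub>M\<^esub> f \<in> carrier M" using c f by (rule smult_closed)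
    have "lin_ext F V \<beta> (c \<odot>\<^bsub>M\<^esub> f) = (\<Oplus>\<^bsub>V\<^esub>s\<in>B. (c \<odot>\<^bsub>M\<^esub> f) s \<odot>\<^bsub>V\<^esub> \<beta> s)"
      using c by (intro lin_ext_eq[OF assms(1) fg assms(2) B(1) _ B(2)]) (auto simp: B_def)
    also have "\<dots> = (\<Oplus>\<^bsub>V\<^esub>s\<in>B. c \<odot>\<^bsub>V\<^esub> (f s \<odot>\<^bsub>V\<^esub> \<beta> s))"
      using \<beta> B val_closed[OF f] c by (intro V.finsum_cong') (auto simp: V.smult_assoc1 subset_iff)
    also have "\<dots> = c \<odot>\<^bsub>V\<^esub> (\<Oplus>\<^bsub>V\<^esub>s\<in>B. f s \<odot>\<^bsub>V\<^esub> \<beta> s)"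
      using \<beta> B val_closed[OF f] c by (intro V.finsum_smult_ldistr[symmetric]) (auto simp: subset_iff)
    finally show "lin_ext F V \<beta> (c \<odot>\<^bsub>M\<^esub> f) = c \<odot>\<^bsub>V\<^esub> lin_ext F V \<beta> f" by (simp add: lin_ext_def B_def)
  qed
qed

lemma lin_ext_basis:
  assumes "module F V" "\<beta> \<in> carrier G \<rightarrow> carrier V" "s \<in> carrier G"
  shows "lin_ext F V \<beta> (basis_elem F s) = \<beta> s"
proof -
  interpret V: module F V by fact
  have \<beta>: "\<beta> s \<in> carrier V" using assms by auto
  have "lin_ext F V \<beta> (basis_elem F s) = (\<Oplus>\<^bsub>V\<^esub>t\<in>{s}. basis_elem F s t \<odot>\<^bsub>V\<^esub> \<beta> t)"
    using assms(3) by (intro lin_ext_eq[OF assms(1) basis_elem_closed assms(2)]) (auto simp: basis_elem_def)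
  also have "\<dots> = \<beta> s" using \<beta> by (simp add: basis_elem_def)
  finally show ?thesis .
qed

lemma lin_ext_comp:
  assumes "module F V" "module F W" "h \<in> module_hom F V W" "\<beta> \<in> carrier G \<rightarrow> carrier V" "f \<in> carrier M"
  shows "h (lin_ext F V \<beta> f) = lin_ext F W (\<lambda>s. h (\<beta> s)) f"
proof -
  interpret V: module F V by fact
  interpret W: module F W by fact
  have \<beta>: "\<beta> s \<in> carrier V" if "f s \<noteq> \<zero>\<^bsub>F\<^esub>" for s using assms(4) supp_subset[OF assms(5)] that by auto
  have fc: "f s \<in> carrier F" for s using val_closed[OF assms(5)] .
  have "h (lin_ext F V \<beta> f) = (\<Oplus>\<^bsub>W\<^esub>s\<in>{s. f s \<noteq> \<zero>\<^bsub>F\<^esub>}. h (f s \<odot>\<^bsub>V\<^esub> \<beta> s))"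
    unfolding lin_ext_def using \<beta> fc by (intro module_hom_finsum[OF assms(1-3)]) auto
  also have "\<dots> = lin_ext F W (\<lambda>s. h (\<beta> s)) f"
    unfolding lin_ext_def using \<beta> fc module_hom_in[OF assms(3)]
    by (intro W.finsum_cong') (auto simp: module_hom_smult[OF assms(3)])
  finally show ?thesis .
qed

text \<open>Evaluation at a point is linear, which reduces the claim to a sum with at most one
  nonzero term.\<close>

lemma lin_ext_self: "f \<in> carrier M \<Longrightarrow> lin_ext F M (basis_elem F) f = f"
proof
  fix u assume f: "f \<in> carrier M"
  have fc: "f s \<in> carrier F" for s using val_closed[OF f] .
  have "lin_ext F M (basis_elem F) f u = lin_ext F (self_module F) (\<lambda>s. basis_elem F s u) f"
    using basis_elem_closed
    by (intro lin_ext_comp[OF magma_module module_self_module[OF F.is_cring] eval_hom _ f]) auto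
  also have "\<dots> = (\<Oplus>\<^bsub>F\<^esub>s\<in>{s. f s \<noteq> \<zero>\<^bsub>F\<^esub>}. if s = u then f s else \<zero>\<^bsub>F\<^esub>)"
    unfolding lin_ext_def using fc by (simp, intro F.finsum_cong') (auto simp: basis_elem_def)
  also have "\<dots> = f u"
  proof (cases "f u = \<zero>\<^bsub>F\<^esub>")
    case True
    then show ?thesis by (intro trans[OF F.add.finprod_one_eqI]) auto
  next
    case False
    then show ?thesis using fc supp_finite[OF f] by (intro F.add.finprod_singleton_swap) auto
  qed
  finally show "lin_ext F M (basis_elem F) f u = f u" .
qed

lemma hom_lin_ext:
  assumes "module F V" "h \<in> module_hom F M V" "f \<in> carrier M"
  shows "h f = lin_ext F V (\<lambda>s. h (basis_elem F s)) f"
proof -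
  have "h f = h (lin_ext F M (basis_elem F) f)" using lin_ext_self[OF assms(3)] by simp
  also have "\<dots> = lin_ext F V (\<lambda>s. h (basis_elem F s)) f"
    using basis_elem_closed by (intro lin_ext_comp[OF magma_module assms(1,2) _ assms(3)]) auto
  finally show ?thesis .
qed

text \<open>Linearity in a parameter of the extended map, with the formal sum held fixed. It gives
  linearity of the product in its second argument, and later the bilinearity needed to show that the
  relators span an ideal.\<close>

lemma lin_ext_param_hom:
  assumes "module F V" "module F W" "\<And>s. s \<in> carrier G \<Longrightarrow> \<beta> s \<in> module_hom F W V" "f \<in> carrier M"
  shows "(\<lambda>w. lin_ext F V (\<lambda>s. \<beta> s w) f) \<in> module_hom F W V"
  unfolding lin_ext_def using supp_subset[OF assms(4)] val_closed[OF assms(4)]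
  by (intro module_hom_sum_fun[OF assms(2,1)] module_hom_smult_fun[OF assms(1)] assms(3)) auto

end

section \<open>Bilinear maps and the product of the free module\<close>

definition bilinear ::
    "('f, 'm) ring_scheme \<Rightarrow> ('f, 'a, 'n) module_scheme \<Rightarrow> ('f, 'b, 'k) module_scheme \<Rightarrow>
     ('f, 'c, 'l) module_scheme \<Rightarrow> ('a \<Rightarrow> 'b \<Rightarrow> 'c) \<Rightarrow> bool" where
  "bilinear F A B V \<beta> \<longleftrightarrow> (\<forall>a\<in>carrier A. \<beta> a \<in> module_hom F B V) \<and>
     (\<forall>b\<in>carrier B. (\<lambda>a. \<beta> a b) \<in> module_hom F A V)"

lemma bilinearD:
  assumes "bilinear F A B V \<beta>"
  shows "a \<in> carrier A \<Longrightarrow> \<beta> a \<in> module_hom F B V" "b \<in> carrier B \<Longrightarrow> (\<lambda>a. \<beta> a b) \<in> module_hom F A V"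
    "a \<in> carrier A \<Longrightarrow> b \<in> carrier B \<Longrightarrow> \<beta> a b \<in> carrier V"
  using assms module_hom_in[of "\<beta> a" F B V b] by (auto simp: bilinear_def)

lemma bilinear_simps:
  assumes "bilinear F A B V \<beta>"
  shows "a \<in> carrier A \<Longrightarrow> b \<in> carrier B \<Longrightarrow> b' \<in> carrier B \<Longrightarrow> \<beta> a (b \<oplus>\<^bsub>B\<^esub> b') = \<beta> a b \<oplus>\<^bsub>V\<^esub> \<beta> a b'"
    "a \<in> carrier A \<Longrightarrow> b \<in> carrier B \<Longrightarrow> a' \<in> carrier A \<Longrightarrow> \<beta> (a \<oplus>\<^bsub>A\<^esub> a') b = \<beta> a b \<oplus>\<^bsub>V\<^esub> \<beta> a' b"
    "a \<in> carrier A \<Longrightarrow> b \<in> carrier B \<Longrightarrow> c \<in> carrier F \<Longrightarrow> \<beta> a (c \<odot>\<^bsub>B\<^esub> b) = c \<odot>\<^bsub>V\<^esub> \<beta> a b"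
    "a \<in> carrier A \<Longrightarrow> b \<in> carrier B \<Longrightarrow> c \<in> carrier F \<Longrightarrow> \<beta> (c \<odot>\<^bsub>A\<^esub> a) b = c \<odot>\<^bsub>V\<^esub> \<beta> a b"
  using bilinearD[OF assms] module_hom_add[of "\<beta> a" F B V b b'] module_hom_smult[of "\<beta> a" F B V c b]
    module_hom_add[of "\<lambda>a. \<beta> a b" F A V a a'] module_hom_smult[of "\<lambda>a. \<beta> a b" F A V c a]
  by blast+

lemma bilinear_zero:
  assumes "bilinear F A B V \<beta>" "module F A" "module F B" "module F V"
  shows "a \<in> carrier A \<Longrightarrow> \<beta> a \<zero>\<^bsub>B\<^esub> = \<zero>\<^bsub>V\<^esub>" "b \<in> carrier B \<Longrightarrow> \<beta> \<zero>\<^bsub>A\<^esub> b = \<zero>\<^bsub>V\<^esub>"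
  using module_hom_zero[OF assms(3,4) bilinearD(1)[OF assms(1)]]
    module_hom_zero[OF assms(2,4) bilinearD(2)[OF assms(1)]] by auto

context magma_alg begin

text \<open>The convolution product, whose value at \<open>u\<close> is a sum over the pairs with
  product \<open>u\<close>, is rewritten as an iterated linear extension. Bilinearity and
  compatibility with quotients then come from the properties of \<open>lin_ext\<close>.\<close>

lemma magma_mult:
  assumes G: "\<And>s t. s \<in> carrier G \<Longrightarrow> t \<in> carrier G \<Longrightarrow> s \<otimes>\<^bsub>G\<^esub> t \<in> carrier G"
    and f: "f \<in> carrier M" and g: "g \<in> carrier M"
  shows "f \<otimes>\<^bsub>M\<^esub> g = lin_ext F M (\<lambda>s. lin_ext F M (\<lambda>t. basis_elem F (s \<otimes>\<^bsub>G\<^esub> t)) g) f"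
proof
  fix u
  define A where "A = {s. f s \<noteq> \<zero>\<^bsub>F\<^esub>}"
  define B where "B = {s. g s \<noteq> \<zero>\<^bsub>F\<^esub>}"
  have fin: "finite A" "finite B" and sub: "A \<subseteq> carrier G" "B \<subseteq> carrier G"
    using f g supp_finite supp_subset by (auto simp: A_def B_def)
  have c: "f s \<in> carrier F" "g s \<in> carrier F" for s using val_closed f g by auto
  have be: "basis_elem F s \<in> carrier G \<rightarrow> carrier F" for s by (auto simp: basis_elem_def)
  have inner: "(\<lambda>t. basis_elem F (s \<otimes>\<^bsub>G\<^esub> t)) \<in> carrier G \<rightarrow> carrier M" if "s \<in> carrier G" for s
    using that G by (auto intro!: basis_elem_closed)
  note ms = magma_module module_self_module[OF F.is_cring] eval_hom
  have iv: "lin_ext F M (\<lambda>t. basis_elem F (s \<otimes>\<^bsub>G\<^esub> t)) g u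
      = (\<Oplus>\<^bsub>F\<^esub>t\<in>B. g t \<otimes>\<^bsub>F\<^esub> basis_elem F (s \<otimes>\<^bsub>G\<^esub> t) u)" if "s \<in> carrier G" for s
    using lin_ext_comp[OF ms inner[OF that] g, of u] by (simp add: lin_ext_def B_def)
  have "lin_ext F M (\<lambda>s. lin_ext F M (\<lambda>t. basis_elem F (s \<otimes>\<^bsub>G\<^esub> t)) g) f u
      = lin_ext F (self_module F) (\<lambda>s. lin_ext F M (\<lambda>t. basis_elem F (s \<otimes>\<^bsub>G\<^esub> t)) g u) f"
  proof (rule lin_ext_comp[OF ms _ f])
    show "(\<lambda>s. lin_ext F M (\<lambda>t. basis_elem F (s \<otimes>\<^bsub>G\<^esub> t)) g) \<in> carrier G \<rightarrow> carrier M"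
      using module_hom_in[OF lin_ext_hom[OF magma_module inner] g] by auto
  qed
  also have "\<dots> = (\<Oplus>\<^bsub>F\<^esub>s\<in>A. f s \<otimes>\<^bsub>F\<^esub> lin_ext F M (\<lambda>t. basis_elem F (s \<otimes>\<^bsub>G\<^esub> t)) g u)"
    by (simp add: lin_ext_def A_def)
  \<comment> \<open>A pair contributes to the value at \<open>u\<close> only if its product is
    \<open>u\<close>. The condition moves into the summand, so that both sums run over fixed finite
    sets.\<close>
  also have "\<dots> = (\<Oplus>\<^bsub>F\<^esub>s\<in>A. \<Oplus>\<^bsub>F\<^esub>t\<in>B. if s \<otimes>\<^bsub>G\<^esub> t = u then f s \<otimes>\<^bsub>F\<^esub> g t else \<zero>\<^bsub>F\<^esub>)"
  proof (rule F.finsum_cong'[OF refl])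
    show "(\<lambda>s. \<Oplus>\<^bsub>F\<^esub>t\<in>B. if s \<otimes>\<^bsub>G\<^esub> t = u then f s \<otimes>\<^bsub>F\<^esub> g t else \<zero>\<^bsub>F\<^esub>) \<in> A \<rightarrow> carrier F"
      using c by (auto intro!: F.finsum_closed)
    fix s assume "s \<in> A"
    then have "s \<in> carrier G" using sub by auto
    then have "f s \<otimes>\<^bsub>F\<^esub> lin_ext F M (\<lambda>t. basis_elem F (s \<otimes>\<^bsub>G\<^esub> t)) g u
        = (\<Oplus>\<^bsub>F\<^esub>t\<in>B. f s \<otimes>\<^bsub>F\<^esub> (g t \<otimes>\<^bsub>F\<^esub> basis_elem F (s \<otimes>\<^bsub>G\<^esub> t) u))"
      unfolding iv[OF \<open>s \<in> carrier G\<close>] using c fin by (intro F.finsum_rdistr) (auto simp: basis_elem_def)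
    also have "\<dots> = (\<Oplus>\<^bsub>F\<^esub>t\<in>B. if s \<otimes>\<^bsub>G\<^esub> t = u then f s \<otimes>\<^bsub>F\<^esub> g t else \<zero>\<^bsub>F\<^esub>)"
      using c by (intro F.finsum_cong') (auto simp: basis_elem_def)
    finally show "f s \<otimes>\<^bsub>F\<^esub> lin_ext F M (\<lambda>t. basis_elem F (s \<otimes>\<^bsub>G\<^esub> t)) g u
        = (\<Oplus>\<^bsub>F\<^esub>t\<in>B. if s \<otimes>\<^bsub>G\<^esub> t = u then f s \<otimes>\<^bsub>F\<^esub> g t else \<zero>\<^bsub>F\<^esub>)" .
  qed
  also have "\<dots> = (\<Oplus>\<^bsub>F\<^esub>p\<in>A \<times> B. if fst p \<otimes>\<^bsub>G\<^esub> snd p = u then f (fst p) \<otimes>\<^bsub>F\<^esub> g (snd p) else \<zero>\<^bsub>F\<^esub>)"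
    using F.finsum_cartesian[OF fin, where g = "\<lambda>s t. if s \<otimes>\<^bsub>G\<^esub> t = u then f s \<otimes>\<^bsub>F\<^esub> g t else \<zero>\<^bsub>F\<^esub>"] c by simp
  also have "\<dots> = (\<Oplus>\<^bsub>F\<^esub>p \<in> {(s, t). f s \<noteq> \<zero>\<^bsub>F\<^esub> \<and> g t \<noteq> \<zero>\<^bsub>F\<^esub> \<and> s \<otimes>\<^bsub>G\<^esub> t = u}. f (fst p) \<otimes>\<^bsub>F\<^esub> g (snd p))"
    using c fin by (intro F.add.finprod_mono_neutral_cong_right) (auto simp: A_def B_def)
  also have "\<dots> = (f \<otimes>\<^bsub>M\<^esub> g) u" by (simp add: magma_algebra_def)
  finally show "(f \<otimes>\<^bsub>M\<^esub> g) u = lin_ext F M (\<lambda>s. lin_ext F M (\<lambda>t. basis_elem F (s \<otimes>\<^bsub>G\<^esub> t)) g) f u" by simp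
qed

lemma magma_mult_bilinear:
  assumes G: "\<And>s t. s \<in> carrier G \<Longrightarrow> t \<in> carrier G \<Longrightarrow> s \<otimes>\<^bsub>G\<^esub> t \<in> carrier G"
  shows "bilinear F M M M (monoid.mult M)"
proof -
  have inner: "(\<lambda>t. basis_elem F (s \<otimes>\<^bsub>G\<^esub> t)) \<in> carrier G \<rightarrow> carrier M" if "s \<in> carrier G" for s
    using that G by (auto intro!: basis_elem_closed)
  have h: "lin_ext F M (\<lambda>t. basis_elem F (s \<otimes>\<^bsub>G\<^esub> t)) \<in> module_hom F M M" if "s \<in> carrier G" for s
    by (rule lin_ext_hom[OF magma_module inner[OF that]])
  have "monoid.mult M f \<in> module_hom F M M" if f: "f \<in> carrier M" for f
    by (rule module_hom_cong[OF magma_module lin_ext_param_hom[OF magma_module magma_module h f]])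
      (use magma_mult[OF G f] in auto)
  moreover have "(\<lambda>f. f \<otimes>\<^bsub>M\<^esub> g) \<in> module_hom F M M" if g: "g \<in> carrier M" for g
  proof (rule module_hom_cong[OF magma_module lin_ext_hom[OF magma_module]])
    show "(\<lambda>s. lin_ext F M (\<lambda>t. basis_elem F (s \<otimes>\<^bsub>G\<^esub> t)) g) \<in> carrier G \<rightarrow> carrier M"
      using module_hom_in[OF h g] by auto
  qed (use magma_mult[OF G _ g] in auto)
  ultimately show ?thesis by (simp add: bilinear_def)
qed

lemma magma_mult_basis:
  assumes "\<And>s t. s \<in> carrier G \<Longrightarrow> t \<in> carrier G \<Longrightarrow> s \<otimes>\<^bsub>G\<^esub> t \<in> carrier G"
    and "s \<in> carrier G" "t \<in> carrier G"
  shows "basis_elem F s \<otimes>\<^bsub>M\<^esub> basis_elem F t = basis_elem F (s \<otimes>\<^bsub>G\<^esub> t)"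
proof -
  have inner: "(\<lambda>t. basis_elem F (s \<otimes>\<^bsub>G\<^esub> t)) \<in> carrier G \<rightarrow> carrier M" if "s \<in> carrier G" for s
    using that assms(1) by (auto intro!: basis_elem_closed)
  have "(\<lambda>s. lin_ext F M (\<lambda>t. basis_elem F (s \<otimes>\<^bsub>G\<^esub> t)) (basis_elem F t)) \<in> carrier G \<rightarrow> carrier M"
    using module_hom_in[OF lin_ext_hom[OF magma_module inner] basis_elem_closed[OF assms(3)]] by auto
  then show ?thesis
    using magma_mult[OF assms(1) basis_elem_closed[OF assms(2)] basis_elem_closed[OF assms(3)]]
      lin_ext_basis[OF magma_module _ assms(2)] lin_ext_basis[OF magma_module inner[OF assms(2)] assms(3)]
    by simp
qed

end


section \<open>Quotients and tensor products\<close>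

text \<open>If \<open>h\<close> is constant on the coset \<open>U\<close>, its image is a singleton
  and \<open>the_elem\<close> returns the common value. The encoding is the one of
  \<open>bimodule_action\<close>.\<close>

definition quot_lift :: "('a \<Rightarrow> 'b) \<Rightarrow> 'a set \<Rightarrow> 'b" where
  "quot_lift h U = the_elem (h ` U)"

lemma quot_module_simps [simp]:
  "carrier (quot_module M N) = a_rcosets\<^bsub>M\<^esub> N" "\<zero>\<^bsub>quot_module M N\<^esub> = N"
  "U \<oplus>\<^bsub>quot_module M N\<^esub> V = U <+>\<^bsub>M\<^esub> V"
  "c \<odot>\<^bsub>quot_module M N\<^esub> U = (\<Union>x\<in>U. N +>\<^bsub>M\<^esub> (c \<odot>\<^bsub>M\<^esub> x))"
  "U \<otimes>\<^bsub>quot_module M N\<^esub> V = rcoset_mult M N U V" "\<one>\<^bsub>quot_module M N\<^esub> = N +>\<^bsub>M\<^esub> \<one>\<^bsub>M\<^esub>"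
  by (simp_all add: quot_module_def)

section \<open>Quotient modules\<close>

locale quotient_mod = module R M for R :: "('r, 'm) ring_scheme" and M :: "('r, 'a) module" +
  fixes N assumes sub: "LinearCombinations.submodule R N M"
begin

abbreviation "Q \<equiv> quot_module M N"
abbreviation proj where "proj x \<equiv> N +>\<^bsub>M\<^esub> x"

lemma N_sub: "N \<subseteq> carrier M" and N_zero: "\<zero>\<^bsub>M\<^esub> \<in> N"
  and N_add: "x \<in> N \<Longrightarrow> y \<in> N \<Longrightarrow> x \<oplus>\<^bsub>M\<^esub> y \<in> N"
  and N_smult: "c \<in> carrier R \<Longrightarrow> x \<in> N \<Longrightarrow> c \<odot>\<^bsub>M\<^esub> x \<in> N"
  using sub by (simp_all add: LinearCombinations.submodule_def)

lemma N_neg: "x \<in> N \<Longrightarrow> \<ominus>\<^bsub>M\<^esub> x \<in> N"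
  using N_smult[of "\<ominus>\<^bsub>R\<^esub> \<one>\<^bsub>R\<^esub>" x] N_sub smult_minus_1[of x] by auto

sublocale abelian_subgroup N M
proof (rule abelian_subgroupI3)
  show "additive_subgroup N M"
    using N_sub N_zero N_add N_neg
    by (intro additive_subgroup.intro M.add.subgroupI) (auto simp: a_inv_def)
qed (rule M.abelian_group_axioms)

lemma carrier_Q: "U \<in> carrier Q \<longleftrightarrow> (\<exists>x\<in>carrier M. U = proj x)"
  by (auto simp: A_RCOSETS_def RCOSETS_def a_r_coset_def)

lemma proj_closed: "x \<in> carrier M \<Longrightarrow> proj x \<in> carrier Q"
  using carrier_Q by blast

lemma in_proj: "y \<in> proj x \<longleftrightarrow> (\<exists>n\<in>N. y = n \<oplus>\<^bsub>M\<^esub> x)"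
  by (auto simp: a_r_coset_def')

lemma proj_eq:
  assumes "x \<in> carrier M" "y \<in> carrier M" shows "proj x = proj y \<longleftrightarrow> x \<ominus>\<^bsub>M\<^esub> y \<in> N"
proof
  assume "proj x = proj y"
  then have "x \<in> proj y" using a_rcos_self[OF assms(1)] by simp
  then obtain n where n: "n \<in> N" "x = n \<oplus>\<^bsub>M\<^esub> y" by (auto simp: in_proj)
  then have "x \<ominus>\<^bsub>M\<^esub> y = n" using assms N_sub by (auto simp: M.minus_eq M.a_assoc M.r_neg)
  then show "x \<ominus>\<^bsub>M\<^esub> y \<in> N" using n by simp
next
  assume a: "x \<ominus>\<^bsub>M\<^esub> y \<in> N"
  have "x = (x \<ominus>\<^bsub>M\<^esub> y) \<oplus>\<^bsub>M\<^esub> y" using assms by (simp add: M.minus_eq M.a_assoc M.l_neg)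
  then have "x \<in> proj y" using a in_proj by blast
  then show "proj x = proj y" using a_repr_independence'[of x y] assms by simp
qed

lemma proj_zero: "x \<in> carrier M \<Longrightarrow> proj x = \<zero>\<^bsub>Q\<^esub> \<longleftrightarrow> x \<in> N"
proof -
  assume x: "x \<in> carrier M"
  have "\<ominus>\<^bsub>M\<^esub> \<zero>\<^bsub>M\<^esub> = \<zero>\<^bsub>M\<^esub>" by (rule M.minus_equality) simp_all
  then have "x \<ominus>\<^bsub>M\<^esub> \<zero>\<^bsub>M\<^esub> = x" using x by (simp only: M.minus_eq M.r_zero)
  then show ?thesis using proj_eq[OF x M.zero_closed] a_coset_add_zero[OF N_sub] by simp
qed

lemma proj_add: "x \<in> carrier M \<Longrightarrow> y \<in> carrier M \<Longrightarrow> proj (x \<oplus>\<^bsub>M\<^esub> y) = proj x \<oplus>\<^bsub>Q\<^esub> proj y"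
  by (simp add: a_rcos_sum)

text \<open>Scalar multiplication on the quotient is a union of cosets, one for each representative.
  All of them coincide, so the union is a single coset.\<close>

lemma proj_smult:
  assumes "c \<in> carrier R" "x \<in> carrier M" shows "proj (c \<odot>\<^bsub>M\<^esub> x) = c \<odot>\<^bsub>Q\<^esub> proj x"
proof -
  have "proj (c \<odot>\<^bsub>M\<^esub> y) = proj (c \<odot>\<^bsub>M\<^esub> x)" if y: "y \<in> proj x" for y
  proof -
    obtain n where n: "n \<in> N" "y = n \<oplus>\<^bsub>M\<^esub> x" using y by (auto simp: in_proj)
    have nc: "n \<in> carrier M" using n N_sub by auto
    have "c \<odot>\<^bsub>M\<^esub> y = c \<odot>\<^bsub>M\<^esub> n \<oplus>\<^bsub>M\<^esub> c \<odot>\<^bsub>M\<^esub> x"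
      using n nc assms by (simp add: smult_r_distr)
    then have "c \<odot>\<^bsub>M\<^esub> y \<in> proj (c \<odot>\<^bsub>M\<^esub> x)" using N_smult[OF assms(1) n(1)] in_proj by blast
    then show ?thesis using a_repr_independence'[of "c \<odot>\<^bsub>M\<^esub> y" "c \<odot>\<^bsub>M\<^esub> x"] assms by simp
  qed
  moreover have "proj x \<noteq> {}" using a_rcos_self[OF assms(2)] by blast
  ultimately show ?thesis unfolding quot_module_simps(4) by simp
qed

lemma Q_cases: "U \<in> carrier Q \<Longrightarrow> (\<And>x. x \<in> carrier M \<Longrightarrow> P (proj x)) \<Longrightarrow> P U"
proof -
  assume U: "U \<in> carrier Q" and H: "\<And>x. x \<in> carrier M \<Longrightarrow> P (proj x)"
  obtain x where "x \<in> carrier M" "U = proj x" using U unfolding carrier_Q by (elim bexE)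
  then show ?thesis using H[of x] by (simp only:)
qed

lemma module_Q: "module R Q"
proof -
  have z: "\<zero>\<^bsub>Q\<^esub> = proj \<zero>\<^bsub>M\<^esub>" using a_coset_add_zero[OF N_sub] by simp
  \<comment> \<open>As rewrite rules these equations pull every quotient operation into one
    application of \<open>proj\<close>, so each axiom becomes the one of \<open>M\<close>. Using
    \<open>simp only\<close> keeps the operations from being unfolded into operations on
    sets.\<close>
  note P = proj_add[symmetric] proj_smult[symmetric] proj_closed
  have 1: "\<zero>\<^bsub>Q\<^esub> \<in> carrier Q" unfolding z by (rule proj_closed[OF M.zero_closed])
  have 2: "v \<oplus>\<^bsub>Q\<^esub> w \<in> carrier Q" if "v \<in> carrier Q" "w \<in> carrier Q" for v w
    by (rule Q_cases[OF that(1)], rule Q_cases[OF that(2)]) (simp only: P M.a_closed)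
  have 3: "c \<odot>\<^bsub>Q\<^esub> v \<in> carrier Q" if "c \<in> carrier R" "v \<in> carrier Q" for c v
    by (rule Q_cases[OF that(2)]) (simp only: P smult_closed that(1))
  have 4: "\<exists>w\<in>carrier Q. v \<oplus>\<^bsub>Q\<^esub> w = \<zero>\<^bsub>Q\<^esub>" if "v \<in> carrier Q" for v
  proof (rule Q_cases[OF that])
    fix x assume "x \<in> carrier M"
    then show "\<exists>w\<in>carrier Q. proj x \<oplus>\<^bsub>Q\<^esub> w = \<zero>\<^bsub>Q\<^esub>"
      unfolding z by (intro bexI[of _ "proj (\<ominus>\<^bsub>M\<^esub> x)"]) (simp_all only: P M.a_inv_closed M.r_neg)
  qed
  have 5: "v \<oplus>\<^bsub>Q\<^esub> w = w \<oplus>\<^bsub>Q\<^esub> v" if "v \<in> carrier Q" "w \<in> carrier Q" for v w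
    by (rule Q_cases[OF that(1)], rule Q_cases[OF that(2)]) (simp only: P M.a_comm)
  have 6: "(v \<oplus>\<^bsub>Q\<^esub> w) \<oplus>\<^bsub>Q\<^esub> x = v \<oplus>\<^bsub>Q\<^esub> (w \<oplus>\<^bsub>Q\<^esub> x)"
    if "v \<in> carrier Q" "w \<in> carrier Q" "x \<in> carrier Q" for v w x
    by (rule Q_cases[OF that(1)], rule Q_cases[OF that(2)], rule Q_cases[OF that(3)])
      (simp only: P M.a_assoc M.a_closed)
  have 7: "v \<oplus>\<^bsub>Q\<^esub> \<zero>\<^bsub>Q\<^esub> = v" if "v \<in> carrier Q" for v
    unfolding z by (rule Q_cases[OF that]) (simp only: P M.r_zero M.zero_closed)
  have 8: "(a \<otimes>\<^bsub>R\<^esub> b) \<odot>\<^bsub>Q\<^esub> v = a \<odot>\<^bsub>Q\<^esub> (b \<odot>\<^bsub>Q\<^esub> v)"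
    if "a \<in> carrier R" "b \<in> carrier R" "v \<in> carrier Q" for a b v
    by (rule Q_cases[OF that(3)]) (simp only: P smult_assoc1 smult_closed R.m_closed that)
  have 9: "\<one>\<^bsub>R\<^esub> \<odot>\<^bsub>Q\<^esub> v = v" if "v \<in> carrier Q" for v
    by (rule Q_cases[OF that]) (simp only: P smult_one R.one_closed)
  have 10: "(a \<oplus>\<^bsub>R\<^esub> b) \<odot>\<^bsub>Q\<^esub> v = a \<odot>\<^bsub>Q\<^esub> v \<oplus>\<^bsub>Q\<^esub> b \<odot>\<^bsub>Q\<^esub> v"
    if "a \<in> carrier R" "b \<in> carrier R" "v \<in> carrier Q" for a b v
    by (rule Q_cases[OF that(3)]) (simp only: P smult_l_distr smult_closed R.a_closed that)
  have 11: "a \<odot>\<^bsub>Q\<^esub> (v \<oplus>\<^bsub>Q\<^esub> w) = a \<odot>\<^bsub>Q\<^esub> v \<oplus>\<^bsub>Q\<^esub> a \<odot>\<^bsub>Q\<^esub> w"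
    if "a \<in> carrier R" "v \<in> carrier Q" "w \<in> carrier Q" for a v w
    by (rule Q_cases[OF that(2)], rule Q_cases[OF that(3)])
      (simp only: P smult_r_distr smult_closed M.a_closed that)
  have 12: "\<zero>\<^bsub>Q\<^esub> \<oplus>\<^bsub>Q\<^esub> v = v" if "v \<in> carrier Q" for v
    using 5[OF 1 that] 7[OF that] by (simp only:)
  have 13: "\<exists>w\<in>carrier Q. w \<oplus>\<^bsub>Q\<^esub> v = \<zero>\<^bsub>Q\<^esub>" if v: "v \<in> carrier Q" for v
  proof -
    obtain w where w: "w \<in> carrier Q" "v \<oplus>\<^bsub>Q\<^esub> w = \<zero>\<^bsub>Q\<^esub>" using 4[OF v] by (elim bexE)
    show ?thesis by (rule bexI[OF _ w(1)]) (simp only: 5[OF w(1) v] w(2))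
  qed
  have ag: "abelian_group Q" by (rule abelian_groupI; (rule 1 2 5 6 12 13)?; assumption)
  show ?thesis by (rule moduleI[OF R.is_cring ag]) (rule 3 8 9 10 11; assumption)+
qed

lemma proj_hom: "proj \<in> module_hom R M Q"
  by (intro module_homI proj_closed proj_add proj_smult)

text \<open>Representatives \<open>n + x\<close> and \<open>m + y\<close> have as product
  \<open>x y\<close> plus terms with a factor in \<open>N\<close>. As with scalars, the union that
  defines the product of cosets is therefore a single coset.\<close>

lemma proj_mult:
  assumes bil: "bilinear R M M M (monoid.mult M)"
    and ideal: "\<And>n x. n \<in> N \<Longrightarrow> x \<in> carrier M \<Longrightarrow> n \<otimes>\<^bsub>M\<^esub> x \<in> N \<and> x \<otimes>\<^bsub>M\<^esub> n \<in> N"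
    and x: "x \<in> carrier M" and y: "y \<in> carrier M"
  shows "proj (x \<otimes>\<^bsub>M\<^esub> y) = proj x \<otimes>\<^bsub>Q\<^esub> proj y"
proof -
  have "proj (a \<otimes>\<^bsub>M\<^esub> b) = proj (x \<otimes>\<^bsub>M\<^esub> y)" if ab: "a \<in> proj x" "b \<in> proj y" for a b
  proof -
    obtain n m where n: "n \<in> N" "a = n \<oplus>\<^bsub>M\<^esub> x" and m: "m \<in> N" "b = m \<oplus>\<^bsub>M\<^esub> y"
      using ab by (auto simp: in_proj)
    have nc: "n \<in> carrier M" "m \<in> carrier M" using n m N_sub by auto
    have c: "n \<otimes>\<^bsub>M\<^esub> m \<in> carrier M" "x \<otimes>\<^bsub>M\<^esub> m \<in> carrier M" "n \<otimes>\<^bsub>M\<^esub> y \<in> carrier M" "x \<otimes>\<^bsub>M\<^esub> y \<in> carrier M"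
      using nc x y bilinearD(3)[OF bil] by auto
    have "a \<otimes>\<^bsub>M\<^esub> b = (n \<otimes>\<^bsub>M\<^esub> m \<oplus>\<^bsub>M\<^esub> x \<otimes>\<^bsub>M\<^esub> m \<oplus>\<^bsub>M\<^esub> n \<otimes>\<^bsub>M\<^esub> y) \<oplus>\<^bsub>M\<^esub> x \<otimes>\<^bsub>M\<^esub> y"
      using n m nc x y c bilinear_simps(1,2)[OF bil] by (simp add: M.a_assoc)
    moreover have "n \<otimes>\<^bsub>M\<^esub> m \<oplus>\<^bsub>M\<^esub> x \<otimes>\<^bsub>M\<^esub> m \<oplus>\<^bsub>M\<^esub> n \<otimes>\<^bsub>M\<^esub> y \<in> N"
      using ideal n m nc x y N_add by auto
    ultimately have "a \<otimes>\<^bsub>M\<^esub> b \<in> proj (x \<otimes>\<^bsub>M\<^esub> y)" using in_proj by blast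
    then show ?thesis using a_repr_independence'[of "a \<otimes>\<^bsub>M\<^esub> b" "x \<otimes>\<^bsub>M\<^esub> y"] c by simp
  qed
  moreover have "proj x \<noteq> {}" "proj y \<noteq> {}" using a_rcos_self x y by blast+
  ultimately show ?thesis unfolding quot_module_simps(5) rcoset_mult_def by simp
qed

lemma quot_lift:
  assumes "module R V" "h \<in> module_hom R M V" "\<And>n. n \<in> N \<Longrightarrow> h n = \<zero>\<^bsub>V\<^esub>"
  shows "x \<in> carrier M \<Longrightarrow> quot_lift h (proj x) = h x" "quot_lift h \<in> module_hom R Q V"
proof -
  interpret V: module R V by fact
  have 1: "quot_lift h (proj x) = h x" if x: "x \<in> carrier M" for x
  proof -
    have "h y = h x" if "y \<in> proj x" for y
    proof -
      obtain n where n: "n \<in> N" "y = n \<oplus>\<^bsub>M\<^esub> x" using \<open>y \<in> proj x\<close> by (auto simp: in_proj)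
      then show ?thesis using module_hom_add[OF assms(2), of n x] N_sub x assms(3)[OF n(1)]
          module_hom_in[OF assms(2) x] V.M.l_zero by (simp add: subset_iff)
    qed
    moreover have "x \<in> proj x" using a_rcos_self[OF x] .
    ultimately have "h ` proj x = {h x}" by blast
    then show ?thesis by (simp add: quot_lift_def)
  qed
  show "x \<in> carrier M \<Longrightarrow> quot_lift h (proj x) = h x" by (rule 1)
  have E: "\<exists>x\<in>carrier M. U = proj x" if "U \<in> carrier Q" for U using that carrier_Q by blast
  show "quot_lift h \<in> module_hom R Q V"
  proof (rule module_homI)
    show "quot_lift h U \<in> carrier V" if "U \<in> carrier Q" for U
      by (rule Q_cases[OF that]) (simp only: 1 module_hom_in[OF assms(2)])
    fix U W assume "U \<in> carrier Q" "W \<in> carrier Q"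
    then obtain x y where xy: "x \<in> carrier M" "U = proj x" "y \<in> carrier M" "W = proj y" using E by blast
    show "quot_lift h (U \<oplus>\<^bsub>Q\<^esub> W) = quot_lift h U \<oplus>\<^bsub>V\<^esub> quot_lift h W"
      unfolding xy proj_add[OF xy(1,3), symmetric] using xy(1,3) module_hom_add[OF assms(2)]
      by (simp add: 1)
  next
    fix c U assume c: "c \<in> carrier R" "U \<in> carrier Q"
    then obtain x where xy: "x \<in> carrier M" "U = proj x" using E by blast
    show "quot_lift h (c \<odot>\<^bsub>Q\<^esub> U) = c \<odot>\<^bsub>V\<^esub> quot_lift h U"
      unfolding xy proj_smult[OF c(1) xy(1), symmetric] using xy(1) c(1) module_hom_smult[OF assms(2)]
      by (simp add: 1)
  qed
qed

end

definition tens :: "('f, 'm) ring_scheme \<Rightarrow> ('f, 'a) module \<Rightarrow> ('f, 'b) module \<Rightarrow> 'a \<Rightarrow> 'b \<Rightarrow>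
    ('a \<times> 'b \<Rightarrow> 'f) set" where
  "tens F A B a b = module.span F (magma_algebra F (A \<times>\<times> B)) (tensor_relators F A B)
     +>\<^bsub>magma_algebra F (A \<times>\<times> B)\<^esub> basis_elem F (a, b)"

definition tens_lift :: "('f, 'm) ring_scheme \<Rightarrow> ('f, 'c, 'n) module_scheme \<Rightarrow> ('a \<Rightarrow> 'b \<Rightarrow> 'c) \<Rightarrow>
    ('a \<times> 'b \<Rightarrow> 'f) set \<Rightarrow> 'c" where
  "tens_lift F V \<beta> = quot_lift (lin_ext F V (\<lambda>p. \<beta> (fst p) (snd p)))"

section \<open>The universal property of the tensor product\<close>

locale tensor_modules = A: module F A + B: module F B
  for F :: "('f, 'm) ring_scheme" and A :: "('f, 'a) module" and B :: "('f, 'b) module"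
begin

sublocale magma_alg F "A \<times>\<times> B" by unfold_locales

abbreviation "T \<equiv> tensor_algebra F A B"
abbreviation "N \<equiv> module.span F M (tensor_relators F A B)"

lemma be: "a \<in> carrier A \<Longrightarrow> b \<in> carrier B \<Longrightarrow> basis_elem F (a, b) \<in> carrier M"
  by (rule basis_elem_closed) simp

lemma relators_closed: "tensor_relators F A B \<subseteq> carrier M"
  unfolding tensor_relators_def Let_def
  by (auto intro!: M.minus_closed M.a_closed smult_closed be simp del: magma_algebra_simps)

sublocale quotient_mod F M N
  by (rule quotient_mod.intro[OF magma_module quotient_mod_axioms.intro[OF span_is_submodule[OF relators_closed]]])

lemma T_eq: "T = Q" unfolding tensor_algebra_def Let_def by (rule refl)

lemma tens_eq: "tens F A B a b = proj (basis_elem F (a, b))" by (rule tens_def)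

lemma module_T: "module F T" unfolding T_eq by (rule module_Q)

lemma relators_in: "r \<in> tensor_relators F A B \<Longrightarrow> r \<in> N"
  by (rule subsetD[OF in_own_span[OF relators_closed]])

lemma tens_closed: "a \<in> carrier A \<Longrightarrow> b \<in> carrier B \<Longrightarrow> tens F A B a b \<in> carrier T"
  unfolding T_eq tens_eq by (intro proj_closed be)

lemma tens_bilinear: "bilinear F A B T (tens F A B)"
proof -
  have 1: "tens F A B (a \<oplus>\<^bsub>A\<^esub> a') b = tens F A B a b \<oplus>\<^bsub>T\<^esub> tens F A B a' b"
    if "a \<in> carrier A" "a' \<in> carrier A" "b \<in> carrier B" for a a' b
  proof -
    have "basis_elem F (a \<oplus>\<^bsub>A\<^esub> a', b) \<ominus>\<^bsub>M\<^esub> (basis_elem F (a, b) \<oplus>\<^bsub>M\<^esub> basis_elem F (a', b)) \<in> N"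
      by (rule relators_in, unfold tensor_relators_def Let_def) (use that in blast)
    then have "proj (basis_elem F (a \<oplus>\<^bsub>A\<^esub> a', b)) = proj (basis_elem F (a, b) \<oplus>\<^bsub>M\<^esub> basis_elem F (a', b))"
      using that by (subst proj_eq) (auto intro!: be M.a_closed simp del: magma_algebra_simps)
    then show ?thesis unfolding T_eq tens_eq using that proj_add[OF be be] by simp
  qed
  have 2: "tens F A B a (b \<oplus>\<^bsub>B\<^esub> b') = tens F A B a b \<oplus>\<^bsub>T\<^esub> tens F A B a b'"
    if "a \<in> carrier A" "b \<in> carrier B" "b' \<in> carrier B" for a b b'
  proof -
    have "basis_elem F (a, b \<oplus>\<^bsub>B\<^esub> b') \<ominus>\<^bsub>M\<^esub> (basis_elem F (a, b) \<oplus>\<^bsub>M\<^esub> basis_elem F (a, b')) \<in> N"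
      by (rule relators_in, unfold tensor_relators_def Let_def) (use that in blast)
    then have "proj (basis_elem F (a, b \<oplus>\<^bsub>B\<^esub> b')) = proj (basis_elem F (a, b) \<oplus>\<^bsub>M\<^esub> basis_elem F (a, b'))"
      using that by (subst proj_eq) (auto intro!: be M.a_closed simp del: magma_algebra_simps)
    then show ?thesis unfolding T_eq tens_eq using that proj_add[OF be be] by simp
  qed
  have 3: "tens F A B (c \<odot>\<^bsub>A\<^esub> a) b = c \<odot>\<^bsub>T\<^esub> tens F A B a b"
    if "c \<in> carrier F" "a \<in> carrier A" "b \<in> carrier B" for c a b
  proof -
    have "basis_elem F (c \<odot>\<^bsub>A\<^esub> a, b) \<ominus>\<^bsub>M\<^esub> c \<odot>\<^bsub>M\<^esub> basis_elem F (a, b) \<in> N"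
      by (rule relators_in, unfold tensor_relators_def Let_def) (use that in blast)
    then have "proj (basis_elem F (c \<odot>\<^bsub>A\<^esub> a, b)) = proj (c \<odot>\<^bsub>M\<^esub> basis_elem F (a, b))"
      using that by (subst proj_eq) (auto intro!: be smult_closed simp del: magma_algebra_simps)
    then show ?thesis unfolding T_eq tens_eq using that proj_smult[OF _ be] by simp
  qed
  have 4: "tens F A B a (c \<odot>\<^bsub>B\<^esub> b) = c \<odot>\<^bsub>T\<^esub> tens F A B a b"
    if "c \<in> carrier F" "a \<in> carrier A" "b \<in> carrier B" for c a b
  proof -
    have "basis_elem F (a, c \<odot>\<^bsub>B\<^esub> b) \<ominus>\<^bsub>M\<^esub> c \<odot>\<^bsub>M\<^esub> basis_elem F (a, b) \<in> N"
      by (rule relators_in, unfold tensor_relators_def Let_def) (use that in blast)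
    then have "proj (basis_elem F (a, c \<odot>\<^bsub>B\<^esub> b)) = proj (c \<odot>\<^bsub>M\<^esub> basis_elem F (a, b))"
      using that by (subst proj_eq) (auto intro!: be smult_closed simp del: magma_algebra_simps)
    then show ?thesis unfolding T_eq tens_eq using that proj_smult[OF _ be] by simp
  qed
  show ?thesis unfolding bilinear_def
    by (intro conjI ballI module_homI) (simp_all only: 1 2 3 4 tens_closed)
qed

lemmas tens_simps = bilinear_simps[OF tens_bilinear]

lemma proj_lin_ext:
  assumes "f \<in> carrier M"
  shows "proj f = lin_ext F T (\<lambda>p. tens F A B (fst p) (snd p)) f"
  using hom_lin_ext[OF module_Q proj_hom assms] by (simp add: T_eq tens_eq)

text \<open>The rule has no case for scalars or for zero, because a scalar is absorbed into the
  first factor of a pure tensor and zero is the pure tensor \<open>0 \<otimes> 0\<close>.\<close>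

lemma tens_induct [consumes 1, case_names tens add]:
  assumes x: "x \<in> carrier T"
    and tens: "\<And>a b. a \<in> carrier A \<Longrightarrow> b \<in> carrier B \<Longrightarrow> P (tens F A B a b)"
    and add: "\<And>x y. x \<in> carrier T \<Longrightarrow> y \<in> carrier T \<Longrightarrow> P x \<Longrightarrow> P y \<Longrightarrow> P (x \<oplus>\<^bsub>T\<^esub> y)"
  shows "P x"
proof -
  interpret T: module F T by (rule module_T)
  obtain f where f: "f \<in> carrier M" "x = proj f" using x unfolding T_eq carrier_Q by blast
  have P0: "P \<zero>\<^bsub>T\<^esub>"
    using tens[OF A.M.zero_closed B.M.zero_closed]
      bilinear_zero(1)[OF tens_bilinear A.module_axioms B.module_axioms module_T A.M.zero_closed] by simp
  have c: "f p \<odot>\<^bsub>T\<^esub> tens F A B (fst p) (snd p) = tens F A B (f p \<odot>\<^bsub>A\<^esub> fst p) (snd p)"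
      "fst p \<in> carrier A" "snd p \<in> carrier B" "f p \<in> carrier F"
    if "f p \<noteq> \<zero>\<^bsub>F\<^esub>" for p
    using that supp_subset[OF f(1)] val_closed[OF f(1), of p] by (auto simp: tens_simps(4))
  show ?thesis unfolding f(2) proj_lin_ext[OF f(1)] lin_ext_def
    by (rule T.finsum_induct[of P, OF P0 add]) (use c tens tens_closed in \<open>auto intro!: A.smult_closed\<close>)
qed

text \<open>The linear extension of a bilinear map vanishes on the relators, hence on their span, so
  it factors through the quotient.\<close>

lemma tens_lift:
  assumes V: "module F V" and bil: "bilinear F A B V \<beta>"
  shows "a \<in> carrier A \<Longrightarrow> b \<in> carrier B \<Longrightarrow> tens_lift F V \<beta> (tens F A B a b) = \<beta> a b"
    "tens_lift F V \<beta> \<in> module_hom F T V"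
proof -
  interpret V: module F V by fact
  define h where "h = lin_ext F V (\<lambda>p. \<beta> (fst p) (snd p))"
  have \<beta>: "(\<lambda>p. \<beta> (fst p) (snd p)) \<in> carrier (A \<times>\<times> B) \<rightarrow> carrier V" using bilinearD(3)[OF bil] by auto
  have h: "h \<in> module_hom F M V" unfolding h_def by (rule lin_ext_hom[OF V \<beta>])
  have hb: "h (basis_elem F (a, b)) = \<beta> a b" if "a \<in> carrier A" "b \<in> carrier B" for a b
    unfolding h_def using lin_ext_basis[OF V \<beta>, of "(a, b)"] that by simp
  interpret h: mod_hom F M V h using module_axioms V h by (simp add: mod_hom_def mod_hom_axioms_def)
  note bs = bilinear_simps[OF bil] bilinearD(3)[OF bil]
  have hm: "h (x \<ominus>\<^bsub>M\<^esub> y) = \<zero>\<^bsub>V\<^esub>" if "x \<in> carrier M" "y \<in> carrier M" "h x = h y" for x y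
    using that h.f_minus[OF that(1,2)] module_hom_in[OF h] by (simp del: magma_algebra_simps)
  have "h r = \<zero>\<^bsub>V\<^esub>" if "r \<in> tensor_relators F A B" for r
    using that unfolding tensor_relators_def Let_def
    by (elim UnE CollectE exE conjE)
      (auto intro!: hm be M.a_closed smult_closed
        simp: module_hom_add[OF h] module_hom_smult[OF h] hb be bs simp del: magma_algebra_simps)
  then have "tensor_relators F A B \<subseteq> h.ker" using relators_closed by (auto simp: h.ker_def)
  then have "N \<subseteq> h.ker" by (rule span_is_subset[OF _ h.ker_is_submodule])
  then have k: "h n = \<zero>\<^bsub>V\<^esub>" if "n \<in> N" for n using that by (auto simp: h.ker_def)
  have q1: "quot_lift h (proj x) = h x" if "x \<in> carrier M" for x
    by (rule quot_lift(1)[OF V h _ that]) (rule k)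
  have q2: "quot_lift h \<in> module_hom F Q V" by (rule quot_lift(2)[OF V h]) (rule k)
  have e: "tens_lift F V \<beta> = quot_lift h" by (simp add: tens_lift_def h_def)
  show "tens_lift F V \<beta> (tens F A B a b) = \<beta> a b" if "a \<in> carrier A" "b \<in> carrier B"
    unfolding e tens_eq using q1[OF be[OF that]] hb[OF that] by (simp only:)
  show "tens_lift F V \<beta> \<in> module_hom F T V" unfolding e T_eq by (rule q2)
qed

text \<open>By the universal property, the linear extension of \<open>\<beta>\<close> is
  \<open>proj\<close> followed by the induced map, so it vanishes on \<open>N\<close>. In this form
  the universal property shows that products with elements of \<open>N\<close> stay in
  \<open>N\<close>.\<close>

lemma bilinear_kills_N:
  assumes V: "module F V" and bil: "bilinear F A B V \<beta>" and n: "n \<in> N"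
  shows "lin_ext F V (\<lambda>p. \<beta> (fst p) (snd p)) n = \<zero>\<^bsub>V\<^esub>"
proof -
  have nc: "n \<in> carrier M" using n N_sub by auto
  have \<beta>: "(\<lambda>p. \<beta> (fst p) (snd p)) \<in> carrier (A \<times>\<times> B) \<rightarrow> carrier V" using bilinearD(3)[OF bil] by auto
  define h where "h = tens_lift F V \<beta>"
  have h: "h \<in> module_hom F T V" and ht: "a \<in> carrier A \<Longrightarrow> b \<in> carrier B \<Longrightarrow> h (tens F A B a b) = \<beta> a b" for a b
    using tens_lift[OF V bil] by (auto simp: h_def)
  have t: "(\<lambda>p. tens F A B (fst p) (snd p)) \<in> carrier (A \<times>\<times> B) \<rightarrow> carrier T" using tens_closed by auto
  have "h (proj n) = lin_ext F V (\<lambda>p. h (tens F A B (fst p) (snd p))) n"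
    unfolding proj_lin_ext[OF nc] by (rule lin_ext_comp[OF module_T V h t nc])
  also have "\<dots> = lin_ext F V (\<lambda>p. \<beta> (fst p) (snd p)) n"
  proof -
    interpret V: module F V by fact
    have "fst p \<in> carrier A" "snd p \<in> carrier B" if "n p \<noteq> \<zero>\<^bsub>F\<^esub>" for p
      using that supp_subset[OF nc] by auto
    then show ?thesis unfolding lin_ext_def using val_closed[OF nc] bilinearD(3)[OF bil]
      by (intro V.finsum_cong') (auto simp: ht)
  qed
  finally show ?thesis using proj_zero[OF nc] n module_hom_zero[OF module_T V h] by (simp add: T_eq)
qed

end


section \<open>The tensor product algebra\<close>

lemma bilinearI:
  assumes "\<And>a b. a \<in> carrier A \<Longrightarrow> b \<in> carrier B \<Longrightarrow> \<beta> a b \<in> carrier V"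
    and "\<And>a a' b. a \<in> carrier A \<Longrightarrow> a' \<in> carrier A \<Longrightarrow> b \<in> carrier B \<Longrightarrow> \<beta> (a \<oplus>\<^bsub>A\<^esub> a') b = \<beta> a b \<oplus>\<^bsub>V\<^esub> \<beta> a' b"
    and "\<And>a b b'. a \<in> carrier A \<Longrightarrow> b \<in> carrier B \<Longrightarrow> b' \<in> carrier B \<Longrightarrow> \<beta> a (b \<oplus>\<^bsub>B\<^esub> b') = \<beta> a b \<oplus>\<^bsub>V\<^esub> \<beta> a b'"
    and "\<And>c a b. c \<in> carrier F \<Longrightarrow> a \<in> carrier A \<Longrightarrow> b \<in> carrier B \<Longrightarrow> \<beta> (c \<odot>\<^bsub>A\<^esub> a) b = c \<odot>\<^bsub>V\<^esub> \<beta> a b"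
    and "\<And>c a b. c \<in> carrier F \<Longrightarrow> a \<in> carrier A \<Longrightarrow> b \<in> carrier B \<Longrightarrow> \<beta> a (c \<odot>\<^bsub>B\<^esub> b) = c \<odot>\<^bsub>V\<^esub> \<beta> a b"
  shows "bilinear F A B V \<beta>"
  unfolding bilinear_def by (intro conjI ballI module_homI) (simp_all only: assms)

lemma bilinear_finsum:
  assumes "bilinear F A B V \<beta>" "module F A" "module F B" "module F V"
  shows "a \<in> carrier A \<Longrightarrow> g \<in> I \<rightarrow> carrier B \<Longrightarrow> \<beta> a (finsum B g I) = finsum V (\<lambda>i. \<beta> a (g i)) I"
    "b \<in> carrier B \<Longrightarrow> f \<in> I \<rightarrow> carrier A \<Longrightarrow> \<beta> (finsum A f I) b = finsum V (\<lambda>i. \<beta> (f i) b) I"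
  using module_hom_finsum[OF assms(3,4) bilinearD(1)[OF assms(1)]]
    module_hom_finsum[OF assms(2,4) bilinearD(2)[OF assms(1)]] by auto

context nonassoc_algebra begin

lemma mult_bilinear: "bilinear F A A A (monoid.mult A)"
  by (rule bilinearI) (simp_all only: prod_closed prod_add_left prod_add_right prod_smult_left prod_smult_right)

lemma associator_zero:
  assumes "x \<in> carrier A" "y \<in> carrier A" "z \<in> carrier A"
  shows "associator A x y z = \<zero>\<^bsub>A\<^esub> \<longleftrightarrow> (x \<otimes>\<^bsub>A\<^esub> y) \<otimes>\<^bsub>A\<^esub> z = x \<otimes>\<^bsub>A\<^esub> (y \<otimes>\<^bsub>A\<^esub> z)"
  unfolding associator_def using assms by (intro M.minus_other_side prod_closed)

lemma nucleus_iff: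
  "x \<in> nucleus A \<longleftrightarrow> x \<in> carrier A \<and> (\<forall>a\<in>carrier A. \<forall>b\<in>carrier A.
     (x \<otimes>\<^bsub>A\<^esub> a) \<otimes>\<^bsub>A\<^esub> b = x \<otimes>\<^bsub>A\<^esub> (a \<otimes>\<^bsub>A\<^esub> b) \<and> (a \<otimes>\<^bsub>A\<^esub> x) \<otimes>\<^bsub>A\<^esub> b = a \<otimes>\<^bsub>A\<^esub> (x \<otimes>\<^bsub>A\<^esub> b) \<and>
     (a \<otimes>\<^bsub>A\<^esub> b) \<otimes>\<^bsub>A\<^esub> x = a \<otimes>\<^bsub>A\<^esub> (b \<otimes>\<^bsub>A\<^esub> x))"
  unfolding nucleus_def by (simp add: associator_zero cong: conj_cong)

lemma nucleusD:
  assumes "x \<in> nucleus A" "a \<in> carrier A" "b \<in> carrier A"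
  shows "(x \<otimes>\<^bsub>A\<^esub> a) \<otimes>\<^bsub>A\<^esub> b = x \<otimes>\<^bsub>A\<^esub> (a \<otimes>\<^bsub>A\<^esub> b)" "(a \<otimes>\<^bsub>A\<^esub> x) \<otimes>\<^bsub>A\<^esub> b = a \<otimes>\<^bsub>A\<^esub> (x \<otimes>\<^bsub>A\<^esub> b)"
    "(a \<otimes>\<^bsub>A\<^esub> b) \<otimes>\<^bsub>A\<^esub> x = a \<otimes>\<^bsub>A\<^esub> (b \<otimes>\<^bsub>A\<^esub> x)"
  using assms by (auto simp: nucleus_iff)

lemma nucleus_add:
  assumes "x \<in> nucleus A" "y \<in> nucleus A" shows "x \<oplus>\<^bsub>A\<^esub> y \<in> nucleus A"
  using assms unfolding nucleus_iff by (simp add: prod_add_left prod_add_right prod_closed)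

lemma alg_center_iff:
  "x \<in> alg_center A \<longleftrightarrow> x \<in> nucleus A \<and> (\<forall>a\<in>carrier A. x \<otimes>\<^bsub>A\<^esub> a = a \<otimes>\<^bsub>A\<^esub> x)"
  by (simp add: alg_center_def)

lemma smult_one_center:
  assumes "c \<in> carrier F" shows "c \<odot>\<^bsub>A\<^esub> \<one>\<^bsub>A\<^esub> \<in> alg_center A"
  unfolding alg_center_iff nucleus_iff using assms
  by (simp add: prod_smult_left prod_smult_right unit_closed unit_left unit_right prod_closed)

end

lemma nonassoc_algebraI:
  assumes "vectorspace F A" "bilinear F A A A (monoid.mult A)" "\<one>\<^bsub>A\<^esub> \<in> carrier A"
    and "\<And>x. x \<in> carrier A \<Longrightarrow> \<one>\<^bsub>A\<^esub> \<otimes>\<^bsub>A\<^esub> x = x" "\<And>x. x \<in> carrier A \<Longrightarrow> x \<otimes>\<^bsub>A\<^esub> \<one>\<^bsub>A\<^esub> = x"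
  shows "nonassoc_algebra F A"
  by (rule nonassoc_algebra.intro[OF assms(1)], unfold_locales)
    (simp_all only: assms bilinear_simps[OF assms(2)] bilinearD(3)[OF assms(2)])

locale tensor_algs = A: nonassoc_algebra F A + B: nonassoc_algebra F B
  for F :: "('f, 'm) ring_scheme" and A :: "('f, 'a) module" and B :: "('f, 'b) module"
begin

sublocale tensor_modules F A B
  by (rule tensor_modules.intro[OF A.module_axioms B.module_axioms])

lemma prod_carrier: "s \<in> carrier (A \<times>\<times> B) \<Longrightarrow> t \<in> carrier (A \<times>\<times> B) \<Longrightarrow> s \<otimes>\<^bsub>A \<times>\<times> B\<^esub> t \<in> carrier (A \<times>\<times> B)"
  by (cases s; cases t) (simp add: A.prod_closed B.prod_closed)

lemma magma_mult_eq:
  assumes "f \<in> carrier M" "g \<in> carrier M"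
  shows "f \<otimes>\<^bsub>M\<^esub> g = lin_ext F M (\<lambda>s. lin_ext F M (\<lambda>t. basis_elem F (s \<otimes>\<^bsub>A \<times>\<times> B\<^esub> t)) g) f"
  by (rule magma_mult[OF _ assms]) (rule prod_carrier)

lemma M_mult_bilinear: "bilinear F M M M (monoid.mult M)"
  by (rule magma_mult_bilinear) (rule prod_carrier)

lemma left_tens_bilinear:
  assumes "a \<in> carrier A" "b \<in> carrier B"
  shows "bilinear F A B T (\<lambda>a' b'. tens F A B (a \<otimes>\<^bsub>A\<^esub> a') (b \<otimes>\<^bsub>B\<^esub> b'))"
  by (rule bilinearI) (simp_all only: assms tens_closed A.prod_closed B.prod_closed A.prod_add_right
      B.prod_add_right A.prod_smult_right B.prod_smult_right tens_simps)

lemma right_tens_bilinear: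
  assumes "a \<in> carrier A" "b \<in> carrier B"
  shows "bilinear F A B T (\<lambda>a' b'. tens F A B (a' \<otimes>\<^bsub>A\<^esub> a) (b' \<otimes>\<^bsub>B\<^esub> b))"
  by (rule bilinearI) (simp_all only: assms tens_closed A.prod_closed B.prod_closed A.prod_add_left
      B.prod_add_left A.prod_smult_left B.prod_smult_left tens_simps)

text \<open>The class of a product of formal sums is the double sum of the products of their pure
  tensors. In this form the inner and the outer sum can each be recognized as the linear extension
  of a bilinear map.\<close>

lemma proj_magma_mult:
  assumes f: "f \<in> carrier M" and g: "g \<in> carrier M"
  shows "proj (f \<otimes>\<^bsub>M\<^esub> g) = lin_ext F T (\<lambda>s. lin_ext F T
    (\<lambda>t. tens F A B (fst s \<otimes>\<^bsub>A\<^esub> fst t) (snd s \<otimes>\<^bsub>B\<^esub> snd t)) g) f"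
proof -
  interpret T: module F T by (rule module_T)
  have inner: "(\<lambda>t. basis_elem F (s \<otimes>\<^bsub>A \<times>\<times> B\<^esub> t)) \<in> carrier (A \<times>\<times> B) \<rightarrow> carrier M"
    if "s \<in> carrier (A \<times>\<times> B)" for s
    using basis_elem_closed[OF prod_carrier[OF that]] by blast
  have mc: "lin_ext F M (\<lambda>t. basis_elem F (s \<otimes>\<^bsub>A \<times>\<times> B\<^esub> t)) g \<in> carrier M"
    if "s \<in> carrier (A \<times>\<times> B)" for s
    using module_hom_in[OF lin_ext_hom[OF magma_module inner[OF that]] g] .
  have pt: "proj (basis_elem F (s \<otimes>\<^bsub>A \<times>\<times> B\<^esub> t)) = tens F A B (fst s \<otimes>\<^bsub>A\<^esub> fst t) (snd s \<otimes>\<^bsub>B\<^esub> snd t)" for s t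
    by (cases s; cases t) (simp add: tens_eq)
  have p: "proj (lin_ext F M (\<lambda>t. basis_elem F (s \<otimes>\<^bsub>A \<times>\<times> B\<^esub> t)) g)
      = lin_ext F T (\<lambda>t. tens F A B (fst s \<otimes>\<^bsub>A\<^esub> fst t) (snd s \<otimes>\<^bsub>B\<^esub> snd t)) g"
    if "s \<in> carrier (A \<times>\<times> B)" for s
    using lin_ext_comp[OF magma_module module_Q proj_hom inner[OF that] g]
    unfolding pt T_eq .
  have "proj (f \<otimes>\<^bsub>M\<^esub> g) = lin_ext F T (\<lambda>s. proj (lin_ext F M (\<lambda>t. basis_elem F (s \<otimes>\<^bsub>A \<times>\<times> B\<^esub> t)) g)) f"
    unfolding magma_mult_eq[OF f g] T_eq
    by (rule lin_ext_comp[OF magma_module module_Q proj_hom Pi_I[OF mc] f])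
  also have "\<dots> = lin_ext F T (\<lambda>s. lin_ext F T
    (\<lambda>t. tens F A B (fst s \<otimes>\<^bsub>A\<^esub> fst t) (snd s \<otimes>\<^bsub>B\<^esub> snd t)) g) f"
    unfolding lin_ext_def[of F T _ f]
  proof (rule T.finsum_cong'[OF refl])
    fix s assume "s \<in> {s. f s \<noteq> \<zero>\<^bsub>F\<^esub>}"
    then have s: "s \<in> carrier (A \<times>\<times> B)" using supp_subset[OF f] by blast
    show "f s \<odot>\<^bsub>T\<^esub> proj (lin_ext F M (\<lambda>t. basis_elem F (s \<otimes>\<^bsub>A \<times>\<times> B\<^esub> t)) g) =
      f s \<odot>\<^bsub>T\<^esub> lin_ext F T (\<lambda>t. tens F A B (fst s \<otimes>\<^bsub>A\<^esub> fst t) (snd s \<otimes>\<^bsub>B\<^esub> snd t)) g"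
      by (simp only: p[OF s])
  next
    show "(\<lambda>s. f s \<odot>\<^bsub>T\<^esub> lin_ext F T (\<lambda>t. tens F A B (fst s \<otimes>\<^bsub>A\<^esub> fst t) (snd s \<otimes>\<^bsub>B\<^esub> snd t)) g)
      \<in> {s. f s \<noteq> \<zero>\<^bsub>F\<^esub>} \<rightarrow> carrier T"
    proof
      fix s assume "s \<in> {s. f s \<noteq> \<zero>\<^bsub>F\<^esub>}"
      then have s: "s \<in> carrier (A \<times>\<times> B)" using supp_subset[OF f] by blast
      show "f s \<odot>\<^bsub>T\<^esub> lin_ext F T (\<lambda>t. tens F A B (fst s \<otimes>\<^bsub>A\<^esub> fst t) (snd s \<otimes>\<^bsub>B\<^esub> snd t)) g \<in> carrier T"
        unfolding p[OF s, symmetric]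
        by (rule T.smult_closed[OF val_closed[OF f]]) (simp only: T_eq proj_closed[OF mc[OF s]])
    qed
  qed
  finally show ?thesis .
qed

text \<open>In either order, the double sum for the product contains the linear extension of a
  bilinear map evaluated at \<open>n\<close>. For \<open>f n\<close> it is the inner sum, for each
  term of \<open>f\<close>, and the map is left multiplication by a pure tensor. For
  \<open>n f\<close> it is the outer sum.\<close>

lemma N_ideal:
  assumes n: "n \<in> N" and f: "f \<in> carrier M"
  shows "n \<otimes>\<^bsub>M\<^esub> f \<in> N \<and> f \<otimes>\<^bsub>M\<^esub> n \<in> N"
proof -
  interpret T: module F T by (rule module_T)
  have nc: "n \<in> carrier M" using N_sub n by blast
  note mm = bilinearD(3)[OF M_mult_bilinear]
  have fs: "fst s \<in> carrier A" "snd s \<in> carrier B" if "f s \<noteq> \<zero>\<^bsub>F\<^esub>" for s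
    using that supp_subset[OF f] by auto
  have "lin_ext F T (\<lambda>t. tens F A B (fst s \<otimes>\<^bsub>A\<^esub> fst t) (snd s \<otimes>\<^bsub>B\<^esub> snd t)) n = \<zero>\<^bsub>T\<^esub>"
    if "f s \<noteq> \<zero>\<^bsub>F\<^esub>" for s
    by (rule bilinear_kills_N[OF module_T left_tens_bilinear[OF fs[OF that]] n])
  then have "proj (f \<otimes>\<^bsub>M\<^esub> n) = (\<Oplus>\<^bsub>T\<^esub>s\<in>{s. f s \<noteq> \<zero>\<^bsub>F\<^esub>}. \<zero>\<^bsub>T\<^esub>)"
    unfolding proj_magma_mult[OF f nc] lin_ext_def[of F T _ f] using val_closed[OF f]
    by (intro T.finsum_cong') simp_all
  then have 1: "f \<otimes>\<^bsub>M\<^esub> n \<in> N" using proj_zero[OF mm[OF f nc], folded T_eq]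
    by (simp only: T.M.add.finprod_one_eqI)
  have "proj (n \<otimes>\<^bsub>M\<^esub> f) = lin_ext F T (\<lambda>s. (\<lambda>a b. lin_ext F T
    (\<lambda>t. tens F A B (a \<otimes>\<^bsub>A\<^esub> fst t) (b \<otimes>\<^bsub>B\<^esub> snd t)) f) (fst s) (snd s)) n"
    unfolding proj_magma_mult[OF nc f] ..
  also have "\<dots> = \<zero>\<^bsub>T\<^esub>"
  proof (rule bilinear_kills_N[OF module_T _ n], unfold bilinear_def, intro conjI ballI)
    fix a assume "a \<in> carrier A"
    then show "(\<lambda>b. lin_ext F T (\<lambda>t. tens F A B (a \<otimes>\<^bsub>A\<^esub> fst t) (b \<otimes>\<^bsub>B\<^esub> snd t)) f) \<in> module_hom F B T"
      by (intro lin_ext_param_hom[OF module_T B.module_axioms _ f]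
          bilinearD(1)[OF right_tens_bilinear]) auto
  next
    fix b assume "b \<in> carrier B"
    then show "(\<lambda>a. lin_ext F T (\<lambda>t. tens F A B (a \<otimes>\<^bsub>A\<^esub> fst t) (b \<otimes>\<^bsub>B\<^esub> snd t)) f) \<in> module_hom F A T"
      by (intro lin_ext_param_hom[OF module_T A.module_axioms _ f]
          bilinearD(2)[OF right_tens_bilinear]) auto
  qed
  finally have "n \<otimes>\<^bsub>M\<^esub> f \<in> N" using proj_zero[OF mm[OF nc f], folded T_eq]
    by (simp only:)
  then show ?thesis using 1 by (rule conjI)
qed

lemma T_mult_proj:
  assumes "x \<in> carrier M" "y \<in> carrier M"
  shows "proj x \<otimes>\<^bsub>T\<^esub> proj y = proj (x \<otimes>\<^bsub>M\<^esub> y)"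
  unfolding T_eq by (rule proj_mult[OF M_mult_bilinear _ assms, symmetric]) (rule N_ideal)

lemma T_cases: "x \<in> carrier T \<Longrightarrow> (\<And>y. y \<in> carrier M \<Longrightarrow> P (proj y)) \<Longrightarrow> P x"
  unfolding T_eq by (rule Q_cases)

lemma T_mult_bilinear: "bilinear F T T T (monoid.mult T)"
proof -
  note mb = M_mult_bilinear
  note P = T_mult_proj proj_add[symmetric, folded T_eq] proj_smult[symmetric, folded T_eq]
    proj_closed[folded T_eq] M.a_closed smult_closed bilinear_simps[OF mb] bilinearD(3)[OF mb]
  show ?thesis
  proof (rule bilinearI)
    fix x y assume x: "x \<in> carrier T" and y: "y \<in> carrier T"
    show "x \<otimes>\<^bsub>T\<^esub> y \<in> carrier T"
      by (rule T_cases[OF x], rule T_cases[OF y]) (simp only: P)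
    show "c \<odot>\<^bsub>T\<^esub> x \<otimes>\<^bsub>T\<^esub> y = c \<odot>\<^bsub>T\<^esub> (x \<otimes>\<^bsub>T\<^esub> y)" if "c \<in> carrier F" for c
      by (rule T_cases[OF x], rule T_cases[OF y]) (simp only: P that)
    show "x \<otimes>\<^bsub>T\<^esub> (c \<odot>\<^bsub>T\<^esub> y) = c \<odot>\<^bsub>T\<^esub> (x \<otimes>\<^bsub>T\<^esub> y)" if "c \<in> carrier F" for c
      by (rule T_cases[OF x], rule T_cases[OF y]) (simp only: P that)
    fix z assume z: "z \<in> carrier T"
    show "(x \<oplus>\<^bsub>T\<^esub> y) \<otimes>\<^bsub>T\<^esub> z = x \<otimes>\<^bsub>T\<^esub> z \<oplus>\<^bsub>T\<^esub> y \<otimes>\<^bsub>T\<^esub> z"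
      by (rule T_cases[OF x], rule T_cases[OF y], rule T_cases[OF z]) (simp only: P)
    show "x \<otimes>\<^bsub>T\<^esub> (y \<oplus>\<^bsub>T\<^esub> z) = x \<otimes>\<^bsub>T\<^esub> y \<oplus>\<^bsub>T\<^esub> x \<otimes>\<^bsub>T\<^esub> z"
      by (rule T_cases[OF x], rule T_cases[OF y], rule T_cases[OF z]) (simp only: P)
  qed
qed

lemma tens_mult:
  assumes "a \<in> carrier A" "b \<in> carrier B" "a' \<in> carrier A" "b' \<in> carrier B"
  shows "tens F A B a b \<otimes>\<^bsub>T\<^esub> tens F A B a' b' = tens F A B (a \<otimes>\<^bsub>A\<^esub> a') (b \<otimes>\<^bsub>B\<^esub> b')"
proof -
  have "basis_elem F (a, b) \<otimes>\<^bsub>M\<^esub> basis_elem F (a', b') = basis_elem F ((a, b) \<otimes>\<^bsub>A \<times>\<times> B\<^esub> (a', b'))"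
    by (rule magma_mult_basis) (rule prod_carrier, assumption+, use assms in simp_all)
  then show ?thesis unfolding tens_eq T_mult_proj[OF be[OF assms(1,2)] be[OF assms(3,4)]]
    by (simp only: mult_DirProd)
qed

lemma tens_one: "\<one>\<^bsub>T\<^esub> = tens F A B \<one>\<^bsub>A\<^esub> \<one>\<^bsub>B\<^esub>"
  by (simp add: T_eq tens_eq)

lemma nonassoc_algebra_T: "nonassoc_algebra F T"
proof (rule nonassoc_algebraI)
  interpret T: module F T by (rule module_T)
  show "vectorspace F T" by (rule vectorspace.intro[OF module_T A.field_axioms])
  show "bilinear F T T T (monoid.mult T)" by (rule T_mult_bilinear)
  show one: "\<one>\<^bsub>T\<^esub> \<in> carrier T" unfolding tens_one by (rule tens_closed[OF A.unit_closed B.unit_closed])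
  fix x assume "x \<in> carrier T"
  then have "\<one>\<^bsub>T\<^esub> \<otimes>\<^bsub>T\<^esub> x = x \<and> x \<otimes>\<^bsub>T\<^esub> \<one>\<^bsub>T\<^esub> = x"
  proof (induct rule: tens_induct)
    case (tens a b)
    then show ?case unfolding tens_one
      by (simp only: tens_mult A.unit_closed B.unit_closed A.unit_left A.unit_right B.unit_left B.unit_right simp_thms)
  next
    case (add x y)
    then show ?case by (simp only: bilinear_simps(1,2)[OF T_mult_bilinear] one simp_thms)
  qed
  then show "\<one>\<^bsub>T\<^esub> \<otimes>\<^bsub>T\<^esub> x = x" "x \<otimes>\<^bsub>T\<^esub> \<one>\<^bsub>T\<^esub> = x" by (rule conjunct1, rule conjunct2)
qed

sublocale T: nonassoc_algebra F T by (rule nonassoc_algebra_T)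

end

section \<open>Dual bases of tensor products\<close>

text \<open>Abstracts from the construction: a bilinear map whose values generate \<open>T\<close>
  additively and along which products of functionals extend. The last condition takes the place of
  the universal property and suffices for dual bases and dimensions. The instances are
  \<open>tensor_algebra\<close> and the image of \<open>K \<otimes> L\<close> in
  \<open>A \<otimes> B\<close>.\<close>

locale tensor_like = A: module F A + B: module F B + T: module F T
  for F :: "('f, 'm) ring_scheme" and A :: "('f, 'a) module" and B :: "('f, 'b) module"
    and T :: "('f, 't) module" +
  fixes tau :: "'a \<Rightarrow> 'b \<Rightarrow> 't"
  assumes tau_bilinear: "bilinear F A B T tau"
    and tau_induct: "x \<in> carrier T \<Longrightarrow> (\<And>a b. a \<in> carrier A \<Longrightarrow> b \<in> carrier B \<Longrightarrow> P (tau a b)) \<Longrightarrow>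
      (\<And>x y. x \<in> carrier T \<Longrightarrow> y \<in> carrier T \<Longrightarrow> P x \<Longrightarrow> P y \<Longrightarrow> P (x \<oplus>\<^bsub>T\<^esub> y)) \<Longrightarrow> P x"
    and tau_functional: "f \<in> module_hom F A (self_module F) \<Longrightarrow> g \<in> module_hom F B (self_module F) \<Longrightarrow>
      \<exists>h\<in>module_hom F T (self_module F). \<forall>a\<in>carrier A. \<forall>b\<in>carrier B. h (tau a b) = f a \<otimes>\<^bsub>F\<^esub> g b"
begin

lemma tau_closed: "a \<in> carrier A \<Longrightarrow> b \<in> carrier B \<Longrightarrow> tau a b \<in> carrier T"
  by (rule bilinearD(3)[OF tau_bilinear])

lemma tau_hom_eq:
  assumes "g \<in> module_hom F T V" "h \<in> module_hom F T V" "x \<in> carrier T"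
    and "\<And>a b. a \<in> carrier A \<Longrightarrow> b \<in> carrier B \<Longrightarrow> g (tau a b) = h (tau a b)"
  shows "g x = h x"
  by (rule tau_induct[OF assms(3), of "\<lambda>x. g x = h x"])
    (simp_all only: assms(4) module_hom_add[OF assms(1)] module_hom_add[OF assms(2)])

lemma tau_expand:
  assumes d: "dual_basis F A I b f" and e: "dual_basis F B J c g"
    and a: "a \<in> carrier A" and b': "b' \<in> carrier B"
  shows "(\<Oplus>\<^bsub>T\<^esub>p\<in>I \<times> J. (f (fst p) a \<otimes>\<^bsub>F\<^esub> g (snd p) b') \<odot>\<^bsub>T\<^esub> tau (b (fst p)) (c (snd p))) = tau a b'"
proof -
  note D = dual_basisD[OF d] and E = dual_basisD[OF e]
  have "(\<Oplus>\<^bsub>T\<^esub>p\<in>I \<times> J. (f (fst p) a \<otimes>\<^bsub>F\<^esub> g (snd p) b') \<odot>\<^bsub>T\<^esub> tau (b (fst p)) (c (snd p)))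
      = (\<Oplus>\<^bsub>T\<^esub>i\<in>I. \<Oplus>\<^bsub>T\<^esub>j\<in>J. (f i a \<otimes>\<^bsub>F\<^esub> g j b') \<odot>\<^bsub>T\<^esub> tau (b i) (c j))"
    using D(1,2) E(1,2) D(6)[OF _ a] E(6)[OF _ b']
    by (intro T.finsum_cartesian[where g = "\<lambda>i j. (f i a \<otimes>\<^bsub>F\<^esub> g j b') \<odot>\<^bsub>T\<^esub> tau (b i) (c j)"])
      (simp_all add: tau_closed)
  also have "\<dots> = (\<Oplus>\<^bsub>T\<^esub>i\<in>I. tau (f i a \<odot>\<^bsub>A\<^esub> b i) b')"
  proof (rule T.finsum_cong'[OF refl])
    fix i assume i: "i \<in> I"
    have "tau (f i a \<odot>\<^bsub>A\<^esub> b i) b' = tau (f i a \<odot>\<^bsub>A\<^esub> b i) (\<Oplus>\<^bsub>B\<^esub>j\<in>J. g j b' \<odot>\<^bsub>B\<^esub> c j)"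
      by (simp only: E(5)[OF b'])
    also have "\<dots> = (\<Oplus>\<^bsub>T\<^esub>j\<in>J. tau (f i a \<odot>\<^bsub>A\<^esub> b i) (g j b' \<odot>\<^bsub>B\<^esub> c j))"
      using i D(2) D(6)[OF _ a] E(2) E(6)[OF _ b']
      by (intro bilinear_finsum(1)[OF tau_bilinear A.module_axioms B.module_axioms T.module_axioms]) simp_all
    also have "\<dots> = (\<Oplus>\<^bsub>T\<^esub>j\<in>J. (f i a \<otimes>\<^bsub>F\<^esub> g j b') \<odot>\<^bsub>T\<^esub> tau (b i) (c j))"
      using i D(2) D(6)[OF _ a] E(2) E(6)[OF _ b']
      by (intro T.finsum_cong')
        (simp_all add: bilinear_simps[OF tau_bilinear] tau_closed T.smult_assoc_simp A.R.m_comm)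
    finally show "(\<Oplus>\<^bsub>T\<^esub>j\<in>J. (f i a \<otimes>\<^bsub>F\<^esub> g j b') \<odot>\<^bsub>T\<^esub> tau (b i) (c j)) = tau (f i a \<odot>\<^bsub>A\<^esub> b i) b'" by (rule sym)
  qed (use D(2) D(6)[OF _ a] b' tau_closed in simp)
  also have "\<dots> = tau (\<Oplus>\<^bsub>A\<^esub>i\<in>I. f i a \<odot>\<^bsub>A\<^esub> b i) b'"
    using D(2) D(6)[OF _ a]
    by (intro bilinear_finsum(2)[OF tau_bilinear A.module_axioms B.module_axioms T.module_axioms b', symmetric]) simp
  also have "\<dots> = tau a b'" by (simp only: D(5)[OF a])
  finally show ?thesis .
qed

text \<open>The coordinate functionals are the products of those of the factors. Both sides of the
  expansion are linear in \<open>x\<close>, so they are compared on pure tensors only.\<close>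

lemma tau_dual_basis:
  assumes d: "dual_basis F A I b f" and e: "dual_basis F B J c g"
  shows "\<exists>h. dual_basis F T (I \<times> J) (\<lambda>p. tau (b (fst p)) (c (snd p))) h \<and>
    (\<forall>p\<in>I \<times> J. \<forall>x\<in>carrier A. \<forall>y\<in>carrier B. h p (tau x y) = f (fst p) x \<otimes>\<^bsub>F\<^esub> g (snd p) y)"
proof -
  note D = dual_basisD[OF d] and E = dual_basisD[OF e]
  have "\<exists>h. \<forall>p\<in>I \<times> J. h p \<in> module_hom F T (self_module F) \<and>
    (\<forall>x\<in>carrier A. \<forall>y\<in>carrier B. h p (tau x y) = f (fst p) x \<otimes>\<^bsub>F\<^esub> g (snd p) y)"
  proof (rule bchoice, rule ballI)
    fix p assume "p \<in> I \<times> J"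
    then have "fst p \<in> I" "snd p \<in> J" by auto
    then show "\<exists>h. h \<in> module_hom F T (self_module F) \<and>
      (\<forall>x\<in>carrier A. \<forall>y\<in>carrier B. h (tau x y) = f (fst p) x \<otimes>\<^bsub>F\<^esub> g (snd p) y)"
      using tau_functional[OF D(3) E(3)] unfolding Bex_def by simp
  qed
  then obtain h where H: "\<forall>p\<in>I \<times> J. h p \<in> module_hom F T (self_module F) \<and>
    (\<forall>x\<in>carrier A. \<forall>y\<in>carrier B. h p (tau x y) = f (fst p) x \<otimes>\<^bsub>F\<^esub> g (snd p) y)"
    by (rule exE)
  have h: "h p \<in> module_hom F T (self_module F)" if "p \<in> I \<times> J" for p
    using bspec[OF H that] by (rule conjunct1)
  have ht: "h p (tau x y) = f (fst p) x \<otimes>\<^bsub>F\<^esub> g (snd p) y"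
    if "p \<in> I \<times> J" "x \<in> carrier A" "y \<in> carrier B" for p x y
    using bspec[OF bspec[OF conjunct2[OF bspec[OF H that(1)]] that(2)] that(3)] .
  have fst: "fst p \<in> I" "snd p \<in> J" if "p \<in> I \<times> J" for p using that by auto
  have bc: "tau (b (fst p)) (c (snd p)) \<in> carrier T" if "p \<in> I \<times> J" for p
    using fst[OF that] D(2) E(2) tau_closed by simp
  have "dual_basis F T (I \<times> J) (\<lambda>p. tau (b (fst p)) (c (snd p))) h"
    unfolding dual_basis_def
  proof (intro conjI ballI)
    show "finite (I \<times> J)" using D(1) E(1) by simp
    show "(\<lambda>p. tau (b (fst p)) (c (snd p))) \<in> I \<times> J \<rightarrow> carrier T" using bc by (rule Pi_I)
    show "h p \<in> module_hom F T (self_module F)" if "p \<in> I \<times> J" for p by (rule h[OF that])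
    show "h p (tau (b (fst q)) (c (snd q))) = (if p = q then \<one>\<^bsub>F\<^esub> else \<zero>\<^bsub>F\<^esub>)"
      if "p \<in> I \<times> J" "q \<in> I \<times> J" for p q
      using ht[OF that(1)] D(2)[of "fst q"] E(2)[of "snd q"] fst[OF that(1)] fst[OF that(2)]
      by (simp add: D(4) E(4) prod_eq_iff)
    fix x assume x: "x \<in> carrier T"
    show "(\<Oplus>\<^bsub>T\<^esub>p\<in>I \<times> J. h p x \<odot>\<^bsub>T\<^esub> tau (b (fst p)) (c (snd p))) = x"
    proof (rule tau_hom_eq[OF _ _ x, of _ T "\<lambda>x. x"])
      show "(\<lambda>x. \<Oplus>\<^bsub>T\<^esub>p\<in>I \<times> J. h p x \<odot>\<^bsub>T\<^esub> tau (b (fst p)) (c (snd p))) \<in> module_hom F T T"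
        by (rule module_hom_sum_fun[OF T.module_axioms T.module_axioms])
          (rule module_hom_smult_vec[OF T.module_axioms h bc])
      show "(\<lambda>x. x) \<in> module_hom F T T" by (simp add: module_hom_def)
      fix u v assume u: "u \<in> carrier A" and v: "v \<in> carrier B"
      have "(\<Oplus>\<^bsub>T\<^esub>p\<in>I \<times> J. h p (tau u v) \<odot>\<^bsub>T\<^esub> tau (b (fst p)) (c (snd p)))
        = (\<Oplus>\<^bsub>T\<^esub>p\<in>I \<times> J. (f (fst p) u \<otimes>\<^bsub>F\<^esub> g (snd p) v) \<odot>\<^bsub>T\<^esub> tau (b (fst p)) (c (snd p)))"
        using bc D(6)[OF _ u] E(6)[OF _ v]
        by (intro T.finsum_cong') (simp_all add: ht u v fst del: mem_Times_iff)
      then show "(\<Oplus>\<^bsub>T\<^esub>p\<in>I \<times> J. h p (tau u v) \<odot>\<^bsub>T\<^esub> tau (b (fst p)) (c (snd p))) = tau u v"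
        by (simp only: tau_expand[OF d e u v])
    qed
  qed
  then show ?thesis using ht by (intro exI[of _ h]) simp
qed

end

lemma (in tensor_modules) tensor_like_T: "tensor_like F A B T (tens F A B)"
proof -
  interpret T: module F T by (rule module_T)
  have sm: "module F (self_module F)" by (rule module_self_module[OF A.R.is_cring])
  show ?thesis
  proof unfold_locales
    show "bilinear F A B T (tens F A B)" by (rule tens_bilinear)
    show "P x" if "x \<in> carrier T" "\<And>a b. a \<in> carrier A \<Longrightarrow> b \<in> carrier B \<Longrightarrow> P (tens F A B a b)"
      "\<And>x y. x \<in> carrier T \<Longrightarrow> y \<in> carrier T \<Longrightarrow> P x \<Longrightarrow> P y \<Longrightarrow> P (x \<oplus>\<^bsub>T\<^esub> y)" for P x
      by (rule tens_induct[of x P, OF that])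
    fix f g assume f: "f \<in> module_hom F A (self_module F)" and g: "g \<in> module_hom F B (self_module F)"
    have fc: "x \<in> carrier A \<Longrightarrow> f x \<in> carrier F" for x using module_hom_in[OF f] by simp
    have gc: "x \<in> carrier B \<Longrightarrow> g x \<in> carrier F" for x using module_hom_in[OF g] by simp
    have bil: "bilinear F A B (self_module F) (\<lambda>a b. f a \<otimes>\<^bsub>F\<^esub> g b)"
      by (rule bilinearI) (simp_all add: fc gc module_hom_add[OF f] module_hom_add[OF g]
        module_hom_smult[OF f] module_hom_smult[OF g] A.R.m_assoc A.R.m_lcomm A.R.l_distr A.R.r_distr)
    show "\<exists>h\<in>module_hom F T (self_module F). \<forall>a\<in>carrier A. \<forall>b\<in>carrier B. h (tens F A B a b) = f a \<otimes>\<^bsub>F\<^esub> g b"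
      using tens_lift[OF sm bil] by (intro bexI[of _ "tens_lift F (self_module F) (\<lambda>a b. f a \<otimes>\<^bsub>F\<^esub> g b)"]) simp_all
  qed
qed


lemma tensor_like_dim:
  assumes "vectorspace F A" "vectorspace F B" "vectorspace F T" "tensor_like F A B T tau"
    and fdA: "vectorspace.fin_dim F A" and fdB: "vectorspace.fin_dim F B"
  shows "vectorspace.fin_dim F T" "vectorspace.dim F T = vectorspace.dim F A * vectorspace.dim F B"
proof -
  interpret A: vectorspace F A by fact
  interpret B: vectorspace F B by fact
  interpret T: vectorspace F T by fact
  obtain I f where d: "dual_basis F A I (\<lambda>x. x) f" using A.dual_basis_exists[OF fdA] by (elim exE)
  obtain J g where e: "dual_basis F B J (\<lambda>x. x) g" using B.dual_basis_exists[OF fdB] by (elim exE)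
  obtain h where h: "dual_basis F T (I \<times> J) (\<lambda>p. tau (fst p) (snd p)) h"
    using tensor_like.tau_dual_basis[OF assms(4) d e] by (elim exE conjE)
  show "T.fin_dim" by (rule T.dual_basis_dim(1)[OF h])
  show "T.dim = A.dim * B.dim"
    unfolding T.dual_basis_dim(2)[OF h] A.dual_basis_dim(2)[OF d] B.dual_basis_dim(2)[OF e]
    by (rule card_cartesian_product)
qed

section \<open>The center of a tensor product\<close>

text \<open>Along \<open>\<iota>\<close>, the map \<open>h\<close> commutes with left and right
  multiplication by elements of \<open>A\<close>. Applying \<open>h\<close> to the identities by
  which \<open>x\<close> associates and commutes with elements \<open>\<iota> a\<close> gives the
  same identities for \<open>h x\<close>. The abstract form serves both tensor factors.\<close>

lemma center_contraction:
  assumes "nonassoc_algebra F T" "nonassoc_algebra F A" "h \<in> module_hom F T A"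
    and \<iota>: "\<And>a. a \<in> carrier A \<Longrightarrow> \<iota> a \<in> carrier T"
    and \<iota>_mult: "\<And>a b. a \<in> carrier A \<Longrightarrow> b \<in> carrier A \<Longrightarrow> \<iota> a \<otimes>\<^bsub>T\<^esub> \<iota> b = \<iota> (a \<otimes>\<^bsub>A\<^esub> b)"
    and right: "\<And>x a. x \<in> carrier T \<Longrightarrow> a \<in> carrier A \<Longrightarrow> h (x \<otimes>\<^bsub>T\<^esub> \<iota> a) = h x \<otimes>\<^bsub>A\<^esub> a"
    and left: "\<And>x a. x \<in> carrier T \<Longrightarrow> a \<in> carrier A \<Longrightarrow> h (\<iota> a \<otimes>\<^bsub>T\<^esub> x) = a \<otimes>\<^bsub>A\<^esub> h x"
    and x: "x \<in> alg_center T"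
  shows "h x \<in> alg_center A"
proof -
  interpret T: nonassoc_algebra F T by fact
  interpret A: nonassoc_algebra F A by fact
  have xn: "x \<in> nucleus T" and comm: "\<And>a. a \<in> carrier T \<Longrightarrow> x \<otimes>\<^bsub>T\<^esub> a = a \<otimes>\<^bsub>T\<^esub> x"
    using x by (simp_all add: T.alg_center_iff)
  have xc: "x \<in> carrier T" using xn by (simp add: T.nucleus_iff)
  have hc: "h x \<in> carrier A" by (rule module_hom_in[OF assms(3) xc])
  have "(h x \<otimes>\<^bsub>A\<^esub> a) \<otimes>\<^bsub>A\<^esub> b = h x \<otimes>\<^bsub>A\<^esub> (a \<otimes>\<^bsub>A\<^esub> b) \<and> (a \<otimes>\<^bsub>A\<^esub> h x) \<otimes>\<^bsub>A\<^esub> b = a \<otimes>\<^bsub>A\<^esub> (h x \<otimes>\<^bsub>A\<^esub> b) \<and>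
     (a \<otimes>\<^bsub>A\<^esub> b) \<otimes>\<^bsub>A\<^esub> h x = a \<otimes>\<^bsub>A\<^esub> (b \<otimes>\<^bsub>A\<^esub> h x)"
    if a: "a \<in> carrier A" and b: "b \<in> carrier A" for a b
  proof (intro conjI)
    note n = T.nucleusD[OF xn \<iota>[OF a] \<iota>[OF b]]
    note c = xc a b \<iota> A.prod_closed T.prod_closed
    have "(h x \<otimes>\<^bsub>A\<^esub> a) \<otimes>\<^bsub>A\<^esub> b = h ((x \<otimes>\<^bsub>T\<^esub> \<iota> a) \<otimes>\<^bsub>T\<^esub> \<iota> b)" by (simp only: right c)
    also have "\<dots> = h x \<otimes>\<^bsub>A\<^esub> (a \<otimes>\<^bsub>A\<^esub> b)" unfolding n(1) by (simp only: right c \<iota>_mult)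
    finally show "(h x \<otimes>\<^bsub>A\<^esub> a) \<otimes>\<^bsub>A\<^esub> b = h x \<otimes>\<^bsub>A\<^esub> (a \<otimes>\<^bsub>A\<^esub> b)" .
    have "(a \<otimes>\<^bsub>A\<^esub> h x) \<otimes>\<^bsub>A\<^esub> b = h ((\<iota> a \<otimes>\<^bsub>T\<^esub> x) \<otimes>\<^bsub>T\<^esub> \<iota> b)" by (simp only: left right c)
    also have "\<dots> = a \<otimes>\<^bsub>A\<^esub> (h x \<otimes>\<^bsub>A\<^esub> b)" unfolding n(2) by (simp only: left right c)
    finally show "(a \<otimes>\<^bsub>A\<^esub> h x) \<otimes>\<^bsub>A\<^esub> b = a \<otimes>\<^bsub>A\<^esub> (h x \<otimes>\<^bsub>A\<^esub> b)" .
    have "a \<otimes>\<^bsub>A\<^esub> (b \<otimes>\<^bsub>A\<^esub> h x) = h (\<iota> a \<otimes>\<^bsub>T\<^esub> (\<iota> b \<otimes>\<^bsub>T\<^esub> x))" by (simp only: left c)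
    also have "\<dots> = (a \<otimes>\<^bsub>A\<^esub> b) \<otimes>\<^bsub>A\<^esub> h x" unfolding n(3)[symmetric] by (simp only: left c \<iota>_mult)
    finally show "(a \<otimes>\<^bsub>A\<^esub> b) \<otimes>\<^bsub>A\<^esub> h x = a \<otimes>\<^bsub>A\<^esub> (b \<otimes>\<^bsub>A\<^esub> h x)" by (rule sym)
  qed
  moreover have "h x \<otimes>\<^bsub>A\<^esub> a = a \<otimes>\<^bsub>A\<^esub> h x" if "a \<in> carrier A" for a
    using arg_cong[OF comm[OF \<iota>[OF that]], of h] by (simp only: left right xc that)
  ultimately show ?thesis using hc unfolding A.alg_center_iff A.nucleus_iff by blast
qed

text \<open>Injectivity of the structure map gives \<open>1 \<noteq> 0\<close>, so some coordinate
  of the unit is nonzero. The value is not normalized to 1, which is why \<open>f 1\<close> is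
  inverted later.\<close>

lemma (in nonassoc_algebra) central_functional:
  assumes "central F A" fin_dim
  shows "\<exists>f\<in>module_hom F A (self_module F). f \<one>\<^bsub>A\<^esub> \<noteq> \<zero>\<^bsub>F\<^esub>"
proof -
  have "\<zero>\<^bsub>F\<^esub> \<odot>\<^bsub>A\<^esub> \<one>\<^bsub>A\<^esub> \<noteq> \<one>\<^bsub>F\<^esub> \<odot>\<^bsub>A\<^esub> \<one>\<^bsub>A\<^esub>"
    using assms(1) inj_onD[of "\<lambda>c. c \<odot>\<^bsub>A\<^esub> \<one>\<^bsub>A\<^esub>" "carrier F" "\<zero>\<^bsub>F\<^esub>" "\<one>\<^bsub>F\<^esub>"]
    unfolding central_def bij_betw_def by auto
  then have one: "\<one>\<^bsub>A\<^esub> \<noteq> \<zero>\<^bsub>A\<^esub>" using unit_closed by simp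
  obtain I f where d: "dual_basis F A I (\<lambda>x. x) f" using dual_basis_exists[OF assms(2)] by blast
  note D = dual_basisD[OF d]
  show ?thesis
  proof (rule ccontr)
    assume n: "\<not> ?thesis"
    have "(\<Oplus>\<^bsub>A\<^esub>i\<in>I. f i \<one>\<^bsub>A\<^esub> \<odot>\<^bsub>A\<^esub> i) = \<zero>\<^bsub>A\<^esub>"
    proof (rule M.add.finprod_one_eqI)
      fix i assume i: "i \<in> I"
      have "f i \<one>\<^bsub>A\<^esub> = \<zero>\<^bsub>F\<^esub>" using n D(3)[OF i] by blast
      then show "f i \<one>\<^bsub>A\<^esub> \<odot>\<^bsub>A\<^esub> i = \<zero>\<^bsub>A\<^esub>" using D(2)[OF i] by simp
    qed
    then show False using D(5)[OF unit_closed] one by simp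
  qed
qed

context tensor_algs begin

text \<open>This is the map \<open>id \<otimes> g\<close>, which commutes with multiplication by
  elements \<open>a \<otimes> 1\<close> on either side.\<close>

lemma left_contraction:
  assumes g: "g \<in> module_hom F B (self_module F)"
  shows "\<exists>h\<in>module_hom F T A. (\<forall>a\<in>carrier A. \<forall>b\<in>carrier B. h (tens F A B a b) = g b \<odot>\<^bsub>A\<^esub> a) \<and>
    (\<forall>x\<in>alg_center T. h x \<in> alg_center A)"
proof -
  have gc: "b \<in> carrier B \<Longrightarrow> g b \<in> carrier F" for b using module_hom_in[OF g] by simp
  have bil: "bilinear F A B A (\<lambda>a b. g b \<odot>\<^bsub>A\<^esub> a)"
    by (rule bilinearI) (simp_all add: gc module_hom_add[OF g] module_hom_smult[OF g]
      A.smult_assoc_simp A.R.m_comm A.smult_l_distr A.smult_r_distr)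
  define h where "h = tens_lift F A (\<lambda>a b. g b \<odot>\<^bsub>A\<^esub> a)"
  have ht: "h (tens F A B a b) = g b \<odot>\<^bsub>A\<^esub> a" if "a \<in> carrier A" "b \<in> carrier B" for a b
    using tens_lift(1)[OF A.module_axioms bil that] by (simp add: h_def)
  have h: "h \<in> module_hom F T A" using tens_lift(2)[OF A.module_axioms bil] by (simp add: h_def)
  define \<iota> where "\<iota> = (\<lambda>a. tens F A B a \<one>\<^bsub>B\<^esub>)"
  have \<iota>: "\<iota> a \<in> carrier T" if "a \<in> carrier A" for a
    unfolding \<iota>_def by (rule tens_closed[OF that B.unit_closed])
  have hx: "h (x \<otimes>\<^bsub>T\<^esub> \<iota> a) = h x \<otimes>\<^bsub>A\<^esub> a \<and> h (\<iota> a \<otimes>\<^bsub>T\<^esub> x) = a \<otimes>\<^bsub>A\<^esub> h x"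
    if x: "x \<in> carrier T" and a: "a \<in> carrier A" for x a
    using x
  proof (induct rule: tens_induct)
    case (tens a' b')
    then show ?case unfolding \<iota>_def using a
      by (simp only: tens_mult B.unit_closed B.unit_left B.unit_right ht A.prod_closed gc
          A.prod_smult_left A.prod_smult_right simp_thms)
  next
    case (add x y)
    then show ?case
      by (simp only: T.prod_add_left T.prod_add_right module_hom_add[OF h] T.prod_closed \<iota> a
          module_hom_in[OF h] A.prod_add_left A.prod_add_right simp_thms)
  qed
  have "h x \<in> alg_center A" if "x \<in> alg_center T" for x
  proof (rule center_contraction[OF nonassoc_algebra_T A.nonassoc_algebra_axioms h \<iota> _ _ _ that])
    show "\<iota> a \<otimes>\<^bsub>T\<^esub> \<iota> b = \<iota> (a \<otimes>\<^bsub>A\<^esub> b)" if "a \<in> carrier A" "b \<in> carrier A" for a b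
      unfolding \<iota>_def using that by (simp only: tens_mult B.unit_closed B.unit_left)
  qed (use hx in blast)+
  then show ?thesis using h ht by (intro bexI[of _ h] conjI ballI)
qed

lemma right_contraction:
  assumes g: "g \<in> module_hom F A (self_module F)"
  shows "\<exists>h\<in>module_hom F T B. (\<forall>a\<in>carrier A. \<forall>b\<in>carrier B. h (tens F A B a b) = g a \<odot>\<^bsub>B\<^esub> b) \<and>
    (\<forall>x\<in>alg_center T. h x \<in> alg_center B)"
proof -
  have gc: "b \<in> carrier A \<Longrightarrow> g b \<in> carrier F" for b using module_hom_in[OF g] by simp
  have bil: "bilinear F A B B (\<lambda>a b. g a \<odot>\<^bsub>B\<^esub> b)"
    by (rule bilinearI) (simp_all add: gc module_hom_add[OF g] module_hom_smult[OF g]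
      B.smult_assoc_simp A.R.m_comm B.smult_l_distr B.smult_r_distr)
  define h where "h = tens_lift F B (\<lambda>a b. g a \<odot>\<^bsub>B\<^esub> b)"
  have ht: "h (tens F A B a b) = g a \<odot>\<^bsub>B\<^esub> b" if "a \<in> carrier A" "b \<in> carrier B" for a b
    using tens_lift(1)[OF B.module_axioms bil that] by (simp add: h_def)
  have h: "h \<in> module_hom F T B" using tens_lift(2)[OF B.module_axioms bil] by (simp add: h_def)
  define \<iota> where "\<iota> = (\<lambda>b. tens F A B \<one>\<^bsub>A\<^esub> b)"
  have \<iota>: "\<iota> b \<in> carrier T" if "b \<in> carrier B" for b
    unfolding \<iota>_def by (rule tens_closed[OF A.unit_closed that])
  have hx: "h (x \<otimes>\<^bsub>T\<^esub> \<iota> b) = h x \<otimes>\<^bsub>B\<^esub> b \<and> h (\<iota> b \<otimes>\<^bsub>T\<^esub> x) = b \<otimes>\<^bsub>B\<^esub> h x"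
    if x: "x \<in> carrier T" and b: "b \<in> carrier B" for x b
    using x
  proof (induct rule: tens_induct)
    case (tens a' b')
    then show ?case unfolding \<iota>_def using b
      by (simp only: tens_mult A.unit_closed A.unit_left A.unit_right ht B.prod_closed gc
          B.prod_smult_left B.prod_smult_right simp_thms)
  next
    case (add x y)
    then show ?case
      by (simp only: T.prod_add_left T.prod_add_right module_hom_add[OF h] T.prod_closed \<iota> b
          module_hom_in[OF h] B.prod_add_left B.prod_add_right simp_thms)
  qed
  have "h x \<in> alg_center B" if "x \<in> alg_center T" for x
  proof (rule center_contraction[OF nonassoc_algebra_T B.nonassoc_algebra_axioms h \<iota> _ _ _ that])
    show "\<iota> a \<otimes>\<^bsub>T\<^esub> \<iota> b = \<iota> (a \<otimes>\<^bsub>B\<^esub> b)" if "a \<in> carrier B" "b \<in> carrier B" for a b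
      unfolding \<iota>_def using that by (simp only: tens_mult A.unit_closed A.unit_left)
  qed (use hx in blast)+
  then show ?thesis using h ht by (intro bexI[of _ h] conjI ballI)
qed

text \<open>A central \<open>x\<close> is contracted against a basis of \<open>B\<close>. The
  contractions are central in \<open>A\<close>, hence scalars, which forces
  \<open>x = 1 \<otimes> y\<close>. A contraction from the other side then shows that
  \<open>y\<close> is a scalar.\<close>

lemma central_T:
  assumes "central F A" "central F B" "vectorspace.fin_dim F A" "vectorspace.fin_dim F B"
  shows "central F T"
proof -
  have ms: "module F (self_module F)" by (rule module_self_module[OF A.R.is_cring])
  obtain f where f: "f \<in> module_hom F A (self_module F)" "f \<one>\<^bsub>A\<^esub> \<noteq> \<zero>\<^bsub>F\<^esub>"
    using A.central_functional[OF assms(1,3)] by (elim bexE)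
  obtain g where g: "g \<in> module_hom F B (self_module F)" "g \<one>\<^bsub>B\<^esub> \<noteq> \<zero>\<^bsub>F\<^esub>"
    using B.central_functional[OF assms(2,4)] by (elim bexE)
  have fc: "f \<one>\<^bsub>A\<^esub> \<in> carrier F" using module_hom_in[OF f(1) A.unit_closed] by simp
  have gc: "g \<one>\<^bsub>B\<^esub> \<in> carrier F" using module_hom_in[OF g(1) B.unit_closed] by simp
  interpret tl: tensor_like F A B T "tens F A B" by (rule tensor_like_T)
  obtain J c where d: "dual_basis F B J (\<lambda>x. x) c" using B.dual_basis_exists[OF assms(4)] by (elim exE)
  note D = dual_basisD[OF d]
  \<comment> \<open>\<open>k\<close> is \<open>f \<otimes> id\<close>. The maps \<open>h j\<close>
    obtained next are \<open>id \<otimes> c j\<close>, one for each basis vector \<open>j\<close> of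
    \<open>B\<close>.\<close>
  obtain k where k: "k \<in> module_hom F T B"
    "\<forall>a\<in>carrier A. \<forall>b\<in>carrier B. k (tens F A B a b) = f a \<odot>\<^bsub>B\<^esub> b" "\<forall>x\<in>alg_center T. k x \<in> alg_center B"
    using right_contraction[OF f(1)] by (elim bexE conjE)
  have "\<exists>h. \<forall>j\<in>J. h j \<in> module_hom F T A \<and>
    (\<forall>a\<in>carrier A. \<forall>b\<in>carrier B. h j (tens F A B a b) = c j b \<odot>\<^bsub>A\<^esub> a) \<and> (\<forall>x\<in>alg_center T. h j x \<in> alg_center A)"
    using left_contraction[OF D(3)] by (intro bchoice ballI) (auto simp: Bex_def)
  then obtain h where H: "\<forall>j\<in>J. h j \<in> module_hom F T A \<and>
    (\<forall>a\<in>carrier A. \<forall>b\<in>carrier B. h j (tens F A B a b) = c j b \<odot>\<^bsub>A\<^esub> a) \<and> (\<forall>x\<in>alg_center T. h j x \<in> alg_center A)"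
    by (rule exE)
  have h: "h j \<in> module_hom F T A" if "j \<in> J" for j using bspec[OF H that] by (rule conjunct1)
  have ht: "h j (tens F A B a b) = c j b \<odot>\<^bsub>A\<^esub> a" if "j \<in> J" "a \<in> carrier A" "b \<in> carrier B" for j a b
    using bspec[OF H that(1)] that by blast
  have hc: "h j x \<in> alg_center A" if "j \<in> J" "x \<in> alg_center T" for j x
    using bspec[OF H that(1)] that by blast
  have hin: "h j x \<in> carrier A" if "j \<in> J" "x \<in> carrier T" for j x by (rule module_hom_in[OF h[OF that(1)] that(2)])
  have expand: "(\<Oplus>\<^bsub>T\<^esub>j\<in>J. tens F A B (h j x) j) = x" if x: "x \<in> carrier T" for x
  proof (rule tl.tau_hom_eq[OF _ _ x, of _ T "\<lambda>x. x"])
    show "(\<lambda>x. x) \<in> module_hom F T T" by (simp add: module_hom_def)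
    show "(\<lambda>x. \<Oplus>\<^bsub>T\<^esub>j\<in>J. tens F A B (h j x) j) \<in> module_hom F T T"
      by (rule module_hom_sum_fun[OF module_T module_T])
        (rule module_hom_comp[OF h bilinearD(2)[OF tens_bilinear D(2)]])
    fix a b assume a: "a \<in> carrier A" and b: "b \<in> carrier B"
    have "(\<Oplus>\<^bsub>T\<^esub>j\<in>J. tens F A B (h j (tens F A B a b)) j) = (\<Oplus>\<^bsub>T\<^esub>j\<in>J. tens F A B a (c j b \<odot>\<^bsub>B\<^esub> j))"
      using a b D(2) D(6)[OF _ b]
      by (intro T.M.finsum_cong') (simp_all add: ht tens_simps tens_closed)
    also have "\<dots> = tens F A B a (\<Oplus>\<^bsub>B\<^esub>j\<in>J. c j b \<odot>\<^bsub>B\<^esub> j)"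
      using a b D(2) D(6)[OF _ b]
      by (intro bilinear_finsum(1)[OF tens_bilinear A.module_axioms B.module_axioms module_T, symmetric]) simp_all
    also have "\<dots> = tens F A B a b" by (simp only: D(5)[OF b])
    finally show "(\<Oplus>\<^bsub>T\<^esub>j\<in>J. tens F A B (h j (tens F A B a b)) j) = tens F A B a b" .
  qed
  have one: "c \<odot>\<^bsub>T\<^esub> \<one>\<^bsub>T\<^esub> = tens F A B \<one>\<^bsub>A\<^esub> (c \<odot>\<^bsub>B\<^esub> \<one>\<^bsub>B\<^esub>)" if "c \<in> carrier F" for c
    unfolding tens_one using that by (simp only: tens_simps A.unit_closed B.unit_closed)
  have surj: "\<exists>c\<in>carrier F. x = c \<odot>\<^bsub>T\<^esub> \<one>\<^bsub>T\<^esub>" if x: "x \<in> alg_center T" for x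
  proof -
    have xc: "x \<in> carrier T" using x by (simp add: T.alg_center_iff T.nucleus_iff)
    have "\<exists>e\<in>carrier F. h j x = e \<odot>\<^bsub>A\<^esub> \<one>\<^bsub>A\<^esub>" if "j \<in> J" for j
      using hc[OF that x] assms(1) unfolding central_def bij_betw_def by blast
    then have "\<exists>e. \<forall>j\<in>J. e j \<in> carrier F \<and> h j x = e j \<odot>\<^bsub>A\<^esub> \<one>\<^bsub>A\<^esub>"
      by (intro bchoice ballI) (simp add: Bex_def)
    then obtain e where E: "\<forall>j\<in>J. e j \<in> carrier F \<and> h j x = e j \<odot>\<^bsub>A\<^esub> \<one>\<^bsub>A\<^esub>" by (rule exE)
    define y where "y = (\<Oplus>\<^bsub>B\<^esub>j\<in>J. e j \<odot>\<^bsub>B\<^esub> j)"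
    have yc: "y \<in> carrier B" unfolding y_def using E D(2) by (intro B.M.finsum_closed) simp
    have "x = (\<Oplus>\<^bsub>T\<^esub>j\<in>J. tens F A B (h j x) j)" by (rule expand[OF xc, symmetric])
    also have "\<dots> = (\<Oplus>\<^bsub>T\<^esub>j\<in>J. tens F A B \<one>\<^bsub>A\<^esub> (e j \<odot>\<^bsub>B\<^esub> j))"
      using E D(2) A.unit_closed by (intro T.M.finsum_cong') (simp_all add: tens_simps tens_closed)
    also have "\<dots> = tens F A B \<one>\<^bsub>A\<^esub> y" unfolding y_def using E D(2)
      by (intro bilinear_finsum(1)[OF tens_bilinear A.module_axioms B.module_axioms module_T A.unit_closed, symmetric]) simp
    finally have xy: "x = tens F A B \<one>\<^bsub>A\<^esub> y" .
    \<comment> \<open>The left side is \<open>k x\<close>, central in \<open>B\<close> as the image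
      of a central element. Since \<open>f 1\<close> is nonzero, \<open>y\<close> itself is then a
      multiple of the unit.\<close>
    have "f \<one>\<^bsub>A\<^esub> \<odot>\<^bsub>B\<^esub> y \<in> alg_center B" using k(2,3) x yc A.unit_closed unfolding xy by fastforce
    then obtain r where r: "r \<in> carrier F" "f \<one>\<^bsub>A\<^esub> \<odot>\<^bsub>B\<^esub> y = r \<odot>\<^bsub>B\<^esub> \<one>\<^bsub>B\<^esub>"
      using assms(2) unfolding central_def bij_betw_def by blast
    have "y = inv\<^bsub>F\<^esub> (f \<one>\<^bsub>A\<^esub>) \<odot>\<^bsub>B\<^esub> (r \<odot>\<^bsub>B\<^esub> \<one>\<^bsub>B\<^esub>)" by (rule B.mult_inverse[OF fc yc r(2) f(2)])
    then have "y = (inv\<^bsub>F\<^esub> (f \<one>\<^bsub>A\<^esub>) \<otimes>\<^bsub>F\<^esub> r) \<odot>\<^bsub>B\<^esub> \<one>\<^bsub>B\<^esub>"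
      using field.inverse_exists[OF A.field_axioms fc f(2)] r(1) B.unit_closed by (simp add: B.smult_assoc1)
    then show ?thesis using one field.inverse_exists[OF A.field_axioms fc f(2)] r(1) xy
      by (intro bexI[of _ "inv\<^bsub>F\<^esub> (f \<one>\<^bsub>A\<^esub>) \<otimes>\<^bsub>F\<^esub> r"]) simp_all
  qed
  have inj: "inj_on (\<lambda>c. c \<odot>\<^bsub>T\<^esub> \<one>\<^bsub>T\<^esub>) (carrier F)"
  proof (rule inj_onI)
    fix r s assume rs: "r \<in> carrier F" "s \<in> carrier F" "r \<odot>\<^bsub>T\<^esub> \<one>\<^bsub>T\<^esub> = s \<odot>\<^bsub>T\<^esub> \<one>\<^bsub>T\<^esub>"
    \<comment> \<open>\<open>u\<close> is \<open>f \<otimes> g\<close>. Its value at the unit is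
      \<open>f 1 \<cdot> g 1\<close>, nonzero because a field has no zero divisors, so
      \<open>u\<close> separates the multiples of the unit.\<close>
    obtain u where u: "u \<in> module_hom F T (self_module F)"
      "\<forall>a\<in>carrier A. \<forall>b\<in>carrier B. u (tens F A B a b) = f a \<otimes>\<^bsub>F\<^esub> g b"
      using tl.tau_functional[OF f(1) g(1)] by (elim bexE)
    have u1: "u \<one>\<^bsub>T\<^esub> = f \<one>\<^bsub>A\<^esub> \<otimes>\<^bsub>F\<^esub> g \<one>\<^bsub>B\<^esub>" unfolding tens_one using u(2) A.unit_closed B.unit_closed by blast
    have "r \<otimes>\<^bsub>F\<^esub> u \<one>\<^bsub>T\<^esub> = s \<otimes>\<^bsub>F\<^esub> u \<one>\<^bsub>T\<^esub>"
      using arg_cong[OF rs(3), of u] module_hom_smult[OF u(1) rs(1) T.unit_closed]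
        module_hom_smult[OF u(1) rs(2) T.unit_closed] by simp
    moreover have "u \<one>\<^bsub>T\<^esub> \<noteq> \<zero>\<^bsub>F\<^esub>" unfolding u1 using fc gc f(2) g(2) A.integral_iff by simp
    moreover have "u \<one>\<^bsub>T\<^esub> \<in> carrier F" unfolding u1 using fc gc by simp
    ultimately show "r = s" using rs(1,2) A.m_rcancel by blast
  qed
  have "(\<lambda>c. c \<odot>\<^bsub>T\<^esub> \<one>\<^bsub>T\<^esub>) ` carrier F = alg_center T"
  proof
    show "(\<lambda>c. c \<odot>\<^bsub>T\<^esub> \<one>\<^bsub>T\<^esub>) ` carrier F \<subseteq> alg_center T" by (rule image_subsetI) (rule T.smult_one_center)
    show "alg_center T \<subseteq> (\<lambda>c. c \<odot>\<^bsub>T\<^esub> \<one>\<^bsub>T\<^esub>) ` carrier F" using surj by (simp add: subset_iff image_iff)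
  qed
  then show ?thesis unfolding central_def bij_betw_def using inj by simp
qed

end


section \<open>Frobenius\<close>

context cring begin

lemma add_pow_closed: "x \<in> carrier R \<Longrightarrow> add_pow R (n::nat) x \<in> carrier R"
  by (rule add.nat_pow_closed)

text \<open>Induction with Pascal's rule, where binomial coefficients act as integer multiples
  through \<open>add_pow\<close>.\<close>

lemma binomial_expansion:
  assumes x: "x \<in> carrier R" and y: "y \<in> carrier R"
  shows "(x \<oplus> y) [^] n = (\<Oplus>k\<in>{..n}. add_pow R (n choose k) (x [^] k \<otimes> y [^] (n - k)))"
proof (induct n)
  case 0
  then show ?case using x y by simp
next
  case (Suc n)
  \<comment> \<open>The coefficient is an argument of its own, so that multiplication by
    \<open>x\<close> or \<open>y\<close> changes only the exponents and Pascal's rule can be applied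
    at the end.\<close>
  define t where "t = (\<lambda>(n::nat) (c::nat) (k::nat). add_pow R c (x [^] k \<otimes> y [^] (n - k)))"
  have tc: "t n c k \<in> carrier R" for n c k
    unfolding t_def using x y by (intro add_pow_closed m_closed nat_pow_closed)
  have X: "x \<otimes> t n c k = t (Suc n) c (Suc k)" for c k
    unfolding t_def using x y by (simp add: add_pow_rdistr m_ac)
  have Y: "y \<otimes> t n c k = t (Suc n) c k" if "k \<le> n" for c k
    unfolding t_def using x y that by (simp add: add_pow_rdistr Suc_diff_le m_ac)
  have "(x \<oplus> y) [^] Suc n = (x \<oplus> y) \<otimes> (\<Oplus>k\<in>{..n}. t n (n choose k) k)"
    using x y Suc by (simp add: t_def m_comm nat_pow_closed)
  also have "\<dots> = x \<otimes> (\<Oplus>k\<in>{..n}. t n (n choose k) k) \<oplus> y \<otimes> (\<Oplus>k\<in>{..n}. t n (n choose k) k)"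
    using x y tc by (intro l_distr finsum_closed) auto
  also have "x \<otimes> (\<Oplus>k\<in>{..n}. t n (n choose k) k) = (\<Oplus>k\<in>{..n}. t (Suc n) (n choose k) (Suc k))"
    using x tc by (subst finsum_rdistr) (simp_all add: X)
  also have "y \<otimes> (\<Oplus>k\<in>{..n}. t n (n choose k) k) = (\<Oplus>k\<in>{..n}. t (Suc n) (n choose k) k)"
    using y tc by (subst finsum_rdistr) (auto intro!: finsum_cong' simp: Y)
  also have "\<dots> = (\<Oplus>k\<in>{..Suc n}. t (Suc n) (n choose k) k)"
  proof -
    \<comment> \<open>The added top term has coefficient \<open>n choose Suc n = 0\<close>. It gives
      both sums the same range after an index shift.\<close>
    have "t (Suc n) (n choose Suc n) (Suc n) = \<zero>" by (simp add: t_def binomial_eq_0)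
    then show ?thesis using tc by (subst finsum_Suc) (auto intro!: finsum_closed)
  qed
  also have "\<dots> = (\<Oplus>k\<in>{..n}. t (Suc n) (n choose Suc k) (Suc k)) \<oplus> t (Suc n) 1 0"
    using tc by (subst finsum_Suc2) auto
  also have "(\<Oplus>k\<in>{..n}. t (Suc n) (n choose k) (Suc k)) \<oplus> ((\<Oplus>k\<in>{..n}. t (Suc n) (n choose Suc k) (Suc k)) \<oplus> t (Suc n) 1 0)
     = (\<Oplus>k\<in>{..n}. t (Suc n) (n choose k) (Suc k) \<oplus> t (Suc n) (n choose Suc k) (Suc k)) \<oplus> t (Suc n) 1 0"
    using tc by (subst finsum_addf) (auto intro!: finsum_closed simp: a_assoc)
  also have "(\<Oplus>k\<in>{..n}. t (Suc n) (n choose k) (Suc k) \<oplus> t (Suc n) (n choose Suc k) (Suc k))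
     = (\<Oplus>k\<in>{..n}. t (Suc n) (Suc n choose Suc k) (Suc k))"
  proof (rule finsum_cong'[OF refl])
    fix k
    show "t (Suc n) (n choose k) (Suc k) \<oplus> t (Suc n) (n choose Suc k) (Suc k) = t (Suc n) (Suc n choose Suc k) (Suc k)"
      unfolding t_def binomial_Suc_Suc using x y by (intro add.nat_pow_mult) simp
  qed (use tc in simp)
  also have "\<dots> \<oplus> t (Suc n) 1 0 = (\<Oplus>k\<in>{..Suc n}. t (Suc n) (Suc n choose k) k)"
    using tc by (subst finsum_Suc2) auto
  finally show ?case by (simp only: t_def)
qed

lemma add_pow_char:
  assumes "add_pow R p \<one> = \<zero>" "p dvd n" "z \<in> carrier R" shows "add_pow R (n::nat) z = \<zero>"
proof -
  obtain m where m: "n = p * m" using assms(2) by blast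
  have "add_pow R p z = add_pow R p \<one> \<otimes> z" using assms(3) add_pow_ldistr[of \<one> z p] by simp
  then have "add_pow R p z = \<zero>" using assms by simp
  moreover have "add_pow R n z = add_pow R m (add_pow R p z)"
    unfolding m using assms(3) add.nat_pow_pow[of z m p] by (simp add: mult.commute)
  ultimately show ?thesis by simp
qed

text \<open>The binomial coefficients strictly between \<open>0\<close> and \<open>p\<close> are
  divisible by the prime \<open>p\<close>, so only the two outer terms remain.\<close>

lemma frobenius_add:
  assumes p: "Factorial_Ring.prime (p::nat)" "add_pow R p \<one> = \<zero>" and x: "x \<in> carrier R" and y: "y \<in> carrier R"
  shows "(x \<oplus> y) [^] p = x [^] p \<oplus> y [^] p"
proof -
  have p0: "0 < p" using p(1) prime_gt_0_nat by blast
  have c: "x [^] k \<otimes> y [^] l \<in> carrier R" for k l :: nat using x y by simp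
  have z: "add_pow R (p choose k) (x [^] k \<otimes> y [^] (p - k)) = \<zero>" if "k \<in> {..p} - {0, p}" for k
    using that p(1) by (intro add_pow_char[OF p(2) _ c] dvd_choose_prime) auto
  have "(\<Oplus>k\<in>{..p}. add_pow R (p choose k) (x [^] k \<otimes> y [^] (p - k)))
      = (\<Oplus>k\<in>{0, p}. add_pow R (p choose k) (x [^] k \<otimes> y [^] (p - k)))"
    using z c by (intro add.finprod_mono_neutral_cong_right) (auto intro!: add_pow_closed)
  also have "\<dots> = y [^] p \<oplus> x [^] p" using x y p0 by simp
  finally show ?thesis using binomial_expansion[OF x y, of p] x y by (simp add: a_comm)
qed

text \<open>In a domain, \<open>p m\<close> times the unit is the product of \<open>p\<close> times
  and \<open>m\<close> times the unit. If no prime multiple of the unit vanishes, induction over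
  prime factors shows that no positive multiple does.\<close>

lemma char_cases:
  assumes "\<one> \<noteq> \<zero>" "domain R"
  shows "(\<forall>n>0. add_pow R (n::nat) \<one> \<noteq> \<zero>) \<or> (\<exists>p::nat. Factorial_Ring.prime p \<and> add_pow R p \<one> = \<zero>)"
proof (rule disjCI)
  interpret domain R by fact
  assume n: "\<nexists>p::nat. Factorial_Ring.prime p \<and> add_pow R p \<one> = \<zero>"
  show "\<forall>n>0. add_pow R (n::nat) \<one> \<noteq> \<zero>"
  proof (intro allI impI)
    fix n :: nat assume "n > 0"
    then show "add_pow R n \<one> \<noteq> \<zero>"
    proof (induct n rule: less_induct)
      case (less n)
      show ?case
      proof (cases "n = 1")
        case True
        then show ?thesis using assms(1) by simp
      next
        case False
        obtain p where p: "Factorial_Ring.prime p" "p dvd n" using prime_factor_nat[OF False] by blast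
        then obtain m where m: "n = p * m" by blast
        have "m < n" "m > 0" using less.prems p(1) prime_gt_1_nat[of p] m by auto
        then have "add_pow R m \<one> \<noteq> \<zero>" using less.hyps by blast
        moreover have "add_pow R p \<one> \<noteq> \<zero>" using n p(1) by blast
        moreover have "add_pow R n \<one> = add_pow R p \<one> \<otimes> add_pow R m \<one>"
          unfolding m using add_pow_ldistr[OF one_closed add_pow_closed[OF one_closed, of m], of p]
            add.nat_pow_pow[of \<one> p m] add_pow_closed[OF one_closed, of m] by (simp add: mult.commute)
        ultimately show ?thesis using integral_iff add_pow_closed[OF one_closed] by simp
      qed
    qed
  qed
qed

end

section \<open>Traces\<close>

text \<open>Both sides equal the double sum of \<open>f i (w j) \<cdot> \<psi> j (b i)\<close>,
  taken in either order. So the trace may be computed from any expression of \<open>T\<close> as a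
  sum of rank-one maps, which replaces matrices and independence of the basis.\<close>

lemma (in module) trace_of_expansion:
  assumes d: "dual_basis R M I b f" and J: "finite J"
    and \<psi>: "\<And>j. j \<in> J \<Longrightarrow> \<psi> j \<in> module_hom R M (self_module R)" and w: "\<And>j. j \<in> J \<Longrightarrow> w j \<in> carrier M"
    and T: "\<And>v. v \<in> carrier M \<Longrightarrow> T v = (\<Oplus>\<^bsub>M\<^esub>j\<in>J. \<psi> j v \<odot>\<^bsub>M\<^esub> w j)"
  shows "(\<Oplus>\<^bsub>R\<^esub>i\<in>I. f i (T (b i))) = (\<Oplus>\<^bsub>R\<^esub>j\<in>J. \<psi> j (w j))"
proof -
  note D = dual_basisD[OF d]
  have sm: "module R (self_module R)" by (rule module_self_module[OF R.is_cring])
  have pc: "\<psi> j v \<in> carrier R" if "j \<in> J" "v \<in> carrier M" for j v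
    using module_hom_in[OF \<psi>[OF that(1)] that(2)] by simp
  have fc: "f i v \<in> carrier R" if "i \<in> I" "v \<in> carrier M" for i v by (rule D(6)[OF that])
  have "(\<Oplus>\<^bsub>R\<^esub>i\<in>I. f i (T (b i))) = (\<Oplus>\<^bsub>R\<^esub>i\<in>I. \<Oplus>\<^bsub>R\<^esub>j\<in>J. f i (w j) \<otimes>\<^bsub>R\<^esub> \<psi> j (b i))"
  proof (rule R.finsum_cong'[OF refl])
    fix i assume i: "i \<in> I"
    have "f i (T (b i)) = (\<Oplus>\<^bsub>self_module R\<^esub>j\<in>J. f i (\<psi> j (b i) \<odot>\<^bsub>M\<^esub> w j))"
      unfolding T[OF D(2)[OF i]] using pc[OF _ D(2)[OF i]] w
      by (intro module_hom_finsum[OF module_axioms sm D(3)[OF i]]) simp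
    also have "\<dots> = (\<Oplus>\<^bsub>R\<^esub>j\<in>J. f i (w j) \<otimes>\<^bsub>R\<^esub> \<psi> j (b i))"
      unfolding finsum_self_module using pc[OF _ D(2)[OF i]] w fc[OF i]
      by (intro R.finsum_cong') (simp_all add: module_hom_smult[OF D(3)[OF i]] R.m_comm)
    finally show "f i (T (b i)) = (\<Oplus>\<^bsub>R\<^esub>j\<in>J. f i (w j) \<otimes>\<^bsub>R\<^esub> \<psi> j (b i))" .
  qed (use pc fc w D(2) in \<open>auto intro!: R.finsum_closed\<close>)
  also have "\<dots> = (\<Oplus>\<^bsub>R\<^esub>j\<in>J. \<Oplus>\<^bsub>R\<^esub>i\<in>I. f i (w j) \<otimes>\<^bsub>R\<^esub> \<psi> j (b i))"
    using pc fc w D(2) by (intro R.finsum_interchange D(1) J) simp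
  also have "\<dots> = (\<Oplus>\<^bsub>R\<^esub>j\<in>J. \<psi> j (w j))"
  proof (rule R.finsum_cong'[OF refl])
    fix j assume j: "j \<in> J"
    have "\<psi> j (w j) = \<psi> j (\<Oplus>\<^bsub>M\<^esub>i\<in>I. f i (w j) \<odot>\<^bsub>M\<^esub> b i)" by (simp only: D(5)[OF w[OF j]])
    also have "\<dots> = (\<Oplus>\<^bsub>self_module R\<^esub>i\<in>I. \<psi> j (f i (w j) \<odot>\<^bsub>M\<^esub> b i))"
      using fc[OF _ w[OF j]] D(2) by (intro module_hom_finsum[OF module_axioms sm \<psi>[OF j]]) simp
    also have "\<dots> = (\<Oplus>\<^bsub>R\<^esub>i\<in>I. f i (w j) \<otimes>\<^bsub>R\<^esub> \<psi> j (b i))"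
      unfolding finsum_self_module using fc[OF _ w[OF j]] D(2) pc[OF j]
      by (intro R.finsum_cong') (simp_all add: module_hom_smult[OF \<psi>[OF j]])
    finally show "(\<Oplus>\<^bsub>R\<^esub>i\<in>I. f i (w j) \<otimes>\<^bsub>R\<^esub> \<psi> j (b i)) = \<psi> j (w j)" by (rule sym)
  qed (use pc w in simp)
  finally show ?thesis .
qed

section \<open>Traces of square-zero and idempotent maps\<close>

context vectorspace begin

text \<open>\<open>C\<close> is a basis of the image with coordinates \<open>g\<close>, and
  \<open>T v = \<Sum> g c (T v) \<cdot> c\<close> is a sum of rank-one maps. The trace becomes a sum
  over vectors of the image, where \<open>T\<close> is zero or the identity in the two cases of
  interest. The clause on empty \<open>C\<close> ensures positive rank for a nonzero
  idempotent.\<close>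

lemma trace_via_image:
  assumes fd: fin_dim and d: "dual_basis K V I b f" and T: "T \<in> module_hom K V V"
  shows "\<exists>C g. finite C \<and> C \<subseteq> T ` carrier V \<and> (C = {} \<longrightarrow> T ` carrier V = {\<zero>\<^bsub>V\<^esub>}) \<and>
    (\<forall>c\<in>C. g c c = \<one>\<^bsub>K\<^esub> \<and> g c \<zero>\<^bsub>V\<^esub> = \<zero>\<^bsub>K\<^esub>) \<and> (\<Oplus>\<^bsub>K\<^esub>i\<in>I. f i (T (b i))) = (\<Oplus>\<^bsub>K\<^esub>c\<in>C. g c (T c))"
proof -
  interpret T: linear_map K V V T
    by (rule linear_mapI[OF vectorspace_axioms vectorspace_axioms T])
  define W where "W = T ` carrier V"
  have W: "subspace K W V" using T.imT_is_subspace unfolding T.im_def W_def .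
  have sub: "LinearCombinations.submodule K W V" using W by simp
  have Wc: "W \<subseteq> carrier V" using sub by (simp add: LinearCombinations.submodule_def)
  interpret W: vectorspace K "V\<lparr>carrier := W\<rparr>" using W by (rule subspace_is_vs)
  have sm: "module K (self_module K)" by (rule module_self_module[OF R.is_cring])
  obtain C g where d': "dual_basis K (V\<lparr>carrier := W\<rparr>) C (\<lambda>x. x) g"
    using W.dual_basis_exists[OF subspace_dim(1)[OF fd W]] by (elim exE)
  note D = dual_basisD[OF d', simplified]
  have Tin: "T v \<in> W" if "v \<in> carrier V" for v using that by (simp add: W_def)
  have Th: "T \<in> module_hom K V (V\<lparr>carrier := W\<rparr>)" using T Tin by (simp add: module_hom_def)
  have a1: "(\<Oplus>\<^bsub>K\<^esub>i\<in>I. f i (T (b i))) = (\<Oplus>\<^bsub>K\<^esub>c\<in>C. g c (T c))"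
  proof (rule trace_of_expansion[OF d D(1), of "\<lambda>c v. g c (T v)"])
    show "(\<lambda>v. g c (T v)) \<in> module_hom K V (self_module K)" if "c \<in> C" for c
      by (rule module_hom_comp[OF Th D(3)[OF that]])
    show "c \<in> carrier V" if "c \<in> C" for c using D(2)[OF that] Wc by blast
    fix v assume v: "v \<in> carrier V"
    have "(\<Oplus>\<^bsub>V\<lparr>carrier := W\<rparr>\<^esub>c\<in>C. g c (T v) \<odot>\<^bsub>V\<^esub> c) = (\<Oplus>\<^bsub>V\<^esub>c\<in>C. g c (T v) \<odot>\<^bsub>V\<^esub> c)"
      by (rule finsum_carrier_update[OF sub])
        (use W.smult_closed D(2) D(6)[OF _ Tin[OF v]] in simp)
    then show "T v = (\<Oplus>\<^bsub>V\<^esub>c\<in>C. g c (T v) \<odot>\<^bsub>V\<^esub> c)" using D(5)[OF Tin[OF v]] by simp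
  qed
  have a2: "g c c = \<one>\<^bsub>K\<^esub>" "g c \<zero>\<^bsub>V\<^esub> = \<zero>\<^bsub>K\<^esub>" if "c \<in> C" for c
    using D(4)[OF that that] module_hom_zero[OF W.module_axioms sm D(3)[OF that]] by simp_all
  have a3: "W = {\<zero>\<^bsub>V\<^esub>}" if "C = {}"
  proof -
    have "w = \<zero>\<^bsub>V\<^esub>" if "w \<in> W" for w using D(5)[OF that] \<open>C = {}\<close> W.M.finsum_empty by simp
    moreover have "\<zero>\<^bsub>V\<^esub> \<in> W" using W.M.zero_closed by simp
    ultimately show ?thesis by blast
  qed
  have a4: "C \<subseteq> W" using D(2) by blast
  show ?thesis unfolding W_def[symmetric]
    by (intro exI[of _ C] exI[of _ g] conjI impI ballI) (rule D(1) a1 a2 a3 a4; assumption)+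
qed

lemma trace_square_zero:
  assumes fd: fin_dim and d: "dual_basis K V I b f" and T: "T \<in> module_hom K V V"
    and z: "\<And>v. v \<in> carrier V \<Longrightarrow> T (T v) = \<zero>\<^bsub>V\<^esub>"
  shows "(\<Oplus>\<^bsub>K\<^esub>i\<in>I. f i (T (b i))) = \<zero>\<^bsub>K\<^esub>"
proof -
  obtain C g where C: "C \<subseteq> T ` carrier V" "\<forall>c\<in>C. g c c = \<one>\<^bsub>K\<^esub> \<and> g c \<zero>\<^bsub>V\<^esub> = \<zero>\<^bsub>K\<^esub>"
    "(\<Oplus>\<^bsub>K\<^esub>i\<in>I. f i (T (b i))) = (\<Oplus>\<^bsub>K\<^esub>c\<in>C. g c (T c))"
    using trace_via_image[OF fd d T] by (elim exE conjE)
  have "g c (T c) = \<zero>\<^bsub>K\<^esub>" if c: "c \<in> C" for c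
  proof -
    obtain v where "c = T v" "v \<in> carrier V" using subsetD[OF C(1) c] by (rule imageE)
    then show ?thesis using z[of v] bspec[OF C(2) c] by (simp only:)
  qed
  then show ?thesis unfolding C(3) by (rule R.add.finprod_one_eqI)
qed

text \<open>The trace is the rank: each vector of a basis of the image is fixed by \<open>T\<close>
  and contributes 1.\<close>

lemma trace_idempotent:
  assumes fd: fin_dim and d: "dual_basis K V I b f" and T: "T \<in> module_hom K V V"
    and z: "\<And>v. v \<in> carrier V \<Longrightarrow> T (T v) = T v" and v: "v \<in> carrier V" "T v \<noteq> \<zero>\<^bsub>V\<^esub>"
  shows "\<exists>n>0. (\<Oplus>\<^bsub>K\<^esub>i\<in>I. f i (T (b i))) = add_pow K (n::nat) \<one>\<^bsub>K\<^esub>"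
proof -
  obtain C g where C: "finite C" "C \<subseteq> T ` carrier V" "C = {} \<longrightarrow> T ` carrier V = {\<zero>\<^bsub>V\<^esub>}"
    "\<forall>c\<in>C. g c c = \<one>\<^bsub>K\<^esub> \<and> g c \<zero>\<^bsub>V\<^esub> = \<zero>\<^bsub>K\<^esub>"
    "(\<Oplus>\<^bsub>K\<^esub>i\<in>I. f i (T (b i))) = (\<Oplus>\<^bsub>K\<^esub>c\<in>C. g c (T c))"
    using trace_via_image[OF fd d T] by (elim exE conjE)
  have "g c (T c) = \<one>\<^bsub>K\<^esub>" if c: "c \<in> C" for c
  proof -
    obtain v where "c = T v" "v \<in> carrier V" using subsetD[OF C(2) c] by (rule imageE)
    then have "T c = c" using z[of v] by (simp only:)
    then show ?thesis using bspec[OF C(4) c] by (simp only:)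
  qed
  then have "(\<Oplus>\<^bsub>K\<^esub>c\<in>C. g c (T c)) = (\<Oplus>\<^bsub>K\<^esub>c\<in>C. \<one>\<^bsub>K\<^esub>)" by (intro R.finsum_cong') simp_all
  also have "\<dots> = add_pow K (card C) \<one>\<^bsub>K\<^esub>" by (rule R.add.finprod_const) simp
  finally have "(\<Oplus>\<^bsub>K\<^esub>i\<in>I. f i (T (b i))) = add_pow K (card C) \<one>\<^bsub>K\<^esub>" using C(5) by (simp only:)
  moreover have "C \<noteq> {}" using C(3) v by blast
  then have "card C > 0" using C(1) by (simp add: card_gt_0_iff)
  ultimately show ?thesis by blast
qed

end


section \<open>Finite-dimensional commutative algebras\<close>

locale fd_comm_algebra = nonassoc_algebra F A
  for F :: "('f, 'm) ring_scheme" and A :: "('f, 'a) module" +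
  assumes prod_assoc: "x \<in> carrier A \<Longrightarrow> y \<in> carrier A \<Longrightarrow> z \<in> carrier A \<Longrightarrow>
      (x \<otimes>\<^bsub>A\<^esub> y) \<otimes>\<^bsub>A\<^esub> z = x \<otimes>\<^bsub>A\<^esub> (y \<otimes>\<^bsub>A\<^esub> z)"
    and prod_comm: "x \<in> carrier A \<Longrightarrow> y \<in> carrier A \<Longrightarrow> x \<otimes>\<^bsub>A\<^esub> y = y \<otimes>\<^bsub>A\<^esub> x"
    and fd: fin_dim
begin

lemma cring_A: "cring A"
proof (rule cringI)
  show "abelian_group A" by (rule M.abelian_group_axioms)
  show "comm_monoid A"
    by (rule comm_monoidI) (rule prod_closed unit_closed prod_assoc unit_left prod_comm; assumption)+
qed (rule prod_add_left)

sublocale C: cring A by (rule cring_A)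

lemma mult_hom: "x \<in> carrier A \<Longrightarrow> (\<lambda>v. x \<otimes>\<^bsub>A\<^esub> v) \<in> module_hom F A A"
  by (rule bilinearD(1)[OF mult_bilinear])

lemma smult_pow:
  assumes "c \<in> carrier F" "x \<in> carrier A"
  shows "(c \<odot>\<^bsub>A\<^esub> x) [^]\<^bsub>A\<^esub> (n::nat) = (c [^]\<^bsub>F\<^esub> n) \<odot>\<^bsub>A\<^esub> (x [^]\<^bsub>A\<^esub> n)"
proof (induct n)
  case (Suc n)
  have "(c \<odot>\<^bsub>A\<^esub> x) [^]\<^bsub>A\<^esub> Suc n = (c [^]\<^bsub>F\<^esub> n) \<odot>\<^bsub>A\<^esub> (x [^]\<^bsub>A\<^esub> n) \<otimes>\<^bsub>A\<^esub> (c \<odot>\<^bsub>A\<^esub> x)"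
    by (simp only: C.nat_pow_Suc Suc)
  also have "\<dots> = (c [^]\<^bsub>F\<^esub> n) \<odot>\<^bsub>A\<^esub> (c \<odot>\<^bsub>A\<^esub> (x [^]\<^bsub>A\<^esub> n \<otimes>\<^bsub>A\<^esub> x))"
    by (simp only: prod_smult_left[OF R.nat_pow_closed[OF assms(1)] C.nat_pow_closed[OF assms(2)] smult_closed[OF assms]]
      prod_smult_right[OF assms(1) C.nat_pow_closed[OF assms(2)] assms(2)])
  also have "\<dots> = (c [^]\<^bsub>F\<^esub> Suc n) \<odot>\<^bsub>A\<^esub> (x [^]\<^bsub>A\<^esub> Suc n)"
    using assms by (simp only: smult_assoc1 R.nat_pow_closed C.nat_pow_closed prod_closed R.nat_pow_Suc C.nat_pow_Suc)
  finally show ?case .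
qed (use C.one_closed in simp)

text \<open>Transfers the characteristic from \<open>F\<close> to \<open>A\<close>.\<close>

lemma add_pow_one: "add_pow A (n::nat) \<one>\<^bsub>A\<^esub> = add_pow F n \<one>\<^bsub>F\<^esub> \<odot>\<^bsub>A\<^esub> \<one>\<^bsub>A\<^esub>"
proof (induct n)
  case (Suc n)
  have "add_pow A (Suc n) \<one>\<^bsub>A\<^esub> = add_pow A n \<one>\<^bsub>A\<^esub> \<oplus>\<^bsub>A\<^esub> \<one>\<^bsub>A\<^esub>" by (rule M.add.nat_pow_Suc)
  also have "\<dots> = (add_pow F n \<one>\<^bsub>F\<^esub> \<oplus>\<^bsub>F\<^esub> \<one>\<^bsub>F\<^esub>) \<odot>\<^bsub>A\<^esub> \<one>\<^bsub>A\<^esub>"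
    unfolding Suc by (simp only: smult_l_distr[OF R.add_pow_closed[OF R.one_closed] R.one_closed C.one_closed]
      smult_one C.one_closed)
  also have "add_pow F n \<one>\<^bsub>F\<^esub> \<oplus>\<^bsub>F\<^esub> \<one>\<^bsub>F\<^esub> = add_pow F (Suc n) \<one>\<^bsub>F\<^esub>" by (rule R.add.nat_pow_Suc[symmetric])
  finally show ?case .
qed (use C.one_closed in simp)

text \<open>In characteristic \<open>p\<close> this is \<open>F \<cdot> A^p\<close>, and a finite
  field extension is separable iff it coincides with this span.\<close>

definition pow_span :: "nat \<Rightarrow> 'a set" where
  "pow_span p = span ((\<lambda>x. x [^]\<^bsub>A\<^esub> p) ` carrier A)"

lemma pow_span_submodule: "LinearCombinations.submodule F (pow_span p) A"
  unfolding pow_span_def by (rule span_is_submodule) (use C.nat_pow_closed in blast)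

lemma pow_span_carrier: "pow_span p \<subseteq> carrier A"
  using pow_span_submodule by (simp add: LinearCombinations.submodule_def)

lemma pow_in_pow_span: "x \<in> carrier A \<Longrightarrow> x [^]\<^bsub>A\<^esub> p \<in> pow_span p"
  unfolding pow_span_def
  by (rule subsetD[OF in_own_span]) (use C.nat_pow_closed in blast)+

text \<open>Serves as an induction principle: a linear condition holds on the whole span as soon as
  it holds for the \<open>p\<close>-th powers.\<close>

lemma pow_span_minimal:
  assumes "LinearCombinations.submodule F N A" "\<And>x. x \<in> carrier A \<Longrightarrow> x [^]\<^bsub>A\<^esub> p \<in> N"
  shows "pow_span p \<subseteq> N"
  unfolding pow_span_def by (rule span_is_subset[OF _ assms(1)]) (use assms(2) in blast)

end

text \<open>Over a field of characteristic \<open>p > 0\<close>, a finite-dimensional commutative algebra is etale iff it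
  is spanned by its \<open>p\<close>-th powers. In characteristic 0 it is etale iff it is von Neumann regular.\<close>

locale etale_like = fd_comm_algebra +
  assumes regular: "x \<in> carrier A \<Longrightarrow> \<exists>y\<in>carrier A. x \<otimes>\<^bsub>A\<^esub> x \<otimes>\<^bsub>A\<^esub> y = x"
    and pow_span: "Factorial_Ring.prime p \<Longrightarrow> add_pow F p \<one>\<^bsub>F\<^esub> = \<zero>\<^bsub>F\<^esub> \<Longrightarrow> pow_span p = carrier A"

section \<open>Powers of a basis, reducedness and regularity\<close>

context fd_comm_algebra begin

text \<open>Frobenius is additive and raises scalars to the \<open>p\<close>-th power, so it acts on
  an expansion in a basis term by term.\<close>

lemma frobenius_dual_basis:
  assumes p: "Factorial_Ring.prime (p::nat)" "add_pow F p \<one>\<^bsub>F\<^esub> = \<zero>\<^bsub>F\<^esub>" and d: "dual_basis F A I b f"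
    and x: "x \<in> carrier A"
  shows "x [^]\<^bsub>A\<^esub> p = (\<Oplus>\<^bsub>A\<^esub>i\<in>I. (f i x [^]\<^bsub>F\<^esub> p) \<odot>\<^bsub>A\<^esub> (b i [^]\<^bsub>A\<^esub> p))"
proof -
  note D = dual_basisD[OF d]
  have p0: "p > 0" using p(1) prime_gt_0_nat by blast
  have pA: "add_pow A p \<one>\<^bsub>A\<^esub> = \<zero>\<^bsub>A\<^esub>" unfolding add_pow_one p(2) by (rule lmult_0[OF C.one_closed])
  have "finsum A g J [^]\<^bsub>A\<^esub> p = (\<Oplus>\<^bsub>A\<^esub>j\<in>J. g j [^]\<^bsub>A\<^esub> p)" if "finite J" "g \<in> J \<rightarrow> carrier A" for g J
    using that
  proof (induct J rule: finite_induct)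
    case empty
    then show ?case using p0 by (simp add: C.nat_pow_zero)
  next
    case (insert j J)
    then have g: "g j \<in> carrier A" "g \<in> J \<rightarrow> carrier A" by auto
    have "finsum A g (insert j J) = g j \<oplus>\<^bsub>A\<^esub> finsum A g J"
      by (rule M.finsum_insert[OF insert(1,2) g(2) g(1)])
    moreover have "(\<Oplus>\<^bsub>A\<^esub>j\<in>insert j J. g j [^]\<^bsub>A\<^esub> p) = g j [^]\<^bsub>A\<^esub> p \<oplus>\<^bsub>A\<^esub> (\<Oplus>\<^bsub>A\<^esub>j\<in>J. g j [^]\<^bsub>A\<^esub> p)"
      using insert(1,2) g by (intro M.finsum_insert) auto
    moreover have "(g j \<oplus>\<^bsub>A\<^esub> finsum A g J) [^]\<^bsub>A\<^esub> p = g j [^]\<^bsub>A\<^esub> p \<oplus>\<^bsub>A\<^esub> finsum A g J [^]\<^bsub>A\<^esub> p"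
      by (rule C.frobenius_add[OF p(1) pA g(1) M.finsum_closed[OF g(2)]])
    ultimately show ?case using insert(3)[OF g(2)] by (simp only:)
  qed
  from this[OF D(1), of "\<lambda>i. f i x \<odot>\<^bsub>A\<^esub> b i"]
  have "x [^]\<^bsub>A\<^esub> p = (\<Oplus>\<^bsub>A\<^esub>i\<in>I. (f i x \<odot>\<^bsub>A\<^esub> b i) [^]\<^bsub>A\<^esub> p)"
    using D(2) D(6)[OF _ x] by (simp add: D(5)[OF x])
  also have "\<dots> = (\<Oplus>\<^bsub>A\<^esub>i\<in>I. (f i x [^]\<^bsub>F\<^esub> p) \<odot>\<^bsub>A\<^esub> (b i [^]\<^bsub>A\<^esub> p))"
    using D(2) D(6)[OF _ x] by (intro M.finsum_cong') (simp_all add: smult_pow)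
  finally show ?thesis .
qed

text \<open>By the Frobenius expansion, the \<open>p\<close>-th powers of a basis span
  \<open>A\<close>. The linear map \<open>L\<close> that sends each \<open>b i\<close> to its
  \<open>p\<close>-th power is therefore onto, hence injective by finite dimension.\<close>

lemma pow_basis_independent:
  assumes p: "Factorial_Ring.prime (p::nat)" "add_pow F p \<one>\<^bsub>F\<^esub> = \<zero>\<^bsub>F\<^esub>" and d: "dual_basis F A I b f"
    and ps: "pow_span p = carrier A" and c: "c \<in> I \<rightarrow> carrier F"
    and z: "(\<Oplus>\<^bsub>A\<^esub>i\<in>I. c i \<odot>\<^bsub>A\<^esub> (b i [^]\<^bsub>A\<^esub> p)) = \<zero>\<^bsub>A\<^esub>" and i: "i \<in> I"
  shows "c i = \<zero>\<^bsub>F\<^esub>"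
proof -
  note D = dual_basisD[OF d]
  have ms: "module F (self_module F)" by (rule module_self_module[OF R.is_cring])
  define L where "L = (\<lambda>v. \<Oplus>\<^bsub>A\<^esub>i\<in>I. f i v \<odot>\<^bsub>A\<^esub> (b i [^]\<^bsub>A\<^esub> p))"
  have bc: "b i [^]\<^bsub>A\<^esub> p \<in> carrier A" if "i \<in> I" for i by (rule C.nat_pow_closed[OF D(2)[OF that]])
  have Lh: "L \<in> module_hom F A A" unfolding L_def
    by (rule module_hom_sum_fun[OF module_axioms module_axioms]) (rule module_hom_smult_vec[OF module_axioms D(3) bc])
  interpret L: linear_map F A A L
    by (rule linear_mapI[OF vectorspace_axioms vectorspace_axioms Lh])
  have Lc: "L (\<Oplus>\<^bsub>A\<^esub>i\<in>I. a i \<odot>\<^bsub>A\<^esub> b i) = (\<Oplus>\<^bsub>A\<^esub>i\<in>I. a i \<odot>\<^bsub>A\<^esub> (b i [^]\<^bsub>A\<^esub> p))" if "a \<in> I \<rightarrow> carrier F" for a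
    unfolding L_def
  proof (rule M.finsum_cong'[OF refl])
    show "(\<lambda>i. a i \<odot>\<^bsub>A\<^esub> (b i [^]\<^bsub>A\<^esub> p)) \<in> I \<rightarrow> carrier A" using that bc by (simp add: Pi_iff)
    show "f i (\<Oplus>\<^bsub>A\<^esub>i\<in>I. a i \<odot>\<^bsub>A\<^esub> b i) \<odot>\<^bsub>A\<^esub> (b i [^]\<^bsub>A\<^esub> p) = a i \<odot>\<^bsub>A\<^esub> (b i [^]\<^bsub>A\<^esub> p)" if i: "i \<in> I" for i
      by (simp only: dual_basis_finsum[OF module_axioms d \<open>a \<in> I \<rightarrow> carrier F\<close> i])
  qed
  have im: "LinearCombinations.submodule F (L ` carrier A) A" using L.im_is_submodule unfolding L.im_def .
  have "pow_span p \<subseteq> L ` carrier A"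
  proof (rule pow_span_minimal[OF im])
    fix x assume x: "x \<in> carrier A"
    have "(\<lambda>i. f i x [^]\<^bsub>F\<^esub> p) \<in> I \<rightarrow> carrier F" using D(6)[OF _ x] by simp
    from Lc[OF this] have "x [^]\<^bsub>A\<^esub> p = L (\<Oplus>\<^bsub>A\<^esub>i\<in>I. (f i x [^]\<^bsub>F\<^esub> p) \<odot>\<^bsub>A\<^esub> b i)"
      by (simp only: frobenius_dual_basis[OF p d x])
    then show "x [^]\<^bsub>A\<^esub> p \<in> L ` carrier A"
    proof (rule image_eqI)
      show "(\<Oplus>\<^bsub>A\<^esub>i\<in>I. (f i x [^]\<^bsub>F\<^esub> p) \<odot>\<^bsub>A\<^esub> b i) \<in> carrier A"
        using D(2) D(6)[OF _ x] by (intro M.finsum_closed) simp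
    qed
  qed
  moreover have "L ` carrier A \<subseteq> carrier A" using L.f_im by blast
  ultimately have "L ` carrier A = carrier A" using ps by blast
  then have inj: "inj_on L (carrier A)" by (rule L.surj_imp_inj[OF fd refl])
  have vc: "(\<Oplus>\<^bsub>A\<^esub>i\<in>I. c i \<odot>\<^bsub>A\<^esub> b i) \<in> carrier A" using D(2) c by (intro M.finsum_closed) (simp add: Pi_iff)
  have "L (\<Oplus>\<^bsub>A\<^esub>i\<in>I. c i \<odot>\<^bsub>A\<^esub> b i) = L \<zero>\<^bsub>A\<^esub>" using Lc[OF c] z L.f0_is_0 by (simp only:)
  then have "(\<Oplus>\<^bsub>A\<^esub>i\<in>I. c i \<odot>\<^bsub>A\<^esub> b i) = \<zero>\<^bsub>A\<^esub>" by (rule inj_onD[OF inj _ vc M.zero_closed])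
  then have "f i \<zero>\<^bsub>A\<^esub> = c i" using dual_basis_finsum[OF module_axioms d c i] by (simp only:)
  then show ?thesis using module_hom_zero[OF module_axioms ms D(3)[OF i]] by simp
qed

text \<open>\<open>x^2 = 0\<close> gives \<open>x^p = 0\<close>, as \<open>p\<close> is at least 2.
  In terms of the independent \<open>p\<close>-th powers of a basis, \<open>x^p\<close> has the
  coordinates \<open>(f i x)^p\<close>, so they all vanish, and with them the coordinates of
  \<open>x\<close>.\<close>

lemma reduced_of_pow_span:
  assumes p: "Factorial_Ring.prime (p::nat)" "add_pow F p \<one>\<^bsub>F\<^esub> = \<zero>\<^bsub>F\<^esub>" and ps: "pow_span p = carrier A"
    and x: "x \<in> carrier A" "x \<otimes>\<^bsub>A\<^esub> x = \<zero>\<^bsub>A\<^esub>"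
  shows "x = \<zero>\<^bsub>A\<^esub>"
proof -
  obtain I f where d: "dual_basis F A I (\<lambda>x. x) f" using dual_basis_exists[OF fd] by (elim exE)
  note D = dual_basisD[OF d]
  have "p = Suc (Suc (p - 2))" using prime_ge_2_nat[OF p(1)] by linarith
  then have "x [^]\<^bsub>A\<^esub> p = x [^]\<^bsub>A\<^esub> (Suc (Suc (p - 2)))" by (rule arg_cong)
  also have "\<dots> = x [^]\<^bsub>A\<^esub> (p - 2) \<otimes>\<^bsub>A\<^esub> (x \<otimes>\<^bsub>A\<^esub> x)"
    using x(1) by (simp only: C.nat_pow_Suc C.m_assoc C.nat_pow_closed)
  also have "\<dots> = \<zero>\<^bsub>A\<^esub>" unfolding x(2) by (rule C.r_null[OF C.nat_pow_closed[OF x(1)]])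
  finally have z: "(\<Oplus>\<^bsub>A\<^esub>i\<in>I. (f i x [^]\<^bsub>F\<^esub> p) \<odot>\<^bsub>A\<^esub> (i [^]\<^bsub>A\<^esub> p)) = \<zero>\<^bsub>A\<^esub>"
    by (simp only: frobenius_dual_basis[OF p d x(1)])
  have fz: "f i x = \<zero>\<^bsub>F\<^esub>" if i: "i \<in> I" for i
  proof (rule ccontr)
    assume n: "f i x \<noteq> \<zero>\<^bsub>F\<^esub>"
    have "f i x [^]\<^bsub>F\<^esub> k \<noteq> \<zero>\<^bsub>F\<^esub>" for k :: nat
      by (induct k) (use n D(6)[OF i x(1)] integral_iff in auto)
    moreover have "f i x [^]\<^bsub>F\<^esub> p = \<zero>\<^bsub>F\<^esub>"
      by (rule pow_basis_independent[OF p d ps _ z i]) (use D(6)[OF _ x(1)] in simp)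
    ultimately show False by blast
  qed
  have "(\<Oplus>\<^bsub>A\<^esub>i\<in>I. f i x \<odot>\<^bsub>A\<^esub> i) = \<zero>\<^bsub>A\<^esub>"
    by (rule M.add.finprod_one_eqI) (use fz D(2) in simp)
  then show ?thesis by (simp only: D(5)[OF x(1)])
qed

text \<open>Multiplication by \<open>x\<close> is injective on the ideal \<open>x A\<close>: if
  \<open>x w = 0\<close> with \<open>w = x c\<close>, then \<open>w^2 = 0\<close>. By finite
  dimension it maps \<open>x A\<close> onto itself, and a preimage of \<open>x\<close> in
  \<open>x A\<close> has the form \<open>x y\<close>.\<close>

lemma regular_of_reduced:
  assumes red: "\<And>x. x \<in> carrier A \<Longrightarrow> x \<otimes>\<^bsub>A\<^esub> x = \<zero>\<^bsub>A\<^esub> \<Longrightarrow> x = \<zero>\<^bsub>A\<^esub>" and x: "x \<in> carrier A"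
  shows "\<exists>y\<in>carrier A. x \<otimes>\<^bsub>A\<^esub> x \<otimes>\<^bsub>A\<^esub> y = x"
proof -
  interpret T: linear_map F A A "\<lambda>v. x \<otimes>\<^bsub>A\<^esub> v"
    by (rule linear_mapI[OF vectorspace_axioms vectorspace_axioms mult_hom[OF x]])
  define W where "W = (\<lambda>v. x \<otimes>\<^bsub>A\<^esub> v) ` carrier A"
  have W: "subspace F W A" using T.imT_is_subspace unfolding T.im_def W_def .
  have Wc: "W \<subseteq> carrier A" unfolding W_def using prod_closed[OF x] by blast
  interpret W: vectorspace F "A\<lparr>carrier := W\<rparr>" using W by (rule subspace_is_vs)
  have h: "(\<lambda>v. x \<otimes>\<^bsub>A\<^esub> v) \<in> module_hom F (A\<lparr>carrier := W\<rparr>) (A\<lparr>carrier := W\<rparr>)"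
  proof (rule module_homI)
    show "x \<otimes>\<^bsub>A\<^esub> w \<in> carrier (A\<lparr>carrier := W\<rparr>)" if "w \<in> carrier (A\<lparr>carrier := W\<rparr>)" for w
      using that Wc by (simp add: W_def image_iff) (use prod_closed x in blast)
  qed (use Wc x prod_add_right prod_smult_right in \<open>simp_all add: subset_iff\<close>)
  interpret S: linear_map F "A\<lparr>carrier := W\<rparr>" "A\<lparr>carrier := W\<rparr>" "\<lambda>v. x \<otimes>\<^bsub>A\<^esub> v"
    by (rule linear_mapI[OF W.vectorspace_axioms W.vectorspace_axioms h])
  have "inj_on (\<lambda>v. x \<otimes>\<^bsub>A\<^esub> v) W"
  proof (rule inj_onI)
    fix u v assume uv: "u \<in> W" "v \<in> W" "x \<otimes>\<^bsub>A\<^esub> u = x \<otimes>\<^bsub>A\<^esub> v"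
    have c: "u \<in> carrier A" "v \<in> carrier A" using uv Wc by blast+
    have w: "u \<ominus>\<^bsub>A\<^esub> v \<in> carrier A" using c by simp
    obtain a b where ab: "a \<in> carrier A" "u = x \<otimes>\<^bsub>A\<^esub> a" "b \<in> carrier A" "v = x \<otimes>\<^bsub>A\<^esub> b"
      using uv(1,2) unfolding W_def by blast
    have 1: "u \<ominus>\<^bsub>A\<^esub> v = x \<otimes>\<^bsub>A\<^esub> (a \<ominus>\<^bsub>A\<^esub> b)"
      using ab x by (simp add: M.minus_eq C.r_distr C.r_minus)
    have "x \<otimes>\<^bsub>A\<^esub> (u \<ominus>\<^bsub>A\<^esub> v) = x \<otimes>\<^bsub>A\<^esub> u \<ominus>\<^bsub>A\<^esub> x \<otimes>\<^bsub>A\<^esub> v"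
      using c x by (simp add: M.minus_eq C.r_distr C.r_minus)
    then have 2: "x \<otimes>\<^bsub>A\<^esub> (u \<ominus>\<^bsub>A\<^esub> v) = \<zero>\<^bsub>A\<^esub>"
      unfolding uv(3) using c x M.r_neg[of "x \<otimes>\<^bsub>A\<^esub> v"] by (simp add: M.minus_eq)
    have "(u \<ominus>\<^bsub>A\<^esub> v) \<otimes>\<^bsub>A\<^esub> (u \<ominus>\<^bsub>A\<^esub> v) = (x \<otimes>\<^bsub>A\<^esub> (a \<ominus>\<^bsub>A\<^esub> b)) \<otimes>\<^bsub>A\<^esub> (u \<ominus>\<^bsub>A\<^esub> v)"
      by (simp only: 1)
    also have "\<dots> = (x \<otimes>\<^bsub>A\<^esub> (u \<ominus>\<^bsub>A\<^esub> v)) \<otimes>\<^bsub>A\<^esub> (a \<ominus>\<^bsub>A\<^esub> b)"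
      using x w ab by (simp only: C.m_ac M.minus_closed)
    also have "\<dots> = \<zero>\<^bsub>A\<^esub>" unfolding 2 using ab by (intro C.l_null M.minus_closed)
    finally have "u \<ominus>\<^bsub>A\<^esub> v = \<zero>\<^bsub>A\<^esub>" by (rule red[OF w])
    then show "u = v" using c by simp
  qed
  then have "(\<lambda>v. x \<otimes>\<^bsub>A\<^esub> v) ` W = W"
    using S.inj_imp_surj[OF subspace_dim(1)[OF fd W] subspace_dim(1)[OF fd W] refl] by simp
  moreover have "x \<in> W" unfolding W_def by (rule image_eqI[of _ _ "\<one>\<^bsub>A\<^esub>"]) (use x in simp_all)
  ultimately obtain w where "w \<in> W" "x = x \<otimes>\<^bsub>A\<^esub> w" by blast
  then obtain y where "y \<in> carrier A" "x = x \<otimes>\<^bsub>A\<^esub> (x \<otimes>\<^bsub>A\<^esub> y)" unfolding W_def by blast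
  then show ?thesis using x by (intro bexI[of _ y]) (simp_all only: C.m_assoc)
qed

end


section \<open>Tensor products of etale algebras\<close>

context fd_comm_algebra begin

text \<open>The trace of the map \<open>v \<mapsto> x v\<close>. The dual basis is an argument, so
  that the product basis can be chosen on a tensor product, which makes the trace multiplicative
  there.\<close>

definition alg_trace :: "'i set \<Rightarrow> ('i \<Rightarrow> 'a) \<Rightarrow> ('i \<Rightarrow> 'a \<Rightarrow> 'f) \<Rightarrow> 'a \<Rightarrow> 'f" where
  "alg_trace I b f x = (\<Oplus>\<^bsub>F\<^esub>i\<in>I. f i (x \<otimes>\<^bsub>A\<^esub> b i))"

lemma alg_trace_hom:
  assumes d: "dual_basis F A I b f" shows "alg_trace I b f \<in> module_hom F A (self_module F)"
proof -
  have ms: "module F (self_module F)" by (rule module_self_module[OF R.is_cring])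
  note D = dual_basisD[OF d]
  have "(\<lambda>x. \<Oplus>\<^bsub>self_module F\<^esub>i\<in>I. f i (x \<otimes>\<^bsub>A\<^esub> b i)) \<in> module_hom F A (self_module F)"
    by (rule module_hom_sum_fun[OF module_axioms ms])
      (rule module_hom_comp[OF bilinearD(2)[OF mult_bilinear D(2)] D(3)])
  then show ?thesis unfolding alg_trace_def finsum_self_module .
qed

lemma alg_trace_nilpotent:
  assumes d: "dual_basis F A I b f" and z: "z \<in> carrier A" "z \<otimes>\<^bsub>A\<^esub> z = \<zero>\<^bsub>A\<^esub>"
  shows "alg_trace I b f z = \<zero>\<^bsub>F\<^esub>"
  unfolding alg_trace_def
proof (rule trace_square_zero[OF fd d mult_hom[OF z(1)]])
  show "z \<otimes>\<^bsub>A\<^esub> (z \<otimes>\<^bsub>A\<^esub> v) = \<zero>\<^bsub>A\<^esub>" if "v \<in> carrier A" for v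
    using z that C.m_assoc[OF z(1) z(1) that] by simp
qed

end

text \<open>For \<open>x \<noteq> 0\<close>, regularity provides an idempotent
  \<open>e = x y\<close> with \<open>e x = x\<close>. Its trace is a positive rank, nonzero in
  characteristic 0, although it is a value of the trace form at \<open>x\<close>.\<close>

lemma (in etale_like) alg_trace_nondegenerate:
  assumes d: "dual_basis F A I b f" and char0: "\<forall>n>0. add_pow F (n::nat) \<one>\<^bsub>F\<^esub> \<noteq> \<zero>\<^bsub>F\<^esub>"
    and x: "x \<in> carrier A" "\<And>y. y \<in> carrier A \<Longrightarrow> alg_trace I b f (x \<otimes>\<^bsub>A\<^esub> y) = \<zero>\<^bsub>F\<^esub>"
  shows "x = \<zero>\<^bsub>A\<^esub>"
proof (rule ccontr)
  assume n: "x \<noteq> \<zero>\<^bsub>A\<^esub>"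
  obtain y where y: "y \<in> carrier A" "x \<otimes>\<^bsub>A\<^esub> x \<otimes>\<^bsub>A\<^esub> y = x" using regular[OF x(1)] by (elim bexE)
  define e where "e = x \<otimes>\<^bsub>A\<^esub> y"
  have e: "e \<in> carrier A" unfolding e_def by (rule C.m_closed[OF x(1) y(1)])
  have ex: "e \<otimes>\<^bsub>A\<^esub> x = x" unfolding e_def using x(1) y by (simp add: C.m_ac)
  have ee: "e \<otimes>\<^bsub>A\<^esub> e = e"
    using C.m_assoc[OF e x(1) y(1)] unfolding ex e_def[symmetric] by simp
  have "\<exists>n>0. alg_trace I b f e = add_pow F (n::nat) \<one>\<^bsub>F\<^esub>"
    unfolding alg_trace_def
  proof (rule trace_idempotent[OF fd d mult_hom[OF e] _ x(1)])
    show "e \<otimes>\<^bsub>A\<^esub> (e \<otimes>\<^bsub>A\<^esub> v) = e \<otimes>\<^bsub>A\<^esub> v" if "v \<in> carrier A" for v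
      using C.m_assoc[OF e e that] ee by simp
    show "e \<otimes>\<^bsub>A\<^esub> x \<noteq> \<zero>\<^bsub>A\<^esub>" unfolding ex by (rule n)
  qed
  then obtain n where "n > 0" "alg_trace I b f e = add_pow F (n::nat) \<one>\<^bsub>F\<^esub>" by (elim exE conjE)
  moreover have "alg_trace I b f e = \<zero>\<^bsub>F\<^esub>" unfolding e_def by (rule x(2)[OF y(1)])
  ultimately show False using char0 by auto
qed

text \<open>Nondegeneracy in coordinates: the sum is the trace of \<open>x u\<close> for the element
  \<open>x\<close> with coordinates \<open>c\<close>. This form applies to one tensor factor at a
  time, with coefficients that come from the other.\<close>

lemma (in etale_like) alg_trace_coeff_zero:
  assumes d: "dual_basis F A I b f" and char0: "\<forall>n>0. add_pow F (n::nat) \<one>\<^bsub>F\<^esub> \<noteq> \<zero>\<^bsub>F\<^esub>"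
    and c: "c \<in> I \<rightarrow> carrier F" and i: "i \<in> I"
    and z: "\<And>u. u \<in> carrier A \<Longrightarrow> (\<Oplus>\<^bsub>F\<^esub>i\<in>I. c i \<otimes>\<^bsub>F\<^esub> alg_trace I b f (b i \<otimes>\<^bsub>A\<^esub> u)) = \<zero>\<^bsub>F\<^esub>"
  shows "c i = \<zero>\<^bsub>F\<^esub>"
proof -
  note D = dual_basisD[OF d]
  note th = alg_trace_hom[OF d]
  have ms: "module F (self_module F)" by (rule module_self_module[OF R.is_cring])
  define x where "x = (\<Oplus>\<^bsub>A\<^esub>i\<in>I. c i \<odot>\<^bsub>A\<^esub> b i)"
  have cb: "(\<lambda>i. c i \<odot>\<^bsub>A\<^esub> b i) \<in> I \<rightarrow> carrier A" using c D(2) by (simp add: Pi_iff)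
  have x: "x \<in> carrier A" unfolding x_def by (rule M.finsum_closed[OF cb])
  have "x = \<zero>\<^bsub>A\<^esub>"
  proof (rule alg_trace_nondegenerate[OF d char0 x])
    fix u assume u: "u \<in> carrier A"
    have tc: "alg_trace I b f (b i \<otimes>\<^bsub>A\<^esub> u) \<in> carrier F" if "i \<in> I" for i
      using module_hom_in[OF th C.m_closed[OF D(2)[OF that] u]] by simp
    have "alg_trace I b f (x \<otimes>\<^bsub>A\<^esub> u) = alg_trace I b f (\<Oplus>\<^bsub>A\<^esub>i\<in>I. (c i \<odot>\<^bsub>A\<^esub> b i) \<otimes>\<^bsub>A\<^esub> u)"
      unfolding x_def by (simp only: bilinear_finsum(2)[OF mult_bilinear module_axioms module_axioms module_axioms u cb])
    also have "\<dots> = (\<Oplus>\<^bsub>self_module F\<^esub>i\<in>I. alg_trace I b f ((c i \<odot>\<^bsub>A\<^esub> b i) \<otimes>\<^bsub>A\<^esub> u))"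
      by (rule module_hom_finsum[OF module_axioms ms th]) (use cb u in \<open>simp add: Pi_iff\<close>)
    also have "\<dots> = (\<Oplus>\<^bsub>F\<^esub>i\<in>I. c i \<otimes>\<^bsub>F\<^esub> alg_trace I b f (b i \<otimes>\<^bsub>A\<^esub> u))"
      unfolding finsum_self_module
    proof (rule R.finsum_cong'[OF refl])
      fix i assume i: "i \<in> I"
      have ci: "c i \<in> carrier F" using c i by (rule Pi_mem)
      show "alg_trace I b f ((c i \<odot>\<^bsub>A\<^esub> b i) \<otimes>\<^bsub>A\<^esub> u) = c i \<otimes>\<^bsub>F\<^esub> alg_trace I b f (b i \<otimes>\<^bsub>A\<^esub> u)"
        by (simp only: prod_smult_left[OF ci D(2)[OF i] u] module_hom_smult[OF th ci C.m_closed[OF D(2)[OF i] u]] self_module_simps)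
    qed (use tc c in \<open>simp add: Pi_iff\<close>)
    finally show "alg_trace I b f (x \<otimes>\<^bsub>A\<^esub> u) = \<zero>\<^bsub>F\<^esub>" by (simp only: z[OF u])
  qed
  then have "f i \<zero>\<^bsub>A\<^esub> = c i" using dual_basis_finsum[OF module_axioms d c i] unfolding x_def by (simp only:)
  then show ?thesis using module_hom_zero[OF module_axioms ms D(3)[OF i]] by simp
qed

text \<open>The multiplicative version of \<open>tensor_like\<close>, kept abstract for the same two
  instances: tensor algebras and the image of \<open>K \<otimes> L\<close>.\<close>

locale tensor_etale = A: etale_like F A + B: etale_like F B + T: nonassoc_algebra F T + tensor_like F A B T tau
  for F :: "('f, 'm) ring_scheme" and A :: "('f, 'a) module" and B :: "('f, 'b) module"
    and T :: "('f, 't) module" and tau +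
  assumes tau_mult: "a \<in> carrier A \<Longrightarrow> b \<in> carrier B \<Longrightarrow> a' \<in> carrier A \<Longrightarrow> b' \<in> carrier B \<Longrightarrow>
      tau a b \<otimes>\<^bsub>T\<^esub> tau a' b' = tau (a \<otimes>\<^bsub>A\<^esub> a') (b \<otimes>\<^bsub>B\<^esub> b')"
    and tau_one: "\<one>\<^bsub>T\<^esub> = tau \<one>\<^bsub>A\<^esub> \<one>\<^bsub>B\<^esub>"
begin

lemma T_fin_dim: "T.fin_dim" and T_dim: "T.dim = A.dim * B.dim"
  by (rule tensor_like_dim[OF A.vectorspace_axioms B.vectorspace_axioms T.vectorspace_axioms tensor_like_axioms
        A.fd B.fd])+

lemma T_comm: 
  assumes x: "x \<in> carrier T" and y: "y \<in> carrier T" shows "x \<otimes>\<^bsub>T\<^esub> y = y \<otimes>\<^bsub>T\<^esub> x"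
proof (rule tau_induct[OF x, of "\<lambda>x. x \<otimes>\<^bsub>T\<^esub> y = y \<otimes>\<^bsub>T\<^esub> x"])
  fix a b assume ab: "a \<in> carrier A" "b \<in> carrier B"
  show "tau a b \<otimes>\<^bsub>T\<^esub> y = y \<otimes>\<^bsub>T\<^esub> tau a b"
    by (rule tau_induct[OF y, of "\<lambda>y. tau a b \<otimes>\<^bsub>T\<^esub> y = y \<otimes>\<^bsub>T\<^esub> tau a b"])
      (simp_all only: ab tau_mult A.prod_comm[OF ab(1)] B.prod_comm[OF ab(2)]
        T.prod_add_left T.prod_add_right tau_closed)
qed (simp_all only: T.prod_add_left T.prod_add_right y)

lemma T_assoc:
  assumes x: "x \<in> carrier T" and y: "y \<in> carrier T" and z: "z \<in> carrier T"
  shows "(x \<otimes>\<^bsub>T\<^esub> y) \<otimes>\<^bsub>T\<^esub> z = x \<otimes>\<^bsub>T\<^esub> (y \<otimes>\<^bsub>T\<^esub> z)"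
proof (rule tau_induct[OF x, of "\<lambda>x. (x \<otimes>\<^bsub>T\<^esub> y) \<otimes>\<^bsub>T\<^esub> z = x \<otimes>\<^bsub>T\<^esub> (y \<otimes>\<^bsub>T\<^esub> z)"])
  fix a b assume ab: "a \<in> carrier A" "b \<in> carrier B"
  note t = tau_closed[OF ab]
  show "(tau a b \<otimes>\<^bsub>T\<^esub> y) \<otimes>\<^bsub>T\<^esub> z = tau a b \<otimes>\<^bsub>T\<^esub> (y \<otimes>\<^bsub>T\<^esub> z)"
  proof (rule tau_induct[OF y, of "\<lambda>y. (tau a b \<otimes>\<^bsub>T\<^esub> y) \<otimes>\<^bsub>T\<^esub> z = tau a b \<otimes>\<^bsub>T\<^esub> (y \<otimes>\<^bsub>T\<^esub> z)"])
    fix c d assume cd: "c \<in> carrier A" "d \<in> carrier B"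
    note t' = tau_closed[OF cd]
    show "(tau a b \<otimes>\<^bsub>T\<^esub> tau c d) \<otimes>\<^bsub>T\<^esub> z = tau a b \<otimes>\<^bsub>T\<^esub> (tau c d \<otimes>\<^bsub>T\<^esub> z)"
      by (rule tau_induct[OF z, of "\<lambda>z. (tau a b \<otimes>\<^bsub>T\<^esub> tau c d) \<otimes>\<^bsub>T\<^esub> z = tau a b \<otimes>\<^bsub>T\<^esub> (tau c d \<otimes>\<^bsub>T\<^esub> z)"])
        (simp_all only: ab cd t t' tau_mult A.C.m_assoc B.C.m_assoc A.prod_closed B.prod_closed
          T.prod_add_right T.prod_closed tau_closed)
  qed (simp_all only: t z T.prod_add_left T.prod_add_right T.prod_closed)
qed (simp_all only: y z T.prod_add_left T.prod_closed)

sublocale T: fd_comm_algebra F T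
  by unfold_locales (fact T_assoc T_comm T_fin_dim)+

lemma tau_pow:
  assumes "a \<in> carrier A" "b \<in> carrier B"
  shows "tau a b [^]\<^bsub>T\<^esub> (n::nat) = tau (a [^]\<^bsub>A\<^esub> n) (b [^]\<^bsub>B\<^esub> n)"
proof (induct n)
  case 0
  show ?case by (simp add: tau_one)
next
  case (Suc n)
  show ?case
    by (simp only: T.C.nat_pow_Suc A.C.nat_pow_Suc B.C.nat_pow_Suc Suc tau_mult
        A.C.nat_pow_closed B.C.nat_pow_closed assms)
qed

text \<open>\<open>(x \<otimes> y)^p = x^p \<otimes> y^p\<close>. With one factor fixed, the
  elements of the other whose tensor lies in the span form a subspace. Once it contains all
  \<open>p\<close>-th powers it is everything; the two factors are treated in turn.\<close>

lemma T_pow_span: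
  assumes p: "Factorial_Ring.prime (p::nat)" "add_pow F p \<one>\<^bsub>F\<^esub> = \<zero>\<^bsub>F\<^esub>"
  shows "T.pow_span p = carrier T"
proof
  show "T.pow_span p \<subseteq> carrier T" by (rule T.pow_span_carrier)
  note S = T.pow_span_submodule[of p]
  have hs: "LinearCombinations.submodule F {x \<in> carrier V. h x \<in> T.pow_span p} V"
    if V: "module F V" and h: "h \<in> module_hom F V T" for V :: "('f, 'v) module" and h
  proof -
    interpret V: module F V by fact
    have z: "h \<zero>\<^bsub>V\<^esub> = \<zero>\<^bsub>T\<^esub>" by (rule module_hom_zero[OF V T.module_axioms h])
    show ?thesis
      using S V unfolding LinearCombinations.submodule_def
      by (simp add: z module_hom_add[OF h] module_hom_smult[OF h] subset_iff)
  qed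
  have 1: "tau (x [^]\<^bsub>A\<^esub> p) b \<in> T.pow_span p" if x: "x \<in> carrier A" and b: "b \<in> carrier B" for x b
  proof -
    have xp: "x [^]\<^bsub>A\<^esub> p \<in> carrier A" by (rule A.C.nat_pow_closed[OF x])
    have "B.pow_span p \<subseteq> {b \<in> carrier B. tau (x [^]\<^bsub>A\<^esub> p) b \<in> T.pow_span p}"
    proof (rule B.pow_span_minimal[OF hs[OF B.module_axioms bilinearD(1)[OF tau_bilinear xp]]])
      fix y assume y: "y \<in> carrier B"
      have "tau (x [^]\<^bsub>A\<^esub> p) (y [^]\<^bsub>B\<^esub> p) \<in> T.pow_span p"
        unfolding tau_pow[OF x y, symmetric] by (rule T.pow_in_pow_span[OF tau_closed[OF x y]])
      then show "y [^]\<^bsub>B\<^esub> p \<in> {b \<in> carrier B. tau (x [^]\<^bsub>A\<^esub> p) b \<in> T.pow_span p}"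
        using B.C.nat_pow_closed[OF y] by simp
    qed
    then show ?thesis using b unfolding B.pow_span[OF p] by blast
  qed
  have 2: "tau a b \<in> T.pow_span p" if a: "a \<in> carrier A" and b: "b \<in> carrier B" for a b
  proof -
    have "A.pow_span p \<subseteq> {a \<in> carrier A. tau a b \<in> T.pow_span p}"
      by (rule A.pow_span_minimal[OF hs[OF A.module_axioms bilinearD(2)[OF tau_bilinear b]]])
        (use 1[OF _ b] A.C.nat_pow_closed in simp)
    then show ?thesis using a unfolding A.pow_span[OF p] by blast
  qed
  show "carrier T \<subseteq> T.pow_span p"
  proof
    fix x assume x: "x \<in> carrier T"
    show "x \<in> T.pow_span p"
      by (rule tau_induct[OF x, of "\<lambda>x. x \<in> T.pow_span p"])
        (use 2 S in \<open>simp_all add: LinearCombinations.submodule_def\<close>)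
  qed
qed

text \<open>Multiples of a square-zero \<open>z\<close> are square-zero, so the trace form vanishes
  at \<open>z\<close> and any \<open>w\<close>. As the trace is multiplicative on pure tensors, the
  matrix of coordinates of \<open>z\<close> vanishes after multiplication by the Gram matrices of
  \<open>A\<close> and \<open>B\<close> on its two sides, and these are nonsingular.\<close>

lemma T_reduced_char0:
  assumes char0: "\<forall>n>0. add_pow F (n::nat) \<one>\<^bsub>F\<^esub> \<noteq> \<zero>\<^bsub>F\<^esub>"
    and z: "z \<in> carrier T" "z \<otimes>\<^bsub>T\<^esub> z = \<zero>\<^bsub>T\<^esub>"
  shows "z = \<zero>\<^bsub>T\<^esub>"
proof -
  have ms: "module F (self_module F)" by (rule module_self_module[OF A.R.is_cring])
  obtain I f where d: "dual_basis F A I (\<lambda>x. x) f" using A.dual_basis_exists[OF A.fd] by (elim exE)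
  obtain J g where e: "dual_basis F B J (\<lambda>x. x) g" using B.dual_basis_exists[OF B.fd] by (elim exE)
  obtain h where h: "dual_basis F T (I \<times> J) (\<lambda>p. tau (fst p) (snd p)) h"
    and ht: "\<forall>p\<in>I \<times> J. \<forall>x\<in>carrier A. \<forall>y\<in>carrier B. h p (tau x y) = f (fst p) x \<otimes>\<^bsub>F\<^esub> g (snd p) y"
    using tau_dual_basis[OF d e] by (elim exE conjE)
  note D = dual_basisD[OF d] and E = dual_basisD[OF e] and H = dual_basisD[OF h]
  define tA where "tA = A.alg_trace I (\<lambda>x. x) f"
  define tB where "tB = B.alg_trace J (\<lambda>x. x) g"
  define tT where "tT = T.alg_trace (I \<times> J) (\<lambda>p. tau (fst p) (snd p)) h"
  have tAc: "tA x \<in> carrier F" if "x \<in> carrier A" for x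
    using module_hom_in[OF A.alg_trace_hom[OF d] that] by (simp add: tA_def)
  have tBc: "tB x \<in> carrier F" if "x \<in> carrier B" for x
    using module_hom_in[OF B.alg_trace_hom[OF e] that] by (simp add: tB_def)
  have tTh: "tT \<in> module_hom F T (self_module F)" unfolding tT_def by (rule T.alg_trace_hom[OF h])
  have tt: "tT (tau x y) = tA x \<otimes>\<^bsub>F\<^esub> tB y" if x: "x \<in> carrier A" and y: "y \<in> carrier B" for x y
  proof -
    have fc: "f i (x \<otimes>\<^bsub>A\<^esub> i) \<in> carrier F" if "i \<in> I" for i by (rule D(6)[OF that A.prod_closed[OF x D(2)[OF that]]])
    have gc: "g j (y \<otimes>\<^bsub>B\<^esub> j) \<in> carrier F" if "j \<in> J" for j by (rule E(6)[OF that B.prod_closed[OF y E(2)[OF that]]])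
    have "tT (tau x y) = (\<Oplus>\<^bsub>F\<^esub>p\<in>I \<times> J. f (fst p) (x \<otimes>\<^bsub>A\<^esub> fst p) \<otimes>\<^bsub>F\<^esub> g (snd p) (y \<otimes>\<^bsub>B\<^esub> snd p))"
      unfolding tT_def T.alg_trace_def
    proof (rule A.R.finsum_cong'[OF refl])
      fix p assume p: "p \<in> I \<times> J"
      then have p': "fst p \<in> I" "snd p \<in> J" by auto
      show "h p (tau x y \<otimes>\<^bsub>T\<^esub> tau (fst p) (snd p)) = f (fst p) (x \<otimes>\<^bsub>A\<^esub> fst p) \<otimes>\<^bsub>F\<^esub> g (snd p) (y \<otimes>\<^bsub>B\<^esub> snd p)"
        unfolding tau_mult[OF x y D(2)[OF p'(1)] E(2)[OF p'(2)]]
        using bspec[OF bspec[OF bspec[OF ht p] A.prod_closed[OF x D(2)[OF p'(1)]]] B.prod_closed[OF y E(2)[OF p'(2)]]] .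
    qed (use fc gc in auto)
    also have "\<dots> = (\<Oplus>\<^bsub>F\<^esub>i\<in>I. \<Oplus>\<^bsub>F\<^esub>j\<in>J. f i (x \<otimes>\<^bsub>A\<^esub> i) \<otimes>\<^bsub>F\<^esub> g j (y \<otimes>\<^bsub>B\<^esub> j))"
      by (rule A.R.finsum_cartesian[OF D(1) E(1), where g = "\<lambda>i j. f i (x \<otimes>\<^bsub>A\<^esub> i) \<otimes>\<^bsub>F\<^esub> g j (y \<otimes>\<^bsub>B\<^esub> j)"])
        (use fc gc in simp)
    also have "\<dots> = (\<Oplus>\<^bsub>F\<^esub>i\<in>I. f i (x \<otimes>\<^bsub>A\<^esub> i) \<otimes>\<^bsub>F\<^esub> tB y)"
    proof (rule A.R.finsum_cong'[OF refl])
      show "(\<Oplus>\<^bsub>F\<^esub>j\<in>J. f i (x \<otimes>\<^bsub>A\<^esub> i) \<otimes>\<^bsub>F\<^esub> g j (y \<otimes>\<^bsub>B\<^esub> j)) = f i (x \<otimes>\<^bsub>A\<^esub> i) \<otimes>\<^bsub>F\<^esub> tB y" if "i \<in> I" for i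
        unfolding tB_def B.alg_trace_def
        by (rule A.R.finsum_rdistr[symmetric]) (use fc[OF that] gc E(1) in simp_all)
    qed (use fc tBc[OF y] in simp)
    also have "\<dots> = tA x \<otimes>\<^bsub>F\<^esub> tB y" unfolding tA_def A.alg_trace_def
      by (rule A.R.finsum_ldistr[symmetric]) (use fc tBc[OF y] D(1) in simp_all)
    finally show ?thesis .
  qed
  have hc: "h p z \<in> carrier F" if "p \<in> I \<times> J" for p by (rule H(6)[OF that z(1)])
  \<comment> \<open>The vanishing trace of \<open>z \<cdot> (u \<otimes> v)\<close> in coordinates,
    grouped so that the inner sums are coefficients for the trace form of \<open>A\<close>.\<close>
  have key: "(\<Oplus>\<^bsub>F\<^esub>i\<in>I. (\<Oplus>\<^bsub>F\<^esub>j\<in>J. h (i, j) z \<otimes>\<^bsub>F\<^esub> tB (j \<otimes>\<^bsub>B\<^esub> v)) \<otimes>\<^bsub>F\<^esub> tA (i \<otimes>\<^bsub>A\<^esub> u)) = \<zero>\<^bsub>F\<^esub>"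
    if u: "u \<in> carrier A" and v: "v \<in> carrier B" for u v
  proof -
    define w where "w = tau u v"
    have w: "w \<in> carrier T" unfolding w_def by (rule tau_closed[OF u v])
    have au: "tA (i \<otimes>\<^bsub>A\<^esub> u) \<in> carrier F" if "i \<in> I" for i by (rule tAc[OF A.prod_closed[OF D(2)[OF that] u]])
    have bv: "tB (j \<otimes>\<^bsub>B\<^esub> v) \<in> carrier F" if "j \<in> J" for j by (rule tBc[OF B.prod_closed[OF E(2)[OF that] v]])
    have zw: "z \<otimes>\<^bsub>T\<^esub> w \<in> carrier T" by (rule T.prod_closed[OF z(1) w])
    have "(z \<otimes>\<^bsub>T\<^esub> w) \<otimes>\<^bsub>T\<^esub> (z \<otimes>\<^bsub>T\<^esub> w) = (z \<otimes>\<^bsub>T\<^esub> z) \<otimes>\<^bsub>T\<^esub> (w \<otimes>\<^bsub>T\<^esub> w)"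
      using z(1) w by (simp only: T.C.m_ac T.C.m_closed)
    also have "\<dots> = \<zero>\<^bsub>T\<^esub>" unfolding z(2) by (rule T.C.l_null[OF T.prod_closed[OF w w]])
    finally have "tT (z \<otimes>\<^bsub>T\<^esub> w) = \<zero>\<^bsub>F\<^esub>" unfolding tT_def by (rule T.alg_trace_nilpotent[OF h zw])
    moreover have "tT (z \<otimes>\<^bsub>T\<^esub> w)
        = (\<Oplus>\<^bsub>F\<^esub>p\<in>I \<times> J. h p z \<otimes>\<^bsub>F\<^esub> (tA (fst p \<otimes>\<^bsub>A\<^esub> u) \<otimes>\<^bsub>F\<^esub> tB (snd p \<otimes>\<^bsub>B\<^esub> v)))"
    proof -
      have hb: "(\<lambda>p. h p z \<odot>\<^bsub>T\<^esub> tau (fst p) (snd p)) \<in> I \<times> J \<rightarrow> carrier T"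
        by (rule Pi_I, rule T.smult_closed[OF hc H(2)])
      have "tT (z \<otimes>\<^bsub>T\<^esub> w) = tT ((\<Oplus>\<^bsub>T\<^esub>p\<in>I \<times> J. h p z \<odot>\<^bsub>T\<^esub> tau (fst p) (snd p)) \<otimes>\<^bsub>T\<^esub> w)"
        by (simp only: H(5)[OF z(1)])
      also have "\<dots> = tT (\<Oplus>\<^bsub>T\<^esub>p\<in>I \<times> J. (h p z \<odot>\<^bsub>T\<^esub> tau (fst p) (snd p)) \<otimes>\<^bsub>T\<^esub> w)"
        by (simp only: bilinear_finsum(2)[OF T.mult_bilinear T.module_axioms T.module_axioms T.module_axioms w hb])
      also have "\<dots> = (\<Oplus>\<^bsub>self_module F\<^esub>p\<in>I \<times> J. tT ((h p z \<odot>\<^bsub>T\<^esub> tau (fst p) (snd p)) \<otimes>\<^bsub>T\<^esub> w))"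
        by (rule module_hom_finsum[OF T.module_axioms ms tTh], rule Pi_I, rule T.prod_closed[OF Pi_mem[OF hb] w])
      also have "\<dots> = (\<Oplus>\<^bsub>F\<^esub>p\<in>I \<times> J. h p z \<otimes>\<^bsub>F\<^esub> (tA (fst p \<otimes>\<^bsub>A\<^esub> u) \<otimes>\<^bsub>F\<^esub> tB (snd p \<otimes>\<^bsub>B\<^esub> v)))"
        unfolding finsum_self_module
      proof (rule A.R.finsum_cong'[OF refl])
        fix p assume p: "p \<in> I \<times> J"
        then have p': "fst p \<in> I" "snd p \<in> J" by auto
        have "tT ((h p z \<odot>\<^bsub>T\<^esub> tau (fst p) (snd p)) \<otimes>\<^bsub>T\<^esub> w) = h p z \<otimes>\<^bsub>F\<^esub> tT (tau (fst p) (snd p) \<otimes>\<^bsub>T\<^esub> w)"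
          by (simp only: T.prod_smult_left[OF hc[OF p] H(2)[OF p] w]
              module_hom_smult[OF tTh hc[OF p] T.prod_closed[OF H(2)[OF p] w]] self_module_simps)
        also have "tau (fst p) (snd p) \<otimes>\<^bsub>T\<^esub> w = tau (fst p \<otimes>\<^bsub>A\<^esub> u) (snd p \<otimes>\<^bsub>B\<^esub> v)"
          unfolding w_def by (rule tau_mult[OF D(2)[OF p'(1)] E(2)[OF p'(2)] u v])
        also have "tT (tau (fst p \<otimes>\<^bsub>A\<^esub> u) (snd p \<otimes>\<^bsub>B\<^esub> v)) = tA (fst p \<otimes>\<^bsub>A\<^esub> u) \<otimes>\<^bsub>F\<^esub> tB (snd p \<otimes>\<^bsub>B\<^esub> v)"
          by (rule tt[OF A.prod_closed[OF D(2)[OF p'(1)] u] B.prod_closed[OF E(2)[OF p'(2)] v]])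
        finally show "tT ((h p z \<odot>\<^bsub>T\<^esub> tau (fst p) (snd p)) \<otimes>\<^bsub>T\<^esub> w)
          = h p z \<otimes>\<^bsub>F\<^esub> (tA (fst p \<otimes>\<^bsub>A\<^esub> u) \<otimes>\<^bsub>F\<^esub> tB (snd p \<otimes>\<^bsub>B\<^esub> v))" .
      qed (use hc au bv in auto)
      finally show ?thesis .
    qed
    moreover have "(\<Oplus>\<^bsub>F\<^esub>p\<in>I \<times> J. h p z \<otimes>\<^bsub>F\<^esub> (tA (fst p \<otimes>\<^bsub>A\<^esub> u) \<otimes>\<^bsub>F\<^esub> tB (snd p \<otimes>\<^bsub>B\<^esub> v)))
      = (\<Oplus>\<^bsub>F\<^esub>i\<in>I. \<Oplus>\<^bsub>F\<^esub>j\<in>J. h (i, j) z \<otimes>\<^bsub>F\<^esub> (tA (i \<otimes>\<^bsub>A\<^esub> u) \<otimes>\<^bsub>F\<^esub> tB (j \<otimes>\<^bsub>B\<^esub> v)))"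
      using A.R.finsum_cartesian[OF D(1) E(1),
          where g = "\<lambda>i j. h (i, j) z \<otimes>\<^bsub>F\<^esub> (tA (i \<otimes>\<^bsub>A\<^esub> u) \<otimes>\<^bsub>F\<^esub> tB (j \<otimes>\<^bsub>B\<^esub> v))"] hc au bv by simp
    moreover have "(\<Oplus>\<^bsub>F\<^esub>i\<in>I. \<Oplus>\<^bsub>F\<^esub>j\<in>J. h (i, j) z \<otimes>\<^bsub>F\<^esub> (tA (i \<otimes>\<^bsub>A\<^esub> u) \<otimes>\<^bsub>F\<^esub> tB (j \<otimes>\<^bsub>B\<^esub> v)))
      = (\<Oplus>\<^bsub>F\<^esub>i\<in>I. (\<Oplus>\<^bsub>F\<^esub>j\<in>J. h (i, j) z \<otimes>\<^bsub>F\<^esub> tB (j \<otimes>\<^bsub>B\<^esub> v)) \<otimes>\<^bsub>F\<^esub> tA (i \<otimes>\<^bsub>A\<^esub> u))"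
    proof (rule A.R.finsum_cong'[OF refl])
      show "(\<lambda>i. (\<Oplus>\<^bsub>F\<^esub>j\<in>J. h (i, j) z \<otimes>\<^bsub>F\<^esub> tB (j \<otimes>\<^bsub>B\<^esub> v)) \<otimes>\<^bsub>F\<^esub> tA (i \<otimes>\<^bsub>A\<^esub> u)) \<in> I \<rightarrow> carrier F"
        using hc au bv by (auto intro!: A.R.finsum_closed)
      fix i assume i: "i \<in> I"
      have "(\<Oplus>\<^bsub>F\<^esub>j\<in>J. h (i, j) z \<otimes>\<^bsub>F\<^esub> (tA (i \<otimes>\<^bsub>A\<^esub> u) \<otimes>\<^bsub>F\<^esub> tB (j \<otimes>\<^bsub>B\<^esub> v)))
        = (\<Oplus>\<^bsub>F\<^esub>j\<in>J. h (i, j) z \<otimes>\<^bsub>F\<^esub> tB (j \<otimes>\<^bsub>B\<^esub> v) \<otimes>\<^bsub>F\<^esub> tA (i \<otimes>\<^bsub>A\<^esub> u))"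
        using hc i au[OF i] bv by (intro A.R.finsum_cong') (simp_all add: A.R.m_ac)
      also have "\<dots> = (\<Oplus>\<^bsub>F\<^esub>j\<in>J. h (i, j) z \<otimes>\<^bsub>F\<^esub> tB (j \<otimes>\<^bsub>B\<^esub> v)) \<otimes>\<^bsub>F\<^esub> tA (i \<otimes>\<^bsub>A\<^esub> u)"
        by (rule A.R.finsum_ldistr[symmetric]) (use hc i au[OF i] bv E(1) in simp_all)
      finally show "(\<Oplus>\<^bsub>F\<^esub>j\<in>J. h (i, j) z \<otimes>\<^bsub>F\<^esub> (tA (i \<otimes>\<^bsub>A\<^esub> u) \<otimes>\<^bsub>F\<^esub> tB (j \<otimes>\<^bsub>B\<^esub> v)))
        = (\<Oplus>\<^bsub>F\<^esub>j\<in>J. h (i, j) z \<otimes>\<^bsub>F\<^esub> tB (j \<otimes>\<^bsub>B\<^esub> v)) \<otimes>\<^bsub>F\<^esub> tA (i \<otimes>\<^bsub>A\<^esub> u)" .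
    qed
    ultimately show ?thesis by (simp only:)
  qed
  have bv: "tB (j \<otimes>\<^bsub>B\<^esub> v) \<in> carrier F" if "j \<in> J" "v \<in> carrier B" for j v
    by (rule tBc[OF B.prod_closed[OF E(2)[OF that(1)] that(2)]])
  \<comment> \<open>Nondegeneracy in \<open>A\<close> makes the sums over \<open>J\<close> vanish
    for each \<open>i\<close> and \<open>v\<close>; they are relations for the trace form of
    \<open>B\<close>, where nondegeneracy applies again.\<close>
  have hz: "h (i, j) z = \<zero>\<^bsub>F\<^esub>" if i: "i \<in> I" and j: "j \<in> J" for i j
  proof (rule B.alg_trace_coeff_zero[OF e char0 _ j])
    show "(\<lambda>j. h (i, j) z) \<in> J \<rightarrow> carrier F" using hc i by simp
    fix v assume v: "v \<in> carrier B"
    have "(\<lambda>i. \<Oplus>\<^bsub>F\<^esub>j\<in>J. h (i, j) z \<otimes>\<^bsub>F\<^esub> tB (j \<otimes>\<^bsub>B\<^esub> v)) \<in> I \<rightarrow> carrier F"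
      using hc bv[OF _ v] by (auto intro!: A.R.finsum_closed)
    from A.alg_trace_coeff_zero[OF d char0 this i, folded tA_def, OF key[OF _ v]]
    show "(\<Oplus>\<^bsub>F\<^esub>j\<in>J. h (i, j) z \<otimes>\<^bsub>F\<^esub> B.alg_trace J (\<lambda>x. x) g (j \<otimes>\<^bsub>B\<^esub> v)) = \<zero>\<^bsub>F\<^esub>"
      unfolding tB_def .
  qed
  have "(\<Oplus>\<^bsub>T\<^esub>p\<in>I \<times> J. h p z \<odot>\<^bsub>T\<^esub> tau (fst p) (snd p)) = \<zero>\<^bsub>T\<^esub>"
  proof (rule T.M.add.finprod_one_eqI)
    fix p assume p: "p \<in> I \<times> J"
    then have "h p z = \<zero>\<^bsub>F\<^esub>" using hz[of "fst p" "snd p"] by auto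
    then show "h p z \<odot>\<^bsub>T\<^esub> tau (fst p) (snd p) = \<zero>\<^bsub>T\<^esub>" using T.lmult_0[OF H(2)[OF p]] by simp
  qed
  then show ?thesis by (simp only: H(5)[OF z(1)])
qed

lemma T_etale_like: "etale_like F T"
proof -
  have red: "x = \<zero>\<^bsub>T\<^esub>" if "x \<in> carrier T" "x \<otimes>\<^bsub>T\<^esub> x = \<zero>\<^bsub>T\<^esub>" for x
    using A.R.char_cases[OF A.one_not_zero A.domain_axioms]
  proof
    assume "\<forall>n>0. add_pow F (n::nat) \<one>\<^bsub>F\<^esub> \<noteq> \<zero>\<^bsub>F\<^esub>"
    then show ?thesis using that by (rule T_reduced_char0)
  next
    assume "\<exists>p::nat. Factorial_Ring.prime p \<and> add_pow F p \<one>\<^bsub>F\<^esub> = \<zero>\<^bsub>F\<^esub>"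
    then obtain p :: nat where p: "Factorial_Ring.prime p" "add_pow F p \<one>\<^bsub>F\<^esub> = \<zero>\<^bsub>F\<^esub>" by (elim exE conjE)
    show ?thesis by (rule T.reduced_of_pow_span[OF p T_pow_span[OF p] that])
  qed
  show ?thesis by unfold_locales (rule T.regular_of_reduced, rule red, assumption+, rule T_pow_span)
qed

end


section \<open>Separable polynomials\<close>

lemma univ_poly_set: "p \<in> carrier (K[X]\<^bsub>R\<^esub>) \<Longrightarrow> set p \<subseteq> K"
  by (auto simp: univ_poly_carrier[symmetric] polynomial_def)

section \<open>Coefficients and values of the formal derivative\<close>

context ring begin

lemma eval_as_sum:
  assumes "set p \<subseteq> carrier R" "x \<in> carrier R"
  shows "eval p x = (\<Oplus>i\<in>{..<length p}. coeff p i \<otimes> x [^] i)"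
  using assms(1)
proof (induct p)
  case (Cons a p)
  have c: "coeff (a # p) i \<otimes> x [^] i \<in> carrier R" for i
    using coeff_in_carrier[OF Cons.prems, of i] assms(2) by simp
  have "(\<Oplus>i\<in>{..<length (a # p)}. coeff (a # p) i \<otimes> x [^] i)
      = coeff (a # p) (length p) \<otimes> x [^] length p \<oplus> (\<Oplus>i\<in>{..<length p}. coeff (a # p) i \<otimes> x [^] i)"
    unfolding length_Cons lessThan_Suc using c by (intro finsum_insert) (auto simp del: coeff.simps)
  also have "(\<Oplus>i\<in>{..<length p}. coeff (a # p) i \<otimes> x [^] i) = (\<Oplus>i\<in>{..<length p}. coeff p i \<otimes> x [^] i)"
    using Cons.prems assms(2) by (intro finsum_cong') auto
  finally show ?case using Cons by simp
qed simp

lemma eval_as_sum_le: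
  assumes "set p \<subseteq> carrier R" "x \<in> carrier R" "length p \<le> n"
  shows "eval p x = (\<Oplus>i\<in>{..<n}. coeff p i \<otimes> x [^] i)"
proof -
  have "(\<Oplus>i\<in>{..<length p}. coeff p i \<otimes> x [^] i) = (\<Oplus>i\<in>{..<n}. coeff p i \<otimes> x [^] i)"
    using assms coeff_length[of p] by (intro add.finprod_mono_neutral_cong_left) auto
  then show ?thesis using eval_as_sum[OF assms(1,2)] by simp
qed

lemma deriv_list_set:
  assumes "\<And>n y. y \<in> K \<Longrightarrow> add_pow R (n::nat) y \<in> K" "set p \<subseteq> K"
  shows "set (map (\<lambda>i. add_pow R (length p - Suc i) (p ! i)) [0..<length p - 1]) \<subseteq> K"
proof
  fix y assume "y \<in> set (map (\<lambda>i. add_pow R (length p - Suc i) (p ! i)) [0..<length p - 1])"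
  then obtain i where i: "i < length p - 1" "y = add_pow R (length p - Suc i) (p ! i)" by auto
  have "p ! i \<in> set p" using i(1) by (intro nth_mem) simp
  then have "p ! i \<in> K" using assms(2) by (rule rev_subsetD)
  then show "y \<in> K" unfolding i(2) by (rule assms(1))
qed

lemma formal_deriv_set:
  assumes "subring K R" "set p \<subseteq> K"
  shows "formal_deriv R p \<in> carrier (K[X])"
proof -
  have "add_pow R n y \<in> K" if "y \<in> K" for n :: nat and y
    by (induct n) (use that subringE(1,2,7)[OF assms(1)] in auto)
  then show ?thesis
    unfolding formal_deriv_def univ_poly_carrier[symmetric]
    by (intro normalize_gives_polynomial deriv_list_set assms(2))
qed

text \<open>Lists start with the leading coefficient. The entry of degree \<open>j\<close> of the
  derivative is at position \<open>length p - 2 - j\<close>, and at the same position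
  \<open>p\<close> has its coefficient of degree \<open>Suc j\<close>.\<close>

lemma coeff_deriv_list:
  assumes "j < length p - 1"
  shows "coeff (map (\<lambda>i. add_pow R (length p - Suc i) (p ! i)) [0..<length p - 1]) j = add_pow R (Suc j) (coeff p (Suc j))"
proof -
  have "length p - Suc (length p - 1 - 1 - j) = Suc j" "length p - 1 - 1 - j = length p - 1 - Suc j"
    "length p - 1 - Suc j < length p - 1"
    using assms by linarith+
  then show ?thesis using coeff_nth[of "Suc j" p] assms by (simp add: coeff_nth)
qed

lemma coeff_formal_deriv:
  assumes "j < length p - 1" shows "coeff (formal_deriv R p) j = add_pow R (Suc j) (coeff p (Suc j))"
  unfolding formal_deriv_def normalize_coeff[symmetric] by (rule coeff_deriv_list[OF assms])

lemma length_formal_deriv: "length (formal_deriv R p) \<le> length p - 1"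
  unfolding formal_deriv_def using normalize_length_le by (metis length_map length_upt minus_nat.diff_0)

text \<open>The term for \<open>i = 0\<close> is a zero multiple, so the truncated exponent
  \<open>i - 1\<close> does no harm and the sum runs over the same degrees as for \<open>p\<close>.
  The value is computed on the list before normalization, which does not change it.\<close>

lemma eval_formal_deriv:
  assumes p: "set p \<subseteq> carrier R" and x: "x \<in> carrier R"
  shows "eval (formal_deriv R p) x = (\<Oplus>i\<in>{..<length p}. add_pow R i (coeff p i \<otimes> x [^] (i - 1)))"
proof (cases "p = []")
  case True
  then show ?thesis by (simp add: formal_deriv_def)
next
  case False
  define l where "l = map (\<lambda>i. add_pow R (length p - Suc i) (p ! i)) [0..<length p - 1]"
  have cp: "coeff p i \<in> carrier R" for i by (rule coeff_in_carrier[OF p])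
  have l: "set l \<subseteq> carrier R" unfolding l_def by (rule deriv_list_set[OF add.nat_pow_closed p])
  have ll: "length l = length p - 1" by (simp add: l_def)
  have t: "add_pow R i (coeff p i \<otimes> x [^] (i - 1)) \<in> carrier R" for i using cp x by simp
  have "eval (formal_deriv R p) x = eval l x" unfolding formal_deriv_def l_def[symmetric] by (rule eval_normalize[OF l x])
  also have "\<dots> = (\<Oplus>j\<in>{..<length p - 1}. coeff l j \<otimes> x [^] j)" unfolding eval_as_sum[OF l x] ll ..
  also have "\<dots> = (\<Oplus>j\<in>{..<length p - 1}. add_pow R (Suc j) (coeff p (Suc j) \<otimes> x [^] (Suc j - 1)))"
  proof (rule finsum_cong'[OF refl])
    fix j assume "j \<in> {..<length p - 1}"
    then have "coeff l j = add_pow R (Suc j) (coeff p (Suc j))" unfolding l_def by (intro coeff_deriv_list) simp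
    then show "coeff l j \<otimes> x [^] j = add_pow R (Suc j) (coeff p (Suc j) \<otimes> x [^] (Suc j - 1))"
      using add_pow_ldistr[OF cp nat_pow_closed[OF x]] by (simp only: diff_Suc_1)
  qed (use t in blast)
  also have "\<dots> = (\<Oplus>i\<in>Suc ` {..<length p - 1}. add_pow R i (coeff p i \<otimes> x [^] (i - 1)))"
    by (rule finsum_reindex[symmetric]) (use t in auto)
  also have "\<dots> = (\<Oplus>i\<in>{..<length p}. add_pow R i (coeff p i \<otimes> x [^] (i - 1)))"
  proof (rule add.finprod_mono_neutral_cong_left)
    show "Suc ` {..<length p - 1} \<subseteq> {..<length p}" by auto
    fix i assume i: "i \<in> {..<length p} - Suc ` {..<length p - 1}"
    have "i = 0"
    proof (rule ccontr)
      assume "i \<noteq> 0"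
      then have "i = Suc (i - 1)" "i - 1 < length p - 1" using i by auto
      then show False using i by blast
    qed
    then show "add_pow R i (coeff p i \<otimes> x [^] (i - 1)) = \<zero>" using add.nat_pow_0 by simp
  qed (use t in auto)
  finally show ?thesis .
qed

end

context domain begin

lemma coeff_linear_mult:
  assumes x: "x \<in> carrier R" "x \<noteq> \<zero>" and q: "set q \<subseteq> carrier R"
  shows "coeff (poly_mult [\<one>, \<ominus> x] q) i = (if i = 0 then \<zero> else coeff q (i - 1)) \<oplus> (\<ominus> x) \<otimes> coeff q i"
proof -
  have mx: "\<ominus> x \<in> carrier R" using x by simp
  have m: "map (\<lambda>a. \<one> \<otimes> a) q = q" using q by (intro map_idI) auto
  have c: "coeff (poly_mult [\<ominus> x] q) = (\<lambda>i. \<ominus> x \<otimes> coeff q i)"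
    using poly_mult_const'(1)[OF q mx] normalize_coeff[of "map (\<lambda>b. \<ominus> x \<otimes> b) q"] scalar_coeff[OF mx] by simp
  have s: "set (q @ [\<zero>]) \<subseteq> carrier R" "set (poly_mult [\<ominus> x] q) \<subseteq> carrier R"
    using q poly_mult_in_carrier[of "[\<ominus> x]" q] mx by auto
  have "replicate (degree [\<one>, \<ominus> x]) \<zero> = [\<zero>]" by simp
  then have e: "poly_mult [\<one>, \<ominus> x] q = poly_add (q @ [\<zero>]) (poly_mult [\<ominus> x] q)"
    by (simp only: poly_mult.simps(2) m list.sel)
  show ?thesis unfolding e poly_add_coeff[OF s] c append_coeff by (cases "i = 0") simp_all
qed

text \<open>The product rule at a root, \<open>((X - x) q)'(x) = q(x)\<close>, obtained by summation
  by parts.\<close>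

lemma eval_deriv_linear_mult:
  assumes x: "x \<in> carrier R" "x \<noteq> \<zero>" and q: "q \<in> carrier (poly_ring R)"
  shows "eval (formal_deriv R ([\<one>, \<ominus> x] \<otimes>\<^bsub>poly_ring R\<^esub> q)) x = eval q x"
proof -
  define f where "f = poly_mult [\<one>, \<ominus> x] q"
  have f: "[\<one>, \<ominus> x] \<otimes>\<^bsub>poly_ring R\<^esub> q = f" unfolding f_def univ_poly_mult ..
  have qs: "set q \<subseteq> carrier R" using q by (rule univ_poly_set)
  have fs: "set f \<subseteq> carrier R" unfolding f_def using x qs by (intro poly_mult_in_carrier) auto
  have cq: "coeff q i \<in> carrier R" and cf: "coeff f i \<in> carrier R" for i
    using coeff_in_carrier qs fs by auto
  define a where "a = (\<lambda>j. coeff q j \<otimes> x [^] j)"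
  have a: "a j \<in> carrier R" for j using cq x by (simp add: a_def)
  define t where "t = (\<lambda>i. add_pow R i (coeff f i \<otimes> x [^] (i - 1)))"
  have t: "t i \<in> carrier R" for i using cf x by (simp add: t_def)
  \<comment> \<open>The coefficient of degree \<open>n + 1\<close> of the product, times
    \<open>x^n\<close>, is \<open>a n - a (n + 1)\<close>, where \<open>a n\<close> is the
    \<open>n\<close>-th term of \<open>q(x)\<close>. Weighted by \<open>n + 1\<close>, these
    differences telescope to the sum of the terms \<open>a j\<close>.\<close>
  have tS: "t (Suc n) = add_pow R (Suc n) (a n) \<ominus> add_pow R (Suc n) (a (Suc n))" for n
  proof -
    have "coeff f (Suc n) \<otimes> x [^] n = a n \<ominus> a (Suc n)"
      unfolding f_def coeff_linear_mult[OF x qs] a_def using cq x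
      by (simp add: l_distr r_distr l_minus r_minus minus_eq m_ac)
    then have "t (Suc n) = add_pow R (Suc n) (a n \<oplus> \<ominus> a (Suc n))" by (simp add: t_def minus_eq)
    also have "\<dots> = add_pow R (Suc n) (a n) \<oplus> add_pow R (Suc n) (\<ominus> a (Suc n))"
      by (rule add.nat_pow_distrib) (simp_all add: a)
    also have "add_pow R (Suc n) (\<ominus> a (Suc n)) = \<ominus> add_pow R (Suc n) (a (Suc n))"
      using add.nat_pow_inv[OF a[of "Suc n"], of "Suc n"] by (simp add: a_inv_def)
    finally show ?thesis by (simp add: minus_eq)
  qed
  have S: "(\<Oplus>i\<in>{..<Suc n}. t i) = (\<Oplus>j\<in>{..<n}. a j) \<ominus> add_pow R n (a n)" for n
  proof (induct n)
    case 0
    have "(\<Oplus>i\<in>{..<Suc 0}. t i) = t 0" using t finsum_insert[of "{}" 0 t] by (simp add: lessThan_Suc)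
    then show ?case using cf x by (simp add: t_def minus_eq)
  next
    case (Suc n)
    have s: "(\<Oplus>j\<in>{..<n}. a j) \<in> carrier R" using a by (intro finsum_closed) simp
    have p: "add_pow R n (a n) \<in> carrier R" "add_pow R (Suc n) (a (Suc n)) \<in> carrier R" using a by simp_all
    have "(\<Oplus>i\<in>{..<Suc (Suc n)}. t i) = t (Suc n) \<oplus> (\<Oplus>i\<in>{..<Suc n}. t i)"
      unfolding lessThan_Suc[of "Suc n"] using t by (intro finsum_insert) auto
    also have "\<dots> = (add_pow R n (a n) \<oplus> a n \<ominus> add_pow R (Suc n) (a (Suc n))) \<oplus> ((\<Oplus>j\<in>{..<n}. a j) \<ominus> add_pow R n (a n))"
      unfolding Suc tS by (simp only: add.nat_pow_Suc)
    also have "\<dots> = (a n \<oplus> (\<Oplus>j\<in>{..<n}. a j)) \<ominus> add_pow R (Suc n) (a (Suc n))"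
      using s p a[of n] by algebra
    also have "a n \<oplus> (\<Oplus>j\<in>{..<n}. a j) = (\<Oplus>j\<in>{..<Suc n}. a j)"
      unfolding lessThan_Suc using a by (intro finsum_insert[symmetric]) auto
    finally show ?case .
  qed
  \<comment> \<open>Large enough for \<open>a n\<close> to vanish and for the sum to exhaust the
    coefficients of \<open>f\<close>.\<close>
  define n where "n = length q + length f"
  have an: "a n = \<zero>" using coeff_length[of q n] x by (simp add: a_def n_def)
  have "eval (formal_deriv R f) x = (\<Oplus>i\<in>{..<length f}. t i)"
    unfolding t_def by (rule eval_formal_deriv[OF fs x(1)])
  also have "\<dots> = (\<Oplus>i\<in>{..<Suc n}. t i)"
    using t x coeff_length[of f] by (intro add.finprod_mono_neutral_cong_left) (auto simp: n_def t_def)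
  also have "\<dots> = (\<Oplus>j\<in>{..<n}. a j)" unfolding S an using a
    by (simp add: minus_eq add.nat_pow_one)
  also have "\<dots> = eval q x" unfolding a_def by (rule eval_as_sum_le[OF qs x(1), symmetric]) (simp add: n_def)
  finally show ?thesis unfolding f .
qed

text \<open>If the derivative is zero, the polynomial divides both it and itself, and separability
  would make an irreducible polynomial a unit.\<close>

lemma separable_deriv_nonzero:
  assumes "subfield K R" "x \<in> carrier R" "(algebraic over K) x" "separable_poly R K (Irr K x)"
  shows "formal_deriv R (Irr K x) \<noteq> []"
proof
  assume d: "formal_deriv R (Irr K x) = []"
  note I = IrrE[OF assms(1-3)]
  interpret UP: domain "K[X]" by (rule univ_poly_is_domain[OF subfieldE(1)[OF assms(1)]])
  have "Irr K x divides\<^bsub>K[X]\<^esub> Irr K x" using UP.divides_refl[OF I(1)] .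
  moreover have "Irr K x divides\<^bsub>K[X]\<^esub> []"
    using pdivides_zero[OF subfieldE(1)[OF assms(1)] I(1)]
      pdivides_iff_shell[OF assms(1) I(1) univ_poly_zero_closed] by simp
  ultimately have "Irr K x \<in> Units (K[X])" using assms(4) I(1) d unfolding separable_poly_def by simp
  then show False using pirreducibleE(2)[OF subfieldE(1)[OF assms(1)] I(1,2)] by simp
qed

text \<open>A nonunit divisor of an irreducible polynomial is associated to it, so its degree is too
  large for a divisor of the nonzero derivative.\<close>

lemma deriv_nonzero_separable:
  assumes K: "subfield K R" and x: "x \<in> carrier R" "(algebraic over K) x"
    and d: "formal_deriv R (Irr K x) \<noteq> []"
  shows "separable_poly R K (Irr K x)"
  unfolding separable_poly_def
proof (intro ballI impI, elim conjE)
  note I = IrrE[OF K x]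
  note sr = subfieldE(1)[OF K]
  fix g assume g: "g \<in> carrier (K[X])" "g divides\<^bsub>K[X]\<^esub> Irr K x" "g divides\<^bsub>K[X]\<^esub> formal_deriv R (Irr K x)"
  have f0: "Irr K x \<noteq> []" by (rule pirreducibleE(1)[OF sr I(1,2)])
  have D: "formal_deriv R (Irr K x) \<in> carrier (K[X])"
    by (rule formal_deriv_set[OF sr univ_poly_set[OF I(1)]])
  show "g \<in> Units (K[X])"
  proof (rule ccontr)
    assume "g \<notin> Units (K[X])"
    then have "g \<sim>\<^bsub>K[X]\<^esub> Irr K x" using divides_pirreducible_condition[OF I(2) g(1,2)] by blast
    then have "length g = length (Irr K x)" by (rule associated_polynomials_imp_same_length[OF sr g(1) I(1)])
    moreover have "g pdivides formal_deriv R (Irr K x)" using g(3) pdivides_iff_shell[OF K g(1) D] by simp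
    then have "degree g \<le> degree (formal_deriv R (Irr K x))" by (rule pdivides_imp_degree_le[OF sr g(1) D d])
    ultimately show False using length_formal_deriv[of "Irr K x"] d f0
      by (cases "formal_deriv R (Irr K x)"; cases "Irr K x") auto
  qed
qed

text \<open>For positive \<open>k\<close>, the cofactor \<open>s\<close> vanishes at
  \<open>x\<close> because \<open>r\<close> does not, so one factor \<open>X - x\<close> cancels;
  the induction ends at \<open>k = 0\<close>, where \<open>r\<close> divides 1.\<close>

lemma linear_power_divisor:
  assumes x: "x \<in> carrier R" and r: "r \<in> carrier (poly_ring R)" "eval r x \<noteq> \<zero>" and s: "s \<in> carrier (poly_ring R)"
    and rs: "r \<otimes>\<^bsub>poly_ring R\<^esub> s = [\<one>, \<ominus> x] [^]\<^bsub>poly_ring R\<^esub> (k::nat)"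
  shows "r \<in> Units (poly_ring R)"
  using s rs
proof (induct k arbitrary: s)
  interpret UP: domain "poly_ring R" by (rule univ_poly_is_domain[OF carrier_is_subring])
  case 0
  then have "r \<otimes>\<^bsub>poly_ring R\<^esub> s = \<one>\<^bsub>poly_ring R\<^esub>" by simp
  then show ?case using r(1) 0(1) UP.m_comm[OF r(1) 0(1)] unfolding Units_def by auto
next
  interpret UP: domain "poly_ring R" by (rule univ_poly_is_domain[OF carrier_is_subring])
  case (Suc k)
  let ?l = "[\<one>, \<ominus> x]"
  have l: "?l \<in> carrier (poly_ring R)" using x by (simp add: univ_poly_carrier[symmetric] polynomial_def)
  have l0: "?l \<noteq> \<zero>\<^bsub>poly_ring R\<^esub>" by (simp add: univ_poly_zero)
  have el: "eval ?l x = \<zero>" using x by (simp add: r_neg)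
  note hm = ring_hom_memE(2)[OF eval_is_hom[OF carrier_is_subring x]]
  have lk: "?l [^]\<^bsub>poly_ring R\<^esub> k \<in> carrier (poly_ring R)" using l by simp
  have "eval r x \<otimes> eval s x = eval (?l [^]\<^bsub>poly_ring R\<^esub> k) x \<otimes> eval ?l x"
    using hm[OF r(1) Suc(2)] hm[OF lk l] Suc(3) by simp
  also have "\<dots> = \<zero>" unfolding el
    using ring_hom_memE(1)[OF eval_is_hom[OF carrier_is_subring x] lk] by simp
  finally have "eval s x = \<zero>"
    using r integral_iff ring_hom_memE(1)[OF eval_is_hom[OF carrier_is_subring x]] Suc(2) by simp
  have "?l pdivides s"
  proof (cases "s = []")
    case True
    then show ?thesis using pdivides_zero[OF carrier_is_subring l] by simp
  next
    case False
    then show ?thesis using is_root_imp_pdivides[OF Suc(2), of x] x \<open>eval s x = \<zero>\<close> by (simp add: is_root_def)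
  qed
  then obtain s' where s': "s' \<in> carrier (poly_ring R)" "s = ?l \<otimes>\<^bsub>poly_ring R\<^esub> s'"
    unfolding pdivides_def factor_def by blast
  have "?l \<otimes>\<^bsub>poly_ring R\<^esub> (r \<otimes>\<^bsub>poly_ring R\<^esub> s') = ?l \<otimes>\<^bsub>poly_ring R\<^esub> (?l [^]\<^bsub>poly_ring R\<^esub> k)"
    using Suc(3) unfolding s'(2) UP.nat_pow_Suc using r(1) s'(1) l lk by (simp add: UP.m_ac del: UP.nat_pow_Suc)
  then have "r \<otimes>\<^bsub>poly_ring R\<^esub> s' = ?l [^]\<^bsub>poly_ring R\<^esub> k"
    using UP.m_lcancel[OF l0 l] r(1) s'(1) lk by simp
  then show ?case using Suc(1)[OF s'(1)] by simp
qed

end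

text \<open>\<open>m = Irr M x\<close> divides \<open>(X - x)\<^sup>p\<close> and the separable polynomial \<open>Irr K x\<close>, of which \<open>x\<close> is a
  simple root; hence \<open>m = X - x\<close>.\<close>

lemma (in field) separable_pth_root:
  assumes K: "subfield K R" and M: "subfield M R" and KM: "K \<subseteq> M" and x: "x \<in> carrier R" "(algebraic over K) x"
    and p: "Factorial_Ring.prime (p::nat)" "add_pow R p \<one> = \<zero>" and xp: "x [^] p \<in> M"
    and d: "formal_deriv R (Irr K x) \<noteq> []"
  shows "x \<in> M"
proof (cases "x = \<zero>")
  \<comment> \<open>Zero is treated apart: the list \<open>[\<ominus> x]\<close> is a normalized
    polynomial only for nonzero \<open>x\<close>.\<close>
  case True
  then show ?thesis using subringE(2)[OF subfieldE(1)[OF M]] by simp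
next
  case False
  let ?P = "poly_ring R"
  let ?l = "[\<one>, \<ominus> x]"
  interpret UP: domain ?P by (rule univ_poly_is_domain[OF carrier_is_subring])
  note cs = carrier_is_subring
  note eh = eval_is_hom[OF cs x(1)]
  note em = ring_hom_memE(2)[OF eh]
  note Msr = subfieldE(1)[OF M]
  have p0: "p > 0" using p(1) prime_gt_0_nat by blast
  have xM: "(algebraic over M) x" by (rule algebraic_mono[OF KM x(2)])
  define f where "f = Irr K x"
  define m where "m = Irr M x"
  note If = IrrE[OF K x, folded f_def] and Im = IrrE[OF M x(1) xM, folded m_def]
  have fP: "f \<in> carrier ?P" by (rule carrier_polynomial_shell[OF subfieldE(1)[OF K] If(1)])
  have mP: "m \<in> carrier ?P" by (rule carrier_polynomial_shell[OF Msr Im(1)])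
  have l: "?l \<in> carrier ?P" using x by (simp add: univ_poly_carrier[symmetric] polynomial_def)
  have l0: "?l \<noteq> \<zero>\<^bsub>?P\<^esub>" by (simp add: univ_poly_zero)
  have f0: "f \<noteq> []" by (rule pirreducibleE(1)[OF subfieldE(1)[OF K] If(1,2)])
  have m0: "m \<noteq> []" by (rule pirreducibleE(1)[OF Msr Im(1,2)])
  have root: "\<exists>q\<in>carrier ?P. g = ?l \<otimes>\<^bsub>?P\<^esub> q" if "g \<in> carrier ?P" "g \<noteq> []" "eval g x = \<zero>" for g
    using is_root_imp_pdivides[OF that(1), of x] that x unfolding is_root_def pdivides_def factor_def by blast
  obtain q where q: "q \<in> carrier ?P" "f = ?l \<otimes>\<^bsub>?P\<^esub> q" using root[OF fP f0 If(4)] by blast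
  obtain m1 where m1: "m1 \<in> carrier ?P" "m = ?l \<otimes>\<^bsub>?P\<^esub> m1" using root[OF mP m0 Im(4)] by blast
  have Df: "formal_deriv R f \<in> carrier (K[X])"
    by (rule formal_deriv_set[OF subfieldE(1)[OF K] univ_poly_set[OF If(1)]])
  \<comment> \<open>Otherwise the minimal polynomial \<open>f\<close> would divide its derivative,
    which is nonzero and of smaller degree.\<close>
  have "eval (formal_deriv R f) x \<noteq> \<zero>"
  proof
    assume "eval (formal_deriv R f) x = \<zero>"
    then have "f pdivides formal_deriv R f" unfolding f_def
      by (intro Irr_minimal[OF K x Df[unfolded f_def]])
    then have "degree f \<le> degree (formal_deriv R f)"
      by (rule pdivides_imp_degree_le[OF subfieldE(1)[OF K] If(1) Df d[folded f_def]])
    then show False using length_formal_deriv[of f] d[folded f_def] f0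
      by (cases "formal_deriv R f"; cases f) auto
  qed
  \<comment> \<open>With \<open>f = (X - x) q\<close>, the derivative at \<open>x\<close> is
    \<open>q(x)\<close>, so \<open>x\<close> is a simple root.\<close>
  then have qx: "eval q x \<noteq> \<zero>" unfolding q(2) eval_deriv_linear_mult[OF x(1) False q(1)] .
  have "f \<in> carrier (M[X])"
    using If(1) KM f0 unfolding univ_poly_carrier[symmetric] polynomial_def by blast
  then have "m pdivides f" unfolding m_def by (rule Irr_minimal[OF M x(1) xM _ If(4)])
  then obtain s where s: "s \<in> carrier ?P" "f = m \<otimes>\<^bsub>?P\<^esub> s" unfolding pdivides_def factor_def by blast
  \<comment> \<open>Cancelling \<open>X - x\<close> in \<open>f = m s\<close> leaves
    \<open>q = m1 s\<close>, so \<open>m1\<close> does not vanish at \<open>x\<close>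
    either.\<close>
  have "?l \<otimes>\<^bsub>?P\<^esub> q = ?l \<otimes>\<^bsub>?P\<^esub> (m1 \<otimes>\<^bsub>?P\<^esub> s)"
    using s(2) unfolding q(2) m1(2) using UP.m_assoc[OF l m1(1) s(1)] by simp
  then have "q = m1 \<otimes>\<^bsub>?P\<^esub> s" using UP.m_lcancel[OF l0 l q(1) UP.m_closed[OF m1(1) s(1)]] by simp
  then have m1x: "eval m1 x \<noteq> \<zero>"
    using qx em[OF m1(1) s(1)] ring_hom_memE(1)[OF eh s(1)] by auto
  have charP: "add_pow ?P p \<one>\<^bsub>?P\<^esub> = \<zero>\<^bsub>?P\<^esub>"
  proof -
    have h: "poly_of_const \<in> ring_hom R ?P" using canonical_embedding_is_hom[OF cs] by simp
    have z: "poly_of_const \<zero> = \<zero>\<^bsub>?P\<^esub>" by (simp add: poly_of_const_def univ_poly_zero)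
    have "poly_of_const (add_pow R n \<one>) = add_pow ?P n \<one>\<^bsub>?P\<^esub>" for n :: nat
    proof (induct n)
      case 0
      then show ?case using z by simp
    next
      case (Suc n)
      have "add_pow R n \<one> \<in> carrier R" by simp
      from ring_hom_add[OF h this one_closed] Suc ring_hom_one[OF h] show ?case by simp
    qed
    from this[of p] show ?thesis unfolding p(2) z by simp
  qed
  have mxM: "(\<ominus> x) [^] p \<in> M"
  proof -
    have "\<ominus> x = (\<ominus> \<one>) \<otimes> x" using x(1) by (simp add: l_minus)
    then have "(\<ominus> x) [^] p = (\<ominus> \<one>) [^] p \<otimes> x [^] p" using x(1) nat_pow_distrib[of "\<ominus> \<one>" x p] by simp
    moreover have "(\<ominus> \<one>) [^] n \<in> M" for n :: nat
      by (induct n) (use subringE(3,5,6)[OF Msr] in auto)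
    ultimately show ?thesis using xp subringE(6)[OF Msr] by simp
  qed
  have Xv: "X \<in> carrier ?P" by (rule var_closed(1)[OF cs])
  have XM: "X \<in> carrier (M[X])" by (rule var_closed(1)[OF Msr])
  have cx: "[\<ominus> x] \<in> carrier ?P" using x(1) False by (simp add: univ_poly_carrier[symmetric] polynomial_def)
  have lX: "?l = X \<oplus>\<^bsub>?P\<^esub> [\<ominus> x]" using x(1) by (simp add: univ_poly_add var_def)
  \<comment> \<open>Frobenius in the polynomial ring: \<open>(X - x)^p = X^p + (-x)^p\<close>. The
    constant term lies in \<open>M\<close>, so this is a polynomial over \<open>M\<close> with root
    \<open>x\<close>, and \<open>m\<close> divides it.\<close>
  have "?l [^]\<^bsub>?P\<^esub> p = X [^]\<^bsub>?P\<^esub> p \<oplus>\<^bsub>?P\<^esub> [\<ominus> x] [^]\<^bsub>?P\<^esub> p"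
    unfolding lX by (rule UP.frobenius_add[OF p(1) charP Xv cx])
  also have "[\<ominus> x] [^]\<^bsub>?P\<^esub> n = [(\<ominus> x) [^] n]" for n :: nat
  proof (induct n)
    case 0
    then show ?case by (simp add: univ_poly_one)
  next
    case (Suc n)
    have "(\<ominus> x) [^] n \<otimes> \<ominus> x \<noteq> \<zero>" "(\<ominus> x) [^] n \<noteq> \<zero>"
      using False x(1) by (induct n) (auto simp: integral_iff)
    then show ?case using Suc x(1) by (simp add: univ_poly_mult)
  qed
  finally have lp: "?l [^]\<^bsub>?P\<^esub> p = X [^]\<^bsub>?P\<^esub> p \<oplus>\<^bsub>?P\<^esub> [(\<ominus> x) [^] p]" .
  have lpM: "?l [^]\<^bsub>?P\<^esub> p \<in> carrier (M[X])"
  proof -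
    interpret UM: domain "M[X]" by (rule univ_poly_is_domain[OF Msr])
    have nz: "(\<ominus> x) [^] p \<noteq> \<zero>" using False x(1) by (induct p) (auto simp: integral_iff)
    have 1: "X [^]\<^bsub>M[X]\<^esub> n = X [^]\<^bsub>?P\<^esub> n" for n :: nat
      by (induct n) (simp_all add: univ_poly_mult univ_poly_one)
    have "X [^]\<^bsub>M[X]\<^esub> p \<oplus>\<^bsub>M[X]\<^esub> [(\<ominus> x) [^] p] \<in> carrier (M[X])"
      using XM mxM nz by (intro UM.a_closed UM.nat_pow_closed) (simp_all add: univ_poly_carrier[symmetric] polynomial_def)
    then show ?thesis unfolding lp 1 by (simp add: univ_poly_add)
  qed
  have "eval (?l [^]\<^bsub>?P\<^esub> p) x = \<zero>"
  proof -
    obtain k where k: "p = Suc k" using p0 by (cases p) auto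
    have lk: "?l [^]\<^bsub>?P\<^esub> k \<in> carrier ?P" using l by simp
    have "eval (?l [^]\<^bsub>?P\<^esub> p) x = eval (?l [^]\<^bsub>?P\<^esub> k) x \<otimes> eval ?l x"
      unfolding k UP.nat_pow_Suc by (rule em[OF lk l])
    also have "eval ?l x = \<zero>" using x(1) by (simp add: r_neg)
    finally show ?thesis using ring_hom_memE(1)[OF eh lk] by simp
  qed
  then have "m pdivides (?l [^]\<^bsub>?P\<^esub> p)" unfolding m_def by (rule Irr_minimal[OF M x(1) xM lpM])
  then obtain u where u: "u \<in> carrier ?P" "?l [^]\<^bsub>?P\<^esub> p = m \<otimes>\<^bsub>?P\<^esub> u" unfolding pdivides_def factor_def by blast
  have m1U: "m1 \<in> Units ?P"
  proof (rule linear_power_divisor[OF x(1) m1(1) m1x, of "?l \<otimes>\<^bsub>?P\<^esub> u" p])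
    show "?l \<otimes>\<^bsub>?P\<^esub> u \<in> carrier ?P" using l u(1) by simp
    show "m1 \<otimes>\<^bsub>?P\<^esub> (?l \<otimes>\<^bsub>?P\<^esub> u) = ?l [^]\<^bsub>?P\<^esub> p"
      unfolding u(2) m1(2) using l u(1) m1(1) by (simp add: UP.m_ac)
  qed
  \<comment> \<open>The cofactor \<open>m1\<close> is a unit, so \<open>m\<close> has length 2, that
    is degree 1. Being monic with root \<open>x\<close>, it shows that \<open>x\<close> is the
    negative of an element of \<open>M\<close>.\<close>
  have "m \<sim>\<^bsub>?P\<^esub> ?l" unfolding m1(2) using UP.associatedI2'[OF refl m1U l] UP.associated_sym by blast
  then have "length m = 2" using associated_polynomials_imp_same_length[OF cs mP l] by simp
  then obtain a c where "m = [a, c]" by (metis length_0_conv length_Suc_conv numeral_2_eq_2)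
  then have mc: "m = [\<one>, c]" using Im(3) by simp
  have c: "c \<in> M" using Im(1) unfolding mc by (simp add: univ_poly_carrier[symmetric] polynomial_def)
  have cR: "c \<in> carrier R" using c subringE(1)[OF Msr] by blast
  have "x \<oplus> c = \<zero>" using Im(4) x(1) cR unfolding mc by simp
  then have "x = \<ominus> c" using x(1) cR by (simp add: minus_equality[symmetric] a_comm)
  then show ?thesis using c subringE(5)[OF Msr] by simp
qed


lemma (in ring) poly_of_coeffs:
  assumes "\<And>i. i < n \<Longrightarrow> c i \<in> K"
  shows "\<exists>P\<in>carrier (K[X]). length P \<le> n \<and> (\<forall>i<n. coeff P i = c i)"
proof -
  define l where "l = map (\<lambda>i. c (n - 1 - i)) [0..<n]"
  have ll: "length l = n" by (simp add: l_def)
  have "set l \<subseteq> K" unfolding l_def using assms by auto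
  then have 1: "normalize l \<in> carrier (K[X])" unfolding univ_poly_carrier[symmetric] by (rule normalize_gives_polynomial)
  have 2: "length (normalize l) \<le> n" using normalize_length_le[of l] ll by simp
  have 3: "coeff (normalize l) i = c i" if "i < n" for i
    unfolding normalize_coeff[symmetric] using coeff_nth[of i l] that ll by (simp add: l_def)
  show ?thesis using 1 2 3 by blast
qed

section \<open>Independence of indexed families\<close>

context vectorspace begin

text \<open>Independence of a family is stronger than that of its image: two indices with the same
  vector would satisfy the relation with coefficients \<open>1\<close> and
  \<open>-1\<close>.\<close>

lemma family_lin_indpt:
  assumes I: "finite I" and b: "b \<in> I \<rightarrow> carrier V"
    and ind: "\<And>c i. c \<in> I \<rightarrow> carrier K \<Longrightarrow> (\<Oplus>\<^bsub>V\<^esub>i\<in>I. c i \<odot>\<^bsub>V\<^esub> b i) = \<zero>\<^bsub>V\<^esub> \<Longrightarrow> i \<in> I \<Longrightarrow> c i = \<zero>\<^bsub>K\<^esub>"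
  shows "inj_on b I" "lin_indpt (b ` I)"
proof -
  have bc: "b i \<in> carrier V" if "i \<in> I" for i using b that by auto
  show inj: "inj_on b I"
  proof (rule inj_onI, rule ccontr)
    fix i j assume ij: "i \<in> I" "j \<in> I" "b i = b j" "i \<noteq> j"
    define c where "c = (\<lambda>k. if k = i then \<one>\<^bsub>K\<^esub> else if k = j then \<ominus>\<^bsub>K\<^esub> \<one>\<^bsub>K\<^esub> else \<zero>\<^bsub>K\<^esub>)"
    have c: "c \<in> I \<rightarrow> carrier K" by (auto simp: c_def)
    have "(\<Oplus>\<^bsub>V\<^esub>k\<in>I. c k \<odot>\<^bsub>V\<^esub> b k) = (\<Oplus>\<^bsub>V\<^esub>k\<in>{i, j}. c k \<odot>\<^bsub>V\<^esub> b k)"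
      using I ij bc c by (intro M.add.finprod_mono_neutral_cong_right) (auto simp: c_def)
    also have "\<dots> = b i \<oplus>\<^bsub>V\<^esub> (\<ominus>\<^bsub>K\<^esub> \<one>\<^bsub>K\<^esub>) \<odot>\<^bsub>V\<^esub> b j"
      using ij bc by (simp add: c_def)
    also have "\<dots> = \<zero>\<^bsub>V\<^esub>" unfolding ij(3) smult_minus_1[OF bc[OF ij(2)]] by (rule M.r_neg[OF bc[OF ij(2)]])
    finally have "c i = \<zero>\<^bsub>K\<^esub>" by (rule ind[OF c _ ij(1)])
    then show False by (simp add: c_def)
  qed
  show "lin_indpt (b ` I)"
  proof (rule finite_lin_indpt2)
    show "finite (b ` I)" "b ` I \<subseteq> carrier V" using I bc by auto
    fix a assume a: "a \<in> b ` I \<rightarrow> carrier K" "lincomb a (b ` I) = \<zero>\<^bsub>V\<^esub>"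
    have "lincomb a (b ` I) = (\<Oplus>\<^bsub>V\<^esub>i\<in>I. a (b i) \<odot>\<^bsub>V\<^esub> b i)"
      unfolding lincomb_def using inj a(1) bc by (subst M.finsum_reindex) (auto intro!: smult_closed)
    then have "a (b i) = \<zero>\<^bsub>K\<^esub>" if "i \<in> I" for i
      using ind[of "\<lambda>i. a (b i)", OF _ _ that] a by auto
    then show "\<forall>v\<in>b ` I. a v = \<zero>\<^bsub>K\<^esub>" by blast
  qed
qed

lemma dependent_family:
  assumes fin_dim "finite I" "b \<in> I \<rightarrow> carrier V" "card I > dim"
  shows "\<exists>c i. c \<in> I \<rightarrow> carrier K \<and> (\<Oplus>\<^bsub>V\<^esub>i\<in>I. c i \<odot>\<^bsub>V\<^esub> b i) = \<zero>\<^bsub>V\<^esub> \<and> i \<in> I \<and> c i \<noteq> \<zero>\<^bsub>K\<^esub>"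
proof (rule ccontr)
  assume n: "\<not> (\<exists>c i. c \<in> I \<rightarrow> carrier K \<and> (\<Oplus>\<^bsub>V\<^esub>i\<in>I. c i \<odot>\<^bsub>V\<^esub> b i) = \<zero>\<^bsub>V\<^esub> \<and> i \<in> I \<and> c i \<noteq> \<zero>\<^bsub>K\<^esub>)"
  have ind: "c i = \<zero>\<^bsub>K\<^esub>" if "c \<in> I \<rightarrow> carrier K" "(\<Oplus>\<^bsub>V\<^esub>i\<in>I. c i \<odot>\<^bsub>V\<^esub> b i) = \<zero>\<^bsub>V\<^esub>" "i \<in> I" for c i
    using n that by blast
  have l1: "inj_on b I" by (rule family_lin_indpt(1)[OF assms(2,3)]) (rule ind)
  have l2: "lin_indpt (b ` I)" by (rule family_lin_indpt(2)[OF assms(2,3)]) (rule ind)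
  note l = l1 l2
  have "b ` I \<subseteq> carrier V" using assms(3) by auto
  then have "card (b ` I) \<le> dim" by (rule li_le_dim(2)[OF assms(1) _ l(2)])
  then show False using card_image[OF l(1)] assms(4) by simp
qed

end

context fd_comm_algebra begin

text \<open>The family extends to a basis, and the relation extends by zero to one between the
  \<open>p\<close>-th powers of that basis.\<close>

lemma pow_family_independent:
  assumes p: "Factorial_Ring.prime (p::nat)" "add_pow F p \<one>\<^bsub>F\<^esub> = \<zero>\<^bsub>F\<^esub>" and ps: "pow_span p = carrier A"
    and I: "finite I" and b: "b \<in> I \<rightarrow> carrier A"
    and ind: "\<And>c i. c \<in> I \<rightarrow> carrier F \<Longrightarrow> (\<Oplus>\<^bsub>A\<^esub>i\<in>I. c i \<odot>\<^bsub>A\<^esub> b i) = \<zero>\<^bsub>A\<^esub> \<Longrightarrow> i \<in> I \<Longrightarrow> c i = \<zero>\<^bsub>F\<^esub>"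
    and c: "c \<in> I \<rightarrow> carrier F" and z: "(\<Oplus>\<^bsub>A\<^esub>i\<in>I. c i \<odot>\<^bsub>A\<^esub> (b i [^]\<^bsub>A\<^esub> p)) = \<zero>\<^bsub>A\<^esub>" and i: "i \<in> I"
  shows "c i = \<zero>\<^bsub>F\<^esub>"
proof -
  have l1: "inj_on b I" by (rule family_lin_indpt(1)[OF I b]) (rule ind)
  have l2: "lin_indpt (b ` I)" by (rule family_lin_indpt(2)[OF I b]) (rule ind)
  note l = l1 l2
  have bI: "b ` I \<subseteq> carrier A" using b by auto
  obtain B where B: "finite B" "b ` I \<subseteq> B" "basis B" using extend_to_basis[OF fd bI l(2)] by (elim exE conjE)
  obtain f where f: "dual_basis F A B (\<lambda>x. x) f" using basis_dual_basis[OF B(1,3)] by (elim exE)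
  note D = dual_basisD[OF f]
  \<comment> \<open>The coefficients as a function of the basis vector, well defined because the
    family is injective.\<close>
  define d where "d = (\<lambda>v. if v \<in> b ` I then c (inv_into I b v) else \<zero>\<^bsub>F\<^esub>)"
  have db: "d (b i) = c i" if "i \<in> I" for i using that l(1) by (simp add: d_def)
  have d: "d \<in> B \<rightarrow> carrier F"
  proof
    fix v show "d v \<in> carrier F"
    proof (cases "v \<in> b ` I")
      case True
      then show ?thesis using db c by auto
    qed (simp add: d_def)
  qed
  have t: "d v \<odot>\<^bsub>A\<^esub> (v [^]\<^bsub>A\<^esub> p) \<in> carrier A" if "v \<in> B" for v
    by (rule smult_closed[OF Pi_mem[OF d that] C.nat_pow_closed[OF D(2)[OF that]]])
  have "(\<Oplus>\<^bsub>A\<^esub>v\<in>B. d v \<odot>\<^bsub>A\<^esub> (v [^]\<^bsub>A\<^esub> p)) = (\<Oplus>\<^bsub>A\<^esub>v\<in>b ` I. d v \<odot>\<^bsub>A\<^esub> (v [^]\<^bsub>A\<^esub> p))"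
  proof (rule M.add.finprod_mono_neutral_cong_right[OF B(1,2)])
    fix v assume v: "v \<in> B - b ` I"
    then have "v \<in> carrier A" using D(2) by simp
    then show "d v \<odot>\<^bsub>A\<^esub> (v [^]\<^bsub>A\<^esub> p) = \<zero>\<^bsub>A\<^esub>" using v C.nat_pow_closed by (simp add: d_def)
  qed (use t in auto)
  also have "\<dots> = (\<Oplus>\<^bsub>A\<^esub>i\<in>I. d (b i) \<odot>\<^bsub>A\<^esub> (b i [^]\<^bsub>A\<^esub> p))"
    using t B(2) l(1) by (intro M.finsum_reindex) auto
  also have "\<dots> = (\<Oplus>\<^bsub>A\<^esub>i\<in>I. c i \<odot>\<^bsub>A\<^esub> (b i [^]\<^bsub>A\<^esub> p))"
  proof (rule M.finsum_cong'[OF refl])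
    show "(\<lambda>i. c i \<odot>\<^bsub>A\<^esub> (b i [^]\<^bsub>A\<^esub> p)) \<in> I \<rightarrow> carrier A"
      by (rule Pi_I) (rule smult_closed[OF Pi_mem[OF c] C.nat_pow_closed[OF Pi_mem[OF b]]])
  qed (simp only: db)
  finally have s: "(\<Oplus>\<^bsub>A\<^esub>v\<in>B. d v \<odot>\<^bsub>A\<^esub> (v [^]\<^bsub>A\<^esub> p)) = \<zero>\<^bsub>A\<^esub>" by (simp only: z)
  have "b i \<in> B" using i B(2) by blast
  from pow_basis_independent[OF p f ps d s this] show ?thesis unfolding db[OF i] .
qed

end

section \<open>Separable field extensions\<close>

lemma algebra_fd_comm_algebra:
  assumes "field F" "algebra F L" "vectorspace.fin_dim F L"
  shows "fd_comm_algebra F L"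
proof -
  interpret C: cring L by (rule algebra.M_cring[OF assms(2)])
  interpret algebra F L by fact
  have vs: "vectorspace F L" by (rule vectorspace.intro[OF module assms(1)])
  have "nonassoc_algebra F L"
  proof (rule nonassoc_algebraI[OF vs])
    show "bilinear F L L L (monoid.mult L)"
    proof (rule bilinearI)
      show "a \<otimes>\<^bsub>L\<^esub> (c \<odot>\<^bsub>L\<^esub> b) = c \<odot>\<^bsub>L\<^esub> (a \<otimes>\<^bsub>L\<^esub> b)" if "c \<in> carrier F" "a \<in> carrier L" "b \<in> carrier L" for a b c
        using smult_assoc2[OF that(1,3,2)] that by (simp add: C.m_comm)
    qed (simp_all add: C.l_distr C.r_distr smult_assoc2)
  qed simp_all
  then show ?thesis
    by (intro fd_comm_algebra.intro fd_comm_algebra_axioms.intro assms(3)) (simp_all only: C.m_assoc C.m_comm)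
qed

section \<open>Finite field extensions and separability\<close>

locale fd_field_extension = fd_comm_algebra F L for F :: "('f, 'm) ring_scheme" and L :: "('f, 'a) module" +
  assumes field_L: "field L"
begin

sublocale L: field L by (rule field_L)

text \<open>The set \<open>K\<close> in \<open>finite_separable_extension\<close>: minimal
  polynomials over \<open>F\<close> have their coefficients in this copy of \<open>F\<close> inside
  \<open>L\<close>.\<close>

definition base :: "'a set" where "base = (\<lambda>c. c \<odot>\<^bsub>L\<^esub> \<one>\<^bsub>L\<^esub>) ` carrier F"

lemma base_mult: "c \<in> carrier F \<Longrightarrow> x \<in> carrier L \<Longrightarrow> (c \<odot>\<^bsub>L\<^esub> \<one>\<^bsub>L\<^esub>) \<otimes>\<^bsub>L\<^esub> x = c \<odot>\<^bsub>L\<^esub> x"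
  by (simp add: prod_smult_left)

lemma base_zero: "c \<in> carrier F \<Longrightarrow> c \<odot>\<^bsub>L\<^esub> \<one>\<^bsub>L\<^esub> = \<zero>\<^bsub>L\<^esub> \<Longrightarrow> c = \<zero>\<^bsub>F\<^esub>"
proof (rule ccontr)
  assume c: "c \<in> carrier F" "c \<odot>\<^bsub>L\<^esub> \<one>\<^bsub>L\<^esub> = \<zero>\<^bsub>L\<^esub>" "c \<noteq> \<zero>\<^bsub>F\<^esub>"
  have "\<one>\<^bsub>L\<^esub> = inv\<^bsub>F\<^esub> c \<odot>\<^bsub>L\<^esub> \<zero>\<^bsub>L\<^esub>" by (rule mult_inverse[OF c(1) C.one_closed c(2,3)])
  then show False using rmult_0[OF field.inverse_exists[OF c(1,3)]] L.one_not_zero by simp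
qed

lemma base_subfield: "subfield base L"
proof (rule L.subfieldI')
  show "subring base L"
  proof (rule C.subringI)
    show "base \<subseteq> carrier L" unfolding base_def by auto
    show "\<one>\<^bsub>L\<^esub> \<in> base" unfolding base_def by (rule image_eqI[of _ _ "\<one>\<^bsub>F\<^esub>"]) simp_all
    fix x assume "x \<in> base"
    then obtain c where c: "c \<in> carrier F" "x = c \<odot>\<^bsub>L\<^esub> \<one>\<^bsub>L\<^esub>" unfolding base_def by blast
    show "\<ominus>\<^bsub>L\<^esub> x \<in> base" unfolding base_def
      by (rule image_eqI[of _ _ "\<ominus>\<^bsub>F\<^esub> c"]) (simp_all add: c smult_l_minus)
    fix y assume "y \<in> base"
    then obtain d where d: "d \<in> carrier F" "y = d \<odot>\<^bsub>L\<^esub> \<one>\<^bsub>L\<^esub>" unfolding base_def by blast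
    show "x \<otimes>\<^bsub>L\<^esub> y \<in> base" unfolding base_def
      by (rule image_eqI[of _ _ "c \<otimes>\<^bsub>F\<^esub> d"]) (simp_all add: c d base_mult smult_assoc1)
    show "x \<oplus>\<^bsub>L\<^esub> y \<in> base" unfolding base_def
      by (rule image_eqI[of _ _ "c \<oplus>\<^bsub>F\<^esub> d"]) (simp_all add: c d smult_l_distr)
  qed
  fix x assume x: "x \<in> base - {\<zero>\<^bsub>L\<^esub>}"
  then obtain c where c: "c \<in> carrier F" "x = c \<odot>\<^bsub>L\<^esub> \<one>\<^bsub>L\<^esub>" unfolding base_def by blast
  have c0: "c \<noteq> \<zero>\<^bsub>F\<^esub>" using x c(2) by auto
  have ic: "inv\<^bsub>F\<^esub> c \<in> carrier F" by (rule field.inverse_exists[OF c(1) c0])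
  have "c \<otimes>\<^bsub>F\<^esub> inv\<^bsub>F\<^esub> c = \<one>\<^bsub>F\<^esub>" using c(1) c0 field_Units by simp
  then have "x \<otimes>\<^bsub>L\<^esub> (inv\<^bsub>F\<^esub> c \<odot>\<^bsub>L\<^esub> \<one>\<^bsub>L\<^esub>) = \<one>\<^bsub>L\<^esub>"
    using c ic by (simp add: base_mult smult_assoc1[symmetric])
  then have "inv\<^bsub>L\<^esub> x = inv\<^bsub>F\<^esub> c \<odot>\<^bsub>L\<^esub> \<one>\<^bsub>L\<^esub>"
    using c ic by (intro C.comm_inv_char) simp_all
  then show "inv\<^bsub>L\<^esub> x \<in> base" using ic unfolding base_def by blast
qed

lemma base_subset_submodule:
  assumes "LinearCombinations.submodule F N L" "\<one>\<^bsub>L\<^esub> \<in> N" shows "base \<subseteq> N"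
  using assms unfolding base_def LinearCombinations.submodule_def by auto

lemma eval_sum:
  assumes "P \<in> carrier (K[X]\<^bsub>L\<^esub>)" "K \<subseteq> carrier L" "x \<in> carrier L" "length P \<le> n"
    and "\<And>i. i < n \<Longrightarrow> C.coeff P i = c i \<odot>\<^bsub>L\<^esub> \<one>\<^bsub>L\<^esub>" "\<And>i. i < n \<Longrightarrow> c i \<in> carrier F"
  shows "C.eval P x = (\<Oplus>\<^bsub>L\<^esub>i\<in>{..<n}. c i \<odot>\<^bsub>L\<^esub> (x [^]\<^bsub>L\<^esub> i))"
proof -
  have s: "set P \<subseteq> carrier L" using univ_poly_set[OF assms(1)] assms(2) by (rule order_trans)
  show ?thesis unfolding C.eval_as_sum_le[OF s assms(3,4)]
    using assms(3,5,6) C.nat_pow_closed by (intro M.finsum_cong') (simp_all add: base_mult)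
qed

lemma base_coeffs:
  assumes "P \<in> carrier (base[X]\<^bsub>L\<^esub>)"
  shows "\<exists>c. \<forall>i. c i \<in> carrier F \<and> C.coeff P i = c i \<odot>\<^bsub>L\<^esub> \<one>\<^bsub>L\<^esub>"
proof (rule choice, rule allI)
  fix i
  have "C.coeff P i \<in> set P \<union> {\<zero>\<^bsub>L\<^esub>}" using C.coeff_img(3)[of P] by blast
  then have "C.coeff P i \<in> base"
    using univ_poly_set[OF assms] subringE(2)[OF subfieldE(1)[OF base_subfield]] by (elim UnE) (simp_all add: subset_iff)
  then show "\<exists>c. c \<in> carrier F \<and> C.coeff P i = c \<odot>\<^bsub>L\<^esub> \<one>\<^bsub>L\<^esub>" unfolding base_def by blast
qed

lemma base_carrier: "base \<subseteq> carrier L"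
  by (rule subringE(1)[OF subfieldE(1)[OF base_subfield]])

lemma pow_Pi: "x \<in> carrier L \<Longrightarrow> (\<lambda>i. x [^]\<^bsub>L\<^esub> i) \<in> (I :: nat set) \<rightarrow> carrier L"
  using C.nat_pow_closed by blast

text \<open>The powers of \<open>x\<close> with exponents \<open>0\<close> to \<open>dim\<close> are
  one too many to be independent, and a dependence is a polynomial with root
  \<open>x\<close>.\<close>

lemma algebraic_base:
  assumes x: "x \<in> carrier L" shows "(C.algebraic over base) x"
proof -
  obtain c i where c: "c \<in> {..<Suc dim} \<rightarrow> carrier F" "(\<Oplus>\<^bsub>L\<^esub>i\<in>{..<Suc dim}. c i \<odot>\<^bsub>L\<^esub> (x [^]\<^bsub>L\<^esub> i)) = \<zero>\<^bsub>L\<^esub>"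
    "i \<in> {..<Suc dim}" "c i \<noteq> \<zero>\<^bsub>F\<^esub>"
    using dependent_family[OF fd finite_lessThan pow_Pi[OF x], of "Suc dim"] by auto
  obtain P where P: "P \<in> carrier (base[X]\<^bsub>L\<^esub>)" "length P \<le> Suc dim" "\<forall>i<Suc dim. C.coeff P i = c i \<odot>\<^bsub>L\<^esub> \<one>\<^bsub>L\<^esub>"
    using C.poly_of_coeffs[of "Suc dim" "\<lambda>i. c i \<odot>\<^bsub>L\<^esub> \<one>\<^bsub>L\<^esub>" base] c(1) unfolding base_def by (auto simp: Pi_iff)
  have "C.eval P x = \<zero>\<^bsub>L\<^esub>"
    unfolding c(2)[symmetric] by (rule eval_sum[OF P(1) base_carrier x P(2)]) (use P(3) c(1) in auto)
  moreover have "P \<noteq> []"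
  proof
    assume "P = []"
    then have "c i \<odot>\<^bsub>L\<^esub> \<one>\<^bsub>L\<^esub> = \<zero>\<^bsub>L\<^esub>" using P(3) c(3) by auto
    then show False using base_zero c by auto
  qed
  ultimately show ?thesis using C.algebraicI[OF P(1)] by blast
qed

text \<open>Products of \<open>p\<close>-th powers are \<open>p\<close>-th powers, and minimality of
  the span extends closure under products to each argument in turn. Inverses stay inside because
  \<open>x^-1 = x^(p-1) \<cdot> (x^-1)^p\<close>.\<close>

lemma pow_span_subfield:
  assumes p: "Factorial_Ring.prime (p::nat)"
  shows "subfield (pow_span p) L" "base \<subseteq> pow_span p"
proof -
  note S = pow_span_submodule[of p]
  have p0: "p > 0" using p prime_gt_0_nat by blast
  have one: "\<one>\<^bsub>L\<^esub> \<in> pow_span p" using pow_in_pow_span[of "\<one>\<^bsub>L\<^esub>" p] C.one_closed by simp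
  show "base \<subseteq> pow_span p" by (rule base_subset_submodule[OF S one])
  have 1: "x [^]\<^bsub>L\<^esub> p \<otimes>\<^bsub>L\<^esub> v \<in> pow_span p" if x: "x \<in> carrier L" and v: "v \<in> pow_span p" for x v
  proof -
    have xp: "x [^]\<^bsub>L\<^esub> p \<in> carrier L" using x by simp
    have "pow_span p \<subseteq> {v \<in> carrier L. x [^]\<^bsub>L\<^esub> p \<otimes>\<^bsub>L\<^esub> v \<in> pow_span p}"
    proof (rule pow_span_minimal[OF submodule_vimage[OF module_axioms module_axioms mult_hom[OF xp] S]])
      fix y assume y: "y \<in> carrier L"
      have "x [^]\<^bsub>L\<^esub> p \<otimes>\<^bsub>L\<^esub> y [^]\<^bsub>L\<^esub> p = (x \<otimes>\<^bsub>L\<^esub> y) [^]\<^bsub>L\<^esub> p" by (rule C.nat_pow_distrib[OF x y, symmetric])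
      then show "y [^]\<^bsub>L\<^esub> p \<in> {v \<in> carrier L. x [^]\<^bsub>L\<^esub> p \<otimes>\<^bsub>L\<^esub> v \<in> pow_span p}"
        using pow_in_pow_span[of "x \<otimes>\<^bsub>L\<^esub> y" p] x y by simp
    qed
    then show ?thesis using v by blast
  qed
  have m: "u \<otimes>\<^bsub>L\<^esub> v \<in> pow_span p" if u: "u \<in> pow_span p" and v: "v \<in> pow_span p" for u v
  proof -
    have vc: "v \<in> carrier L" using v pow_span_carrier by blast
    have "pow_span p \<subseteq> {u \<in> carrier L. u \<otimes>\<^bsub>L\<^esub> v \<in> pow_span p}"
      by (rule pow_span_minimal[OF submodule_vimage[OF module_axioms module_axioms bilinearD(2)[OF mult_bilinear vc] S]]) (use 1[OF _ v] in simp)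
    then show ?thesis using u by blast
  qed
  have neg: "\<ominus>\<^bsub>L\<^esub> u \<in> pow_span p" if u: "u \<in> pow_span p" for u
  proof -
    have uc: "u \<in> carrier L" using u pow_span_carrier by blast
    have "(\<ominus>\<^bsub>F\<^esub> \<one>\<^bsub>F\<^esub>) \<odot>\<^bsub>L\<^esub> u \<in> pow_span p" using S u by (simp add: LinearCombinations.submodule_def)
    then show ?thesis by (simp only: smult_minus_1[OF uc])
  qed
  show "subfield (pow_span p) L"
  proof (rule L.subfieldI')
    show "subring (pow_span p) L"
      by (rule C.subringI[OF pow_span_carrier one neg m]) (use S in \<open>simp_all add: LinearCombinations.submodule_def\<close>)
    fix x assume x: "x \<in> pow_span p - {\<zero>\<^bsub>L\<^esub>}"
    then have xc: "x \<in> carrier L" "x \<noteq> \<zero>\<^bsub>L\<^esub>" using pow_span_carrier by blast+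
    have ix: "inv\<^bsub>L\<^esub> x \<in> carrier L" by (rule C.Units_inv_closed) (simp add: L.field_Units xc)
    have xi: "x \<otimes>\<^bsub>L\<^esub> inv\<^bsub>L\<^esub> x = \<one>\<^bsub>L\<^esub>" using xc L.field_Units by simp
    obtain k where k: "p = Suc k" using p0 by (cases p) auto
    have "x [^]\<^bsub>L\<^esub> n \<in> pow_span p" for n :: nat by (induct n) (use one m x in auto)
    then have "x [^]\<^bsub>L\<^esub> k \<otimes>\<^bsub>L\<^esub> (inv\<^bsub>L\<^esub> x) [^]\<^bsub>L\<^esub> p \<in> pow_span p" using m pow_in_pow_span[OF ix] by blast
    moreover have "x [^]\<^bsub>L\<^esub> k \<otimes>\<^bsub>L\<^esub> (inv\<^bsub>L\<^esub> x) [^]\<^bsub>L\<^esub> p = (x \<otimes>\<^bsub>L\<^esub> inv\<^bsub>L\<^esub> x) [^]\<^bsub>L\<^esub> k \<otimes>\<^bsub>L\<^esub> inv\<^bsub>L\<^esub> x"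
      unfolding k using xc(1) ix by (simp add: C.nat_pow_distrib C.m_assoc)
    ultimately show "inv\<^bsub>L\<^esub> x \<in> pow_span p" using ix unfolding xi by simp
  qed
qed

text \<open>The intermediate field \<open>pow_span p\<close> contains \<open>x^p\<close>, and
  separability over the smaller field \<open>base\<close> puts \<open>x\<close> itself into
  it.\<close>

lemma pow_span_of_separable:
  assumes sep: "\<And>x. x \<in> carrier L \<Longrightarrow> separable_poly L base (C.Irr base x)"
    and p: "Factorial_Ring.prime (p::nat)" "add_pow F p \<one>\<^bsub>F\<^esub> = \<zero>\<^bsub>F\<^esub>"
  shows "pow_span p = carrier L"
proof
  show "pow_span p \<subseteq> carrier L" by (rule pow_span_carrier)
  have pL: "add_pow L p \<one>\<^bsub>L\<^esub> = \<zero>\<^bsub>L\<^esub>" unfolding add_pow_one p(2) by (rule lmult_0[OF C.one_closed])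
  show "carrier L \<subseteq> pow_span p"
  proof
    fix x assume x: "x \<in> carrier L"
    show "x \<in> pow_span p"
      by (rule L.separable_pth_root[OF base_subfield pow_span_subfield[OF p(1)] x algebraic_base[OF x] p(1) pL
          pow_in_pow_span[OF x] L.separable_deriv_nonzero[OF base_subfield x algebraic_base[OF x] sep[OF x]]])
  qed
qed

text \<open>\<open>length\<close> exceeds the degree by one, so \<open>n\<close> is at most the
  degree of the minimal polynomial and all exponents are below it. A relation would be a nonzero
  polynomial of too small a degree with root \<open>x\<close>.\<close>

lemma powers_independent:
  assumes x: "x \<in> carrier L" and n: "n < length (C.Irr base x)"
    and c: "c \<in> {..<n} \<rightarrow> carrier F" "(\<Oplus>\<^bsub>L\<^esub>i\<in>{..<n}. c i \<odot>\<^bsub>L\<^esub> (x [^]\<^bsub>L\<^esub> i)) = \<zero>\<^bsub>L\<^esub>" "i \<in> {..<n}"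
  shows "c i = \<zero>\<^bsub>F\<^esub>"
proof -
  note I = L.IrrE[OF base_subfield x algebraic_base[OF x]]
  obtain P where P: "P \<in> carrier (base[X]\<^bsub>L\<^esub>)" "length P \<le> n" "\<forall>i<n. C.coeff P i = c i \<odot>\<^bsub>L\<^esub> \<one>\<^bsub>L\<^esub>"
    using C.poly_of_coeffs[of n "\<lambda>i. c i \<odot>\<^bsub>L\<^esub> \<one>\<^bsub>L\<^esub>" base] c(1) unfolding base_def by (auto simp: Pi_iff)
  have "C.eval P x = \<zero>\<^bsub>L\<^esub>"
    unfolding c(2)[symmetric] by (rule eval_sum[OF P(1) base_carrier x P(2)]) (use P(3) c(1) in auto)
  then have d: "C.Irr base x pdivides\<^bsub>L\<^esub> P" by (rule L.Irr_minimal[OF base_subfield x algebraic_base[OF x] P(1)])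
  have "P = []"
  proof (rule ccontr)
    assume "P \<noteq> []"
    from L.pdivides_imp_degree_le[OF subfieldE(1)[OF base_subfield] I(1) P(1) this d]
    show False using n P(2) \<open>P \<noteq> []\<close> by (cases P) auto
  qed
  then have "c i \<odot>\<^bsub>L\<^esub> \<one>\<^bsub>L\<^esub> = \<zero>\<^bsub>L\<^esub>" using P(3) c(3) by auto
  then show ?thesis using base_zero c(1,3) by auto
qed

text \<open>If the derivative of the minimal polynomial \<open>f\<close> of degree \<open>n\<close>
  vanishes, the characteristic is a prime \<open>p\<close> and \<open>f\<close> has only exponents
  divisible by \<open>p\<close>. Then \<open>f(x) = 0\<close> is a relation between the
  \<open>p\<close>-th powers of \<open>1, x, ..., x^(n/p)\<close>. These powers of \<open>x\<close>
  are independent since \<open>n/p < n\<close>, and so are their \<open>p\<close>-th powers,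
  contrary to the nonzero leading coefficient.\<close>

lemma separable_of_pow_span:
  assumes ps: "\<And>p. Factorial_Ring.prime (p::nat) \<Longrightarrow> add_pow F p \<one>\<^bsub>F\<^esub> = \<zero>\<^bsub>F\<^esub> \<Longrightarrow> pow_span p = carrier L"
    and x: "x \<in> carrier L"
  shows "separable_poly L base (C.Irr base x)"
proof (rule L.deriv_nonzero_separable[OF base_subfield x algebraic_base[OF x]], rule notI)
  assume d: "formal_deriv L (C.Irr base x) = []"
  note I = L.IrrE[OF base_subfield x algebraic_base[OF x]]
  define f where "f = C.Irr base x"
  define n where "n = length f - 1"
  have f0: "f \<noteq> []" unfolding f_def by (rule L.pirreducibleE(1)[OF subfieldE(1)[OF base_subfield] I(1,2)])
  have n1: "n \<ge> 1" unfolding n_def f_def by (rule C.pirreducible_degree[OF base_subfield I(1,2)])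
  have lf: "length f = Suc n" using f0 by (simp add: n_def)
  obtain c where c: "\<forall>i. c i \<in> carrier F \<and> C.coeff f i = c i \<odot>\<^bsub>L\<^esub> \<one>\<^bsub>L\<^esub>"
    using base_coeffs[OF I(1)] unfolding f_def by (elim exE)
  have "C.coeff f n = \<one>\<^bsub>L\<^esub>" using C.lead_coeff_simp[OF f0] I(3) unfolding n_def f_def by simp
  then have cn: "c n \<noteq> \<zero>\<^bsub>F\<^esub>" using c L.one_not_zero lmult_0[OF C.one_closed] by metis
  have fc: "C.coeff f i \<in> carrier L" for i using c C.one_closed by simp
  have cz: "add_pow F i \<one>\<^bsub>F\<^esub> \<otimes>\<^bsub>F\<^esub> c i = \<zero>\<^bsub>F\<^esub>" if i: "i \<ge> 1" "i \<le> n" for i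
  proof -
    have "C.coeff (formal_deriv L f) (i - 1) = add_pow L (Suc (i - 1)) (C.coeff f (Suc (i - 1)))"
      by (rule C.coeff_formal_deriv) (use i n_def in linarith)
    then have "add_pow L i (C.coeff f i) = \<zero>\<^bsub>L\<^esub>" using d i(1) unfolding f_def[symmetric] by simp
    moreover have "add_pow L i (C.coeff f i) = add_pow L i \<one>\<^bsub>L\<^esub> \<otimes>\<^bsub>L\<^esub> C.coeff f i"
      using C.add_pow_ldistr[OF C.one_closed fc] fc by simp
    moreover have "\<dots> = (add_pow F i \<one>\<^bsub>F\<^esub> \<otimes>\<^bsub>F\<^esub> c i) \<odot>\<^bsub>L\<^esub> \<one>\<^bsub>L\<^esub>"
      unfolding add_pow_one using c R.add_pow_closed[OF R.one_closed, of i] C.one_closed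
      by (simp add: base_mult smult_assoc1)
    ultimately have "(add_pow F i \<one>\<^bsub>F\<^esub> \<otimes>\<^bsub>F\<^esub> c i) \<odot>\<^bsub>L\<^esub> \<one>\<^bsub>L\<^esub> = \<zero>\<^bsub>L\<^esub>" by simp
    then show ?thesis using base_zero R.m_closed[OF R.add_pow_closed[OF R.one_closed]] c by simp
  qed
  \<comment> \<open>At \<open>i = n\<close> the coefficient is the leading one and nonzero, so
    \<open>n\<close> itself vanishes in \<open>F\<close> and the characteristic is positive.\<close>
  have "add_pow F n \<one>\<^bsub>F\<^esub> = \<zero>\<^bsub>F\<^esub>"
    using cz[OF n1 le_refl] cn c integral_iff[OF R.add_pow_closed[OF R.one_closed], of "c n" n] by simp
  then have "\<not> (\<forall>m>0. add_pow F (m::nat) \<one>\<^bsub>F\<^esub> \<noteq> \<zero>\<^bsub>F\<^esub>)" using n1 by (auto intro!: exI[of _ n])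
  then obtain p :: nat where p: "Factorial_Ring.prime p" "add_pow F p \<one>\<^bsub>F\<^esub> = \<zero>\<^bsub>F\<^esub>"
    using R.char_cases[OF one_not_zero domain_axioms] by (elim disjE exE conjE) blast+
  have p1: "p > 1" using p(1) prime_gt_1_nat by blast
  have cp: "c i = \<zero>\<^bsub>F\<^esub>" if i: "i \<le> n" "\<not> p dvd i" for i
  proof -
    have i1: "i \<ge> 1" using i(2) by (cases i) auto
    have "coprime i p" using i(2) p(1) prime_imp_coprime coprime_commute by blast
    \<comment> \<open>By Bezout some multiple of \<open>i\<close> is 1 modulo \<open>p\<close>, so
      \<open>i\<close> is nonzero in \<open>F\<close> and \<open>i c_i = 0\<close> forces
      \<open>c_i = 0\<close>.\<close>
    then obtain a y where "i * a = p * y + 1" using bezout_nat[of i p] i1 by (auto simp: coprime_iff_gcd_eq_1)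
    then have ai: "a * i = y * p + 1" by (simp add: mult.commute)
    have "add_pow F (a * i) \<one>\<^bsub>F\<^esub> = add_pow F (y * p) \<one>\<^bsub>F\<^esub> \<oplus>\<^bsub>F\<^esub> \<one>\<^bsub>F\<^esub>"
      by (subst ai) simp
    also have "add_pow F (y * p) \<one>\<^bsub>F\<^esub> = \<zero>\<^bsub>F\<^esub>"
      by (rule R.add_pow_char[OF p(2) _ R.one_closed]) simp
    finally have o: "add_pow F (a * i) \<one>\<^bsub>F\<^esub> = \<one>\<^bsub>F\<^esub>" by simp
    show ?thesis
    proof (rule ccontr)
      assume "c i \<noteq> \<zero>\<^bsub>F\<^esub>"
      then have "add_pow F i \<one>\<^bsub>F\<^esub> = \<zero>\<^bsub>F\<^esub>"
        using cz[OF i1 i(1)] c integral_iff[OF R.add_pow_closed[OF R.one_closed], of "c i" i] by simp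
      then have "add_pow F (a * i) \<one>\<^bsub>F\<^esub> = \<zero>\<^bsub>F\<^esub>" by (rule R.add_pow_char) simp_all
      then show False using o one_not_zero by simp
    qed
  qed
  have "p dvd n" using cp[OF le_refl] cn by blast
  then obtain s where s: "n = p * s" by blast
  \<comment> \<open>Equivalent to \<open>s < n\<close>: the \<open>s + 1\<close> powers up to
    \<open>x^s\<close> have exponents below the degree.\<close>
  have s1: "Suc s < Suc n" using n1 p1 n_less_m_mult_n[of s p] unfolding s by (cases s) simp_all
  have t: "(\<lambda>i. c i \<odot>\<^bsub>L\<^esub> (x [^]\<^bsub>L\<^esub> i)) \<in> (UNIV :: nat set) \<rightarrow> carrier L"
    using c x by simp
  have "C.eval f x = (\<Oplus>\<^bsub>L\<^esub>i\<in>{..<Suc n}. c i \<odot>\<^bsub>L\<^esub> (x [^]\<^bsub>L\<^esub> i))"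
    by (rule eval_sum[OF _ base_carrier x]) (use I(1) f_def lf c in auto)
  also have "\<dots> = (\<Oplus>\<^bsub>L\<^esub>i\<in>(\<lambda>k. p * k) ` {..<Suc s}. c i \<odot>\<^bsub>L\<^esub> (x [^]\<^bsub>L\<^esub> i))"
  proof (rule M.add.finprod_mono_neutral_cong_right)
    show "(\<lambda>k. p * k) ` {..<Suc s} \<subseteq> {..<Suc n}"
    proof
      fix i assume "i \<in> (\<lambda>k. p * k) ` {..<Suc s}"
      then obtain k where k: "k \<in> {..<Suc s}" "i = p * k" by blast
      have "p * k \<le> p * s" using k(1) by (intro mult_le_mono2) simp
      then show "i \<in> {..<Suc n}" unfolding s k(2) by (simp only: lessThan_iff less_Suc_eq_le)
    qed
    fix i assume i: "i \<in> {..<Suc n} - (\<lambda>k. p * k) ` {..<Suc s}"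
    have "\<not> p dvd i"
    proof
      assume "p dvd i"
      then obtain k where k: "i = p * k" by blast
      have "p * k \<le> p * s" using i unfolding k s by (simp only: Diff_iff lessThan_iff less_Suc_eq_le)
      then have "k < Suc s" using p1 by simp
      then show False using i k by blast
    qed
    then have "c i = \<zero>\<^bsub>F\<^esub>" using cp i by simp
    then show "c i \<odot>\<^bsub>L\<^esub> (x [^]\<^bsub>L\<^esub> i) = \<zero>\<^bsub>L\<^esub>" using lmult_0[OF C.nat_pow_closed[OF x]] by simp
  qed (use t in auto)
  also have "\<dots> = (\<Oplus>\<^bsub>L\<^esub>k\<in>{..<Suc s}. c (p * k) \<odot>\<^bsub>L\<^esub> (x [^]\<^bsub>L\<^esub> (p * k)))"
    by (rule M.finsum_reindex) (use t p1 in \<open>auto simp: inj_on_def\<close>)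
  also have "\<dots> = (\<Oplus>\<^bsub>L\<^esub>k\<in>{..<Suc s}. c (p * k) \<odot>\<^bsub>L\<^esub> ((x [^]\<^bsub>L\<^esub> k) [^]\<^bsub>L\<^esub> p))"
    using c x by (intro M.finsum_cong') (auto simp: C.nat_pow_pow mult.commute)
  finally have z: "(\<Oplus>\<^bsub>L\<^esub>k\<in>{..<Suc s}. c (p * k) \<odot>\<^bsub>L\<^esub> ((x [^]\<^bsub>L\<^esub> k) [^]\<^bsub>L\<^esub> p)) = \<zero>\<^bsub>L\<^esub>"
    using I(4) unfolding f_def by simp
  have "c (p * s) = \<zero>\<^bsub>F\<^esub>"
  proof (rule pow_family_independent[OF p ps[OF p] _ pow_Pi[OF x] _ _ z])
    show "e i = \<zero>\<^bsub>F\<^esub>" if "e \<in> {..<Suc s} \<rightarrow> carrier F" "(\<Oplus>\<^bsub>L\<^esub>i\<in>{..<Suc s}. e i \<odot>\<^bsub>L\<^esub> (x [^]\<^bsub>L\<^esub> i)) = \<zero>\<^bsub>L\<^esub>" "i \<in> {..<Suc s}" for e i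
      by (rule powers_independent[OF x _ that]) (use s1 lf f_def in simp)
  qed (use c in auto)
  then show False using cn s by simp
qed

end


section \<open>Etale algebras and their primitive idempotents\<close>

lemma prod_algebra_simps:
  "carrier (prod_algebra I L) = (\<Pi>\<^sub>E i\<in>I. carrier (L i))"
  "x \<otimes>\<^bsub>prod_algebra I L\<^esub> y = (\<lambda>i\<in>I. x i \<otimes>\<^bsub>L i\<^esub> y i)"
  "x \<oplus>\<^bsub>prod_algebra I L\<^esub> y = (\<lambda>i\<in>I. x i \<oplus>\<^bsub>L i\<^esub> y i)"
  "c \<odot>\<^bsub>prod_algebra I L\<^esub> x = (\<lambda>i\<in>I. c \<odot>\<^bsub>L i\<^esub> x i)"
  "\<one>\<^bsub>prod_algebra I L\<^esub> = (\<lambda>i\<in>I. \<one>\<^bsub>L i\<^esub>)"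
  by (simp_all add: prod_algebra_def)

text \<open>All identities are checked through the isomorphism \<open>h\<close> one coordinate at a
  time, in the fields \<open>L i\<close>. Spanning by \<open>p\<close>-th powers is assembled from
  the factors, each included by a map \<open>iota i\<close>.\<close>

lemma etale_algebra_etale_like:
  assumes na: "nonassoc_algebra F E" and fdE: "vectorspace.fin_dim F E" and "etale_algebra F E"
  shows "etale_like F E"
proof -
  interpret nonassoc_algebra F E by fact
  obtain n and L :: "nat \<Rightarrow> ('a, 'c) module" and h where
    L: "\<forall>i<n. finite_separable_extension F (L i)" and h: "h \<in> alg_iso F E (prod_algebra {..<n} L)"
    using assms(3) unfolding etale_algebra_def by blast
  have hr: "h \<in> ring_iso E (prod_algebra {..<n} L)" and hh: "h \<in> module_hom F E (prod_algebra {..<n} L)"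
    using h unfolding alg_iso_def by blast+
  note hI = ring_iso_memE[OF hr]
  have fe: "fd_field_extension F (L i)" if i: "i < n" for i
  proof -
    have "finite_separable_extension F (L i)" using L i by blast
    then have "field F" "field (L i)" "algebra F (L i)" "vectorspace.fin_dim F (L i)"
      unfolding finite_separable_extension_def by blast+
    then show ?thesis
      by (intro fd_field_extension.intro fd_field_extension_axioms.intro algebra_fd_comm_algebra)
  qed
  have hc: "h x i \<in> carrier (L i)" if "x \<in> carrier E" "i < n" for x i
    using hI(1)[OF that(1)] that(2) unfolding prod_algebra_simps by (auto simp: PiE_iff)
  have hm: "h (x \<otimes>\<^bsub>E\<^esub> y) i = h x i \<otimes>\<^bsub>L i\<^esub> h y i" if "x \<in> carrier E" "y \<in> carrier E" "i < n" for x y i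
    using hI(2)[OF that(1,2)] that(3) unfolding prod_algebra_simps by simp
  have ha: "h (x \<oplus>\<^bsub>E\<^esub> y) i = h x i \<oplus>\<^bsub>L i\<^esub> h y i" if "x \<in> carrier E" "y \<in> carrier E" "i < n" for x y i
    using hI(3)[OF that(1,2)] that(3) unfolding prod_algebra_simps by simp
  have hs: "h (c \<odot>\<^bsub>E\<^esub> x) i = c \<odot>\<^bsub>L i\<^esub> h x i" if "c \<in> carrier F" "x \<in> carrier E" "i < n" for c x i
    using module_hom_smult[OF hh that(1,2)] that(3) unfolding prod_algebra_simps by simp
  have h1: "h \<one>\<^bsub>E\<^esub> i = \<one>\<^bsub>L i\<^esub>" if "i < n" for i
    using hI(4) that unfolding prod_algebra_simps by simp
  have h0: "h \<zero>\<^bsub>E\<^esub> i = \<zero>\<^bsub>L i\<^esub>" if i: "i < n" for i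
  proof -
    interpret Li: fd_field_extension F "L i" by (rule fe[OF i])
    show ?thesis using hs[OF R.zero_closed M.zero_closed i] lmult_0[OF M.zero_closed] Li.lmult_0[OF hc[OF M.zero_closed i]] by simp
  qed
  have heq: "x = y" if "x \<in> carrier E" "y \<in> carrier E" "\<And>i. i < n \<Longrightarrow> h x i = h y i" for x y
  proof -
    have "h x = h y"
      by (rule PiE_ext[of _ "{..<n}" "\<lambda>i. carrier (L i)"])
        (use hI(1)[OF that(1)] hI(1)[OF that(2)] that(3) in \<open>simp_all add: prod_algebra_simps\<close>)
    then show ?thesis using inj_onD[OF bij_betw_imp_inj_on[OF hI(5)] _ that(1,2)] by blast
  qed
  have hex: "\<exists>x\<in>carrier E. \<forall>i<n. h x i = u i" if "\<And>i. i < n \<Longrightarrow> u i \<in> carrier (L i)" for u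
  proof -
    have "restrict u {..<n} \<in> carrier (prod_algebra {..<n} L)" using that unfolding prod_algebra_simps by simp
    then obtain x where "x \<in> carrier E" "h x = restrict u {..<n}"
      using bij_betw_imp_surj_on[OF hI(5)] by (metis imageE)
    then show ?thesis by (intro bexI[of _ x]) simp_all
  qed
  have assoc: "(x \<otimes>\<^bsub>E\<^esub> y) \<otimes>\<^bsub>E\<^esub> z = x \<otimes>\<^bsub>E\<^esub> (y \<otimes>\<^bsub>E\<^esub> z)"
    if c: "x \<in> carrier E" "y \<in> carrier E" "z \<in> carrier E" for x y z
  proof (rule heq)
    fix i assume i: "i < n"
    interpret Li: fd_field_extension F "L i" by (rule fe[OF i])
    show "h ((x \<otimes>\<^bsub>E\<^esub> y) \<otimes>\<^bsub>E\<^esub> z) i = h (x \<otimes>\<^bsub>E\<^esub> (y \<otimes>\<^bsub>E\<^esub> z)) i"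
      using c i by (simp add: hm hc prod_closed Li.C.m_assoc)
  qed (use c in \<open>simp_all add: prod_closed\<close>)
  have comm: "x \<otimes>\<^bsub>E\<^esub> y = y \<otimes>\<^bsub>E\<^esub> x" if c: "x \<in> carrier E" "y \<in> carrier E" for x y
  proof (rule heq)
    fix i assume i: "i < n"
    interpret Li: fd_field_extension F "L i" by (rule fe[OF i])
    show "h (x \<otimes>\<^bsub>E\<^esub> y) i = h (y \<otimes>\<^bsub>E\<^esub> x) i" using c i by (simp add: hm hc Li.C.m_comm)
  qed (use c in \<open>simp_all add: prod_closed\<close>)
  interpret E: fd_comm_algebra F E
    by (intro fd_comm_algebra.intro fd_comm_algebra_axioms.intro na fdE assoc comm)
  have regular: "\<exists>y\<in>carrier E. x \<otimes>\<^bsub>E\<^esub> x \<otimes>\<^bsub>E\<^esub> y = x" if x: "x \<in> carrier E" for x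
  proof -
    \<comment> \<open>\<open>z\<close> is the inverse of a nonzero coordinate, and 0 at a zero
      coordinate.\<close>
    have "\<exists>z. z \<in> carrier (L i) \<and> h x i \<otimes>\<^bsub>L i\<^esub> h x i \<otimes>\<^bsub>L i\<^esub> z = h x i" if i: "i < n" for i
    proof -
      interpret Li: fd_field_extension F "L i" by (rule fe[OF i])
      have c: "h x i \<in> carrier (L i)" by (rule hc[OF x i])
      show ?thesis
      proof (cases "h x i = \<zero>\<^bsub>L i\<^esub>")
        case True
        then show ?thesis by (intro exI[of _ "\<zero>\<^bsub>L i\<^esub>"]) simp
      next
        case False
        then have u: "h x i \<in> Units (L i)" by (simp add: Li.L.field_Units c)
        then show ?thesis
          by (intro exI[of _ "inv\<^bsub>L i\<^esub> h x i"]) (simp add: Li.C.m_assoc c Li.C.Units_inv_closed)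
      qed
    qed
    then obtain z where z: "\<And>i. i < n \<Longrightarrow> z i \<in> carrier (L i)" "\<And>i. i < n \<Longrightarrow> h x i \<otimes>\<^bsub>L i\<^esub> h x i \<otimes>\<^bsub>L i\<^esub> z i = h x i"
      by metis
    obtain y where y: "y \<in> carrier E" "\<forall>i<n. h y i = z i" using hex[OF z(1)] by blast
    show ?thesis
      by (rule bexI[OF heq y(1)]) (use x y z(2) in \<open>simp_all add: hm prod_closed\<close>)
  qed
  have pow_span: "E.pow_span p = carrier E"
    if p: "Factorial_Ring.prime (p::nat)" "add_pow F p \<one>\<^bsub>F\<^esub> = \<zero>\<^bsub>F\<^esub>" for p
  proof
    show "E.pow_span p \<subseteq> carrier E" by (rule E.pow_span_carrier)
    have p0: "p > 0" using p(1) prime_gt_0_nat by blast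
    \<comment> \<open>The preimage of a tuple concentrated in coordinate \<open>i\<close>. The
      resulting \<open>iota i\<close> is linear and compatible with \<open>p\<close>-th powers, as
      the other coordinates stay zero because of \<open>p > 0\<close>.\<close>
    have "\<exists>x\<in>carrier E. \<forall>j<n. h x j = (if j = i then z else \<zero>\<^bsub>L j\<^esub>)" if i: "i < n" and z: "z \<in> carrier (L i)" for i z
    proof (rule hex)
      fix j assume j: "j < n"
      interpret Lj: fd_field_extension F "L j" by (rule fe[OF j])
      show "(if j = i then z else \<zero>\<^bsub>L j\<^esub>) \<in> carrier (L j)" using z by simp
    qed
    then obtain iota where iota: "\<And>i z. i < n \<Longrightarrow> z \<in> carrier (L i) \<Longrightarrow> iota i z \<in> carrier E"
      "\<And>i z j. i < n \<Longrightarrow> z \<in> carrier (L i) \<Longrightarrow> j < n \<Longrightarrow> h (iota i z) j = (if j = i then z else \<zero>\<^bsub>L j\<^esub>)"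
      by metis
    have iota_pow_span: "iota i z \<in> E.pow_span p" if i: "i < n" and z: "z \<in> carrier (L i)" for i z
    proof -
      interpret Li: fd_field_extension F "L i" by (rule fe[OF i])
      have hom: "iota i \<in> module_hom F (L i) E"
      proof (rule module_homI)
        fix u v assume u: "u \<in> carrier (L i)" and v: "v \<in> carrier (L i)"
        show "iota i (u \<oplus>\<^bsub>L i\<^esub> v) = iota i u \<oplus>\<^bsub>E\<^esub> iota i v"
        proof (rule heq)
          fix j assume j: "j < n"
          interpret Lj: fd_field_extension F "L j" by (rule fe[OF j])
          show "h (iota i (u \<oplus>\<^bsub>L i\<^esub> v)) j = h (iota i u \<oplus>\<^bsub>E\<^esub> iota i v) j"
            using u v i j by (simp add: ha iota)
        qed (use u v i in \<open>simp_all add: iota\<close>)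
      next
        fix c u assume c: "c \<in> carrier F" and u: "u \<in> carrier (L i)"
        show "iota i (c \<odot>\<^bsub>L i\<^esub> u) = c \<odot>\<^bsub>E\<^esub> iota i u"
        proof (rule heq)
          fix j assume j: "j < n"
          interpret Lj: fd_field_extension F "L j" by (rule fe[OF j])
          show "h (iota i (c \<odot>\<^bsub>L i\<^esub> u)) j = h (c \<odot>\<^bsub>E\<^esub> iota i u) j"
            using c u i j by (simp add: hs iota)
        qed (use c u i in \<open>simp_all add: iota\<close>)
      qed (rule iota(1)[OF i])
      have "Li.pow_span p \<subseteq> {z \<in> carrier (L i). iota i z \<in> E.pow_span p}"
      proof (rule Li.pow_span_minimal[OF submodule_vimage[OF Li.module_axioms module_axioms hom E.pow_span_submodule]])
        fix u assume u: "u \<in> carrier (L i)"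
        have "iota i (u [^]\<^bsub>L i\<^esub> p) = iota i u [^]\<^bsub>E\<^esub> p"
        proof (rule heq)
          fix j assume j: "j < n"
          interpret Lj: fd_field_extension F "L j" by (rule fe[OF j])
          have "h (x [^]\<^bsub>E\<^esub> k) j = h x j [^]\<^bsub>L j\<^esub> k" if "x \<in> carrier E" for x and k :: nat
            by (induct k) (simp_all add: h1 hm that j E.C.nat_pow_closed)
          then show "h (iota i (u [^]\<^bsub>L i\<^esub> p)) j = h (iota i u [^]\<^bsub>E\<^esub> p) j"
            using u i j p0 by (simp add: iota Li.C.nat_pow_closed Lj.C.nat_pow_zero)
        qed (use u i in \<open>simp_all add: iota E.C.nat_pow_closed Li.C.nat_pow_closed\<close>)
        moreover have "iota i u [^]\<^bsub>E\<^esub> p \<in> E.pow_span p" by (rule E.pow_in_pow_span[OF iota(1)[OF i u]])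
        ultimately show "u [^]\<^bsub>L i\<^esub> p \<in> {z \<in> carrier (L i). iota i z \<in> E.pow_span p}"
          using u Li.C.nat_pow_closed by simp
      qed
      moreover have "Li.pow_span p = carrier (L i)"
        by (rule Li.pow_span_of_separable[OF _ p])
          (use L i in \<open>simp add: finite_separable_extension_def Let_def Li.base_def\<close>)
      ultimately show ?thesis using z by blast
    qed
    note S = E.pow_span_submodule[of p, unfolded LinearCombinations.submodule_def]
    show "carrier E \<subseteq> E.pow_span p"
    proof
      fix x assume x: "x \<in> carrier E"
      \<comment> \<open>Induction on the number \<open>k\<close> of coordinates that already agree
        with those of \<open>x\<close>, the others being zero.\<close>
      have "k \<le> n \<Longrightarrow> \<exists>y\<in>E.pow_span p. \<forall>i<n. h y i = (if i < k then h x i else \<zero>\<^bsub>L i\<^esub>)" for k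
      proof (induct k)
        case 0
        show ?case by (rule bexI[of _ "\<zero>\<^bsub>E\<^esub>"]) (use h0 S in simp_all)
      next
        case (Suc k)
        then obtain y where y: "y \<in> E.pow_span p" "\<forall>i<n. h y i = (if i < k then h x i else \<zero>\<^bsub>L i\<^esub>)" by auto
        have k: "k < n" using Suc by simp
        have yc: "y \<in> carrier E" using y(1) E.pow_span_carrier by blast
        have i: "iota k (h x k) \<in> carrier E" by (rule iota(1)[OF k hc[OF x k]])
        show ?case
        proof (rule bexI[of _ "y \<oplus>\<^bsub>E\<^esub> iota k (h x k)"], intro allI impI)
          show "y \<oplus>\<^bsub>E\<^esub> iota k (h x k) \<in> E.pow_span p" using S y(1) iota_pow_span[OF k hc[OF x k]] by simp
          fix j assume j: "j < n"
          interpret Lj: fd_field_extension F "L j" by (rule fe[OF j])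
          have c: "h x j \<in> carrier (L j)" by (rule hc[OF x j])
          show "h (y \<oplus>\<^bsub>E\<^esub> iota k (h x k)) j = (if j < Suc k then h x j else \<zero>\<^bsub>L j\<^esub>)"
            unfolding ha[OF yc i j] iota(2)[OF k hc[OF x k] j] y(2)[rule_format, OF j]
            using Lj.M.l_zero[OF c] Lj.M.r_zero[OF c] Lj.M.r_zero[OF Lj.M.zero_closed] by (auto simp: less_Suc_eq)
        qed
      qed
      from this[OF le_refl] obtain y where y: "y \<in> E.pow_span p" "\<forall>i<n. h y i = h x i" by auto
      have "y = x" by (rule heq) (use y x E.pow_span_carrier in auto)
      then show "x \<in> E.pow_span p" using y(1) by simp
    qed
  qed
  show ?thesis by (intro etale_like.intro etale_like_axioms.intro E.fd_comm_algebra_axioms regular pow_span)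
qed

section \<open>Complete systems of primitive idempotents\<close>

context fd_comm_algebra begin

text \<open>Members are nonzero so that the set is linearly independent and its cardinality is
  bounded by the dimension.\<close>

definition orthogonal_idempotents :: "'a set \<Rightarrow> bool" where
  "orthogonal_idempotents S \<longleftrightarrow> finite S \<and> S \<subseteq> carrier A \<and> (\<forall>e\<in>S. e \<noteq> \<zero>\<^bsub>A\<^esub> \<and> e \<otimes>\<^bsub>A\<^esub> e = e) \<and>
     (\<forall>e\<in>S. \<forall>f\<in>S. e \<noteq> f \<longrightarrow> e \<otimes>\<^bsub>A\<^esub> f = \<zero>\<^bsub>A\<^esub>)"

lemma orthogonal_idempotentsD:
  assumes "orthogonal_idempotents S"
  shows "finite S" "e \<in> S \<Longrightarrow> e \<in> carrier A" "e \<in> S \<Longrightarrow> e \<noteq> \<zero>\<^bsub>A\<^esub>" "e \<in> S \<Longrightarrow> e \<otimes>\<^bsub>A\<^esub> e = e"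
    "e \<in> S \<Longrightarrow> f \<in> S \<Longrightarrow> e \<noteq> f \<Longrightarrow> e \<otimes>\<^bsub>A\<^esub> f = \<zero>\<^bsub>A\<^esub>"
  using assms unfolding orthogonal_idempotents_def by auto

lemma orthogonal_idempotents_Diff: "orthogonal_idempotents S \<Longrightarrow> orthogonal_idempotents (S - T)"
  unfolding orthogonal_idempotents_def by (intro conjI) (elim conjE, simp add: subset_iff)+

lemma orthogonal_idempotents_insert:
  assumes S: "orthogonal_idempotents S" and u: "u \<in> carrier A" "u \<noteq> \<zero>\<^bsub>A\<^esub>" "u \<otimes>\<^bsub>A\<^esub> u = u"
    and ue: "\<And>e. e \<in> S \<Longrightarrow> u \<otimes>\<^bsub>A\<^esub> e = \<zero>\<^bsub>A\<^esub>"
  shows "orthogonal_idempotents (insert u S)" "u \<notin> S"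
proof -
  show "u \<notin> S"
  proof
    assume "u \<in> S"
    from ue[OF this] show False using u by simp
  qed
  have ue': "\<forall>e\<in>S. u \<otimes>\<^bsub>A\<^esub> e = \<zero>\<^bsub>A\<^esub>" using ue by blast
  have eu: "\<forall>e\<in>S. e \<otimes>\<^bsub>A\<^esub> u = \<zero>\<^bsub>A\<^esub>"
  proof
    fix e assume e: "e \<in> S"
    show "e \<otimes>\<^bsub>A\<^esub> u = \<zero>\<^bsub>A\<^esub>" using ue[OF e] C.m_comm[OF orthogonal_idempotentsD(2)[OF S e] u(1)] by simp
  qed
  show "orthogonal_idempotents (insert u S)"
    using S u ue' eu unfolding orthogonal_idempotents_def by simp
qed

text \<open>Since \<open>g f = f \<cdot> g f\<close>, multiplication by \<open>e\<close> kills every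
  summand except the one at \<open>e\<close>.\<close>

lemma orthogonal_idempotents_sum:
  assumes S: "orthogonal_idempotents S" and g: "g \<in> S \<rightarrow> carrier A" "\<And>f. f \<in> S \<Longrightarrow> f \<otimes>\<^bsub>A\<^esub> g f = g f"
    and e: "e \<in> S"
  shows "e \<otimes>\<^bsub>A\<^esub> (\<Oplus>\<^bsub>A\<^esub>f\<in>S. g f) = g e"
proof -
  note D = orthogonal_idempotentsD[OF S]
  have gc: "g f \<in> carrier A" if "f \<in> S" for f using g(1) that by blast
  have "e \<otimes>\<^bsub>A\<^esub> (\<Oplus>\<^bsub>A\<^esub>f\<in>S. g f) = (\<Oplus>\<^bsub>A\<^esub>f\<in>S. e \<otimes>\<^bsub>A\<^esub> g f)"
    by (rule C.finsum_rdistr[OF D(1) D(2)[OF e] g(1)])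
  also have "\<dots> = (\<Oplus>\<^bsub>A\<^esub>f\<in>S. if e = f then g f else \<zero>\<^bsub>A\<^esub>)"
  proof (rule M.finsum_cong'[OF refl])
    show "(\<lambda>f. if e = f then g f else \<zero>\<^bsub>A\<^esub>) \<in> S \<rightarrow> carrier A" using gc by simp
    show "e \<otimes>\<^bsub>A\<^esub> g f = (if e = f then g f else \<zero>\<^bsub>A\<^esub>)" if f: "f \<in> S" for f
    proof (cases "e = f")
      case False
      have "e \<otimes>\<^bsub>A\<^esub> g f = (e \<otimes>\<^bsub>A\<^esub> f) \<otimes>\<^bsub>A\<^esub> g f"
        unfolding C.m_assoc[OF D(2)[OF e] D(2)[OF f] gc[OF f]] g(2)[OF f] ..
      then show ?thesis unfolding D(5)[OF e f False] using C.l_null[OF gc[OF f]] False by simp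
    qed (use g(2)[OF f] in simp)
  qed
  also have "\<dots> = g e" by (rule M.add.finprod_singleton[OF e D(1) g(1)])
  finally show ?thesis .
qed

text \<open>Multiplying a linear relation by \<open>e\<close> isolates its coefficient at
  \<open>e\<close>.\<close>

lemma orthogonal_idempotents_card:
  assumes S: "orthogonal_idempotents S" shows "card S \<le> dim"
proof (rule ccontr)
  note D = orthogonal_idempotentsD[OF S]
  assume "\<not> card S \<le> dim"
  then have l: "card S > dim" by simp
  have b: "(\<lambda>x. x) \<in> S \<rightarrow> carrier A" using D(2) by simp
  obtain c e where c: "c \<in> S \<rightarrow> carrier F" "(\<Oplus>\<^bsub>A\<^esub>f\<in>S. c f \<odot>\<^bsub>A\<^esub> f) = \<zero>\<^bsub>A\<^esub>" "e \<in> S" "c e \<noteq> \<zero>\<^bsub>F\<^esub>"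
    using dependent_family[OF fd D(1) b l] by (elim exE conjE)
  have ce: "c f \<in> carrier F" if "f \<in> S" for f using c(1) that by blast
  have "e \<otimes>\<^bsub>A\<^esub> (\<Oplus>\<^bsub>A\<^esub>f\<in>S. c f \<odot>\<^bsub>A\<^esub> f) = c e \<odot>\<^bsub>A\<^esub> e"
    by (rule orthogonal_idempotents_sum[OF S _ _ c(3)]) (use ce D(2,4) in \<open>simp_all add: prod_smult_right\<close>)
  then have "c e \<odot>\<^bsub>A\<^esub> e = \<zero>\<^bsub>A\<^esub>" unfolding c(2) using C.r_null[OF D(2)[OF c(3)]] by simp
  from mult_inverse[OF ce[OF c(3)] D(2)[OF c(3)] this c(4)]
  have "e = inv\<^bsub>F\<^esub> c e \<odot>\<^bsub>A\<^esub> \<zero>\<^bsub>A\<^esub>" .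
  then show False using rmult_0[OF field.inverse_exists[OF ce[OF c(3)] c(4)]] D(3)[OF c(3)] by simp
qed

end

text \<open>The last clause says that each \<open>e A\<close> is a field. An orthogonal set of
  largest cardinality has these properties. If its sum \<open>s\<close> were not 1, the idempotent
  \<open>1 - s\<close> could be added. For \<open>z = e x \<noteq> 0\<close>, regularity gives an
  idempotent \<open>f = z y\<close> below \<open>e\<close>; if \<open>f \<noteq> e\<close>, then
  \<open>e\<close> could be replaced by the pair \<open>f\<close>, \<open>e - f\<close>.\<close>

lemma (in etale_like) primitive_idempotents:
  "\<exists>S. orthogonal_idempotents S \<and> (\<Oplus>\<^bsub>A\<^esub>e\<in>S. e) = \<one>\<^bsub>A\<^esub> \<and>
     (\<forall>e\<in>S. \<forall>x\<in>carrier A. e \<otimes>\<^bsub>A\<^esub> x \<noteq> \<zero>\<^bsub>A\<^esub> \<longrightarrow> (\<exists>y\<in>carrier A. (e \<otimes>\<^bsub>A\<^esub> x) \<otimes>\<^bsub>A\<^esub> y = e))"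
proof -
  have "orthogonal_idempotents {}" by (simp add: orthogonal_idempotents_def)
  from ex_has_greatest_nat[of orthogonal_idempotents, OF this, of card "Suc dim"]
  have "\<exists>S. orthogonal_idempotents S \<and> (\<forall>S'. orthogonal_idempotents S' \<longrightarrow> card S' \<le> card S)"
    using orthogonal_idempotents_card by (simp add: less_Suc_eq_le)
  then
  obtain S where S: "orthogonal_idempotents S" and mx: "\<forall>S'. orthogonal_idempotents S' \<longrightarrow> card S' \<le> card S"
    by (elim exE conjE)
  have max: "card S' \<le> card S" if "orthogonal_idempotents S'" for S' using mx that by (elim allE impE)
  note D = orthogonal_idempotentsD[OF S]
  have idc: "(\<lambda>e. e) \<in> S \<rightarrow> carrier A" using D(2) by simp
  define s where "s = (\<Oplus>\<^bsub>A\<^esub>e\<in>S. e)"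
  have s: "s \<in> carrier A" unfolding s_def by (rule M.finsum_closed[OF idc])
  have es: "e \<otimes>\<^bsub>A\<^esub> s = e" if "e \<in> S" for e
    unfolding s_def by (rule orthogonal_idempotents_sum[OF S idc D(4) that])
  have "s = \<one>\<^bsub>A\<^esub>"
  proof (rule ccontr)
    assume n: "s \<noteq> \<one>\<^bsub>A\<^esub>"
    define u where "u = \<one>\<^bsub>A\<^esub> \<ominus>\<^bsub>A\<^esub> s"
    have u: "u \<in> carrier A" unfolding u_def by (rule M.minus_closed[OF C.one_closed s])
    have u0: "u \<noteq> \<zero>\<^bsub>A\<^esub>" using n s C.one_closed unfolding u_def by simp
    have eu: "e \<otimes>\<^bsub>A\<^esub> u = \<zero>\<^bsub>A\<^esub>" if e: "e \<in> S" for e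
    proof -
      have "e \<otimes>\<^bsub>A\<^esub> u = e \<ominus>\<^bsub>A\<^esub> e \<otimes>\<^bsub>A\<^esub> s"
        unfolding u_def using D(2)[OF e] s by (simp add: M.minus_eq C.r_distr C.r_minus)
      then show ?thesis unfolding es[OF e] using D(2)[OF e] by (simp add: M.minus_eq M.r_neg)
    qed
    have ue: "u \<otimes>\<^bsub>A\<^esub> e = \<zero>\<^bsub>A\<^esub>" if "e \<in> S" for e using eu[OF that] C.m_comm[OF u D(2)[OF that]] by simp
    have su: "u \<otimes>\<^bsub>A\<^esub> s = \<zero>\<^bsub>A\<^esub>"
    proof -
      have "u \<otimes>\<^bsub>A\<^esub> s = (\<Oplus>\<^bsub>A\<^esub>e\<in>S. u \<otimes>\<^bsub>A\<^esub> e)" unfolding s_def by (rule C.finsum_rdistr[OF D(1) u idc])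
      also have "\<dots> = \<zero>\<^bsub>A\<^esub>" by (rule M.add.finprod_one_eqI) (rule ue)
      finally show ?thesis .
    qed
    have "u \<otimes>\<^bsub>A\<^esub> u = u \<ominus>\<^bsub>A\<^esub> u \<otimes>\<^bsub>A\<^esub> s"
      using u s unfolding u_def by (simp add: M.minus_eq C.r_distr C.r_minus)
    then have uu: "u \<otimes>\<^bsub>A\<^esub> u = u" unfolding su using u by (simp add: M.minus_eq)
    have 1: "orthogonal_idempotents (insert u S)" "u \<notin> S"
      using orthogonal_idempotents_insert[OF S u u0 uu ue] by blast+
    then show False using max[OF 1(1)] D(1) by simp
  qed
  moreover have "\<exists>y\<in>carrier A. (e \<otimes>\<^bsub>A\<^esub> x) \<otimes>\<^bsub>A\<^esub> y = e" if e: "e \<in> S" and x: "x \<in> carrier A" and n: "e \<otimes>\<^bsub>A\<^esub> x \<noteq> \<zero>\<^bsub>A\<^esub>" for e x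
  proof -
    have ec: "e \<in> carrier A" by (rule D(2)[OF e])
    define z where "z = e \<otimes>\<^bsub>A\<^esub> x"
    have z: "z \<in> carrier A" unfolding z_def by (rule C.m_closed[OF ec x])
    obtain y where y: "y \<in> carrier A" "z \<otimes>\<^bsub>A\<^esub> z \<otimes>\<^bsub>A\<^esub> y = z" using regular[OF z] by (elim bexE)
    define f where "f = z \<otimes>\<^bsub>A\<^esub> y"
    have f: "f \<in> carrier A" unfolding f_def by (rule C.m_closed[OF z y(1)])
    have ez: "e \<otimes>\<^bsub>A\<^esub> z = z" unfolding z_def using C.m_assoc[OF ec ec x] D(4)[OF e] by simp
    have ef: "e \<otimes>\<^bsub>A\<^esub> f = f" unfolding f_def using C.m_assoc[OF ec z y(1)] ez by simp
    have fz: "f \<otimes>\<^bsub>A\<^esub> z = z" using z y unfolding f_def by (simp only: C.m_ac C.m_closed)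
    have ff: "f \<otimes>\<^bsub>A\<^esub> f = f" using C.m_assoc[OF f z y(1)] unfolding fz f_def[symmetric] by simp
    have fe: "f \<otimes>\<^bsub>A\<^esub> e = f" using ef C.m_comm[OF f ec] by simp
    have f0: "f \<noteq> \<zero>\<^bsub>A\<^esub>" using fz n z C.l_null[OF z] unfolding z_def[symmetric] by auto
    have "f = e"
    proof (rule ccontr)
      assume ne: "f \<noteq> e"
      define g where "g = e \<ominus>\<^bsub>A\<^esub> f"
      have g: "g \<in> carrier A" unfolding g_def by (rule M.minus_closed[OF ec f])
      have g0: "g \<noteq> \<zero>\<^bsub>A\<^esub>" using ne ec f unfolding g_def by simp
      have fg: "f \<otimes>\<^bsub>A\<^esub> g = \<zero>\<^bsub>A\<^esub>"
      proof -
        have "f \<otimes>\<^bsub>A\<^esub> g = f \<otimes>\<^bsub>A\<^esub> e \<ominus>\<^bsub>A\<^esub> f \<otimes>\<^bsub>A\<^esub> f"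
          unfolding g_def using ec f by (simp add: M.minus_eq C.r_distr C.r_minus)
        then show ?thesis unfolding fe ff using f by (simp add: M.minus_eq M.r_neg)
      qed
      have eg: "e \<otimes>\<^bsub>A\<^esub> g = g"
      proof -
        have "e \<otimes>\<^bsub>A\<^esub> g = e \<otimes>\<^bsub>A\<^esub> e \<ominus>\<^bsub>A\<^esub> e \<otimes>\<^bsub>A\<^esub> f"
          unfolding g_def using ec f by (simp add: M.minus_eq C.r_distr C.r_minus)
        then show ?thesis unfolding ef D(4)[OF e] g_def .
      qed
      have gf: "g \<otimes>\<^bsub>A\<^esub> f = \<zero>\<^bsub>A\<^esub>" using fg C.m_comm[OF g f] by simp
      have gg: "g \<otimes>\<^bsub>A\<^esub> g = g"
      proof -
        have "g \<otimes>\<^bsub>A\<^esub> g = e \<otimes>\<^bsub>A\<^esub> g \<ominus>\<^bsub>A\<^esub> f \<otimes>\<^bsub>A\<^esub> g"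
          using ec f g unfolding g_def by (simp add: M.minus_eq C.l_distr C.l_minus)
        then show ?thesis unfolding eg fg using g by (simp add: M.minus_eq)
      qed
      have orth: "v \<otimes>\<^bsub>A\<^esub> e' = \<zero>\<^bsub>A\<^esub>" if v: "v \<in> carrier A" "v \<otimes>\<^bsub>A\<^esub> e = v" and e': "e' \<in> S - {e}" for v e'
      proof -
        have c: "e' \<in> carrier A" and 0: "e \<otimes>\<^bsub>A\<^esub> e' = \<zero>\<^bsub>A\<^esub>"
          using e' D(2)[of e'] D(5)[OF e, of e'] by auto
        have "v \<otimes>\<^bsub>A\<^esub> e' = v \<otimes>\<^bsub>A\<^esub> (e \<otimes>\<^bsub>A\<^esub> e')" unfolding C.m_assoc[OF v(1) ec c, symmetric] v(2) ..
        then show ?thesis unfolding 0 using C.r_null[OF v(1)] by simp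
      qed
      have ge: "g \<otimes>\<^bsub>A\<^esub> e = g" using eg C.m_comm[OF g ec] by simp
      have fo: "f \<otimes>\<^bsub>A\<^esub> e' = \<zero>\<^bsub>A\<^esub>" if "e' \<in> S - {e}" for e' by (rule orth[OF f fe that])
      have go: "g \<otimes>\<^bsub>A\<^esub> e' = \<zero>\<^bsub>A\<^esub>" if "e' \<in> insert f (S - {e})" for e'
        using that gf orth[OF g ge] by (elim insertE) simp_all
      note Sd = orthogonal_idempotents_Diff[OF S, of "{e}"]
      have 1: "orthogonal_idempotents (insert f (S - {e}))" "f \<notin> S - {e}"
        using orthogonal_idempotents_insert[OF Sd f f0 ff fo] by blast+
      have 2: "orthogonal_idempotents (insert g (insert f (S - {e})))" "g \<notin> insert f (S - {e})"
        using orthogonal_idempotents_insert[OF 1(1) g g0 gg go] by blast+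
      have "card (insert g (insert f (S - {e}))) = Suc (card S)"
        unfolding card_insert_disjoint[OF finite.insertI[OF finite_Diff[OF D(1)]] 2(2)]
          card_insert_disjoint[OF finite_Diff[OF D(1)] 1(2)] card_Suc_Diff1[OF D(1) e] ..
      then show False using max[OF 2(1)] by simp
    qed
    then show ?thesis using y(1) unfolding f_def z_def by (intro bexI[of _ y])
  qed
  ultimately show ?thesis using S unfolding s_def by blast
qed


section \<open>From the intrinsic description to products of fields\<close>

lemma vectorspace_one_update:
  assumes "vectorspace F V" shows "vectorspace F (V\<lparr>one := e\<rparr>)"
proof -
  interpret vectorspace F V by fact
  have "abelian_group (V\<lparr>one := e\<rparr>)"
    using M.abelian_group_axioms
    unfolding abelian_group_def abelian_group_axioms_def abelian_monoid_def by simp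
  then have "module F (V\<lparr>one := e\<rparr>)"
    by (intro moduleI[OF R.is_cring]) (simp_all add: smult_l_distr smult_r_distr smult_assoc1)
  then show ?thesis by (intro vectorspace.intro field_axioms)
qed

lemma (in fd_comm_algebra) algebra_A: "algebra F A"
  by (intro algebra.intro algebra_axioms.intro module_axioms cring_A) (rule prod_smult_left)

text \<open>The ideal \<open>e A\<close> with unit \<open>e\<close>; the other operations are those
  of \<open>A\<close>. Its elements have the type of those of \<open>A\<close>, as
  \<open>etale_algebra\<close> requires of the factors.\<close>

definition corner :: "('f, 'a) module \<Rightarrow> 'a \<Rightarrow> ('f, 'a) module" where
  "corner A e = A\<lparr>carrier := (\<lambda>x. e \<otimes>\<^bsub>A\<^esub> x) ` carrier A, one := e\<rparr>"

lemma corner_simps: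
  "carrier (corner A e) = (\<lambda>x. e \<otimes>\<^bsub>A\<^esub> x) ` carrier A" "\<one>\<^bsub>corner A e\<^esub> = e" "\<zero>\<^bsub>corner A e\<^esub> = \<zero>\<^bsub>A\<^esub>"
  "x \<otimes>\<^bsub>corner A e\<^esub> y = x \<otimes>\<^bsub>A\<^esub> y" "x \<oplus>\<^bsub>corner A e\<^esub> y = x \<oplus>\<^bsub>A\<^esub> y" "c \<odot>\<^bsub>corner A e\<^esub> x = c \<odot>\<^bsub>A\<^esub> x"
  by (simp_all add: corner_def)

context fd_comm_algebra begin

text \<open>\<open>e A\<close> consists of the fixed points of multiplication by the idempotent
  \<open>e\<close>, a form of membership from which closure and the unit laws can be
  rewritten.\<close>

lemma corner_fd_comm_algebra:
  assumes e: "e \<in> carrier A" "e \<otimes>\<^bsub>A\<^esub> e = e"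
  shows "fd_comm_algebra F (corner A e)"
    and "x \<in> carrier (corner A e) \<longleftrightarrow> x \<in> carrier A \<and> e \<otimes>\<^bsub>A\<^esub> x = x"
proof -
  have mem: "x \<in> carrier (corner A e) \<longleftrightarrow> x \<in> carrier A \<and> e \<otimes>\<^bsub>A\<^esub> x = x" for x
  proof
    assume "x \<in> carrier (corner A e)"
    then obtain y where y: "y \<in> carrier A" "x = e \<otimes>\<^bsub>A\<^esub> y" unfolding corner_simps by blast
    show "x \<in> carrier A \<and> e \<otimes>\<^bsub>A\<^esub> x = x"
      unfolding y(2) using C.m_assoc[OF e(1) e(1) y(1)] e y(1) by simp
  next
    assume "x \<in> carrier A \<and> e \<otimes>\<^bsub>A\<^esub> x = x"
    then show "x \<in> carrier (corner A e)" unfolding corner_simps by (metis imageI)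
  qed
  interpret T: linear_map F A A "\<lambda>v. e \<otimes>\<^bsub>A\<^esub> v"
    by (rule linear_mapI[OF vectorspace_axioms vectorspace_axioms mult_hom[OF e(1)]])
  have W: "subspace F ((\<lambda>v. e \<otimes>\<^bsub>A\<^esub> v) ` carrier A) A" using T.imT_is_subspace unfolding T.im_def .
  have vs: "vectorspace F (corner A e)"
    using vectorspace_one_update[OF subspace_is_vs[OF W], of e] unfolding corner_def .
  interpret W: vectorspace F "corner A e" by (rule vs)
  have hom: "(\<lambda>v. e \<otimes>\<^bsub>A\<^esub> v) \<in> module_hom F A (corner A e)"
    by (rule module_homI) (simp_all only: corner_simps imageI prod_add_right[OF _ _ e(1)] prod_smult_right[OF _ e(1)])
  interpret S: linear_map F A "corner A e" "\<lambda>v. e \<otimes>\<^bsub>A\<^esub> v"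
    by (rule linear_mapI[OF vectorspace_axioms vs hom])
  have fdW: "W.fin_dim" by (rule S.rank_nullity_main(2)[OF fd]) (simp only: corner_simps)
  have na: "nonassoc_algebra F (corner A e)"
  proof (rule nonassoc_algebraI[OF vs])
    show "bilinear F (corner A e) (corner A e) (corner A e) (monoid.mult (corner A e))"
    proof (rule bilinearI)
      fix a b assume "a \<in> carrier (corner A e)" "b \<in> carrier (corner A e)"
      then show "a \<otimes>\<^bsub>corner A e\<^esub> b \<in> carrier (corner A e)"
        unfolding mem using C.m_assoc[OF e(1), of a b] by (simp add: corner_simps)
    qed (simp_all only: mem corner_simps(4-6) prod_add_left prod_add_right prod_smult_left prod_smult_right)
    show "\<one>\<^bsub>corner A e\<^esub> \<in> carrier (corner A e)" unfolding mem using e by (simp only: corner_simps)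
    fix x assume x: "x \<in> carrier (corner A e)"
    show "\<one>\<^bsub>corner A e\<^esub> \<otimes>\<^bsub>corner A e\<^esub> x = x" using x unfolding mem by (simp only: corner_simps)
    show "x \<otimes>\<^bsub>corner A e\<^esub> \<one>\<^bsub>corner A e\<^esub> = x"
      using x C.m_comm[OF _ e(1), of x] unfolding mem by (simp only: corner_simps)
  qed
  show "fd_comm_algebra F (corner A e)"
    by (intro fd_comm_algebra.intro fd_comm_algebra_axioms.intro na fdW)
      (simp_all only: mem corner_simps(4) C.m_assoc C.m_comm)
  show "x \<in> carrier (corner A e) \<longleftrightarrow> x \<in> carrier A \<and> e \<otimes>\<^bsub>A\<^esub> x = x" by (rule mem)
qed

end

context etale_like begin

text \<open>Primitivity makes \<open>e A\<close> a field. Multiplication by \<open>e\<close> is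
  linear onto it and respects \<open>p\<close>-th powers, so spanning by \<open>p\<close>-th powers
  is inherited, and separability follows.\<close>

lemma corner_separable:
  assumes e: "e \<in> carrier A" "e \<otimes>\<^bsub>A\<^esub> e = e" "e \<noteq> \<zero>\<^bsub>A\<^esub>"
    and prim: "\<And>x. x \<in> carrier A \<Longrightarrow> e \<otimes>\<^bsub>A\<^esub> x \<noteq> \<zero>\<^bsub>A\<^esub> \<Longrightarrow> \<exists>y\<in>carrier A. (e \<otimes>\<^bsub>A\<^esub> x) \<otimes>\<^bsub>A\<^esub> y = e"
  shows "finite_separable_extension F (corner A e)"
proof -
  note mem = corner_fd_comm_algebra(2)[OF e(1,2)]
  interpret L: fd_comm_algebra F "corner A e" by (rule corner_fd_comm_algebra(1)[OF e(1,2)])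
  have fL: "field (corner A e)"
  proof (rule cring.cring_fieldI2[OF L.cring_A])
    show "\<zero>\<^bsub>corner A e\<^esub> \<noteq> \<one>\<^bsub>corner A e\<^esub>" using e(3) by (simp add: corner_simps)
    fix a assume a: "a \<in> carrier (corner A e)" "a \<noteq> \<zero>\<^bsub>corner A e\<^esub>"
    then have ac: "a \<in> carrier A" "e \<otimes>\<^bsub>A\<^esub> a = a" "a \<noteq> \<zero>\<^bsub>A\<^esub>" unfolding mem by (simp_all add: corner_simps)
    obtain y where y: "y \<in> carrier A" "a \<otimes>\<^bsub>A\<^esub> y = e" using prim[OF ac(1)] ac(2,3) by auto
    show "\<exists>b\<in>carrier (corner A e). a \<otimes>\<^bsub>corner A e\<^esub> b = \<one>\<^bsub>corner A e\<^esub>"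
    proof (rule bexI[of _ "e \<otimes>\<^bsub>A\<^esub> y"])
      show "e \<otimes>\<^bsub>A\<^esub> y \<in> carrier (corner A e)" unfolding corner_simps using y(1) by (rule imageI)
      have "a \<otimes>\<^bsub>A\<^esub> (e \<otimes>\<^bsub>A\<^esub> y) = e \<otimes>\<^bsub>A\<^esub> (a \<otimes>\<^bsub>A\<^esub> y)" using ac(1) e(1) y(1) by (simp only: C.m_ac)
      then show "a \<otimes>\<^bsub>corner A e\<^esub> (e \<otimes>\<^bsub>A\<^esub> y) = \<one>\<^bsub>corner A e\<^esub>" unfolding corner_simps y(2) e(2) .
    qed
  qed
  interpret K: fd_field_extension F "corner A e"
    by (intro fd_field_extension.intro fd_field_extension_axioms.intro L.fd_comm_algebra_axioms fL)
  have ps: "L.pow_span p = carrier (corner A e)"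
    if p: "Factorial_Ring.prime (p::nat)" "add_pow F p \<one>\<^bsub>F\<^esub> = \<zero>\<^bsub>F\<^esub>" for p
  proof
    show "L.pow_span p \<subseteq> carrier (corner A e)" by (rule L.pow_span_carrier)
    have hom: "(\<lambda>v. e \<otimes>\<^bsub>A\<^esub> v) \<in> module_hom F A (corner A e)"
      by (rule module_homI) (simp_all only: corner_simps imageI prod_add_right[OF _ _ e(1)] prod_smult_right[OF _ e(1)])
    have ec: "e \<otimes>\<^bsub>A\<^esub> x \<in> carrier (corner A e)" if "x \<in> carrier A" for x
      unfolding corner_simps using that by (rule imageI)
    have "pow_span p \<subseteq> {x \<in> carrier A. e \<otimes>\<^bsub>A\<^esub> x \<in> L.pow_span p}"
    proof (rule pow_span_minimal[OF submodule_vimage[OF module_axioms L.module_axioms hom L.pow_span_submodule]])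
      fix x assume x: "x \<in> carrier A"
      have "(e \<otimes>\<^bsub>A\<^esub> x) [^]\<^bsub>corner A e\<^esub> n = e \<otimes>\<^bsub>A\<^esub> x [^]\<^bsub>A\<^esub> n" for n :: nat
      proof (induct n)
        case 0
        show ?case using e(1) by (simp add: corner_simps)
      next
        case (Suc n)
        have xn: "x [^]\<^bsub>A\<^esub> n \<in> carrier A" using x by simp
        have "(e \<otimes>\<^bsub>A\<^esub> x [^]\<^bsub>A\<^esub> n) \<otimes>\<^bsub>A\<^esub> (e \<otimes>\<^bsub>A\<^esub> x) = (e \<otimes>\<^bsub>A\<^esub> e) \<otimes>\<^bsub>A\<^esub> (x [^]\<^bsub>A\<^esub> n \<otimes>\<^bsub>A\<^esub> x)"
          using x xn e(1) by (simp only: C.m_ac C.m_closed)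
        then show ?case unfolding L.C.nat_pow_Suc C.nat_pow_Suc Suc corner_simps e(2) .
      qed
      then show "x [^]\<^bsub>A\<^esub> p \<in> {x \<in> carrier A. e \<otimes>\<^bsub>A\<^esub> x \<in> L.pow_span p}"
        using L.pow_in_pow_span[OF ec[OF x], of p] x by simp
    qed
    then show "carrier (corner A e) \<subseteq> L.pow_span p" unfolding pow_span[OF p] corner_simps by blast
  qed
  have "separable_poly (corner A e) K.base (ring.Irr (corner A e) K.base x)" if "x \<in> carrier (corner A e)" for x
    by (rule K.separable_of_pow_span[OF ps that])
  then show ?thesis
    unfolding finite_separable_extension_def Let_def K.base_def
    using field_axioms fL L.algebra_A L.fd by blast
qed

text \<open>The isomorphism sends \<open>x\<close> to the tuple of the products
  \<open>e_i x\<close>; its inverse \<open>g\<close> adds up the entries.\<close>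

theorem etale: "etale_algebra F A"
proof -
  obtain S where S: "orthogonal_idempotents S" and S1: "(\<Oplus>\<^bsub>A\<^esub>e\<in>S. e) = \<one>\<^bsub>A\<^esub>" and
    prim: "\<forall>e\<in>S. \<forall>x\<in>carrier A. e \<otimes>\<^bsub>A\<^esub> x \<noteq> \<zero>\<^bsub>A\<^esub> \<longrightarrow> (\<exists>y\<in>carrier A. (e \<otimes>\<^bsub>A\<^esub> x) \<otimes>\<^bsub>A\<^esub> y = e)"
    using primitive_idempotents by (elim exE conjE)
  note D = orthogonal_idempotentsD[OF S]
  obtain e where e: "bij_betw e {0..<card S} S" using ex_bij_betw_nat_finite[OF D(1)] by (elim exE)
  define n where "n = card S"
  have e: "bij_betw e {..<n} S" using e unfolding n_def lessThan_atLeast0 .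
  have eS: "e i \<in> S" if "i < n" for i using bij_betwE[OF e] that by simp
  have ec: "e i \<in> carrier A" if "i < n" for i by (rule D(2)[OF eS[OF that]])
  have ee: "e i \<otimes>\<^bsub>A\<^esub> e i = e i" if "i < n" for i by (rule D(4)[OF eS[OF that]])
  define L where "L = (\<lambda>i. corner A (e i))"
  have sep: "finite_separable_extension F (L i)" if i: "i < n" for i
    unfolding L_def using prim eS[OF i] by (intro corner_separable[OF ec[OF i] ee[OF i] D(3)[OF eS[OF i]]]) blast
  define P where "P = prod_algebra {..<n} L"
  define h where "h = (\<lambda>x. \<lambda>i\<in>{..<n}. e i \<otimes>\<^bsub>A\<^esub> x)"
  \<comment> \<open>The tuple \<open>u\<close> is indexed by numbers and the sum by idempotents;
    \<open>inv_into\<close> passes from one to the other.\<close>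
  define g where "g = (\<lambda>u. \<Oplus>\<^bsub>A\<^esub>f\<in>S. u (inv_into {..<n} e f))"
  have inve: "inv_into {..<n} e (e i) = i" if "i < n" for i
    using bij_betw_imp_inj_on[OF e] that by simp
  have einv: "inv_into {..<n} e f < n" "e (inv_into {..<n} e f) = f" if "f \<in> S" for f
    using bij_betw_inv_into_right[OF e that] bij_betwE[OF bij_betw_inv_into[OF e]] that by auto
  have Lc: "e i \<otimes>\<^bsub>A\<^esub> x \<in> carrier (L i)" if "x \<in> carrier A" for i x
    unfolding L_def corner_simps using that by (rule imageI)
  have hc: "h x \<in> carrier P" if x: "x \<in> carrier A" for x
    unfolding P_def h_def prod_algebra_simps using Lc[OF x] by (simp add: restrict_PiE_iff)
  have uc: "u i \<in> carrier A" "e i \<otimes>\<^bsub>A\<^esub> u i = u i" if "u \<in> carrier P" "i < n" for u i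
  proof -
    have "u i \<in> carrier (L i)" using that unfolding P_def prod_algebra_simps by (simp add: PiE_iff)
    then show "u i \<in> carrier A" "e i \<otimes>\<^bsub>A\<^esub> u i = u i"
      unfolding L_def corner_fd_comm_algebra(2)[OF ec[OF that(2)] ee[OF that(2)]] by blast+
  qed
  have gc: "(\<lambda>f. u (inv_into {..<n} e f)) \<in> S \<rightarrow> carrier A" if "u \<in> carrier P" for u
    using uc(1)[OF that] einv(1) by blast
  have hg: "h (g u) = u" if u: "u \<in> carrier P" for u
  proof
    fix i
    show "h (g u) i = u i"
    proof (cases "i < n")
      case True
      have "e i \<otimes>\<^bsub>A\<^esub> g u = u (inv_into {..<n} e (e i))"
        unfolding g_def
      proof (rule orthogonal_idempotents_sum[OF S gc[OF u] _ eS[OF True]])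
        fix f assume f: "f \<in> S"
        show "f \<otimes>\<^bsub>A\<^esub> u (inv_into {..<n} e f) = u (inv_into {..<n} e f)"
          using uc(2)[OF u einv(1)[OF f]] unfolding einv(2)[OF f] .
      qed
      then show ?thesis using True inve by (simp add: h_def)
    next
      case False
      then show ?thesis using u by (simp add: P_def prod_algebra_simps h_def PiE_iff extensional_def)
    qed
  qed
  have gh: "g (h x) = x" if x: "x \<in> carrier A" for x
  proof -
    have "g (h x) = (\<Oplus>\<^bsub>A\<^esub>f\<in>S. f \<otimes>\<^bsub>A\<^esub> x)"
      unfolding g_def h_def using einv D(2) x by (intro M.finsum_cong') simp_all
    also have "\<dots> = (\<Oplus>\<^bsub>A\<^esub>f\<in>S. f) \<otimes>\<^bsub>A\<^esub> x"
      by (rule C.finsum_ldistr[symmetric, OF D(1) x]) (use D(2) in simp)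
    finally show ?thesis unfolding S1 using x by simp
  qed
  have gcl: "g u \<in> carrier A" if "u \<in> carrier P" for u unfolding g_def by (rule M.finsum_closed[OF gc[OF that]])
  have "h \<in> ring_iso A P"
  proof (rule ring_iso_memI)
    show "bij_betw h (carrier A) (carrier P)"
      by (rule bij_betw_byWitness[where f' = g]) (use hc gcl gh hg in auto)
    fix x y assume x: "x \<in> carrier A" and y: "y \<in> carrier A"
    show "h x \<in> carrier P" by (rule hc[OF x])
    have "e i \<otimes>\<^bsub>A\<^esub> (x \<otimes>\<^bsub>A\<^esub> y) = (e i \<otimes>\<^bsub>A\<^esub> x) \<otimes>\<^bsub>A\<^esub> (e i \<otimes>\<^bsub>A\<^esub> y)" if i: "i < n" for i
    proof -
      have "(e i \<otimes>\<^bsub>A\<^esub> x) \<otimes>\<^bsub>A\<^esub> (e i \<otimes>\<^bsub>A\<^esub> y) = (e i \<otimes>\<^bsub>A\<^esub> e i) \<otimes>\<^bsub>A\<^esub> (x \<otimes>\<^bsub>A\<^esub> y)"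
        using ec[OF i] x y by (simp only: C.m_ac C.m_closed)
      then show ?thesis unfolding ee[OF i] by (rule sym)
    qed
    then show "h (x \<otimes>\<^bsub>A\<^esub> y) = h x \<otimes>\<^bsub>P\<^esub> h y"
      unfolding h_def P_def prod_algebra_simps by (intro restrict_ext) (simp add: L_def corner_simps)
    show "h (x \<oplus>\<^bsub>A\<^esub> y) = h x \<oplus>\<^bsub>P\<^esub> h y"
      unfolding h_def P_def prod_algebra_simps using ec x y
      by (intro restrict_ext) (simp add: L_def corner_simps C.r_distr)
  next
    show "h \<one>\<^bsub>A\<^esub> = \<one>\<^bsub>P\<^esub>"
      unfolding h_def P_def prod_algebra_simps using ec by (intro restrict_ext) (simp add: L_def corner_simps)
  qed
  moreover have "h \<in> module_hom F A P"
  proof (rule module_homI[OF hc])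
    fix x y assume x: "x \<in> carrier A" and y: "y \<in> carrier A"
    show "h (x \<oplus>\<^bsub>A\<^esub> y) = h x \<oplus>\<^bsub>P\<^esub> h y" using calculation x y by (rule ring_iso_memE(3))
  next
    fix c x assume "c \<in> carrier F" "x \<in> carrier A"
    then show "h (c \<odot>\<^bsub>A\<^esub> x) = c \<odot>\<^bsub>P\<^esub> h x"
      unfolding h_def P_def prod_algebra_simps using ec
      by (intro restrict_ext) (simp add: L_def corner_simps prod_smult_right)
  qed
  ultimately have "h \<in> alg_iso F A (prod_algebra {..<n} L)" unfolding alg_iso_def P_def by blast
  then show ?thesis unfolding etale_algebra_def using sep by blast
qed

end


section \<open>Minimally faithful modules\<close>

text \<open>Faithfulness of \<open>P / N\<close> becomes the condition that
  \<open>r P \<subseteq> N\<close> only for \<open>r = 0\<close>, so that later arguments involve no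
  cosets.\<close>

lemma faithful_section_iff:
  assumes "module R M" and P: "LinearCombinations.submodule R P M" and N: "LinearCombinations.submodule R N M"
    and NP: "N \<subseteq> P"
  shows "faithful R (quot_module (M\<lparr>carrier := P\<rparr>) N) \<longleftrightarrow>
    (\<forall>r\<in>carrier R. (\<forall>x\<in>P. r \<odot>\<^bsub>M\<^esub> x \<in> N) \<longrightarrow> r = \<zero>\<^bsub>R\<^esub>)"
proof -
  interpret M: module R M by fact
  have mP: "module R (M\<lparr>carrier := P\<rparr>)" by (rule M.submodule_is_module[OF P])
  have sN: "LinearCombinations.submodule R N (M\<lparr>carrier := P\<rparr>)"
    using N NP mP unfolding LinearCombinations.submodule_def by simp
  interpret Q: quotient_mod R "M\<lparr>carrier := P\<rparr>" N
    by (rule quotient_mod.intro[OF mP quotient_mod_axioms.intro[OF sN]])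
  have "(\<forall>U\<in>carrier Q.Q. r \<odot>\<^bsub>Q.Q\<^esub> U = \<zero>\<^bsub>Q.Q\<^esub>) \<longleftrightarrow> (\<forall>x\<in>P. r \<odot>\<^bsub>M\<^esub> x \<in> N)" if r: "r \<in> carrier R" for r
  proof
    assume L: "\<forall>U\<in>carrier Q.Q. r \<odot>\<^bsub>Q.Q\<^esub> U = \<zero>\<^bsub>Q.Q\<^esub>"
    show "\<forall>x\<in>P. r \<odot>\<^bsub>M\<^esub> x \<in> N"
    proof
      fix x assume "x \<in> P"
      then have x: "x \<in> carrier (M\<lparr>carrier := P\<rparr>)" by simp
      have "Q.proj (r \<odot>\<^bsub>M\<lparr>carrier := P\<rparr>\<^esub> x) = \<zero>\<^bsub>Q.Q\<^esub>"
        unfolding Q.proj_smult[OF r x] using L Q.proj_closed[OF x] by (rule bspec)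
      then show "r \<odot>\<^bsub>M\<^esub> x \<in> N" unfolding Q.proj_zero[OF Q.smult_closed[OF r x]] by simp
    qed
  next
    assume L: "\<forall>x\<in>P. r \<odot>\<^bsub>M\<^esub> x \<in> N"
    show "\<forall>U\<in>carrier Q.Q. r \<odot>\<^bsub>Q.Q\<^esub> U = \<zero>\<^bsub>Q.Q\<^esub>"
    proof
      fix U assume U: "U \<in> carrier Q.Q"
      show "r \<odot>\<^bsub>Q.Q\<^esub> U = \<zero>\<^bsub>Q.Q\<^esub>"
      proof (rule Q.Q_cases[OF U])
        fix x assume x: "x \<in> carrier (M\<lparr>carrier := P\<rparr>)"
        show "r \<odot>\<^bsub>Q.Q\<^esub> Q.proj x = \<zero>\<^bsub>Q.Q\<^esub>"
          unfolding Q.proj_smult[OF r x, symmetric] Q.proj_zero[OF Q.smult_closed[OF r x]] using L x by simp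
      qed
    qed
  qed
  then show ?thesis unfolding faithful_def by (simp only: cong: ball_cong)
qed

text \<open>Multiply the decomposition of the unit by \<open>s\<close>.\<close>

lemma (in fd_comm_algebra) orthogonal_idempotents_separate:
  assumes S: "orthogonal_idempotents S" and S1: "(\<Oplus>\<^bsub>A\<^esub>e\<in>S. e) = \<one>\<^bsub>A\<^esub>"
    and s: "s \<in> carrier A" "\<And>e. e \<in> S \<Longrightarrow> e \<otimes>\<^bsub>A\<^esub> s = \<zero>\<^bsub>A\<^esub>"
  shows "s = \<zero>\<^bsub>A\<^esub>"
proof -
  note D = orthogonal_idempotentsD[OF S]
  have "s = (\<Oplus>\<^bsub>A\<^esub>e\<in>S. e) \<otimes>\<^bsub>A\<^esub> s" unfolding S1 using s(1) by simp
  also have "\<dots> = (\<Oplus>\<^bsub>A\<^esub>e\<in>S. e \<otimes>\<^bsub>A\<^esub> s)"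
    by (rule C.finsum_ldistr[OF D(1) s(1)]) (use D(2) in simp)
  also have "\<dots> = \<zero>\<^bsub>A\<^esub>" by (rule M.add.finprod_one_eqI) (rule s(2))
  finally show ?thesis .
qed

context etale_like begin

lemma minimally_faithful_imp_cyclic:
  assumes mf: "minimally_faithful A M"
  shows "\<exists>a\<in>carrier M. (\<lambda>s. s \<odot>\<^bsub>M\<^esub> a) ` carrier A = carrier M \<and>
    (\<forall>s\<in>carrier A. s \<odot>\<^bsub>M\<^esub> a = \<zero>\<^bsub>M\<^esub> \<longrightarrow> s = \<zero>\<^bsub>A\<^esub>)"
proof -
  have mM: "module A M" and fa: "faithful A M" and min: "\<And>P N. LinearCombinations.submodule A P M \<Longrightarrow>
      LinearCombinations.submodule A N M \<Longrightarrow> N \<subseteq> P \<Longrightarrow>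
        faithful A (quot_module (M\<lparr>carrier := P\<rparr>) N) \<Longrightarrow> P = carrier M"
    using mf unfolding minimally_faithful_def by blast+
  interpret N: module A M by (rule mM)
  obtain S where S: "orthogonal_idempotents S" and S1: "(\<Oplus>\<^bsub>A\<^esub>e\<in>S. e) = \<one>\<^bsub>A\<^esub>" and
    prim: "\<forall>e\<in>S. \<forall>x\<in>carrier A. e \<otimes>\<^bsub>A\<^esub> x \<noteq> \<zero>\<^bsub>A\<^esub> \<longrightarrow> (\<exists>y\<in>carrier A. (e \<otimes>\<^bsub>A\<^esub> x) \<otimes>\<^bsub>A\<^esub> y = e)"
    using primitive_idempotents by (elim exE conjE)
  note D = orthogonal_idempotentsD[OF S]
  have "\<exists>x. x \<in> carrier M \<and> e \<odot>\<^bsub>M\<^esub> x \<noteq> \<zero>\<^bsub>M\<^esub>" if e: "e \<in> S" for e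
    using fa D(2,3)[OF e] unfolding faithful_def by blast
  then obtain x where x: "\<And>e. e \<in> S \<Longrightarrow> x e \<in> carrier M" "\<And>e. e \<in> S \<Longrightarrow> e \<odot>\<^bsub>M\<^esub> x e \<noteq> \<zero>\<^bsub>M\<^esub>" by metis
  have ex: "(\<lambda>e. e \<odot>\<^bsub>M\<^esub> x e) \<in> S \<rightarrow> carrier M" using x(1) D(2) by (intro Pi_I N.smult_closed)
  define a where "a = (\<Oplus>\<^bsub>M\<^esub>e\<in>S. e \<odot>\<^bsub>M\<^esub> x e)"
  have a: "a \<in> carrier M" unfolding a_def by (rule N.M.finsum_closed[OF ex])
  \<comment> \<open>By orthogonality only the summand at \<open>e\<close> survives.\<close>
  have ea: "e \<odot>\<^bsub>M\<^esub> a \<noteq> \<zero>\<^bsub>M\<^esub>" if e: "e \<in> S" for e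
  proof -
    have "e \<odot>\<^bsub>M\<^esub> a = (\<Oplus>\<^bsub>M\<^esub>f\<in>S. e \<odot>\<^bsub>M\<^esub> (f \<odot>\<^bsub>M\<^esub> x f))"
      unfolding a_def by (rule N.finsum_smult_ldistr[OF D(1) D(2)[OF e] ex])
    also have "\<dots> = (\<Oplus>\<^bsub>M\<^esub>f\<in>S. if e = f then f \<odot>\<^bsub>M\<^esub> x f else \<zero>\<^bsub>M\<^esub>)"
    proof (rule N.M.finsum_cong'[OF refl])
      show "(\<lambda>f. if e = f then f \<odot>\<^bsub>M\<^esub> x f else \<zero>\<^bsub>M\<^esub>) \<in> S \<rightarrow> carrier M" using ex by (simp add: Pi_iff)
      fix f assume f: "f \<in> S"
      have "e \<odot>\<^bsub>M\<^esub> (f \<odot>\<^bsub>M\<^esub> x f) = (e \<otimes>\<^bsub>A\<^esub> f) \<odot>\<^bsub>M\<^esub> x f"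
        by (rule N.smult_assoc1[OF D(2)[OF e] D(2)[OF f] x(1)[OF f], symmetric])
      also have "\<dots> = (if e = f then f \<odot>\<^bsub>M\<^esub> x f else \<zero>\<^bsub>M\<^esub>)"
        using D(4)[OF f] D(5)[OF e f] N.smult_l_null[OF x(1)[OF f]] by simp
      finally show "e \<odot>\<^bsub>M\<^esub> (f \<odot>\<^bsub>M\<^esub> x f) = (if e = f then f \<odot>\<^bsub>M\<^esub> x f else \<zero>\<^bsub>M\<^esub>)" .
    qed
    also have "\<dots> = e \<odot>\<^bsub>M\<^esub> x e" by (rule N.M.add.finprod_singleton[OF e D(1) ex])
    finally show ?thesis using x(2)[OF e] by (simp only: not_False_eq_True)
  qed
  have ann: "s = \<zero>\<^bsub>A\<^esub>" if s: "s \<in> carrier A" "s \<odot>\<^bsub>M\<^esub> a = \<zero>\<^bsub>M\<^esub>" for s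
  proof (rule orthogonal_idempotents_separate[OF S S1 s(1)], rule ccontr)
    \<comment> \<open>In the field at \<open>e\<close> a nonzero \<open>e s\<close> is invertible,
      so \<open>e\<close> is a multiple of \<open>s\<close> and kills \<open>a\<close> whenever
      \<open>s\<close> does.\<close>
    fix e assume e: "e \<in> S" and n: "e \<otimes>\<^bsub>A\<^esub> s \<noteq> \<zero>\<^bsub>A\<^esub>"
    obtain y where y: "y \<in> carrier A" "(e \<otimes>\<^bsub>A\<^esub> s) \<otimes>\<^bsub>A\<^esub> y = e" using prim e s(1) n by blast
    have "(e \<otimes>\<^bsub>A\<^esub> s) \<otimes>\<^bsub>A\<^esub> y = (e \<otimes>\<^bsub>A\<^esub> y) \<otimes>\<^bsub>A\<^esub> s" using D(2)[OF e] s(1) y(1) by (simp only: C.m_ac)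
    then have "e = (e \<otimes>\<^bsub>A\<^esub> y) \<otimes>\<^bsub>A\<^esub> s" unfolding y(2) .
    then have "e \<odot>\<^bsub>M\<^esub> a = ((e \<otimes>\<^bsub>A\<^esub> y) \<otimes>\<^bsub>A\<^esub> s) \<odot>\<^bsub>M\<^esub> a" by (rule arg_cong)
    also have "\<dots> = (e \<otimes>\<^bsub>A\<^esub> y) \<odot>\<^bsub>M\<^esub> (s \<odot>\<^bsub>M\<^esub> a)"
      by (rule N.smult_assoc1[OF C.m_closed[OF D(2)[OF e] y(1)] s(1) a])
    also have "\<dots> = \<zero>\<^bsub>M\<^esub>" unfolding s(2) by (rule N.smult_r_null[OF C.m_closed[OF D(2)[OF e] y(1)]])
    finally show False using ea[OF e] by (rule notE[rotated])
  qed
  define P where "P = (\<lambda>s. s \<odot>\<^bsub>M\<^esub> a) ` carrier A"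
  have aP: "a \<in> P" unfolding P_def by (rule image_eqI, rule N.smult_one[OF a, symmetric], rule C.one_closed)
  have sP: "LinearCombinations.submodule A P M"
  proof (intro LinearCombinations.submodule.intro mM)
    show "P \<subseteq> carrier M" unfolding P_def using N.smult_closed[OF _ a] by blast
    show "\<zero>\<^bsub>M\<^esub> \<in> P" unfolding P_def by (rule image_eqI, rule N.smult_l_null[OF a, symmetric], rule M.zero_closed)
    fix c v assume "c \<in> carrier A" "v \<in> P"
    then obtain s where s: "c \<in> carrier A" "s \<in> carrier A" "v = s \<odot>\<^bsub>M\<^esub> a" unfolding P_def by blast
    show "c \<odot>\<^bsub>M\<^esub> v \<in> P" unfolding P_def s(3)
      by (rule image_eqI, rule N.smult_assoc1[OF s(1,2) a, symmetric], rule C.m_closed[OF s(1,2)])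
  next
    fix v w assume "v \<in> P" "w \<in> P"
    then obtain s t where s: "s \<in> carrier A" "t \<in> carrier A" "v = s \<odot>\<^bsub>M\<^esub> a" "w = t \<odot>\<^bsub>M\<^esub> a" unfolding P_def by blast
    show "v \<oplus>\<^bsub>M\<^esub> w \<in> P" unfolding P_def s(3,4)
      by (rule image_eqI, rule N.smult_l_distr[OF s(1,2) a, symmetric], rule M.a_closed[OF s(1,2)])
  qed
  have s0: "LinearCombinations.submodule A {\<zero>\<^bsub>M\<^esub>} M"
    using mM unfolding LinearCombinations.submodule_def by (simp add: N.smult_r_null)
  have z: "{\<zero>\<^bsub>M\<^esub>} \<subseteq> P" using sP unfolding LinearCombinations.submodule_def by simp
  \<comment> \<open>Minimality is applied to the section \<open>P / 0\<close>, whose faithfulness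
    amounts to the trivial annihilator of \<open>a\<close>.\<close>
  have "P = carrier M"
  proof (rule min[OF sP s0 z], unfold faithful_section_iff[OF mM sP s0 z], intro ballI impI)
    fix r assume r: "r \<in> carrier A" "\<forall>x\<in>P. r \<odot>\<^bsub>M\<^esub> x \<in> {\<zero>\<^bsub>M\<^esub>}"
    then have "r \<odot>\<^bsub>M\<^esub> a = \<zero>\<^bsub>M\<^esub>" using aP by simp
    with r(1) show "r = \<zero>\<^bsub>A\<^esub>" by (rule ann)
  qed
  then show ?thesis using a ann unfolding P_def by (intro bexI[of _ a]) simp_all
qed

text \<open>If \<open>P / N\<close> is faithful, every primitive idempotent \<open>e\<close> moves
  some \<open>x\<close> of \<open>P\<close> outside \<open>N\<close>. Then \<open>e x\<close> is
  nonzero in the line \<open>e M\<close> over the field \<open>e A\<close>, so \<open>e a\<close> is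
  a multiple of \<open>e x\<close> and lies in \<open>P\<close>; summing over \<open>e\<close> puts
  \<open>a\<close> into \<open>P\<close>. A nonzero element of \<open>N\<close> would likewise put
  some \<open>e a\<close> into \<open>N\<close>, hence all of \<open>e M\<close>, and
  \<open>e\<close> would annihilate the section.\<close>

lemma cyclic_imp_minimally_faithful:
  assumes mM: "module A M" and a: "a \<in> carrier M" and gen: "(\<lambda>s. s \<odot>\<^bsub>M\<^esub> a) ` carrier A = carrier M"
    and ann: "\<And>s. s \<in> carrier A \<Longrightarrow> s \<odot>\<^bsub>M\<^esub> a = \<zero>\<^bsub>M\<^esub> \<Longrightarrow> s = \<zero>\<^bsub>A\<^esub>"
  shows "minimally_faithful A M"
  unfolding minimally_faithful_def
proof (intro conjI mM allI impI)
  interpret N: module A M by (rule mM)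
  show "faithful A M" unfolding faithful_def using a ann by blast
  fix P N
  assume h: "LinearCombinations.submodule A P M \<and> LinearCombinations.submodule A N M \<and> N \<subseteq> P \<and>
      faithful A (quot_module (M\<lparr>carrier := P\<rparr>) N)"
  have sP: "LinearCombinations.submodule A P M" and sN: "LinearCombinations.submodule A N M" and NP: "N \<subseteq> P"
    using h by blast+
  have fa: "r = \<zero>\<^bsub>A\<^esub>" if "r \<in> carrier A" "\<And>x. x \<in> P \<Longrightarrow> r \<odot>\<^bsub>M\<^esub> x \<in> N" for r
    using h that unfolding faithful_section_iff[OF mM sP sN NP] by blast
  have P: "P \<subseteq> carrier M" "\<zero>\<^bsub>M\<^esub> \<in> P" "\<And>v w. v \<in> P \<Longrightarrow> w \<in> P \<Longrightarrow> v \<oplus>\<^bsub>M\<^esub> w \<in> P"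
    "\<And>c v. c \<in> carrier A \<Longrightarrow> v \<in> P \<Longrightarrow> c \<odot>\<^bsub>M\<^esub> v \<in> P"
    using sP unfolding LinearCombinations.submodule_def by simp_all
  have N: "N \<subseteq> carrier M" "\<zero>\<^bsub>M\<^esub> \<in> N" "\<And>c v. c \<in> carrier A \<Longrightarrow> v \<in> N \<Longrightarrow> c \<odot>\<^bsub>M\<^esub> v \<in> N"
    using sN unfolding LinearCombinations.submodule_def by simp_all
  obtain S where S: "orthogonal_idempotents S" and S1: "(\<Oplus>\<^bsub>A\<^esub>e\<in>S. e) = \<one>\<^bsub>A\<^esub>" and
    prim: "\<forall>e\<in>S. \<forall>x\<in>carrier A. e \<otimes>\<^bsub>A\<^esub> x \<noteq> \<zero>\<^bsub>A\<^esub> \<longrightarrow> (\<exists>y\<in>carrier A. (e \<otimes>\<^bsub>A\<^esub> x) \<otimes>\<^bsub>A\<^esub> y = e)"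
    using primitive_idempotents by (elim exE conjE)
  note D = orthogonal_idempotentsD[OF S]
  have cyc: "\<exists>t\<in>carrier A. x = t \<odot>\<^bsub>M\<^esub> a" if "x \<in> carrier M" for x using that gen by blast
  \<comment> \<open>An element \<open>t a\<close> with \<open>e t \<noteq> 0\<close> can be
    multiplied back to \<open>e a\<close>, since \<open>e t\<close> is invertible in the field at
    \<open>e\<close>.\<close>
  have prim_smult: "\<exists>y\<in>carrier A. e \<odot>\<^bsub>M\<^esub> a = y \<odot>\<^bsub>M\<^esub> (e \<odot>\<^bsub>M\<^esub> (t \<odot>\<^bsub>M\<^esub> a))"
    if e: "e \<in> S" and t: "t \<in> carrier A" and n: "e \<otimes>\<^bsub>A\<^esub> t \<noteq> \<zero>\<^bsub>A\<^esub>" for e t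
  proof -
    note ec = D(2)[OF e]
    obtain y where y: "y \<in> carrier A" "(e \<otimes>\<^bsub>A\<^esub> t) \<otimes>\<^bsub>A\<^esub> y = e" using prim e t n by blast
    have "y \<otimes>\<^bsub>A\<^esub> (e \<otimes>\<^bsub>A\<^esub> t) = e" using y C.m_comm[OF y(1) C.m_closed[OF ec t]] by simp
    moreover have "y \<odot>\<^bsub>M\<^esub> (e \<odot>\<^bsub>M\<^esub> (t \<odot>\<^bsub>M\<^esub> a)) = (y \<otimes>\<^bsub>A\<^esub> (e \<otimes>\<^bsub>A\<^esub> t)) \<odot>\<^bsub>M\<^esub> a"
      by (simp only: N.smult_assoc1[OF ec t a] N.smult_assoc1[OF y(1) C.m_closed[OF ec t] a])
    ultimately have "e \<odot>\<^bsub>M\<^esub> a = y \<odot>\<^bsub>M\<^esub> (e \<odot>\<^bsub>M\<^esub> (t \<odot>\<^bsub>M\<^esub> a))" by simp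
    then show ?thesis using y(1) by (rule bexI)
  qed
  have eP: "e \<odot>\<^bsub>M\<^esub> a \<in> P" if e: "e \<in> S" for e
  proof -
    have "\<not> (\<forall>x\<in>P. e \<odot>\<^bsub>M\<^esub> x \<in> N)" using fa[OF D(2)[OF e]] D(3)[OF e] by blast
    then obtain x where x: "x \<in> P" "e \<odot>\<^bsub>M\<^esub> x \<notin> N" by blast
    obtain t where t: "t \<in> carrier A" "x = t \<odot>\<^bsub>M\<^esub> a" using cyc x(1) P(1) by blast
    have "e \<otimes>\<^bsub>A\<^esub> t \<noteq> \<zero>\<^bsub>A\<^esub>"
    proof
      assume "e \<otimes>\<^bsub>A\<^esub> t = \<zero>\<^bsub>A\<^esub>"
      then have "e \<odot>\<^bsub>M\<^esub> x = \<zero>\<^bsub>M\<^esub>"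
        unfolding t(2) N.smult_assoc1[OF D(2)[OF e] t(1) a, symmetric] using N.smult_l_null[OF a] by simp
      then show False using x(2) N(2) by simp
    qed
    then obtain y where "y \<in> carrier A" "e \<odot>\<^bsub>M\<^esub> a = y \<odot>\<^bsub>M\<^esub> (e \<odot>\<^bsub>M\<^esub> x)"
      using prim_smult[OF e t(1)] unfolding t(2) by blast
    then show ?thesis using P(4) D(2)[OF e] x(1) by simp
  qed
  have "(\<Oplus>\<^bsub>A\<^esub>e\<in>S. e) \<odot>\<^bsub>M\<^esub> a = (\<Oplus>\<^bsub>M\<^esub>e\<in>S. e \<odot>\<^bsub>M\<^esub> a)"
  proof -
    have "finsum A (\<lambda>e. e) J \<odot>\<^bsub>M\<^esub> a = (\<Oplus>\<^bsub>M\<^esub>e\<in>J. e \<odot>\<^bsub>M\<^esub> a)" if "finite J" "J \<subseteq> carrier A" for J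
      using that
    proof (induct J rule: finite_induct)
      case empty
      then show ?case using N.smult_l_null[OF a] by simp
    next
      case (insert j J)
      then have j: "j \<in> carrier A" "J \<subseteq> carrier A" by auto
      have "(\<lambda>e. e) \<in> J \<rightarrow> carrier A" "(\<lambda>e. e \<odot>\<^bsub>M\<^esub> a) \<in> J \<rightarrow> carrier M" using j(2) a by auto
      then show ?case using insert j a by (simp add: M.finsum_insert N.M.finsum_insert N.smult_l_distr)
    qed
    from this[OF D(1)] show ?thesis using D(2) by blast
  qed
  then have "a = (\<Oplus>\<^bsub>M\<^esub>e\<in>S. e \<odot>\<^bsub>M\<^esub> a)" unfolding S1 using N.smult_one[OF a] by simp
  moreover have "(\<Oplus>\<^bsub>M\<^esub>e\<in>S. e \<odot>\<^bsub>M\<^esub> a) \<in> P"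
  proof -
    have "(\<Oplus>\<^bsub>M\<^esub>e\<in>J. e \<odot>\<^bsub>M\<^esub> a) \<in> P" if "finite J" "J \<subseteq> S" for J
      using that
    proof (induct J rule: finite_induct)
      case (insert j J)
      then have j: "j \<in> S" "J \<subseteq> S" by auto
      have "(\<lambda>e. e \<odot>\<^bsub>M\<^esub> a) \<in> J \<rightarrow> carrier M" "j \<odot>\<^bsub>M\<^esub> a \<in> carrier M" using j eP P(1) by blast+
      then show ?case using insert j P(3) eP by (simp add: N.M.finsum_insert)
    qed (simp add: P(2))
    from this[OF D(1)] show ?thesis by blast
  qed
  ultimately have aP: "a \<in> P" by simp
  show "P = carrier M"
  proof
    show "P \<subseteq> carrier M" by (rule P(1))
    show "carrier M \<subseteq> P" unfolding gen[symmetric] using P(4) aP by blast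
  qed
  show "N = {\<zero>\<^bsub>M\<^esub>}"
  proof (intro equalityI subsetI)
    fix n assume n: "n \<in> N"
    obtain t where t: "t \<in> carrier A" "n = t \<odot>\<^bsub>M\<^esub> a" using cyc n N(1) by blast
    have "t = \<zero>\<^bsub>A\<^esub>"
    proof (rule orthogonal_idempotents_separate[OF S S1 t(1)], rule ccontr)
      fix e assume e: "e \<in> S" and nz: "e \<otimes>\<^bsub>A\<^esub> t \<noteq> \<zero>\<^bsub>A\<^esub>"
      note ec = D(2)[OF e]
      obtain y where "y \<in> carrier A" "e \<odot>\<^bsub>M\<^esub> a = y \<odot>\<^bsub>M\<^esub> (e \<odot>\<^bsub>M\<^esub> n)"
        using prim_smult[OF e t(1) nz] unfolding t(2) by blast
      then have ea: "e \<odot>\<^bsub>M\<^esub> a \<in> N" using N(3) n ec by simp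
      have "e = \<zero>\<^bsub>A\<^esub>"
      proof (rule fa[OF ec])
        fix x assume "x \<in> P"
        then obtain u where u: "u \<in> carrier A" "x = u \<odot>\<^bsub>M\<^esub> a" using cyc P(1) by blast
        have "e \<odot>\<^bsub>M\<^esub> x = u \<odot>\<^bsub>M\<^esub> (e \<odot>\<^bsub>M\<^esub> a)"
          unfolding u(2) using C.m_comm[OF ec u(1)]
          by (simp only: N.smult_assoc1[OF ec u(1) a, symmetric] N.smult_assoc1[OF u(1) ec a, symmetric])
        then show "e \<odot>\<^bsub>M\<^esub> x \<in> N" using N(3)[OF u(1) ea] by simp
      qed
      then show False using D(3)[OF e] by simp
    qed
    then show "n \<in> {\<zero>\<^bsub>M\<^esub>}" unfolding t(2) using N.smult_l_null[OF a] by simp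
  qed (use N(2) in simp)
qed

end


lemma unital_subalgebra_nonassoc_algebra:
  assumes "nonassoc_algebra F A" and K: "unital_subalgebra F K A"
  shows "nonassoc_algebra F (A\<lparr>carrier := K\<rparr>)"
proof -
  interpret nonassoc_algebra F A by fact
  have sub: "subspace F K A" and one: "\<one>\<^bsub>A\<^esub> \<in> K" and mult: "\<And>x y. x \<in> K \<Longrightarrow> y \<in> K \<Longrightarrow> x \<otimes>\<^bsub>A\<^esub> y \<in> K"
    using K unfolding unital_subalgebra_def by blast+
  have Kc: "x \<in> carrier A" if "x \<in> K" for x
    using sub that unfolding subspace_def LinearCombinations.submodule_def by blast
  show ?thesis
  proof (rule nonassoc_algebraI[OF subspace_is_vs[OF sub]])
    show "bilinear F (A\<lparr>carrier := K\<rparr>) (A\<lparr>carrier := K\<rparr>) (A\<lparr>carrier := K\<rparr>) (monoid.mult (A\<lparr>carrier := K\<rparr>))"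
      by (rule bilinearI) (simp_all add: mult Kc prod_add_left prod_add_right prod_smult_left prod_smult_right)
  qed (simp_all add: one Kc unit_left unit_right)
qed

lemma tensor_etale_tensor_algebra:
  assumes "etale_like F A" "etale_like F B"
  shows "tensor_etale F A B (tensor_algebra F A B) (tens F A B)"
proof -
  interpret A: etale_like F A by fact
  interpret B: etale_like F B by fact
  interpret tensor_algs F A B
    by (rule tensor_algs.intro[OF A.nonassoc_algebra_axioms B.nonassoc_algebra_axioms])
  show ?thesis
    by (intro tensor_etale.intro tensor_etale_axioms.intro assms nonassoc_algebra_T tensor_like_T tens_mult tens_one)
qed

section \<open>The action of an enveloping algebra on a nonassociative algebra\<close>

locale etale_nucleus = nonassoc_algebra F A
  for F :: "('f, 'm) ring_scheme" and A :: "('f, 'a) module" +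
  fixes K
  assumes fd: fin_dim and unital: "unital_subalgebra F K A" and nuclear: "K \<subseteq> nucleus A"
    and etale_K: "etale_like F (A\<lparr>carrier := K\<rparr>)"
begin

abbreviation "E \<equiv> A\<lparr>carrier := K\<rparr>"
abbreviation "S \<equiv> tensor_algebra F E E"
abbreviation act where "act \<equiv> bimodule_action F A"

lemma K_subspace: "subspace F K A" and K_one: "\<one>\<^bsub>A\<^esub> \<in> K"
  and K_mult: "k \<in> K \<Longrightarrow> l \<in> K \<Longrightarrow> k \<otimes>\<^bsub>A\<^esub> l \<in> K"
  using unital unfolding unital_subalgebra_def by blast+

lemma K_nucleus: "k \<in> K \<Longrightarrow> k \<in> nucleus A"
  using nuclear by blast

lemma K_carrier: "k \<in> K \<Longrightarrow> k \<in> carrier A"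
  using nuclear unfolding nucleus_def by blast

lemma K_comm: "k \<in> K \<Longrightarrow> l \<in> K \<Longrightarrow> k \<otimes>\<^bsub>A\<^esub> l = l \<otimes>\<^bsub>A\<^esub> k"
  using fd_comm_algebra.prod_comm[OF etale_like.axioms(1)[OF etale_K], of k l] by simp

lemma tensor_etale_S: "tensor_etale F E E S (tens F E E)"
  by (rule tensor_etale_tensor_algebra[OF etale_K etale_K])

lemma etale_S: "etale_like F S"
  by (rule tensor_etale.T_etale_like[OF tensor_etale_S])

lemma S_dim: "vectorspace.dim F S = vectorspace.dim F E * vectorspace.dim F E"
  and S_fin_dim: "vectorspace.fin_dim F S"
  using tensor_etale.T_dim[OF tensor_etale_S] tensor_etale.T_fin_dim[OF tensor_etale_S] by blast+

lemma tensor_algs_E: "tensor_algs F E E"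
proof -
  have E: "nonassoc_algebra F E" by (rule unital_subalgebra_nonassoc_algebra[OF nonassoc_algebra_axioms unital])
  show ?thesis by (rule tensor_algs.intro[OF E E])
qed

lemma act_bilinear:
  assumes "x \<in> carrier A" shows "bilinear F E E A (\<lambda>k l. (k \<otimes>\<^bsub>A\<^esub> x) \<otimes>\<^bsub>A\<^esub> l)"
  by (rule bilinearI)
    (use assms in \<open>simp_all add: K_carrier prod_closed prod_add_left prod_add_right prod_smult_left prod_smult_right\<close>)

text \<open>Both sides apply \<open>the_elem\<close> to the image of a coset under the same sum.
  This gives the action the universal property of the tensor product.\<close>

lemma act_tens_lift: "(\<lambda>U. act U x) = tens_lift F A (\<lambda>k l. (k \<otimes>\<^bsub>A\<^esub> x) \<otimes>\<^bsub>A\<^esub> l)"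
  unfolding bimodule_action_def tens_lift_def quot_lift_def lin_ext_def by (rule refl)

lemma act_hom: "x \<in> carrier A \<Longrightarrow> (\<lambda>U. act U x) \<in> module_hom F S A"
proof -
  interpret S: tensor_algs F E E by (rule tensor_algs_E)
  show "x \<in> carrier A \<Longrightarrow> (\<lambda>U. act U x) \<in> module_hom F S A"
    unfolding act_tens_lift by (rule S.tens_lift(2)[OF module_axioms act_bilinear])
qed

lemma act_tens:
  assumes "k \<in> K" "l \<in> K" "x \<in> carrier A"
  shows "act (tens F E E k l) x = (k \<otimes>\<^bsub>A\<^esub> x) \<otimes>\<^bsub>A\<^esub> l"
proof -
  interpret S: tensor_algs F E E by (rule tensor_algs_E)
  show ?thesis
    unfolding fun_cong[OF act_tens_lift]
    by (rule S.tens_lift(1)[OF module_axioms act_bilinear[OF assms(3)]]) (simp_all add: assms)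
qed

lemmas act_closed = module_hom_in[OF act_hom] and act_add_left = module_hom_add[OF act_hom]

lemma S_induct [consumes 1, case_names tens add]:
  assumes "U \<in> carrier S" "\<And>k l. k \<in> K \<Longrightarrow> l \<in> K \<Longrightarrow> P (tens F E E k l)"
    and "\<And>U V. U \<in> carrier S \<Longrightarrow> V \<in> carrier S \<Longrightarrow> P U \<Longrightarrow> P V \<Longrightarrow> P (U \<oplus>\<^bsub>S\<^esub> V)"
  shows "P U"
proof -
  interpret S: tensor_algs F E E by (rule tensor_algs_E)
  show ?thesis by (rule S.tens_induct[OF assms(1)]) (simp_all add: assms(2,3))
qed

lemma act_add_right:
  assumes "U \<in> carrier S" and x: "x \<in> carrier A" and y: "y \<in> carrier A"
  shows "act U (x \<oplus>\<^bsub>A\<^esub> y) = act U x \<oplus>\<^bsub>A\<^esub> act U y"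
  using assms(1)
proof (induct U rule: S_induct)
  case (tens k l)
  then show ?case using x y by (simp add: act_tens K_carrier prod_closed prod_add_left prod_add_right)
next
  case (add U V)
  then show ?case using x y act_closed[of _ U] act_closed[of _ V]
    by (simp only: act_add_left M.a_closed M.a_ac)
qed

text \<open>On pure tensors this is \<open>(k k') x (l l') = k (k' x l') l\<close>. Nuclearity of
  \<open>K\<close> provides the associativity, and commutativity of \<open>K\<close> corrects the
  reversed order on the right.\<close>

lemma act_mult:
  assumes U: "U \<in> carrier S" and V: "V \<in> carrier S" and x: "x \<in> carrier A"
  shows "act (U \<otimes>\<^bsub>S\<^esub> V) x = act U (act V x)"
proof -
  interpret S: tensor_algs F E E by (rule tensor_algs_E)
  show ?thesis using U
  proof (induct U rule: S_induct)
    case (tens k l)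
    then have kl: "k \<in> carrier E" "l \<in> carrier E" by simp_all
    note t = S.tens_closed[OF kl]
    show ?case using V
    proof (induct V rule: S_induct)
      case (tens k' l')
      have c: "k \<in> carrier A" "l \<in> carrier A" "k' \<in> carrier A" "l' \<in> carrier A"
        using kl tens K_carrier by simp_all
      have e: "tens F E E k l \<otimes>\<^bsub>S\<^esub> tens F E E k' l' = tens F E E (k \<otimes>\<^bsub>A\<^esub> k') (l \<otimes>\<^bsub>A\<^esub> l')"
        using S.tens_mult[of k l k' l'] kl tens by simp
      have "act (tens F E E k l \<otimes>\<^bsub>S\<^esub> tens F E E k' l') x = ((k \<otimes>\<^bsub>A\<^esub> k') \<otimes>\<^bsub>A\<^esub> x) \<otimes>\<^bsub>A\<^esub> (l \<otimes>\<^bsub>A\<^esub> l')"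
        unfolding e by (rule act_tens) (use kl tens x K_mult in simp_all)
      also have "\<dots> = (k \<otimes>\<^bsub>A\<^esub> (k' \<otimes>\<^bsub>A\<^esub> x)) \<otimes>\<^bsub>A\<^esub> (l' \<otimes>\<^bsub>A\<^esub> l)"
        using kl tens K_comm[of l l'] nucleusD(1)[OF K_nucleus[of k] c(3) x] by simp
      also have "\<dots> = (k \<otimes>\<^bsub>A\<^esub> (k' \<otimes>\<^bsub>A\<^esub> x) \<otimes>\<^bsub>A\<^esub> l') \<otimes>\<^bsub>A\<^esub> l"
        by (rule nucleusD(3)[symmetric]) (use kl K_nucleus c x prod_closed in simp_all)
      also have "k \<otimes>\<^bsub>A\<^esub> (k' \<otimes>\<^bsub>A\<^esub> x) \<otimes>\<^bsub>A\<^esub> l' = k \<otimes>\<^bsub>A\<^esub> (k' \<otimes>\<^bsub>A\<^esub> x \<otimes>\<^bsub>A\<^esub> l')"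
        by (rule nucleusD(1)) (use kl K_nucleus c x prod_closed in simp_all)
      also have "(k \<otimes>\<^bsub>A\<^esub> (k' \<otimes>\<^bsub>A\<^esub> x \<otimes>\<^bsub>A\<^esub> l')) \<otimes>\<^bsub>A\<^esub> l = act (tens F E E k l) (act (tens F E E k' l') x)"
        using kl tens c x by (simp add: act_tens prod_closed)
      finally show ?case .
    next
      case (add V W)
      show ?case
        unfolding S.T.prod_add_right[OF add(1,2) t]
          act_add_left[OF x S.T.prod_closed[OF t add(1)] S.T.prod_closed[OF t add(2)]] add(3,4)
          act_add_left[OF x add(1,2)] act_add_right[OF t act_closed[OF x add(1)] act_closed[OF x add(2)]] ..
    qed
  next
    case (add U W)
    show ?case
      unfolding S.T.prod_add_left[OF add(1,2) V] add(3,4)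
        act_add_left[OF x S.T.prod_closed[OF add(1) V] S.T.prod_closed[OF add(2) V]]
        act_add_left[OF act_closed[OF x V] add(1,2)] ..
  qed
qed

lemma bimodule_simps:
  "carrier (bimodule F A) = carrier A" "\<zero>\<^bsub>bimodule F A\<^esub> = \<zero>\<^bsub>A\<^esub>"
  "x \<oplus>\<^bsub>bimodule F A\<^esub> y = x \<oplus>\<^bsub>A\<^esub> y" "U \<odot>\<^bsub>bimodule F A\<^esub> x = act U x"
  by (simp_all add: bimodule_def)

lemma module_bimodule: "module S (bimodule F A)"
proof (rule moduleI)
  interpret S: tensor_algs F E E by (rule tensor_algs_E)
  show "cring S" by (rule fd_comm_algebra.cring_A[OF etale_like.axioms(1)[OF etale_S]])
  show "abelian_group (bimodule F A)"
  proof (rule abelian_groupI)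
    fix x assume "x \<in> carrier (bimodule F A)"
    then show "\<exists>y\<in>carrier (bimodule F A). y \<oplus>\<^bsub>bimodule F A\<^esub> x = \<zero>\<^bsub>bimodule F A\<^esub>"
      unfolding bimodule_simps by (intro bexI[of _ "\<ominus>\<^bsub>A\<^esub> x"] M.l_neg M.a_inv_closed)
  qed (simp_all add: bimodule_simps M.a_ac)
  fix x assume x: "x \<in> carrier (bimodule F A)"
  then show "\<one>\<^bsub>S\<^esub> \<odot>\<^bsub>bimodule F A\<^esub> x = x"
    unfolding bimodule_simps S.tens_one by (simp add: act_tens K_one unit_left unit_right)
qed (simp_all only: bimodule_simps act_closed act_add_left act_add_right act_mult)

lemma act_linear_map: "x \<in> carrier A \<Longrightarrow> linear_map F S A (\<lambda>U. act U x)"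
proof -
  assume x: "x \<in> carrier A"
  interpret S: tensor_algs F E E by (rule tensor_algs_E)
  show ?thesis
    by (rule linear_mapI[OF S.T.vectorspace_axioms vectorspace_axioms act_hom[OF x]])
qed

lemma cyclic_of_minimally_faithful:
  assumes "minimally_faithful S (bimodule F A)"
  shows "\<exists>a\<in>carrier A. (\<lambda>U. act U a) ` carrier S = carrier A"
    and "dim = vectorspace.dim F E * vectorspace.dim F E"
proof -
  obtain a where a: "a \<in> carrier A" and gen: "(\<lambda>U. act U a) ` carrier S = carrier A"
    and ann: "\<forall>U\<in>carrier S. act U a = \<zero>\<^bsub>A\<^esub> \<longrightarrow> U = \<zero>\<^bsub>S\<^esub>"
    using etale_like.minimally_faithful_imp_cyclic[OF etale_S assms] unfolding bimodule_simps by (elim bexE conjE)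
  show "\<exists>a\<in>carrier A. (\<lambda>U. act U a) ` carrier S = carrier A" using a gen by (intro bexI[of _ a])
  have "dim = vectorspace.dim F S"
    by (rule linear_map.dim_eq_of_bij[OF act_linear_map[OF a] S_fin_dim gen]) (use ann in simp)
  then show "dim = vectorspace.dim F E * vectorspace.dim F E" unfolding S_dim .
qed

lemma minimally_faithful_of_cyclic:
  assumes a: "a \<in> carrier A" and gen: "(\<lambda>U. act U a) ` carrier S = carrier A"
    and d: "dim = vectorspace.dim F E * vectorspace.dim F E"
  shows "minimally_faithful S (bimodule F A)"
proof (rule etale_like.cyclic_imp_minimally_faithful[OF etale_S module_bimodule])
  interpret S: vectorspace F S by (rule linear_map.axioms(1)[OF act_linear_map[OF a]])
  interpret T: linear_map F S A "\<lambda>U. act U a" by (rule act_linear_map[OF a])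
  have inj: "inj_on (\<lambda>U. act U a) (carrier S)"
    by (rule T.surj_imp_inj[OF S_fin_dim _ gen]) (simp only: d S_dim)
  show "a \<in> carrier (bimodule F A)" "(\<lambda>U. U \<odot>\<^bsub>bimodule F A\<^esub> a) ` carrier S = carrier (bimodule F A)"
    unfolding bimodule_simps by (fact a gen)+
  fix U assume U: "U \<in> carrier S" "U \<odot>\<^bsub>bimodule F A\<^esub> a = \<zero>\<^bsub>bimodule F A\<^esub>"
  then have "act U a = act \<zero>\<^bsub>S\<^esub> a" unfolding bimodule_simps using T.f0_is_0 by simp
  then show "U = \<zero>\<^bsub>S\<^esub>" by (rule inj_onD[OF inj _ U(1) S.M.zero_closed])
qed

end


section \<open>Tensor products of semiassociative algebras\<close>

locale tensor_etale_nucleus = A: etale_nucleus F A K + B: etale_nucleus F B L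
  for F :: "('f, 'm) ring_scheme" and A :: "('f, 'a) module" and B :: "('f, 'b) module" and K L
begin

sublocale tensor_algs F A B
  by (rule tensor_algs.intro[OF A.nonassoc_algebra_axioms B.nonassoc_algebra_axioms])

lemma tensor_algs_E: "tensor_algs F A.E B.E"
  by (rule tensor_algs.intro[OF unital_subalgebra_nonassoc_algebra[OF A.nonassoc_algebra_axioms A.unital]
        unital_subalgebra_nonassoc_algebra[OF B.nonassoc_algebra_axioms B.unital]])

definition incl where "incl = tens_lift F T (tens F A B)"

text \<open>A subalgebra is a subset of its algebra, so the image of \<open>K \<otimes> L\<close> in
  \<open>A \<otimes> B\<close> is taken. What injectivity of \<open>incl\<close> would provide comes
  from \<open>tensor_etale_KL\<close>.\<close>

definition KL where "KL = incl ` carrier (tensor_algebra F A.E B.E)"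

lemma bilinear_E: "bilinear F A.E B.E T (tens F A B)"
  by (rule bilinearI) (simp_all add: A.K_carrier B.K_carrier tens_closed tens_simps)

lemma incl_hom: "incl \<in> module_hom F (tensor_algebra F A.E B.E) T"
  and incl_tens: "k \<in> K \<Longrightarrow> l \<in> L \<Longrightarrow> incl (tens F A.E B.E k l) = tens F A B k l"
proof -
  interpret E: tensor_algs F A.E B.E by (rule tensor_algs_E)
  show "incl \<in> module_hom F (tensor_algebra F A.E B.E) T"
    unfolding incl_def by (rule E.tens_lift(2)[OF T.module_axioms bilinear_E])
  show "k \<in> K \<Longrightarrow> l \<in> L \<Longrightarrow> incl (tens F A.E B.E k l) = tens F A B k l"
    unfolding incl_def by (rule E.tens_lift(1)[OF T.module_axioms bilinear_E]) simp_all
qed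

lemma KL_subspace: "subspace F KL T"
proof -
  interpret E: tensor_algs F A.E B.E by (rule tensor_algs_E)
  interpret I: linear_map F "tensor_algebra F A.E B.E" T incl
    by (rule linear_mapI[OF E.T.vectorspace_axioms T.vectorspace_axioms incl_hom])
  show ?thesis using I.imT_is_subspace unfolding I.im_def KL_def .
qed

lemma KL_submodule: "LinearCombinations.submodule F KL T"
  using KL_subspace unfolding subspace_def by blast

lemma KL_carrier: "x \<in> KL \<Longrightarrow> x \<in> carrier T" and KL_add: "x \<in> KL \<Longrightarrow> y \<in> KL \<Longrightarrow> x \<oplus>\<^bsub>T\<^esub> y \<in> KL"
  using KL_submodule unfolding LinearCombinations.submodule_def by blast+

lemma tens_KL: "k \<in> K \<Longrightarrow> l \<in> L \<Longrightarrow> tens F A B k l \<in> KL"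
proof -
  assume k: "k \<in> K" and l: "l \<in> L"
  interpret E: tensor_algs F A.E B.E by (rule tensor_algs_E)
  have "tens F A.E B.E k l \<in> carrier (tensor_algebra F A.E B.E)" by (rule E.tens_closed) (simp_all add: k l)
  then show ?thesis unfolding KL_def by (rule rev_image_eqI) (simp only: incl_tens[OF k l])
qed

lemma KL_induct [consumes 1, case_names tens add]:
  assumes "x \<in> KL" and tens: "\<And>k l. k \<in> K \<Longrightarrow> l \<in> L \<Longrightarrow> P (tens F A B k l)"
    and add: "\<And>x y. x \<in> KL \<Longrightarrow> y \<in> KL \<Longrightarrow> P x \<Longrightarrow> P y \<Longrightarrow> P (x \<oplus>\<^bsub>T\<^esub> y)"
  shows "P x"
proof -
  interpret E: tensor_algs F A.E B.E by (rule tensor_algs_E)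
  obtain u where u: "u \<in> carrier (tensor_algebra F A.E B.E)" "x = incl u" using assms(1) unfolding KL_def by blast
  show ?thesis unfolding u(2) using u(1)
  proof (induct u rule: E.tens_induct)
    case (tens k l)
    then show ?case using assms(2)[of k l] by (simp add: incl_tens)
  next
    case (add u v)
    have "incl u \<in> KL" "incl v \<in> KL" unfolding KL_def using add(1,2) by (simp_all only: imageI)
    then show ?case unfolding module_hom_add[OF incl_hom add(1,2)] using add(3,4) by (rule assms(3))
  qed
qed

text \<open>Each associativity law is additive in the two free arguments, and on pure tensors it
  holds in each factor.\<close>

lemma tens_nucleus:
  assumes k: "k \<in> nucleus A" and l: "l \<in> nucleus B" shows "tens F A B k l \<in> nucleus T"
  unfolding T.nucleus_iff
proof (intro conjI ballI)
  have kc: "k \<in> carrier A" using k unfolding nucleus_def by blast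
  have lc: "l \<in> carrier B" using l unfolding nucleus_def by blast
  show t: "tens F A B k l \<in> carrier T" by (rule tens_closed[OF kc lc])
  fix u v assume u: "u \<in> carrier T" and v: "v \<in> carrier T"
  show "(tens F A B k l \<otimes>\<^bsub>T\<^esub> u) \<otimes>\<^bsub>T\<^esub> v = tens F A B k l \<otimes>\<^bsub>T\<^esub> (u \<otimes>\<^bsub>T\<^esub> v)"
  proof (rule tens_induct[OF u])
    fix a b assume ab: "a \<in> carrier A" "b \<in> carrier B"
    show "(tens F A B k l \<otimes>\<^bsub>T\<^esub> tens F A B a b) \<otimes>\<^bsub>T\<^esub> v = tens F A B k l \<otimes>\<^bsub>T\<^esub> (tens F A B a b \<otimes>\<^bsub>T\<^esub> v)"
      by (rule tens_induct[OF v]) (simp_all only: ab kc lc t tens_mult A.prod_closed B.prod_closed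
          A.nucleusD[OF k] B.nucleusD[OF l] tens_closed T.prod_add_right T.prod_closed)
  qed (simp_all only: t v T.prod_add_left T.prod_add_right T.prod_closed)
  show "(u \<otimes>\<^bsub>T\<^esub> tens F A B k l) \<otimes>\<^bsub>T\<^esub> v = u \<otimes>\<^bsub>T\<^esub> (tens F A B k l \<otimes>\<^bsub>T\<^esub> v)"
  proof (rule tens_induct[OF u])
    fix a b assume ab: "a \<in> carrier A" "b \<in> carrier B"
    show "(tens F A B a b \<otimes>\<^bsub>T\<^esub> tens F A B k l) \<otimes>\<^bsub>T\<^esub> v = tens F A B a b \<otimes>\<^bsub>T\<^esub> (tens F A B k l \<otimes>\<^bsub>T\<^esub> v)"
      by (rule tens_induct[OF v]) (simp_all only: ab kc lc t tens_mult A.prod_closed B.prod_closed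
          A.nucleusD[OF k] B.nucleusD[OF l] tens_closed T.prod_add_right T.prod_closed)
  qed (simp_all only: t v T.prod_add_left T.prod_add_right T.prod_closed)
  show "(u \<otimes>\<^bsub>T\<^esub> v) \<otimes>\<^bsub>T\<^esub> tens F A B k l = u \<otimes>\<^bsub>T\<^esub> (v \<otimes>\<^bsub>T\<^esub> tens F A B k l)"
  proof (rule tens_induct[OF u])
    fix a b assume ab: "a \<in> carrier A" "b \<in> carrier B"
    show "(tens F A B a b \<otimes>\<^bsub>T\<^esub> v) \<otimes>\<^bsub>T\<^esub> tens F A B k l = tens F A B a b \<otimes>\<^bsub>T\<^esub> (v \<otimes>\<^bsub>T\<^esub> tens F A B k l)"
      by (rule tens_induct[OF v]) (simp_all only: ab kc lc t tens_mult A.prod_closed B.prod_closed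
          A.nucleusD[OF k] B.nucleusD[OF l] tens_closed T.prod_add_left T.prod_add_right T.prod_closed)
  qed (simp_all only: t v T.prod_add_left T.prod_add_right T.prod_closed)
qed

lemma KL_nucleus: "KL \<subseteq> nucleus T"
proof
  fix x assume "x \<in> KL"
  then show "x \<in> nucleus T"
  proof (induct x rule: KL_induct)
    case (tens k l)
    then show ?case by (intro tens_nucleus A.K_nucleus B.K_nucleus)
  qed (rule T.nucleus_add)
qed

lemma KL_unital: "unital_subalgebra F KL T"
  unfolding unital_subalgebra_def
proof (intro conjI ballI)
  show "subspace F KL T" by (rule KL_subspace)
  show "\<one>\<^bsub>T\<^esub> \<in> KL" unfolding tens_one by (rule tens_KL[OF A.K_one B.K_one])
  fix x y assume x: "x \<in> KL" and y: "y \<in> KL"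
  show "x \<otimes>\<^bsub>T\<^esub> y \<in> KL" using x
  proof (induct x rule: KL_induct)
    case (tens k l)
    note t = tens_closed[OF A.K_carrier[OF tens(1)] B.K_carrier[OF tens(2)]]
    show ?case using y
    proof (induct y rule: KL_induct)
      case (tens k' l')
      show ?case
        unfolding tens_mult[OF A.K_carrier[OF \<open>k \<in> K\<close>] B.K_carrier[OF \<open>l \<in> L\<close>] A.K_carrier[OF tens(1)] B.K_carrier[OF tens(2)]]
        by (rule tens_KL[OF A.K_mult[OF \<open>k \<in> K\<close> tens(1)] B.K_mult[OF \<open>l \<in> L\<close> tens(2)]])
    next
      case (add y z)
      then show ?case unfolding T.prod_add_right[OF KL_carrier[OF add(1)] KL_carrier[OF add(2)] t] by (intro KL_add)
    qed
  next
    case (add x z)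
    then show ?case
      unfolding T.prod_add_left[OF KL_carrier[OF add(1)] KL_carrier[OF add(2)] KL_carrier[OF y]] by (intro KL_add)
  qed
qed

lemma T_fin_dim: "T.fin_dim" and T_dim: "T.dim = A.dim * B.dim"
  by (rule tensor_like_dim[OF A.vectorspace_axioms B.vectorspace_axioms T.vectorspace_axioms tensor_like_T A.fd B.fd])+

text \<open>Functionals on \<open>K\<close> and \<open>L\<close> are extended to \<open>A\<close>
  and \<open>B\<close>, their product is formed on \<open>A \<otimes> B\<close> and restricted to
  \<open>KL\<close>. So \<open>KL\<close> has the dimension and the etale property expected of
  \<open>K \<otimes> L\<close>.\<close>

lemma tensor_etale_KL: "tensor_etale F A.E B.E (T\<lparr>carrier := KL\<rparr>) (tens F A B)"
proof -
  interpret E: tensor_algs F A.E B.E by (rule tensor_algs_E)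
  have na: "nonassoc_algebra F (T\<lparr>carrier := KL\<rparr>)"
    by (rule unital_subalgebra_nonassoc_algebra[OF T.nonassoc_algebra_axioms KL_unital])
  interpret KL: nonassoc_algebra F "T\<lparr>carrier := KL\<rparr>" by (rule na)
  have tl: "tensor_like F A.E B.E (T\<lparr>carrier := KL\<rparr>) (tens F A B)"
  proof (intro tensor_like.intro tensor_like_axioms.intro E.A.module_axioms E.B.module_axioms KL.module_axioms)
    show "bilinear F A.E B.E (T\<lparr>carrier := KL\<rparr>) (tens F A B)"
      by (rule bilinearI) (simp_all add: A.K_carrier B.K_carrier tens_KL tens_simps)
  next
    fix x P assume "x \<in> carrier (T\<lparr>carrier := KL\<rparr>)"
      and t: "\<And>a b. a \<in> carrier A.E \<Longrightarrow> b \<in> carrier B.E \<Longrightarrow> P (tens F A B a b)"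
      and a: "\<And>x y. x \<in> carrier (T\<lparr>carrier := KL\<rparr>) \<Longrightarrow> y \<in> carrier (T\<lparr>carrier := KL\<rparr>) \<Longrightarrow> P x \<Longrightarrow> P y \<Longrightarrow>
        P (x \<oplus>\<^bsub>T\<lparr>carrier := KL\<rparr>\<^esub> y)"
    then have "x \<in> KL" by simp
    then show "P x" by (induct x rule: KL_induct) (use t a in simp_all)
  next
    fix f g assume f: "f \<in> module_hom F A.E (self_module F)" and g: "g \<in> module_hom F B.E (self_module F)"
    obtain f' where f': "f' \<in> module_hom F A (self_module F)" "\<forall>k\<in>K. f' k = f k"
      using A.extend_functional[OF A.fd A.K_subspace f] by (elim bexE)
    obtain g' where g': "g' \<in> module_hom F B (self_module F)" "\<forall>l\<in>L. g' l = g l"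
      using B.extend_functional[OF B.fd B.K_subspace g] by (elim bexE)
    obtain h where h: "h \<in> module_hom F T (self_module F)"
      "\<forall>a\<in>carrier A. \<forall>b\<in>carrier B. h (tens F A B a b) = f' a \<otimes>\<^bsub>F\<^esub> g' b"
      using tensor_like.tau_functional[OF tensor_like_T f'(1) g'(1)] by (elim bexE)
    have "h \<in> module_hom F (T\<lparr>carrier := KL\<rparr>) (self_module F)"
      by (rule module_hom_restrict[OF h(1)]) (use KL_carrier in blast)
    then show "\<exists>h\<in>module_hom F (T\<lparr>carrier := KL\<rparr>) (self_module F).
        \<forall>a\<in>carrier A.E. \<forall>b\<in>carrier B.E. h (tens F A B a b) = f a \<otimes>\<^bsub>F\<^esub> g b"
      by (rule bexI[rotated]) (use h(2) f'(2) g'(2) A.K_carrier B.K_carrier in simp)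
  qed
  show ?thesis
    by (intro tensor_etale.intro tensor_etale_axioms.intro A.etale_K B.etale_K na tl)
      (simp_all add: A.K_carrier B.K_carrier tens_mult tens_one)
qed

sublocale TK: etale_nucleus F T KL
  by (rule etale_nucleus.intro[OF T.nonassoc_algebra_axioms etale_nucleus_axioms.intro[OF T_fin_dim KL_unital KL_nucleus
        tensor_etale.T_etale_like[OF tensor_etale_KL]]])

lemma KL_dim: "vectorspace.dim F (T\<lparr>carrier := KL\<rparr>) = vectorspace.dim F A.E * vectorspace.dim F B.E"
  by (rule tensor_etale.T_dim[OF tensor_etale_KL])

text \<open>On pure tensors, \<open>(k \<otimes> l) a \<otimes> (k' \<otimes> l') b\<close> is the
  action of \<open>(k \<otimes> k') \<otimes> (l \<otimes> l')\<close> on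
  \<open>a \<otimes> b\<close>: the middle factors change places. Sums are covered because the image
  \<open>I\<close> is closed under addition, and no map between the enveloping algebras has to be
  constructed.\<close>

lemma act_tens_tens:
  assumes U: "U \<in> carrier A.S" and V: "V \<in> carrier B.S" and a: "a \<in> carrier A" and b: "b \<in> carrier B"
  shows "tens F A B (A.act U a) (B.act V b) \<in> (\<lambda>W. TK.act W (tens F A B a b)) ` carrier TK.S"
proof -
  note t = tens_closed[OF a b]
  define I where "I = (\<lambda>W. TK.act W (tens F A B a b)) ` carrier TK.S"
  interpret TS: tensor_algs F TK.E TK.E by (rule TK.tensor_algs_E)
  have I_add: "x \<oplus>\<^bsub>T\<^esub> y \<in> I" if xy: "x \<in> I" "y \<in> I" for x y
  proof -
    obtain W W' where W: "W \<in> carrier TK.S" "W' \<in> carrier TK.S" "x = TK.act W (tens F A B a b)" "y = TK.act W' (tens F A B a b)"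
      using xy unfolding I_def by blast
    have "TK.act (W \<oplus>\<^bsub>TK.S\<^esub> W') (tens F A B a b) \<in> I"
      unfolding I_def by (rule imageI) (rule TS.T.M.a_closed[OF W(1,2)])
    then show ?thesis unfolding TK.act_add_left[OF t W(1,2)] W(3,4) .
  qed
  have "tens F A B (A.act U a) (B.act V b) \<in> I" using U
  proof (induct U rule: A.S_induct)
    case (tens k l)
    note kl = tens
    note ka = A.prod_closed[OF A.prod_closed[OF A.K_carrier[OF kl(1)] a] A.K_carrier[OF kl(2)]]
    show ?case using V
    proof (induct V rule: B.S_induct)
      case (tens k' l')
      have c: "k \<in> carrier A" "l \<in> carrier A" "k' \<in> carrier B" "l' \<in> carrier B"
        using kl tens A.K_carrier B.K_carrier by blast+
      have m: "tens F A B k k' \<in> KL" "tens F A B l l' \<in> KL" using kl tens by (simp_all only: tens_KL)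
      have "TK.act (tens F TK.E TK.E (tens F A B k k') (tens F A B l l')) (tens F A B a b)
        = tens F A B ((k \<otimes>\<^bsub>A\<^esub> a) \<otimes>\<^bsub>A\<^esub> l) ((k' \<otimes>\<^bsub>B\<^esub> b) \<otimes>\<^bsub>B\<^esub> l')"
        by (simp only: TK.act_tens[OF m t] tens_mult c a b A.prod_closed B.prod_closed)
      also have "\<dots> = tens F A B (A.act (tens F A.E A.E k l) a) (B.act (tens F B.E B.E k' l') b)"
        by (simp only: A.act_tens[OF kl a] B.act_tens[OF tens b])
      finally have e: "TK.act (tens F TK.E TK.E (tens F A B k k') (tens F A B l l')) (tens F A B a b)
        = tens F A B (A.act (tens F A.E A.E k l) a) (B.act (tens F B.E B.E k' l') b)" .
      show ?case unfolding e[symmetric] I_def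
        by (rule imageI, rule TS.tens_closed) (simp_all add: m)
    next
      case (add V W)
      note c = B.act_closed[OF b add(1)] B.act_closed[OF b add(2)]
      have k: "A.act (tens F A.E A.E k l) a \<in> carrier A" unfolding A.act_tens[OF kl a] by (rule ka)
      show ?case unfolding B.act_add_left[OF b add(1,2)] tens_simps(1)[OF k c] using add(3,4) by (rule I_add)
    qed
  next
    case (add U W)
    have c: "A.act U a \<in> carrier A" "A.act W a \<in> carrier A" by (rule A.act_closed[OF a add(1)] A.act_closed[OF a add(2)])+
    show ?case unfolding A.act_add_left[OF a add(1,2)] tens_simps(2)[OF c(1) B.act_closed[OF b V] c(2)] using add(3,4) by (rule I_add)
  qed
  then show ?thesis unfolding I_def .
qed

lemma minimally_faithful_T:
  assumes mfA: "minimally_faithful A.S (bimodule F A)" and mfB: "minimally_faithful B.S (bimodule F B)"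
  shows "minimally_faithful TK.S (bimodule F T)"
proof -
  obtain a where a: "a \<in> carrier A" "(\<lambda>U. A.act U a) ` carrier A.S = carrier A"
    using A.cyclic_of_minimally_faithful(1)[OF mfA] by (elim bexE)
  obtain b where b: "b \<in> carrier B" "(\<lambda>U. B.act U b) ` carrier B.S = carrier B"
    using B.cyclic_of_minimally_faithful(1)[OF mfB] by (elim bexE)
  note t = tens_closed[OF a(1) b(1)]
  interpret TS: tensor_algs F TK.E TK.E by (rule TK.tensor_algs_E)
  show ?thesis
  proof (rule TK.minimally_faithful_of_cyclic[OF t])
    \<comment> \<open>\<open>(dim K)^2 (dim L)^2 = (dim K \<cdot> dim L)^2\<close>, where the base
      on the right is the dimension of \<open>KL\<close>.\<close>
    show "T.dim = vectorspace.dim F TK.E * vectorspace.dim F TK.E"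
      unfolding T_dim KL_dim A.cyclic_of_minimally_faithful(2)[OF mfA] B.cyclic_of_minimally_faithful(2)[OF mfB]
      by simp
    show "(\<lambda>W. TK.act W (tens F A B a b)) ` carrier TK.S = carrier T"
    proof (intro equalityI subsetI)
      fix x assume "x \<in> (\<lambda>W. TK.act W (tens F A B a b)) ` carrier TK.S"
      then show "x \<in> carrier T" using TK.act_closed[OF t] by blast
    next
      fix x assume "x \<in> carrier T"
      then show "x \<in> (\<lambda>W. TK.act W (tens F A B a b)) ` carrier TK.S"
      proof (induct x rule: tens_induct)
        case (tens u v)
        obtain U where U: "U \<in> carrier A.S" "u = A.act U a" using tens(1) unfolding a(2)[symmetric] by (elim imageE)
        obtain V where V: "V \<in> carrier B.S" "v = B.act V b" using tens(2) unfolding b(2)[symmetric] by (elim imageE)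
        show ?case unfolding U(2) V(2) by (rule act_tens_tens[OF U(1) V(1) a(1) b(1)])
      next
        case (add x y)
        obtain W where W: "W \<in> carrier TK.S" "x = TK.act W (tens F A B a b)" using add(3) by (elim imageE)
        obtain W' where W': "W' \<in> carrier TK.S" "y = TK.act W' (tens F A B a b)" using add(4) by (elim imageE)
        show ?case unfolding W(2) W'(2) TK.act_add_left[OF t W(1) W'(1), symmetric]
          by (rule imageI) (rule TS.T.M.a_closed[OF W(1) W'(1)])
      qed
    qed
  qed
qed

end

text \<open>Exchanges products of separable fields for the intrinsic description in both directions,
  so that the theorem becomes a statement about \<open>etale_nucleus\<close>.\<close>

lemma semiassociative_iff:
  "semiassociative F A \<longleftrightarrow> central F A \<and>
    (\<exists>K. etale_nucleus F A K \<and> minimally_faithful (tensor_algebra F (A\<lparr>carrier := K\<rparr>) (A\<lparr>carrier := K\<rparr>)) (bimodule F A))"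
proof
  assume "semiassociative F A"
  then obtain K where na: "nonassoc_algebra F A" and fd: "vectorspace.fin_dim F A" and c: "central F A"
    and K: "unital_subalgebra F K A" "K \<subseteq> nucleus A" "etale_algebra F (A\<lparr>carrier := K\<rparr>)"
    "minimally_faithful (tensor_algebra F (A\<lparr>carrier := K\<rparr>) (A\<lparr>carrier := K\<rparr>)) (bimodule F A)"
    unfolding semiassociative_def Let_def by blast
  interpret nonassoc_algebra F A by (rule na)
  have sub: "subspace F K A" using K(1) unfolding unital_subalgebra_def by blast
  have "etale_like F (A\<lparr>carrier := K\<rparr>)"
    by (rule etale_algebra_etale_like[OF unital_subalgebra_nonassoc_algebra[OF na K(1)] subspace_dim(1)[OF fd sub] K(3)])
  then have "etale_nucleus F A K"
    by (intro etale_nucleus.intro etale_nucleus_axioms.intro na fd K(1,2))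
  then show "central F A \<and> (\<exists>K. etale_nucleus F A K \<and>
      minimally_faithful (tensor_algebra F (A\<lparr>carrier := K\<rparr>) (A\<lparr>carrier := K\<rparr>)) (bimodule F A))"
    using c K(4) by blast
next
  assume r: "central F A \<and> (\<exists>K. etale_nucleus F A K \<and>
      minimally_faithful (tensor_algebra F (A\<lparr>carrier := K\<rparr>) (A\<lparr>carrier := K\<rparr>)) (bimodule F A))"
  then obtain K where K: "etale_nucleus F A K"
    and mf: "minimally_faithful (tensor_algebra F (A\<lparr>carrier := K\<rparr>) (A\<lparr>carrier := K\<rparr>)) (bimodule F A)" by blast
  show "semiassociative F A"
    unfolding semiassociative_def Let_def
    using r K mf etale_nucleus.axioms(1)[OF K] etale_nucleus.fd[OF K] etale_nucleus.unital[OF K]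
      etale_nucleus.nuclear[OF K] etale_like.etale[OF etale_nucleus.etale_K[OF K]] by blast
qed

theorem theorem13p1:
  fixes F :: "('f, 'm) ring_scheme"
    and A :: "('f, 'a) module"
    and A' :: "('f, 'b) module"
  assumes "field F"
    and "semiassociative F A"
    and "semiassociative F A'"
  shows "semiassociative F (tensor_algebra F A A')"
proof -
  obtain K where K: "etale_nucleus F A K"
    "minimally_faithful (tensor_algebra F (A\<lparr>carrier := K\<rparr>) (A\<lparr>carrier := K\<rparr>)) (bimodule F A)"
    and cA: "central F A"
    using assms(2) unfolding semiassociative_iff by (elim exE conjE)
  obtain L where L: "etale_nucleus F A' L"
    "minimally_faithful (tensor_algebra F (A'\<lparr>carrier := L\<rparr>) (A'\<lparr>carrier := L\<rparr>)) (bimodule F A')"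
    and cA': "central F A'"
    using assms(3) unfolding semiassociative_iff by (elim exE conjE)
  interpret tensor_etale_nucleus F A A' K L by (rule tensor_etale_nucleus.intro[OF K(1) L(1)])
  show ?thesis unfolding semiassociative_iff
    using central_T[OF cA cA' A.fd B.fd] TK.etale_nucleus_axioms minimally_faithful_T[OF K(2) L(2)] by blast
qed

end
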